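(* For each $n\ge 1$ let $I_n\subset[0,2\pi)$ be an interval of length $|I_n|$, such that $n|I_n|\to\infty$ as $n\to\infty$. Choose a matrix randomly from $CUE_n$ and let $Z_n$ be the closest spacing between any two eigenvalues whose average is in $I_n$. Fix $\beta>0$. Then as $n\to\infty$, $$\Pr\left( Z_n \left(\frac{n^4|I_n|}{144\pi^2}\right)^{1/3} > \beta \right)\to e^{-\beta^3}.$$
   Context: $CUE_n$ (circular unitary ensemble) is the compact group $U(n)$ of $n\times n$ unitary matrices with normalized Haar measure. Its eigenvalues $e^{i t_1},\dots,e^{i t_n}$ are identified with their angles $t_1,\dots,t_n\in[0,2\pi)$. $Z_n$ is the minimum of $|t_i-t_j|$ over all pairs $i\ne j$ with $\frac{t_i+t_j}{2}\in I_n$ (taken to be $+\infty$ if there is no such pair). *)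

theory Defs
  imports
    "HOL-Probability.Probability"
    "Jordan_Normal_Form.Char_Poly"
    "Jordan_Normal_Form.Schur_Decomposition"
begin

definition unitary_group :: "nat \<Rightarrow> complex mat set" where
  "unitary_group n =
     {A \<in> carrier_mat n n. mat_adjoint A * A = 1\<^sub>m n \<and> A * mat_adjoint A = 1\<^sub>m n}"

text \<open>The usual topology on the unitary group, inherited from the space of complex matrices
  through the matrix entries.\<close>

definition unitary_top :: "nat \<Rightarrow> complex mat topology" where
  "unitary_top n =
     pullback_topology (unitary_group n)
       (\<lambda>A. \<lambda>(i, j) \<in> {..<n} \<times> {..<n}. A $$ (i, j))
       (product_topology (\<lambda>_. euclidean) ({..<n} \<times> {..<n}))"

lemma topspace_unitary_top: "topspace (unitary_top n) = unitary_group n"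
  unfolding unitary_top_def topspace_pullback_topology by auto

text \<open>The normalized Haar measure: the Borel probability measure that is invariant under left
  translations.\<close>

definition haar_prob :: "nat \<Rightarrow> complex mat measure \<Rightarrow> bool" where
  "haar_prob n M \<longleftrightarrow>
     prob_space M \<and>
     space M = unitary_group n \<and>
     sets M = sigma_sets (unitary_group n) {W. openin (unitary_top n) W} \<and>
     (\<forall>U \<in> unitary_group n. \<forall>S \<in> sets M. emeasure M ((*) U ` S) = emeasure M S)"

text \<open>The angles in $[0, 2\pi)$ of all eigenvalues, repeated according to algebraic
  multiplicity; listing them in increasing order is only a way to index them.\<close>

definition eigenangles :: "complex mat \<Rightarrow> real list" where
  "eigenangles A = sorted_list_of_multiset (image_mset Arg2pi (proots (char_poly A)))"

lemma length_eigenangles: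
  assumes "A \<in> carrier_mat n n"
  shows "length (eigenangles A) = n"
proof -
  have "length (eigenangles A) = size (proots (char_poly A))"
    unfolding eigenangles_def by (metis size_mset mset_sorted_list_of_multiset size_image_mset)
  also have "\<dots> = n"
  proof -
    obtain as where as: "char_poly A = (\<Prod>a\<leftarrow>as. [:- a, 1:])" "length as = n"
      using char_poly_factorized[OF assms] by blast
    have "proots (\<Prod>a\<leftarrow>bs. [:- a, 1:]) = mset bs" for bs :: "complex list"
    proof (induction bs)
      case (Cons b bs)
      have nz: "(\<Prod>a\<leftarrow>bs. [:- a, 1:]) \<noteq> 0"
        by (auto simp: prod_list_zero_iff)
      have "proots [:- b, 1:] = {#b#}"
        using proots_linear_factor[of "b"] by simp
      then show ?case using Cons proots_mult[of "[:- b, 1:]" "\<Prod>a\<leftarrow>bs. [:- a, 1:]"] nz by simp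
    qed simp
    then show ?thesis using as by simp
  qed
  finally show ?thesis .
qed

text \<open>The infimum is over a finite set, so it is a minimum; it is $+\infty$ if no pair of
  eigenvalues has its average in the given set.\<close>

definition closest_spacing :: "real set \<Rightarrow> complex mat \<Rightarrow> ereal" where
  "closest_spacing J A =
     (let t = eigenangles A in
      Inf {ereal \<bar>t ! i - t ! j\<bar> | i j.
             i < length t \<and> j < length t \<and> i \<noteq> j \<and> (t ! i + t ! j) / 2 \<in> J})"

end

theory Submission
  imports Defs "HOL-Real_Asymp.Real_Asymp"
begin

text \<open>
  Differentiating along one-parameter rotations, Haar invariance gives loop equations for expectations of
  products of power sums of the eigenvalues. In terms of the Fourier coefficients of the symmetrized law of the
  eigenvalues, they say that these coefficients are annihilated by a Dunkl operator; an induction on the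
  exponents shows that this and the total mass determine them. Integration by parts shows that the density
  \<open>\<Prod> |z\<^sub>i - z\<^sub>j|\<^sup>2\<close> satisfies the same equation, whence Weyl's integration formula, and with it the
  determinantal correlation functions \<open>det (K (x\<^sub>a, x\<^sub>b))\<close>.

  Call two points a close pair if they are at distance at most \<open>\<delta>\<close> and their average lies in \<open>I\<close>. Replacing the
  second point of a pair by a divided difference extracts a factor of order \<open>n\<^sup>4 (b - a)\<^sup>2\<close> per pair from the
  determinant and leaves a Gram determinant with bounded entries, whose blocks belonging to different pairs
  decouple in \<open>L\<^sup>2\<close> because \<open>n |I| \<rightarrow> \<infinity>\<close>. Hence the factorial moments of the number of close pairs converge to
  those of a Poisson variable of mean \<open>\<beta>\<^sup>3\<close>, and the Bonferroni inequalities give the probability of no close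
  pair.
\<close>

text \<open>Haar measure is known only through translation invariance, so Weyl's formula is reached
  by uniqueness instead of a change of variables on the group. The eigenangles come sorted;
  composing them with a uniformly random permutation gives a law on the torus with symmetric Fourier
  coefficients, which traces of powers can see. Constants: the squared differences of the
  frequencies below \<open>n\<close> sum to about \<open>n ^ 4 / 6\<close>, so at separation
  \<open>s\<close> the two-point function is about
  \<open>n ^ 4 * s\<^sup>2 / (48 * pi\<^sup>2)\<close>. Integrated over
  \<open>0 < s \<le> \<delta>\<close> and over \<open>I\<close> this gives
  \<open>n ^ 4 * \<delta> ^ 3 * |I| / (144 * pi\<^sup>2)\<close>, which the scaling in the statement
  turns into \<open>\<beta> ^ 3\<close>. Then \<open>n * \<delta>\<close> is of order
  \<open>(n * |I|) powr (- 1 / 3)\<close>, so \<open>n * \<delta>\<close> and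
  \<open>\<delta> / |I|\<close> both vanish in the limit. Close pairs may share points, and then
  tuples of distinct points do not count tuples of pairs; the Bonferroni inequalities are therefore
  applied to isolated pairs, and the expected number of crowded configurations is shown to vanish in
  the limit.\<close>

lemma mat_adjoint_carrier [simp]:
  "A \<in> carrier_mat n m \<Longrightarrow> mat_adjoint A \<in> carrier_mat m n"
  unfolding mat_adjoint_def by (auto simp: mat_of_rows_def)

lemma mat_adjoint_dim [simp]:
  "dim_row (mat_adjoint A) = dim_col A" "dim_col (mat_adjoint A) = dim_row A"
  unfolding mat_adjoint_def by (auto simp: mat_of_rows_def)

lemma mat_adjoint_index:
  fixes A :: "complex mat"
  assumes "A \<in> carrier_mat n m" "i < m" "j < n"
  shows "mat_adjoint A $$ (i, j) = cnj (A $$ (j, i))"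
  using assms unfolding mat_adjoint_def by (auto simp: mat_of_rows_def)

lemma mult_mat_index:
  fixes A B :: "'a::comm_semiring_1 mat"
  assumes "A \<in> carrier_mat n m" "B \<in> carrier_mat m p" "i < n" "j < p"
  shows "(A * B) $$ (i, j) = (\<Sum>k<m. A $$ (i, k) * B $$ (k, j))"
  using assms by (auto simp: scalar_prod_def atLeast0LessThan)

lemma mat_adjoint_mult:
  fixes A B :: "complex mat"
  assumes "A \<in> carrier_mat n m" "B \<in> carrier_mat m p"
  shows "mat_adjoint (A * B) = mat_adjoint B * mat_adjoint A"
proof (rule eq_matI)
  fix i j assume "i < dim_row (mat_adjoint B * mat_adjoint A)" "j < dim_col (mat_adjoint B * mat_adjoint A)"
  then have ij: "i < p" "j < n" using assms mat_adjoint_carrier[OF assms(1)] mat_adjoint_carrier[OF assms(2)] by auto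
  have "mat_adjoint (A * B) $$ (i, j) = cnj (\<Sum>k<m. A $$ (j, k) * B $$ (k, i))"
    using assms ij by (subst mat_adjoint_index[of _ n p]) (auto simp: scalar_prod_def atLeast0LessThan)
  also have "\<dots> = (\<Sum>k<m. mat_adjoint B $$ (i, k) * mat_adjoint A $$ (k, j))"
    using assms ij by (auto simp: mat_adjoint_index[of _ n m] mat_adjoint_index[of _ m p] mult.commute intro!: sum.cong)
  also have "\<dots> = (mat_adjoint B * mat_adjoint A) $$ (i, j)"
    by (rule mult_mat_index[symmetric]) (use ij assms in auto)
  finally show "mat_adjoint (A * B) $$ (i, j) = (mat_adjoint B * mat_adjoint A) $$ (i, j)" .
qed (use assms mat_adjoint_carrier[OF assms(1)] mat_adjoint_carrier[OF assms(2)]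
       mat_adjoint_carrier[of "A*B" n p] in auto)

lemma unitary_groupD:
  assumes "A \<in> unitary_group n"
  shows "A \<in> carrier_mat n n" "mat_adjoint A \<in> carrier_mat n n"
    "mat_adjoint A * A = 1\<^sub>m n" "A * mat_adjoint A = 1\<^sub>m n"
  using assms by (auto simp: unitary_group_def)

lemma unitary_group_mult:
  assumes A: "A \<in> unitary_group n" and B: "B \<in> unitary_group n"
  shows "A * B \<in> unitary_group n"
proof -
  note a = unitary_groupD[OF A] and b = unitary_groupD[OF B]
  have adj: "mat_adjoint (A * B) = mat_adjoint B * mat_adjoint A"
    using a b by (intro mat_adjoint_mult)
  have "mat_adjoint B * mat_adjoint A * (A * B) = mat_adjoint B * ((mat_adjoint A * A) * B)"
    using a(1,2) b(1,2) by (simp add: assoc_mult_mat[of _ n n _ n _ n])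
  also have "\<dots> = 1\<^sub>m n" using a(3) b(3) b(1) by simp
  finally have 1: "mat_adjoint B * mat_adjoint A * (A * B) = 1\<^sub>m n" .
  have "A * B * (mat_adjoint B * mat_adjoint A) = A * (B * (mat_adjoint B * mat_adjoint A))"
    by (rule assoc_mult_mat) (use a b in auto)
  also have "B * (mat_adjoint B * mat_adjoint A) = (B * mat_adjoint B) * mat_adjoint A"
    by (rule assoc_mult_mat[symmetric]) (use a b in auto)
  also have "A * (B * mat_adjoint B * mat_adjoint A) = 1\<^sub>m n"
    using a(4) b(4) left_mult_one_mat[OF a(2)] by simp
  finally have 2: "A * B * (mat_adjoint B * mat_adjoint A) = 1\<^sub>m n" .
  show ?thesis unfolding unitary_group_def using 1 2 a(1) b(1) adj by auto
qed

lemma mat_adjoint_adjoint: 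
  fixes A :: "complex mat"
  assumes A: "A \<in> carrier_mat n m" shows "mat_adjoint (mat_adjoint A) = A"
  using A mat_adjoint_carrier[OF A] mat_adjoint_carrier[OF mat_adjoint_carrier[OF A]]
  by (intro eq_matI) (auto simp: mat_adjoint_index[of _ n m] mat_adjoint_index[of _ m n])

lemma unitary_group_adjoint: "A \<in> unitary_group n \<Longrightarrow> mat_adjoint A \<in> unitary_group n"
  unfolding unitary_group_def by (auto simp: mat_adjoint_adjoint[of A n n])

text \<open>The diagonal of \<open>A * mat_adjoint A\<close> shows that every row is a unit vector.
  The bound makes all functions built from entries integrable.\<close>

lemma unitary_entry_le_1:
  assumes A: "A \<in> unitary_group n" and ij: "i < n" "j < n"
  shows "norm (A $$ (i, j)) \<le> 1"
proof -
  note a = unitary_groupD[OF A]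
  have "(A * mat_adjoint A) $$ (i, i) = (\<Sum>k<n. A $$ (i, k) * mat_adjoint A $$ (k, i))"
    using a ij by (intro mult_mat_index)
  also have "\<dots> = (\<Sum>k<n. of_real ((norm (A $$ (i, k)))\<^sup>2))"
    using a ij by (intro sum.cong) (auto simp: mat_adjoint_index[of A n n] complex_norm_square simp del: of_real_power)
  finally have "1 = complex_of_real (\<Sum>k<n. (norm (A $$ (i, k)))\<^sup>2)"
    using a ij by simp
  then have 1: "1 = (\<Sum>k<n. (norm (A $$ (i, k)))\<^sup>2)"
    by (metis of_real_eq_1_iff)
  have "(norm (A $$ (i, j)))\<^sup>2 \<le> (\<Sum>k<n. (norm (A $$ (i, k)))\<^sup>2)"
    using ij by (intro member_le_sum) auto
  then show ?thesis using 1 by (metis abs_norm_cancel abs_square_le_1)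
qed

lemma continuous_map_entry:
  assumes "i < n" "j < n"
  shows "continuous_map (unitary_top n) euclidean (\<lambda>A. A $$ (i, j))"
proof -
  have "continuous_map (product_topology (\<lambda>_. euclidean) ({..<n} \<times> {..<n})) euclidean (\<lambda>x. x (i, j) :: complex)"
    using assms by (intro continuous_map_product_projection) auto
  from continuous_map_pullback[OF this, of "unitary_group n" "\<lambda>A. \<lambda>(i, j) \<in> {..<n} \<times> {..<n}. A $$ (i, j)"]
  show ?thesis using assms unfolding unitary_top_def o_def by (simp add: restrict_def)
qed

text \<open>Continuity into the pullback topology means continuity of each entry, and each entry of
  a translate is a fixed linear combination of entries. This is what makes translations
  measurable.\<close>

lemma continuous_map_mult_left:
  assumes G: "G \<in> unitary_group n"
  shows "continuous_map (unitary_top n) (unitary_top n) ((*) G)"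
proof -
  have *: "continuous_map (unitary_top n) euclidean (\<lambda>A. (\<Sum>k<n. G $$ (i, k) * A $$ (k, j)))"
    if "i < n" "j < n" for i j
  proof (intro continuous_map_sum)
    fix k assume k: "k \<in> {..<n}"
    have "continuous_map euclidean euclidean (\<lambda>z. G $$ (i, k) * z)"
      by (simp add: continuous_on_mult_left)
    from continuous_map_compose[OF continuous_map_entry[of k n j] this]
    show "continuous_map (unitary_top n) euclidean (\<lambda>A. G $$ (i, k) * A $$ (k, j))"
      using that k by (auto simp: o_def)
  qed auto
  have "continuous_map (unitary_top n)
     (pullback_topology (unitary_group n)
       (\<lambda>A. \<lambda>(i, j) \<in> {..<n} \<times> {..<n}. A $$ (i, j))
       (product_topology (\<lambda>_. euclidean) ({..<n} \<times> {..<n}))) ((*) G)"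
  proof (rule continuous_map_pullback')
    show "continuous_map (unitary_top n) (product_topology (\<lambda>_. euclidean) ({..<n} \<times> {..<n}))
     ((\<lambda>A. \<lambda>(i, j)\<in>{..<n} \<times> {..<n}. A $$ (i, j)) \<circ> (*) G)"
      unfolding continuous_map_componentwise
    proof (intro conjI ballI)
      fix p assume p: "p \<in> {..<n} \<times> {..<n}"
      obtain i j where ij: "p = (i, j)" by (cases p)
      show "continuous_map (unitary_top n) euclidean
          (\<lambda>x. ((\<lambda>A. \<lambda>(i, j)\<in>{..<n} \<times> {..<n}. A $$ (i, j)) \<circ> (*) G) x p)"
        using p ij G
        by (intro continuous_map_eq[OF *[of i j]])
           (auto simp: topspace_unitary_top mult_mat_index[of _ n n _ n] simp del: index_mult_mat dest!: unitary_groupD(1))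
    qed auto
    show "topspace (unitary_top n) \<subseteq> (*) G -` unitary_group n"
      using G unitary_group_mult by (auto simp: topspace_unitary_top)
  qed
  then show ?thesis unfolding unitary_top_def[symmetric] .
qed

section \<open>Rotations along orthogonal projections\<close>

definition herm_idem :: "nat \<Rightarrow> complex mat \<Rightarrow> bool" where
  "herm_idem n P \<longleftrightarrow> P \<in> carrier_mat n n \<and> P * P = P \<and> mat_adjoint P = P"

text \<open>The exponential of \<open>\<i> * t\<close> times \<open>P\<close> in closed form: since
  \<open>P\<close> is idempotent, the exponential series collapses to a single increment along
  \<open>P\<close>.\<close>

definition rot :: "nat \<Rightarrow> complex mat \<Rightarrow> real \<Rightarrow> complex mat" where
  "rot n P t = 1\<^sub>m n + (cis t - 1) \<cdot>\<^sub>m P"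

text \<open>From \<open>cis t\<close> having modulus one. It says that the adjoint of a rotation
  moves in the opposite direction, up to an error quadratic in the increment.\<close>

lemma cis_minus_one_cnj: "cnj (cis t - 1) = - (cis t - 1) - of_real ((norm (cis t - 1))\<^sup>2)"
proof -
  have "(1 + (cis t - 1)) * cnj (1 + (cis t - 1)) = 1"
    by (simp add: cis_cnj cis_mult)
  then show ?thesis by (simp only: complex_norm_square) (simp add: algebra_simps)
qed

lemma rot_carrier: "herm_idem n P \<Longrightarrow> rot n P t \<in> carrier_mat n n"
  by (auto simp: rot_def herm_idem_def)

lemma herm_idem_entry:
  assumes "herm_idem n P" "i < n" "j < n"
  shows "(\<Sum>k<n. P $$ (i, k) * P $$ (k, j)) = P $$ (i, j)" "cnj (P $$ (i, j)) = P $$ (j, i)"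
  using assms mult_mat_index[of P n n P n i j] mat_adjoint_index[of P n n j i]
  by (auto simp: herm_idem_def)

lemma rot_entry: "herm_idem n P \<Longrightarrow> i < n \<Longrightarrow> j < n \<Longrightarrow>
   rot n P t $$ (i, j) = (if i = j then 1 else 0) + (cis t - 1) * P $$ (i, j)"
  by (auto simp: rot_def herm_idem_def)

lemma mat_adjoint_rot:
  assumes P: "herm_idem n P"
  shows "mat_adjoint (rot n P t) = rot n P (- t)"
proof (rule eq_matI)
  fix i j assume "i < dim_row (rot n P (- t))" "j < dim_col (rot n P (- t))"
  then have ij: "i < n" "j < n" using rot_carrier[OF P, of "- t"] by auto
  show "mat_adjoint (rot n P t) $$ (i, j) = rot n P (- t) $$ (i, j)"
    using ij herm_idem_entry(2)[OF P, of j i]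
    by (simp add: mat_adjoint_index[OF rot_carrier[OF P]] rot_entry[OF P] cis_cnj)
qed (use rot_carrier[OF P, of "- t"] mat_adjoint_carrier[OF rot_carrier[OF P, of t]] in auto)

lemma rot_mult_inverse:
  assumes P: "herm_idem n P"
  shows "rot n P t * rot n P (- t) = 1\<^sub>m n"
proof (rule eq_matI)
  fix i j assume "i < dim_row (1\<^sub>m n :: complex mat)" "j < dim_col (1\<^sub>m n :: complex mat)"
  then have ij: "i < n" "j < n" by auto
  let ?w = "cis t - 1" and ?v = "cis (- t) - 1"
  have "(rot n P t * rot n P (- t)) $$ (i, j)
      = (\<Sum>k<n. ((if i = k then 1 else 0) + ?w * P $$ (i, k)) * ((if k = j then 1 else 0) + ?v * P $$ (k, j)))"
    using ij mult_mat_index[OF rot_carrier[OF P] rot_carrier[OF P] ij, of t "- t"]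
    by (simp add: rot_entry[OF P])
  also have "\<dots> = (\<Sum>k<n. (if k = i then (if k = j then 1 else 0) + ?v * P $$ (k, j) else 0))
      + (\<Sum>k<n. if k = j then ?w * P $$ (i, k) else 0) + (\<Sum>k<n. ?w * ?v * (P $$ (i, k) * P $$ (k, j)))"
    unfolding sum.distrib[symmetric] by (intro sum.cong) (auto simp: algebra_simps)
  also have "\<dots> = (if i = j then 1 else 0) + (?v + ?w + ?w * ?v) * P $$ (i, j)"
    using ij herm_idem_entry(1)[OF P ij] unfolding sum_distrib_left[symmetric]
    by (simp add: algebra_simps)
  also have "?v + ?w + ?w * ?v = 0" by (simp add: algebra_simps cis_mult)
  finally show "(rot n P t * rot n P (- t)) $$ (i, j) = 1\<^sub>m n $$ (i, j)" using ij by simp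
qed (use rot_carrier[OF P, of "- t"] rot_carrier[OF P, of t] in auto)

lemma rot_unitary:
  assumes P: "herm_idem n P" shows "rot n P t \<in> unitary_group n"
  using rot_mult_inverse[OF P, of t] rot_mult_inverse[OF P, of "- t"] rot_carrier[OF P]
  by (auto simp: unitary_group_def mat_adjoint_rot[OF P])

section \<open>Integer powers and oriented sums\<close>

definition upow :: "complex mat \<Rightarrow> int \<Rightarrow> complex mat" where
  "upow A k = (if k \<ge> 0 then A ^\<^sub>m nat k else mat_adjoint A ^\<^sub>m nat (- k))"

lemma upow_carrier [simp]: "A \<in> carrier_mat n n \<Longrightarrow> upow A k \<in> carrier_mat n n"
  by (auto simp: upow_def)

text \<open>For a unitary matrix the adjoint is the inverse, so the step also holds across exponent
  0 and \<open>upow\<close> is a genuine integer power.\<close>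

lemma upow_Suc:
  assumes A: "A \<in> unitary_group n"
  shows "upow A (k + 1) = upow A k * A"
proof (cases "k \<ge> 0")
  case True then show ?thesis by (simp add: upow_def nat_add_distrib)
next
  case False
  note a = unitary_groupD[OF A]
  define m where "m = nat (- k - 1)"
  have "nat (- k) = Suc m" "nat (- (k + 1)) = m" using False by (auto simp: m_def)
  then have "upow A k * A = mat_adjoint A ^\<^sub>m m * mat_adjoint A * A"
    using False by (simp add: upow_def)
  also have "\<dots> = mat_adjoint A ^\<^sub>m m"
    using a(3) assoc_mult_mat[of "mat_adjoint A ^\<^sub>m m" n n "mat_adjoint A" n A n] a(1,2)
    by (metis pow_carrier_mat right_mult_one_mat)
  also have "\<dots> = upow A (k + 1)"
  proof (cases "k = -1")
    case True then show ?thesis using carrier_matD[OF a(1)] by (simp add: upow_def m_def)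
  next
    case False
    then show ?thesis using \<open>\<not> k \<ge> 0\<close> \<open>nat (- (k + 1)) = m\<close> by (simp add: upow_def)
  qed
  finally show ?thesis by simp
qed

lemma upow_pred:
  assumes A: "A \<in> unitary_group n"
  shows "upow A (k - 1) = upow A k * mat_adjoint A"
proof -
  note a = unitary_groupD[OF A]
  have "upow A k * mat_adjoint A = upow A (k - 1) * A * mat_adjoint A"
    using upow_Suc[OF A, of "k - 1"] by simp
  also have "\<dots> = upow A (k - 1) * (A * mat_adjoint A)"
    by (rule assoc_mult_mat[of _ n n _ n _ n]) (use a in auto)
  finally show ?thesis using a right_mult_one_mat[OF upow_carrier[OF a(1), of "k - 1"]] by simp
qed

lemma upow_0: "A \<in> carrier_mat n n \<Longrightarrow> upow A 0 = 1\<^sub>m n"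
  by (simp add: upow_def)

lemma upow_1: "A \<in> carrier_mat n n \<Longrightarrow> upow A 1 = A"
  by (simp add: upow_def)

lemma upow_add:
  assumes A: "A \<in> unitary_group n"
  shows "upow A (k + l) = upow A k * upow A l"
proof (induction l rule: int_induct[where k = 0])
  case base
  then show ?case using unitary_groupD(1)[OF A] right_mult_one_mat[OF upow_carrier] by (simp add: upow_0)
next
  case (step1 i)
  have "upow A (k + (i + 1)) = upow A (k + i) * A"
    using upow_Suc[OF A, of "k + i"] by (simp add: algebra_simps)
  also have "\<dots> = upow A k * upow A i * A" using step1 by simp
  also have "\<dots> = upow A k * (upow A i * A)"
    by (rule assoc_mult_mat[of _ n n _ n _ n]) (use unitary_groupD[OF A] in auto)
  finally show ?case using upow_Suc[OF A] by simp
next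
  case (step2 i)
  have "upow A (k + (i - 1)) = upow A (k + i) * mat_adjoint A"
    using upow_pred[OF A, of "k + i"] by (simp add: algebra_simps)
  also have "\<dots> = upow A k * upow A i * mat_adjoint A" using step2 by simp
  also have "\<dots> = upow A k * (upow A i * mat_adjoint A)"
    by (rule assoc_mult_mat[of _ n n _ n _ n]) (use unitary_groupD[OF A] in auto)
  finally show ?case using upow_pred[OF A] by simp
qed

text \<open>The sum from 0 to \<open>k\<close> with orientation, like an integral: for negative
  \<open>k\<close> it is minus the sum over the exponents from \<open>k\<close> to -1. With it the
  derivative of a power has one formula for both signs of the exponent.\<close>

definition isum :: "int \<Rightarrow> (int \<Rightarrow> complex) \<Rightarrow> complex" where
  "isum k h = (\<Sum>l\<in>{0..<k}. h l) - (\<Sum>l\<in>{k..<0}. h l)"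

lemma isum_0 [simp]: "isum 0 h = 0"
  by (simp add: isum_def)

lemma isum_Suc: "isum (k + 1) h = isum k h + h k"
proof (cases "k \<ge> 0")
  case True
  have "{0..<k+1} = insert k {0..<k}" "{k+1..<0} = {}" "{k..<0} = {}" using True by auto
  then show ?thesis by (simp add: isum_def)
next
  case False
  have "{k..<0} = insert k {k+1..<0}" "{0..<k+1} = {}" "{0..<k} = {}" using False by auto
  then show ?thesis by (simp add: isum_def)
qed

lemma isum_pred: "isum (k - 1) h = isum k h - h (k - 1)"
  using isum_Suc[of "k - 1" h] by simp

lemma isum_cmult: "c * isum k h = isum k (\<lambda>l. c * h l)" "isum k h * c = isum k (\<lambda>l. h l * c)"
  by (auto simp: isum_def sum_distrib_left sum_distrib_right algebra_simps)

lemma isum_sum: "isum k (\<lambda>l. \<Sum>i\<in>I. h i l) = (\<Sum>i\<in>I. isum k (h i))"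
  unfolding isum_def sum_subtractf by (intro arg_cong2[where f = minus] sum.swap)

lemma isum_const: "isum k (\<lambda>_. c) = of_int k * c"
  by (cases "k \<ge> 0") (auto simp: isum_def)

section \<open>Loop equations\<close>

locale haar_unitary =
  fixes n :: nat and M :: "complex mat measure"
  assumes haar: "haar_prob n M"
begin

sublocale prob_space M
  using haar by (simp add: haar_prob_def)

lemma space_haar [simp]: "space M = unitary_group n"
  using haar by (simp add: haar_prob_def)

lemma prob_unitary_group [simp]: "prob (unitary_group n) = 1"
  using prob_space by simp

lemma sets_haar: "sets M = sigma_sets (unitary_group n) {W. openin (unitary_top n) W}"
  using haar by (simp add: haar_prob_def)

lemma opens_subset: "{W. openin (unitary_top n) W} \<subseteq> Pow (unitary_group n)"
  using openin_subset[of "unitary_top n"] by (auto simp: topspace_unitary_top)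

lemma borel_measurable_haar_continuous:
  fixes f :: "complex mat \<Rightarrow> complex"
  assumes f: "continuous_map (unitary_top n) euclidean f"
  shows "f \<in> borel_measurable M"
proof (rule borel_measurableI)
  fix S :: "complex set" assume "open S"
  then have "openin (unitary_top n) {x \<in> topspace (unitary_top n). f x \<in> S}"
    using f by (intro openin_continuous_map_preimage[where Y = euclidean]) auto
  moreover have "f -` S \<inter> space M = {x \<in> topspace (unitary_top n). f x \<in> S}"
    by (auto simp: topspace_unitary_top)
  ultimately show "f -` S \<inter> space M \<in> sets M" by (auto simp: sets_haar)
qed

lemma entry_measurable [measurable]:
  "i < n \<Longrightarrow> j < n \<Longrightarrow> (\<lambda>A. A $$ (i, j)) \<in> borel_measurable M"
  by (intro borel_measurable_haar_continuous continuous_map_entry)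

lemma adjoint_entry_measurable [measurable]:
  assumes "i < n" "j < n" shows "(\<lambda>A. mat_adjoint A $$ (i, j)) \<in> borel_measurable M"
proof -
  have "(\<lambda>A. cnj (A $$ (j, i))) \<in> borel_measurable M"
    using assms by (intro borel_measurable_haar_continuous continuous_map_compose[OF continuous_map_entry, unfolded o_def, where g = cnj])
      (auto intro!: continuous_intros)
  then show ?thesis
    using assms by (subst measurable_cong[where g = "\<lambda>A. cnj (A $$ (j, i))"])
      (auto simp: mat_adjoint_index[of _ n n] dest: unitary_groupD(1))
qed

lemma translation_measurable:
  assumes G: "G \<in> unitary_group n"
  shows "(*) G \<in> measurable M M"
proof (rule measurable_sigma_sets[OF sets_haar])
  show "{W. openin (unitary_top n) W} \<subseteq> Pow (unitary_group n)" by (rule opens_subset)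
  show "(*) G \<in> space M \<rightarrow> unitary_group n" using G unitary_group_mult by auto
  fix W assume W: "W \<in> {W. openin (unitary_top n) W}"
  then have "openin (unitary_top n) {x \<in> topspace (unitary_top n). G * x \<in> W}"
    by (intro openin_continuous_map_preimage[OF continuous_map_mult_left[OF G]]) auto
  moreover have "(*) G -` W \<inter> space M = {x \<in> topspace (unitary_top n). G * x \<in> W}"
    by (auto simp: topspace_unitary_top)
  ultimately show "(*) G -` W \<inter> space M \<in> sets M" by (auto simp: sets_haar)
qed

text \<open>\<open>haar_prob\<close> speaks of images under left translations; the preimage under
  \<open>G\<close> is the image under the adjoint of \<open>G\<close>, which is again
  unitary.\<close>

lemma distr_translation:
  assumes G: "G \<in> unitary_group n"
  shows "distr M M ((*) G) = M"
proof (rule measure_eqI)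
  fix S assume "S \<in> sets (distr M M ((*) G))"
  then have S: "S \<in> sets M" by simp
  have G': "mat_adjoint G \<in> unitary_group n" by (rule unitary_group_adjoint[OF G])
  note g = unitary_groupD[OF G]
  have "(*) G -` S \<inter> space M = (*) (mat_adjoint G) ` S"
  proof (intro equalityI subsetI)
    fix A assume A: "A \<in> (*) G -` S \<inter> space M"
    then have "A = mat_adjoint G * (G * A)"
      using assoc_mult_mat[of "mat_adjoint G" n n G n A n] g unitary_groupD(1)[of A n] by auto
    then show "A \<in> (*) (mat_adjoint G) ` S" using A by auto
  next
    fix A assume "A \<in> (*) (mat_adjoint G) ` S"
    then obtain B where B: "B \<in> S" "A = mat_adjoint G * B" by auto
    have "B \<in> unitary_group n" using B sets.sets_into_space[OF S] by auto
    then have "G * A = B"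
      using B assoc_mult_mat[of G n n "mat_adjoint G" n B n] g unitary_groupD(1)[of B n] by auto
    then show "A \<in> (*) G -` S \<inter> space M"
      using B unitary_group_mult[OF G' \<open>B \<in> unitary_group n\<close>] by auto
  qed
  then show "emeasure (distr M M ((*) G)) S = emeasure M S"
    using S haar G' by (simp add: emeasure_distr translation_measurable[OF G] haar_prob_def)
qed simp

lemma integral_translation:
  fixes f :: "complex mat \<Rightarrow> complex"
  assumes "G \<in> unitary_group n" "f \<in> borel_measurable M"
  shows "(\<integral>A. f (G * A) \<partial>M) = (\<integral>A. f A \<partial>M)"
  using integral_distr[OF translation_measurable[OF assms(1)], of f] assms
  by (simp add: distr_translation)

text \<open>\<open>loopable f D\<close>: \<open>D x y\<close> is the derivative of \<open>f\<close> along the left-invariant direction given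
  by the elementary matrix with entry 1 at \<open>(x, y)\<close>. Only the finite rotations \<open>rot n P t\<close> stay
  inside the unitary group, so differentiability is stated along these, with the increment
  \<open>cis t - 1\<close> in place of \<open>t\<close>.\<close>

definition loopable ::
  "(complex mat \<Rightarrow> complex) \<Rightarrow> (nat \<Rightarrow> nat \<Rightarrow> complex mat \<Rightarrow> complex) \<Rightarrow> bool" where
  "loopable f D \<longleftrightarrow>
     f \<in> borel_measurable M \<and> (\<forall>x<n. \<forall>y<n. D x y \<in> borel_measurable M) \<and>
     (\<exists>C. \<forall>A\<in>unitary_group n. norm (f A) \<le> C \<and> (\<forall>x<n. \<forall>y<n. norm (D x y A) \<le> C)) \<and>
     (\<forall>P. herm_idem n P \<longrightarrow> (\<exists>C. \<forall>A\<in>unitary_group n. \<forall>t.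
        norm (f (rot n P t * A) - f A - (cis t - 1) * (\<Sum>x<n. \<Sum>y<n. P $$ (x, y) * D x y A))
          \<le> C * (norm (cis t - 1))\<^sup>2))"

lemma loopableI:
  assumes "f \<in> borel_measurable M" "\<And>x y. x < n \<Longrightarrow> y < n \<Longrightarrow> D x y \<in> borel_measurable M"
    "\<And>A. A \<in> unitary_group n \<Longrightarrow> norm (f A) \<le> C"
    "\<And>A x y. A \<in> unitary_group n \<Longrightarrow> x < n \<Longrightarrow> y < n \<Longrightarrow> norm (D x y A) \<le> C"
    "\<And>P. herm_idem n P \<Longrightarrow> \<exists>C. \<forall>A\<in>unitary_group n. \<forall>t.
        norm (f (rot n P t * A) - f A - (cis t - 1) * (\<Sum>x<n. \<Sum>y<n. P $$ (x, y) * D x y A))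
          \<le> C * (norm (cis t - 1))\<^sup>2"
  shows "loopable f D"
  unfolding loopable_def using assms by blast

lemma loopable_measurable:
  assumes "loopable f D"
  shows "f \<in> borel_measurable M" "x < n \<Longrightarrow> y < n \<Longrightarrow> D x y \<in> borel_measurable M"
  using assms unfolding loopable_def by blast+

lemma loopable_cong:
  assumes f: "loopable f D" and eq: "\<And>A. A \<in> unitary_group n \<Longrightarrow> f A = f' A"
    "\<And>A x y. A \<in> unitary_group n \<Longrightarrow> x < n \<Longrightarrow> y < n \<Longrightarrow> D x y A = D' x y A"
  shows "loopable f' D'"
proof -
  obtain C where C: "\<And>A. A \<in> unitary_group n \<Longrightarrow> norm (f A) \<le> C"
     "\<And>A x y. A \<in> unitary_group n \<Longrightarrow> x < n \<Longrightarrow> y < n \<Longrightarrow> norm (D x y A) \<le> C"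
    using f unfolding loopable_def by blast
  show ?thesis
  proof (rule loopableI[where C = C])
    show "f' \<in> borel_measurable M"
      by (rule measurable_cong[THEN iffD1, OF _ loopable_measurable(1)[OF f]]) (simp add: eq)
    fix x y assume xy: "x < n" "y < n"
    show "D' x y \<in> borel_measurable M"
      by (rule measurable_cong[THEN iffD1, OF _ loopable_measurable(2)[OF f xy]]) (simp add: eq xy)
  next
    fix A assume A: "A \<in> unitary_group n"
    show "norm (f' A) \<le> C" using C(1)[OF A] eq(1)[OF A] by simp
  next
    fix A x y assume A: "A \<in> unitary_group n" "x < n" "y < n"
    show "norm (D' x y A) \<le> C" using C(2)[OF A] eq(2)[OF A] by simp
  next
    fix P assume P: "herm_idem n P"
    obtain B where B: "\<And>A t. A \<in> unitary_group n \<Longrightarrow>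
       norm (f (rot n P t * A) - f A - (cis t - 1) * (\<Sum>x<n. \<Sum>y<n. P $$ (x, y) * D x y A))
          \<le> B * (norm (cis t - 1))\<^sup>2" using f P unfolding loopable_def by blast
    show "\<exists>C. \<forall>A\<in>unitary_group n. \<forall>t.
       norm (f' (rot n P t * A) - f' A - (cis t - 1) * (\<Sum>x<n. \<Sum>y<n. P $$ (x, y) * D' x y A))
          \<le> C * (norm (cis t - 1))\<^sup>2"
    proof (intro exI[of _ B] ballI allI)
      fix A t assume A: "A \<in> unitary_group n"
      have "(\<Sum>x<n. \<Sum>y<n. P $$ (x, y) * D' x y A) = (\<Sum>x<n. \<Sum>y<n. P $$ (x, y) * D x y A)"
        using eq(2)[OF A] by (intro sum.cong) auto
      then show "norm (f' (rot n P t * A) - f' A - (cis t - 1) * (\<Sum>x<n. \<Sum>y<n. P $$ (x, y) * D' x y A))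
          \<le> B * (norm (cis t - 1))\<^sup>2"
        using B[OF A, of t] eq(1)[OF A] eq(1)[OF unitary_group_mult[OF rot_unitary[OF P] A], of t] by simp
    qed
  qed
qed

lemma loopable_const: "loopable (\<lambda>_. c) (\<lambda>_ _ _. 0)"
  by (rule loopableI[where C = "norm c"]) (auto intro!: exI[of _ 0])

lemma loopable_add:
  assumes "loopable f D" "loopable g E"
  shows "loopable (\<lambda>A. f A + g A) (\<lambda>x y A. D x y A + E x y A)"
proof -
  obtain C1 where C1: "\<And>A. A \<in> unitary_group n \<Longrightarrow> norm (f A) \<le> C1"
     "\<And>A x y. A \<in> unitary_group n \<Longrightarrow> x < n \<Longrightarrow> y < n \<Longrightarrow> norm (D x y A) \<le> C1"
    using assms(1) unfolding loopable_def by blast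
  obtain C2 where C2: "\<And>A. A \<in> unitary_group n \<Longrightarrow> norm (g A) \<le> C2"
     "\<And>A x y. A \<in> unitary_group n \<Longrightarrow> x < n \<Longrightarrow> y < n \<Longrightarrow> norm (E x y A) \<le> C2"
    using assms(2) unfolding loopable_def by blast
  show ?thesis
  proof (rule loopableI[where C = "C1 + C2"])
    fix P assume P: "herm_idem n P"
    obtain B1 where B1: "\<And>A t. A \<in> unitary_group n \<Longrightarrow>
       norm (f (rot n P t * A) - f A - (cis t - 1) * (\<Sum>x<n. \<Sum>y<n. P $$ (x, y) * D x y A))
          \<le> B1 * (norm (cis t - 1))\<^sup>2" using assms(1) P unfolding loopable_def by blast
    obtain B2 where B2: "\<And>A t. A \<in> unitary_group n \<Longrightarrow>
       norm (g (rot n P t * A) - g A - (cis t - 1) * (\<Sum>x<n. \<Sum>y<n. P $$ (x, y) * E x y A))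
          \<le> B2 * (norm (cis t - 1))\<^sup>2" using assms(2) P unfolding loopable_def by blast
    show "\<exists>C. \<forall>A\<in>unitary_group n. \<forall>t.
        norm (f (rot n P t * A) + g (rot n P t * A) - (f A + g A) -
          (cis t - 1) * (\<Sum>x<n. \<Sum>y<n. P $$ (x, y) * (D x y A + E x y A)))
          \<le> C * (norm (cis t - 1))\<^sup>2"
    proof (intro exI[of _ "B1 + B2"] ballI allI)
      fix A t assume A: "A \<in> unitary_group n"
      have eq: "f (rot n P t * A) + g (rot n P t * A) - (f A + g A) -
          (cis t - 1) * (\<Sum>x<n. \<Sum>y<n. P $$ (x, y) * (D x y A + E x y A))
        = (f (rot n P t * A) - f A - (cis t - 1) * (\<Sum>x<n. \<Sum>y<n. P $$ (x, y) * D x y A))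
        + (g (rot n P t * A) - g A - (cis t - 1) * (\<Sum>x<n. \<Sum>y<n. P $$ (x, y) * E x y A))"
        by (simp add: sum.distrib algebra_simps)
      show "norm (f (rot n P t * A) + g (rot n P t * A) - (f A + g A) -
          (cis t - 1) * (\<Sum>x<n. \<Sum>y<n. P $$ (x, y) * (D x y A + E x y A)))
          \<le> (B1 + B2) * (norm (cis t - 1))\<^sup>2"
        unfolding eq using norm_triangle_mono[OF B1[OF A, of t] B2[OF A, of t]]
        by (simp add: algebra_simps)
    qed
  next
    fix A x y assume A: "A \<in> unitary_group n" "x < n" "y < n"
    show "norm (D x y A + E x y A) \<le> C1 + C2" using norm_triangle_mono[OF C1(2)[OF A] C2(2)[OF A]] .
  next
    fix A assume A: "A \<in> unitary_group n"
    show "norm (f A + g A) \<le> C1 + C2" using norm_triangle_mono[OF C1(1)[OF A] C2(1)[OF A]] .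
  qed (intro borel_measurable_add loopable_measurable[OF assms(1)] loopable_measurable[OF assms(2)]; assumption)+
qed

lemma norm_cis_minus_one: "norm (cis t - 1) \<le> 2"
  using norm_triangle_ineq4[of "cis t" 1] by simp

lemma loopable_mult:
  assumes "loopable f D" "loopable g E"
  shows "loopable (\<lambda>A. f A * g A) (\<lambda>x y A. D x y A * g A + f A * E x y A)"
proof -
  obtain C1 where C1: "\<And>A. A \<in> unitary_group n \<Longrightarrow> norm (f A) \<le> C1"
     "\<And>A x y. A \<in> unitary_group n \<Longrightarrow> x < n \<Longrightarrow> y < n \<Longrightarrow> norm (D x y A) \<le> C1"
    using assms(1) unfolding loopable_def by blast
  obtain C2 where C2: "\<And>A. A \<in> unitary_group n \<Longrightarrow> norm (g A) \<le> C2"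
     "\<And>A x y. A \<in> unitary_group n \<Longrightarrow> x < n \<Longrightarrow> y < n \<Longrightarrow> norm (E x y A) \<le> C2"
    using assms(2) unfolding loopable_def by blast
  have one: "1\<^sub>m n \<in> unitary_group n"
    by (auto simp: unitary_group_def mat_adjoint_index[of _ n n] intro!: eq_matI)
  have C0: "C1 \<ge> 0" "C2 \<ge> 0"
    using C1(1)[OF one] C2(1)[OF one] norm_ge_zero order_trans by blast+
  show ?thesis
  proof (rule loopableI[where C = "2 * (C1 * C2)"])
    fix P assume P: "herm_idem n P"
    obtain B1 where B1: "\<And>A t. A \<in> unitary_group n \<Longrightarrow>
       norm (f (rot n P t * A) - f A - (cis t - 1) * (\<Sum>x<n. \<Sum>y<n. P $$ (x, y) * D x y A))
          \<le> B1 * (norm (cis t - 1))\<^sup>2" using assms(1) P unfolding loopable_def by blast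
    obtain B2 where B2: "\<And>A t. A \<in> unitary_group n \<Longrightarrow>
       norm (g (rot n P t * A) - g A - (cis t - 1) * (\<Sum>x<n. \<Sum>y<n. P $$ (x, y) * E x y A))
          \<le> B2 * (norm (cis t - 1))\<^sup>2" using assms(2) P unfolding loopable_def by blast
    define K where "K = (\<Sum>x<n. \<Sum>y<n. norm (P $$ (x, y)))"
    have K0: "K \<ge> 0" unfolding K_def by (intro sum_nonneg) auto
    define S where "S D A = (\<Sum>x<n. \<Sum>y<n. P $$ (x, y) * D x y A)" for D :: "nat \<Rightarrow> nat \<Rightarrow> complex mat \<Rightarrow> complex" and A
    have S: "norm (S F A) \<le> K * C" if "\<And>x y. x < n \<Longrightarrow> y < n \<Longrightarrow> norm (F x y A) \<le> C" for F A C
      unfolding S_def K_def sum_distrib_right using that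
      by (intro sum_norm_le) (auto simp: norm_mult intro!: mult_left_mono)
    show "\<exists>C. \<forall>A\<in>unitary_group n. \<forall>t.
        norm (f (rot n P t * A) * g (rot n P t * A) - f A * g A -
          (cis t - 1) * (\<Sum>x<n. \<Sum>y<n. P $$ (x, y) * (D x y A * g A + f A * E x y A)))
          \<le> C * (norm (cis t - 1))\<^sup>2"
    proof (intro exI[of _ "B1 * C2 + (C1 + 2 * (K * C1)) * B2 + K * C1 * (K * C2)"] ballI allI)
      fix A t assume A: "A \<in> unitary_group n"
      define w where "w = cis t - 1"
      define A' where "A' = rot n P t * A"
      have A': "A' \<in> unitary_group n" unfolding A'_def using rot_unitary[OF P] A unitary_group_mult by blast
      have eq0: "(\<Sum>x<n. \<Sum>y<n. P $$ (x, y) * (D x y A * g A + f A * E x y A)) = S D A * g A + f A * S E A"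
        unfolding S_def by (simp add: sum_distrib_left sum_distrib_right sum.distrib algebra_simps)
      have b1: "norm (f A' - f A - w * S D A) \<le> B1 * (norm w)\<^sup>2" using B1[OF A, of t] by (simp add: A'_def w_def S_def)
      have b2: "norm (g A' - g A - w * S E A) \<le> B2 * (norm w)\<^sup>2" using B2[OF A, of t] by (simp add: A'_def w_def S_def)
      have eq: "f A' * g A' - f A * g A - w * (S D A * g A + f A * S E A)
         = (f A' - f A - w * S D A) * g A' + f A * (g A' - g A - w * S E A) + w * S D A * (g A' - g A)"
        by (simp add: algebra_simps)
      \<comment> \<open>An exact Leibniz identity: the two first-order remainders with bounded
        cofactors, plus one term quadratic in \<open>w\<close>. Every summand is then of order
        \<open>(norm w)\<^sup>2\<close>.\<close>
      have eq2: "f A' * g A' - f A * g A - w * (S D A * g A + f A * S E A)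
         = (f A' - f A - w * S D A) * g A' + (f A + w * S D A) * (g A' - g A - w * S E A) + w\<^sup>2 * (S D A * S E A)"
        by (simp add: algebra_simps power2_eq_square)
      have fw: "norm (f A + w * S D A) \<le> C1 + 2 * (K * C1)"
        by (intro norm_triangle_mono C1(1)[OF A]) (auto simp: norm_mult w_def intro!: mult_mono norm_cis_minus_one S C1(2)[OF A])
      have t1: "norm ((f A' - f A - w * S D A) * g A') \<le> (B1 * (norm w)\<^sup>2) * C2"
        unfolding norm_mult using b1 C1 C2(1)[OF A'] by (intro mult_mono) (auto intro: order_trans[OF norm_ge_zero])
      show "norm (f (rot n P t * A) * g (rot n P t * A) - f A * g A -
          (cis t - 1) * (\<Sum>x<n. \<Sum>y<n. P $$ (x, y) * (D x y A * g A + f A * E x y A)))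
          \<le> (B1 * C2 + (C1 + 2 * (K * C1)) * B2 + K * C1 * (K * C2)) * (norm (cis t - 1))\<^sup>2"
      proof -
        have t2: "norm ((f A + w * S D A) * (g A' - g A - w * S E A)) \<le> (C1 + 2 * (K * C1)) * (B2 * (norm w)\<^sup>2)"
          unfolding norm_mult using b2 fw by (intro mult_mono) (auto intro: order_trans[OF norm_ge_zero])
        have t3: "norm (w\<^sup>2 * (S D A * S E A)) \<le> (norm w)\<^sup>2 * (K * C1 * (K * C2))"
          unfolding norm_mult norm_power
          by (intro mult_left_mono mult_mono S C1(2)[OF A] C2(2)[OF A]) (auto simp: K0 C0)
        show ?thesis
          unfolding eq0 w_def[symmetric] A'_def[symmetric] eq2
          using norm_triangle_mono[OF norm_triangle_mono[OF t1 t2] t3] by (simp add: algebra_simps)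
      qed
    qed
  next
    fix A x y assume A: "A \<in> unitary_group n" "x < n" "y < n"
    have "norm (D x y A * g A) \<le> C1 * C2" "norm (f A * E x y A) \<le> C1 * C2"
      unfolding norm_mult using C1(2)[OF A] C2(1)[OF A(1)] C1(1)[OF A(1)] C2(2)[OF A] C0
      by (auto intro!: mult_mono)
    then show "norm (D x y A * g A + f A * E x y A) \<le> 2 * (C1 * C2)"
      using norm_triangle_mono by fastforce
  next
    fix A assume A: "A \<in> unitary_group n"
    have "norm (f A * g A) \<le> C1 * C2"
      unfolding norm_mult using C1(1)[OF A] C2(1)[OF A] C0 by (auto intro!: mult_mono)
    then show "norm (f A * g A) \<le> 2 * (C1 * C2)" using mult_nonneg_nonneg[OF C0] by linarith
  qed (intro borel_measurable_add borel_measurable_times loopable_measurable[OF assms(1)] loopable_measurable[OF assms(2)]; assumption)+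
qed

lemma loopable_sum:
  assumes "finite I" "\<And>i. i \<in> I \<Longrightarrow> loopable (f i) (D i)"
  shows "loopable (\<lambda>A. \<Sum>i\<in>I. f i A) (\<lambda>x y A. \<Sum>i\<in>I. D i x y A)"
  using assms
proof (induction I)
  case empty then show ?case using loopable_const[of 0] by simp
next
  case (insert i I)
  then show ?case using loopable_add[of "f i" "D i"] by simp
qed

text \<open>Left multiplication by a rotation is affine in \<open>cis t - 1\<close>, so the
  expansion is exact and the error constant 0 suffices.\<close>

lemma loopable_entry:
  assumes cd: "c < n" "d < n"
  shows "loopable (\<lambda>A. A $$ (c, d)) (\<lambda>x y A. if x = c then A $$ (y, d) else 0)"
proof (rule loopableI[where C = 1])
  fix P assume P: "herm_idem n P"
  show "\<exists>C. \<forall>A\<in>unitary_group n. \<forall>t.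
     norm ((rot n P t * A) $$ (c, d) - A $$ (c, d) - (cis t - 1) * (\<Sum>x<n. \<Sum>y<n. P $$ (x, y) * (if x = c then A $$ (y, d) else 0)))
       \<le> C * (norm (cis t - 1))\<^sup>2"
  proof (intro exI[of _ 0] ballI allI)
    fix A t assume A: "A \<in> unitary_group n"
    have 1: "(\<Sum>x<n. \<Sum>y<n. P $$ (x, y) * (if x = c then A $$ (y, d) else 0)) = (\<Sum>y<n. P $$ (c, y) * A $$ (y, d))"
    proof -
      have "(\<Sum>x<n. \<Sum>y<n. P $$ (x, y) * (if x = c then A $$ (y, d) else 0))
         = (\<Sum>x<n. if x = c then (\<Sum>y<n. P $$ (c, y) * A $$ (y, d)) else 0)"
        by (intro sum.cong) auto
      then show ?thesis using cd by simp
    qed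
    have "(rot n P t * A) $$ (c, d) = (\<Sum>k<n. rot n P t $$ (c, k) * A $$ (k, d))"
      using rot_carrier[OF P] unitary_groupD(1)[OF A] cd by (intro mult_mat_index)
    also have "\<dots> = (\<Sum>k<n. (if k = c then A $$ (k, d) else 0) + (cis t - 1) * (P $$ (c, k) * A $$ (k, d)))"
      using cd by (intro sum.cong) (auto simp: rot_entry[OF P] algebra_simps)
    also have "\<dots> = A $$ (c, d) + (cis t - 1) * (\<Sum>k<n. P $$ (c, k) * A $$ (k, d))"
      using cd by (simp add: sum.distrib sum_distrib_left)
    finally show "norm ((rot n P t * A) $$ (c, d) - A $$ (c, d) - (cis t - 1) * (\<Sum>x<n. \<Sum>y<n. P $$ (x, y) * (if x = c then A $$ (y, d) else 0)))
       \<le> 0 * (norm (cis t - 1))\<^sup>2" unfolding 1 by simp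
  qed
qed (use cd unitary_entry_le_1 in auto)

text \<open>The adjoint of a rotation is the rotation by \<open>- t\<close>, whose increment is
  \<open>- (cis t - 1)\<close> up to a quadratic error. This gives the minus sign and, unlike for
  the entries themselves, a genuine remainder.\<close>

lemma loopable_adjoint_entry:
  assumes cd: "c < n" "d < n"
  shows "loopable (\<lambda>A. mat_adjoint A $$ (c, d)) (\<lambda>x y A. if y = d then - mat_adjoint A $$ (c, x) else 0)"
proof (rule loopableI[where C = 1])
  fix P assume P: "herm_idem n P"
  define K where "K = (\<Sum>x<n. norm (P $$ (x, d)))"
  show "\<exists>C. \<forall>A\<in>unitary_group n. \<forall>t.
     norm (mat_adjoint (rot n P t * A) $$ (c, d) - mat_adjoint A $$ (c, d)
       - (cis t - 1) * (\<Sum>x<n. \<Sum>y<n. P $$ (x, y) * (if y = d then - mat_adjoint A $$ (c, x) else 0)))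
       \<le> C * (norm (cis t - 1))\<^sup>2"
  proof (intro exI[of _ K] ballI allI)
    fix A t assume A: "A \<in> unitary_group n"
    define Q where "Q = (\<Sum>x<n. mat_adjoint A $$ (c, x) * P $$ (x, d))"
    have 1: "(\<Sum>x<n. \<Sum>y<n. P $$ (x, y) * (if y = d then - mat_adjoint A $$ (c, x) else 0)) = - Q"
    proof -
      have "(\<Sum>x<n. \<Sum>y<n. P $$ (x, y) * (if y = d then - mat_adjoint A $$ (c, x) else 0))
         = (\<Sum>x<n. \<Sum>y<n. if y = d then - (mat_adjoint A $$ (c, x) * P $$ (x, y)) else 0)"
        by (intro sum.cong) auto
      then show ?thesis using cd by (simp add: Q_def sum_negf)
    qed
    have "mat_adjoint (rot n P t * A) = mat_adjoint A * rot n P (- t)"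
      using mat_adjoint_mult[OF rot_carrier[OF P] unitary_groupD(1)[OF A]] mat_adjoint_rot[OF P] by simp
    then have "mat_adjoint (rot n P t * A) $$ (c, d) = (\<Sum>k<n. mat_adjoint A $$ (c, k) * rot n P (- t) $$ (k, d))"
      using mult_mat_index[OF unitary_groupD(2)[OF A] rot_carrier[OF P] cd, of "- t"] by simp
    also have "\<dots> = (\<Sum>k<n. (if k = d then mat_adjoint A $$ (c, k) else 0) + (cis (- t) - 1) * (mat_adjoint A $$ (c, k) * P $$ (k, d)))"
      using cd by (intro sum.cong) (auto simp: rot_entry[OF P] algebra_simps)
    also have "\<dots> = mat_adjoint A $$ (c, d) + (cis (- t) - 1) * Q"
      using cd by (simp add: sum.distrib sum_distrib_left Q_def)
    also have "cis (- t) - 1 = - (cis t - 1) - of_real ((norm (cis t - 1))\<^sup>2)"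
      using cis_minus_one_cnj[of t] by (simp add: cis_cnj)
    finally have "mat_adjoint (rot n P t * A) $$ (c, d) - mat_adjoint A $$ (c, d) - (cis t - 1) * (- Q)
       = - (of_real ((norm (cis t - 1))\<^sup>2) * Q)"
      by (simp add: algebra_simps)
    moreover have "norm Q \<le> K"
    proof -
      have "norm Q \<le> (\<Sum>x<n. norm (mat_adjoint A $$ (c, x) * P $$ (x, d)))" unfolding Q_def by (rule norm_sum)
      also have "\<dots> \<le> K" unfolding K_def norm_mult
        using unitary_entry_le_1[OF unitary_group_adjoint[OF A]] cd by (intro sum_mono mult_left_le_one_le) auto
      finally show ?thesis .
    qed
    ultimately show "norm (mat_adjoint (rot n P t * A) $$ (c, d) - mat_adjoint A $$ (c, d)
       - (cis t - 1) * (\<Sum>x<n. \<Sum>y<n. P $$ (x, y) * (if y = d then - mat_adjoint A $$ (c, x) else 0)))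
       \<le> K * (norm (cis t - 1))\<^sup>2"
      unfolding 1 by (simp add: norm_mult norm_power mult.commute mult_left_mono mult_right_mono)
  qed
qed (use cd unitary_entry_le_1[OF unitary_group_adjoint] in auto)

lemma integrable_loopable:
  assumes "loopable f D"
  shows "integrable M f" "x < n \<Longrightarrow> y < n \<Longrightarrow> integrable M (D x y)"
proof -
  obtain C where C: "\<And>A. A \<in> unitary_group n \<Longrightarrow> norm (f A) \<le> C"
     "\<And>A x y. A \<in> unitary_group n \<Longrightarrow> x < n \<Longrightarrow> y < n \<Longrightarrow> norm (D x y A) \<le> C"
    using assms(1) unfolding loopable_def by blast
  show "integrable M f"
    by (rule integrable_const_bound[where B = C]) (auto simp: C loopable_measurable(1)[OF assms])
  show "integrable M (D x y)" if "x < n" "y < n"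
    by (rule integrable_const_bound[where B = C]) (auto simp: C that loopable_measurable(2)[OF assms])
qed

text \<open>By invariance the increment of \<open>f\<close> under a rotation has integral 0. So
  \<open>cis t - 1\<close> times the integral of the derivative along \<open>P\<close> is bounded by
  a multiple of the square of \<open>norm (cis t - 1)\<close>; divide and let \<open>t\<close> tend
  to 0.\<close>

lemma integral_loopable_herm_idem:
  assumes f: "loopable f D" and P: "herm_idem n P"
  shows "(\<Sum>x<n. \<Sum>y<n. P $$ (x, y) * (\<integral>A. D x y A \<partial>M)) = 0"
proof -
  obtain C where C: "\<And>A t. A \<in> unitary_group n \<Longrightarrow>
       norm (f (rot n P t * A) - f A - (cis t - 1) * (\<Sum>x<n. \<Sum>y<n. P $$ (x, y) * D x y A))
          \<le> C * (norm (cis t - 1))\<^sup>2" using f P unfolding loopable_def by blast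
  define S where "S = (\<lambda>A. (\<Sum>x<n. \<Sum>y<n. P $$ (x, y) * D x y A))"
  have fm: "f \<in> borel_measurable M" and fi: "integrable M f"
    using loopable_measurable(1)[OF f] integrable_loopable[OF f] by auto
  have Si: "integrable M S" unfolding S_def using integrable_loopable[OF f] by (intro Bochner_Integration.integrable_sum) auto
  have IS: "integral\<^sup>L M S = (\<Sum>x<n. \<Sum>y<n. P $$ (x, y) * (\<integral>A. D x y A \<partial>M))"
    unfolding S_def using integrable_loopable[OF f]
    by (subst Bochner_Integration.integral_sum, force intro!: Bochner_Integration.integrable_sum)
      (intro sum.cong refl, subst Bochner_Integration.integral_sum, auto)
  have bound: "norm (integral\<^sup>L M S) \<le> C * norm (cis t - 1)" if "cis t \<noteq> 1" for t
  proof -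
    have R: "rot n P t \<in> unitary_group n" by (rule rot_unitary[OF P])
    have fRi: "integrable M (\<lambda>A. f (rot n P t * A))"
      using integrable_distr[OF translation_measurable[OF R], of f] fi by (simp add: distr_translation[OF R])
    have int: "integrable M (\<lambda>A. f (rot n P t * A) - f A - (cis t - 1) * S A)"
      using fi fRi Si by auto
    have "norm (\<integral>A. (f (rot n P t * A) - f A - (cis t - 1) * S A) \<partial>M)
        \<le> (\<integral>A. norm (f (rot n P t * A) - f A - (cis t - 1) * S A) \<partial>M)"
      by (rule integral_norm_bound)
    also have "\<dots> \<le> (\<integral>A. C * (norm (cis t - 1))\<^sup>2 \<partial>M)"
      using int C[of _ t] by (intro integral_mono) (auto simp: S_def)
    also have "\<dots> = C * (norm (cis t - 1))\<^sup>2" by simp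
    also have "(\<integral>A. (f (rot n P t * A) - f A - (cis t - 1) * S A) \<partial>M) = - ((cis t - 1) * integral\<^sup>L M S)"
      using fi fRi Si integral_translation[OF R fm] by simp
    finally have "norm (cis t - 1) * norm (integral\<^sup>L M S) \<le> norm (cis t - 1) * (C * norm (cis t - 1))"
      by (simp only: norm_minus_cancel norm_mult power2_eq_square mult_ac)
    then show ?thesis using that by simp
  qed
  have "norm (integral\<^sup>L M S) \<le> 0"
  proof (rule tendsto_lowerbound)
    have "((\<lambda>t. C * norm (cis t - 1)) \<longlongrightarrow> C * norm (cis 0 - 1)) (at 0)"
      by (intro tendsto_intros isCont_tendsto_compose[OF _ tendsto_ident_at] continuous_at_imp_continuous_on) (auto intro!: continuous_intros)
    then show "((\<lambda>t. C * norm (cis t - 1)) \<longlongrightarrow> 0) (at_right 0)" by (auto intro: filterlim_mono[OF _ order.refl at_le])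
    have "\<forall>\<^sub>F t in at_right (0::real). t \<in> {0<..<1}" by (rule eventually_at_right_real) auto
    then show "\<forall>\<^sub>F t in at_right 0. norm (integral\<^sup>L M S) \<le> C * norm (cis t - 1)"
    proof eventually_elim
      case (elim t)
      have "sin t > 0" using elim pi_gt3 by (intro sin_gt_zero) auto
      then have "cis t \<noteq> 1" by (auto simp: complex_eq_iff)
      then show ?case by (rule bound)
    qed
  qed auto
  then show ?thesis unfolding IS by simp
qed

text \<open>The identity for projections is linear in \<open>P\<close>, and orthogonal projections
  span all complex matrices. Coordinate projections give the diagonal; projections on a unit vector
  supported on \<open>a\<close> and \<open>b\<close> with relative phase \<open>\<omega>\<close>
  give \<open>cnj \<omega> * J a b + \<omega> * J b a = 0\<close>, and the phases 1 and
  \<open>\<i>\<close> separate the two unknowns.\<close>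

lemma integral_loopable:
  assumes f: "loopable f D" and a: "a < n" and b: "b < n"
  shows "(\<integral>A. D a b A \<partial>M) = 0"
proof -
  define J where "J x y = (\<integral>A. D x y A \<partial>M)" for x y
  have diag: "J c c = 0" if c: "c < n" for c
  proof -
    define P where "P = mat n n (\<lambda>(i, j). if i = c \<and> j = c then 1 else 0 :: complex)"
    have "herm_idem n P" unfolding herm_idem_def P_def using c
      by (auto intro!: eq_matI simp: mat_adjoint_index[of _ n n] scalar_prod_def sum.delta if_distrib[where f = "\<lambda>z. z * _"] cong: if_cong)
    from integral_loopable_herm_idem[OF f this]
    have "(\<Sum>x<n. \<Sum>y<n. (if x = c \<and> y = c then 1 else 0) * J x y) = 0"
      unfolding J_def P_def by simp
    moreover have "(\<Sum>x<n. \<Sum>y<n. (if x = c \<and> y = c then 1 else 0) * J x y) = (\<Sum>x<n. \<Sum>y<n. if y = c then (if x = c then J x y else 0) else 0)"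
      by (intro sum.cong) auto
    ultimately show ?thesis using c by simp
  qed
  have off: "cnj \<omega> * J a b + \<omega> * J b a = 0" if ab: "a \<noteq> b" and w: "\<omega> * cnj \<omega> = 1" for \<omega>
  proof -
    define v where "v i = (if i = a then 1 else if i = b then \<omega> else 0 :: complex)" for i
    define P where "P = mat n n (\<lambda>(i, j). v i * cnj (v j) / 2)"
    have vv: "(\<Sum>k<n. cnj (v k) * v k) = 2"
    proof -
      have "(\<Sum>k<n. cnj (v k) * v k) = (\<Sum>k<n. (if k = a then 1 else 0) + (if k = b then 1 else 0))"
        using ab w by (intro sum.cong) (auto simp: v_def mult.commute)
      then show ?thesis using a b by (simp add: sum.distrib)
    qed
    have "herm_idem n P" unfolding herm_idem_def
    proof (intro conjI)
      show "P * P = P"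
      proof (rule eq_matI)
        fix i j assume "i < dim_row P" "j < dim_col P"
        then have ij: "i < n" "j < n" by (auto simp: P_def)
        have "(P * P) $$ (i, j) = (\<Sum>k<n. (v i * cnj (v j) / 4) * (cnj (v k) * v k))"
          using ij by (subst mult_mat_index[of _ n n _ n]) (auto simp: P_def intro!: sum.cong)
        also have "\<dots> = P $$ (i, j)"
          unfolding sum_distrib_left[symmetric] vv using ij by (simp add: P_def)
        finally show "(P * P) $$ (i, j) = P $$ (i, j)" .
      qed (auto simp: P_def)
      show "mat_adjoint P = P"
        by (intro eq_matI) (auto simp: P_def mat_adjoint_index[of _ n n])
    qed (auto simp: P_def)
    from integral_loopable_herm_idem[OF f this]
    have "0 = (\<Sum>x<n. \<Sum>y<n. v x * cnj (v y) / 2 * J x y)"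
      unfolding J_def P_def by simp
    also have "\<dots> = (\<Sum>x\<in>{a, b}. \<Sum>y<n. v x * cnj (v y) / 2 * J x y)"
      using a b by (intro sum.mono_neutral_right) (auto simp: v_def)
    also have "\<dots> = (\<Sum>x\<in>{a, b}. \<Sum>y\<in>{a,b}. v x * cnj (v y) / 2 * J x y)"
      using a b by (intro sum.cong sum.mono_neutral_right) (auto simp: v_def)
    also have "\<dots> = (cnj \<omega> * J a b + \<omega> * J b a) / 2"
      using ab diag[OF a] diag[OF b] by (simp add: v_def field_simps)
    finally show ?thesis by simp
  qed
  show ?thesis
  proof (cases "a = b")
    case True then show ?thesis using diag[OF a] by (simp add: J_def)
  next
    case False
    have "J a b + J b a = 0" using off[of 1] False by simp
    moreover have "- \<i> * J a b + \<i> * J b a = 0" using off[of \<i>] False by simp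
    ultimately have "J a b = 0" by (auto simp: add_eq_0_iff algebra_simps)
    then show ?thesis by (simp add: J_def)
  qed
qed

end

section \<open>Traces of powers and the loop equation\<close>

definition mtr :: "nat \<Rightarrow> complex mat \<Rightarrow> int \<Rightarrow> complex" where
  "mtr n A k = (\<Sum>c<n. upow A k $$ (c, c))"

lemma mtr_mult:
  assumes A: "A \<in> unitary_group n"
  shows "(\<Sum>a<n. \<Sum>b<n. upow A k $$ (a, b) * upow A j $$ (b, a)) = mtr n A (k + j)"
  unfolding mtr_def using unitary_groupD(1)[OF A]
  by (intro sum.cong refl) (simp add: upow_add[OF A] mult_mat_index[of _ n n _ n] del: index_mult_mat)

context haar_unitary
begin

text \<open>Leibniz over the factors of the power: differentiating the factor at position
  \<open>l\<close> splits the power there. For negative \<open>k\<close> the derivative of the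
  inverse brings a sign, which the orientation of \<open>isum\<close> absorbs.\<close>

lemma loopable_upow:
  assumes "c < n" "d < n"
  shows "loopable (\<lambda>A. upow A k $$ (c, d)) (\<lambda>x y A. isum k (\<lambda>l. upow A l $$ (c, x) * upow A (k - l) $$ (y, d)))"
  using assms
proof (induction k arbitrary: c d rule: int_induct[where k = 0])
  case base
  show ?case
    by (rule loopable_cong[OF loopable_const[of "if c = d then 1 else 0"]])
       (use base in \<open>auto dest!: unitary_groupD(1) simp: upow_0\<close>)
next
  case (step1 k)
  have "loopable (\<lambda>A. \<Sum>e<n. upow A k $$ (c, e) * A $$ (e, d))
     (\<lambda>x y A. \<Sum>e<n. isum k (\<lambda>l. upow A l $$ (c, x) * upow A (k - l) $$ (y, e)) * A $$ (e, d)
        + upow A k $$ (c, e) * (if x = e then A $$ (y, d) else 0))"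
    using step1 by (intro loopable_sum loopable_mult loopable_entry) auto
  then show ?case
  proof (rule loopable_cong)
    fix A assume A: "A \<in> unitary_group n"
    note a = unitary_groupD(1)[OF A]
    show "(\<Sum>e<n. upow A k $$ (c, e) * A $$ (e, d)) = upow A (k + 1) $$ (c, d)"
      using a step1.prems by (simp add: upow_Suc[OF A] mult_mat_index[of _ n n _ n] del: index_mult_mat)
    fix x y assume xy: "x < n" "y < n"
    have e: "(\<Sum>e<n. upow A (k - l) $$ (y, e) * A $$ (e, d)) = upow A (k + 1 - l) $$ (y, d)" for l
      using a step1.prems xy upow_Suc[OF A, of "k - l"]
      by (simp add: mult_mat_index[of _ n n _ n] algebra_simps del: index_mult_mat)
    have "(\<Sum>e<n. isum k (\<lambda>l. upow A l $$ (c, x) * upow A (k - l) $$ (y, e)) * A $$ (e, d))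
        = isum k (\<lambda>l. upow A l $$ (c, x) * upow A (k + 1 - l) $$ (y, d))"
      unfolding isum_cmult isum_sum[symmetric] e[symmetric] sum_distrib_left by (simp add: mult.assoc)
    moreover have "(\<Sum>e<n. upow A k $$ (c, e) * (if x = e then A $$ (y, d) else 0)) = upow A k $$ (c, x) * A $$ (y, d)"
      using xy by (simp add: if_distrib[where f = "\<lambda>z. _ * z"] cong: if_cong)
    ultimately show "(\<Sum>e<n. isum k (\<lambda>l. upow A l $$ (c, x) * upow A (k - l) $$ (y, e)) * A $$ (e, d)
        + upow A k $$ (c, e) * (if x = e then A $$ (y, d) else 0)) =
        isum (k + 1) (\<lambda>l. upow A l $$ (c, x) * upow A (k + 1 - l) $$ (y, d))"
      unfolding isum_Suc sum.distrib using upow_1[OF a] by simp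
  qed
next
  case (step2 k)
  have "loopable (\<lambda>A. \<Sum>e<n. upow A k $$ (c, e) * mat_adjoint A $$ (e, d))
     (\<lambda>x y A. \<Sum>e<n. isum k (\<lambda>l. upow A l $$ (c, x) * upow A (k - l) $$ (y, e)) * mat_adjoint A $$ (e, d)
        + upow A k $$ (c, e) * (if y = d then - mat_adjoint A $$ (e, x) else 0))"
    using step2 by (intro loopable_sum loopable_mult loopable_adjoint_entry) auto
  then show ?case
  proof (rule loopable_cong)
    fix A assume A: "A \<in> unitary_group n"
    note a = unitary_groupD(1,2)[OF A]
    show "(\<Sum>e<n. upow A k $$ (c, e) * mat_adjoint A $$ (e, d)) = upow A (k - 1) $$ (c, d)"
      using a step2.prems by (simp add: upow_pred[OF A] mult_mat_index[of _ n n _ n] del: index_mult_mat)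
    fix x y assume xy: "x < n" "y < n"
    have e: "(\<Sum>e<n. upow A (k - l) $$ (y, e) * mat_adjoint A $$ (e, d)) = upow A (k - 1 - l) $$ (y, d)" for l
      using a step2.prems xy upow_pred[OF A, of "k - l"]
      by (simp add: mult_mat_index[of _ n n _ n] algebra_simps del: index_mult_mat)
    have "(\<Sum>e<n. isum k (\<lambda>l. upow A l $$ (c, x) * upow A (k - l) $$ (y, e)) * mat_adjoint A $$ (e, d))
        = isum k (\<lambda>l. upow A l $$ (c, x) * upow A (k - 1 - l) $$ (y, d))"
      unfolding isum_cmult isum_sum[symmetric] e[symmetric] sum_distrib_left by (simp add: mult.assoc)
    moreover have "(\<Sum>e<n. upow A k $$ (c, e) * (if y = d then - mat_adjoint A $$ (e, x) else 0))
        = - (upow A (k - 1) $$ (c, x) * upow A 0 $$ (y, d))"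
      using xy step2.prems a by (auto simp: upow_0 upow_pred[OF A] mult_mat_index[of _ n n _ n] sum_negf simp del: index_mult_mat)
    ultimately show "(\<Sum>e<n. isum k (\<lambda>l. upow A l $$ (c, x) * upow A (k - l) $$ (y, e)) * mat_adjoint A $$ (e, d)
        + upow A k $$ (c, e) * (if y = d then - mat_adjoint A $$ (e, x) else 0)) =
        isum (k - 1) (\<lambda>l. upow A l $$ (c, x) * upow A (k - 1 - l) $$ (y, d))"
      unfolding isum_pred sum.distrib by simp
  qed
qed

text \<open>The trace joins the two pieces of the split power cyclically, so all terms of the
  oriented sum agree.\<close>

lemma loopable_mtr: "loopable (\<lambda>A. mtr n A k) (\<lambda>x y A. of_int k * upow A k $$ (y, x))"
  unfolding mtr_def
proof (rule loopable_cong[OF loopable_sum[OF _ loopable_upow]])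
  fix A x y assume A: "A \<in> unitary_group n" and xy: "x < n" "y < n"
  have "(\<Sum>c<n. isum k (\<lambda>l. upow A l $$ (c, x) * upow A (k - l) $$ (y, c)))
     = isum k (\<lambda>l. \<Sum>c<n. upow A (k - l) $$ (y, c) * upow A l $$ (c, x))"
    by (simp add: isum_sum[symmetric] mult.commute)
  also have "\<dots> = isum k (\<lambda>l. upow A k $$ (y, x))"
  proof -
    have "(\<Sum>c<n. upow A (k - l) $$ (y, c) * upow A l $$ (c, x)) = upow A k $$ (y, x)" for l
      using upow_add[OF A, of "k - l" l] mult_mat_index[of "upow A (k - l)" n n "upow A l" n y x]
        unitary_groupD(1)[OF A] xy by simp
    then show ?thesis by simp
  qed
  finally show "(\<Sum>c<n. isum k (\<lambda>l. upow A l $$ (c, x) * upow A (k - l) $$ (y, c))) = of_int k * upow A k $$ (y, x)"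
    by (simp add: isum_const)
qed auto

definition tprod :: "int list \<Rightarrow> complex mat \<Rightarrow> complex" where
  "tprod js A = (\<Prod>j\<leftarrow>js. mtr n A j)"

fun dtprod :: "int list \<Rightarrow> nat \<Rightarrow> nat \<Rightarrow> complex mat \<Rightarrow> complex" where
  "dtprod [] x y A = 0"
| "dtprod (j # js) x y A = of_int j * upow A j $$ (y, x) * tprod js A + mtr n A j * dtprod js x y A"

lemma loopable_tprod: "loopable (tprod js) (dtprod js)"
proof (induction js)
  case Nil
  show ?case by (rule loopable_cong[OF loopable_const[of 1]]) (auto simp: tprod_def)
next
  case (Cons j js)
  show ?case by (rule loopable_cong[OF loopable_mult[OF loopable_mtr[of j] Cons.IH]]) (auto simp: tprod_def)
qed

lemma mtr_measurable [measurable]: "(\<lambda>A. mtr n A k) \<in> borel_measurable M"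
  using loopable_measurable(1)[OF loopable_mtr] .

end

text \<open>The result of differentiating a product of power sums against the power of exponent
  \<open>k\<close>: it merges with each factor of exponent \<open>j\<close> in turn into exponent
  \<open>k + j\<close>.\<close>

fun merge_sum :: "(int \<Rightarrow> complex) \<Rightarrow> int \<Rightarrow> int list \<Rightarrow> complex" where
  "merge_sum p k [] = 0"
| "merge_sum p k (j # js) = of_int j * p (k + j) * (\<Prod>j\<leftarrow>js. p j) + p j * merge_sum p k js"

context haar_unitary
begin

text \<open>Take the entry \<open>(a, b)\<close> of \<open>upow A k\<close> times the product of
  traces, differentiate in the direction of the same \<open>a\<close> and \<open>b\<close>, and sum
  over both. The differentiated power splits into a product of two traces, while each differentiated
  trace merges with the power. These are the Schwinger-Dyson equations of the unitary group.\<close>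

lemma loop_equation:
  "(\<integral>A. isum k (\<lambda>l. mtr n A l * mtr n A (k - l)) * (\<Prod>j\<leftarrow>js. mtr n A j) + merge_sum (mtr n A) k js \<partial>M) = 0"
proof -
  define D where "D c d x y A = isum k (\<lambda>l. upow A l $$ (c, x) * upow A (k - l) $$ (y, d)) * tprod js A
       + upow A k $$ (c, d) * dtprod js x y A" for c d x y A
  have lp: "loopable (\<lambda>A. upow A k $$ (c, d) * tprod js A) (D c d)" if "c < n" "d < n" for c d
    unfolding D_def using that by (intro loopable_mult loopable_upow loopable_tprod)
  have merge: "(\<Sum>a<n. \<Sum>b<n. upow A k $$ (a, b) * dtprod is a b A) = merge_sum (mtr n A) k is"
    if A: "A \<in> unitary_group n" for A "is"
  proof (induction "is")
    case (Cons j "is")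
    have "(\<Sum>a<n. \<Sum>b<n. upow A k $$ (a, b) * dtprod (j # is) a b A)
      = of_int j * tprod is A * (\<Sum>a<n. \<Sum>b<n. upow A k $$ (a, b) * upow A j $$ (b, a))
       + mtr n A j * (\<Sum>a<n. \<Sum>b<n. upow A k $$ (a, b) * dtprod is a b A)"
      by (simp add: sum_distrib_left sum.distrib algebra_simps)
    then show ?case unfolding mtr_mult[OF A] Cons by (simp add: tprod_def algebra_simps)
  qed simp
  have "(\<integral>A. isum k (\<lambda>l. mtr n A l * mtr n A (k - l)) * (\<Prod>j\<leftarrow>js. mtr n A j) + merge_sum (mtr n A) k js \<partial>M)
     = (\<integral>A. (\<Sum>a<n. \<Sum>b<n. D a b a b A) \<partial>M)"
  proof (rule Bochner_Integration.integral_cong[OF refl])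
    fix A assume "A \<in> space M"
    then have A: "A \<in> unitary_group n" by simp
    have "(\<Sum>a<n. \<Sum>b<n. isum k (\<lambda>l. upow A l $$ (a, a) * upow A (k - l) $$ (b, b)))
      = isum k (\<lambda>l. mtr n A l * mtr n A (k - l))"
      unfolding mtr_def by (simp add: isum_sum[symmetric] sum_product)
    then have "(\<Sum>a<n. \<Sum>b<n. D a b a b A)
      = isum k (\<lambda>l. mtr n A l * mtr n A (k - l)) * tprod js A + merge_sum (mtr n A) k js"
      unfolding merge[OF A, symmetric] D_def sum.distrib sum_distrib_right[symmetric] by simp
    then show "isum k (\<lambda>l. mtr n A l * mtr n A (k - l)) * (\<Prod>j\<leftarrow>js. mtr n A j) + merge_sum (mtr n A) k js
      = (\<Sum>a<n. \<Sum>b<n. D a b a b A)" by (simp add: tprod_def)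
  qed
  also have "\<dots> = (\<Sum>a<n. \<Sum>b<n. \<integral>A. D a b a b A \<partial>M)"
    using integrable_loopable(2)[OF lp]
    by (subst Bochner_Integration.integral_sum, force intro!: Bochner_Integration.integrable_sum)
      (intro sum.cong refl, subst Bochner_Integration.integral_sum, auto)
  also have "\<dots> = 0" using integral_loopable[OF lp] by (intro sum.neutral ballI) auto
  finally show ?thesis .
qed

end

section \<open>Eigenangles of unitary matrices\<close>

lemma cis_Arg2pi: "norm z = 1 \<Longrightarrow> cis (Arg2pi z) = z"
  using Arg2pi_eq[of z] by (simp add: cis_conv_exp mult.commute)

text \<open>The columns of \<open>A\<close> are orthonormal, so \<open>A\<close> preserves the norm
  of an eigenvector.\<close>

lemma unitary_eigenvalue_norm:
  assumes A: "A \<in> unitary_group n" and ev: "eigenvalue A a"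
  shows "norm a = 1"
proof -
  note a = unitary_groupD[OF A]
  obtain v where v: "v \<in> carrier_vec n" "v \<noteq> 0\<^sub>v n" "A *\<^sub>v v = a \<cdot>\<^sub>v v"
    using ev a(1) unfolding eigenvalue_def eigenvector_def by auto
  have orth: "(\<Sum>i<n. A $$ (i, j) * cnj (A $$ (i, k))) = (if j = k then 1 else 0)" if "j < n" "k < n" for j k
  proof -
    have "(mat_adjoint A * A) $$ (k, j) = (\<Sum>i<n. mat_adjoint A $$ (k, i) * A $$ (i, j))"
      using a that by (intro mult_mat_index)
    also have "\<dots> = (\<Sum>i<n. A $$ (i, j) * cnj (A $$ (i, k)))"
      using a(1) that by (intro sum.cong) (auto simp: mat_adjoint_index[of A n n])
    finally have "(1\<^sub>m n :: complex mat) $$ (k, j) = (\<Sum>i<n. A $$ (i, j) * cnj (A $$ (i, k)))"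
      unfolding a(3) .
    then show ?thesis using that by (cases "k = j") simp_all
  qed
  have Av: "(\<Sum>j<n. A $$ (i, j) * v $ j) = a * v $ i" if "i < n" for i
    using arg_cong[OF v(3), of "\<lambda>w. w $ i"] that a(1) v(1) by (simp add: scalar_prod_def atLeast0LessThan)
  have "(\<Sum>i<n. (a * v $ i) * cnj (a * v $ i)) = (\<Sum>i<n. \<Sum>j<n. \<Sum>k<n. v $ j * cnj (v $ k) * (A $$ (i, j) * cnj (A $$ (i, k))))"
  proof (intro sum.cong refl)
    fix i assume "i \<in> {..<n}"
    then show "(a * v $ i) * cnj (a * v $ i) = (\<Sum>j<n. \<Sum>k<n. v $ j * cnj (v $ k) * (A $$ (i, j) * cnj (A $$ (i, k))))"
      by (subst (1 2) Av[symmetric]) (auto simp: sum_product algebra_simps)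
  qed
  also have "\<dots> = (\<Sum>j<n. \<Sum>k<n. v $ j * cnj (v $ k) * (\<Sum>i<n. A $$ (i, j) * cnj (A $$ (i, k))))"
    unfolding sum_distrib_left by (subst sum.swap, rule sum.cong[OF refl], rule sum.swap)
  also have "\<dots> = (\<Sum>j<n. v $ j * cnj (v $ j))"
  proof (intro sum.cong refl)
    fix j assume j: "j \<in> {..<n}"
    have "(\<Sum>k<n. v $ j * cnj (v $ k) * (\<Sum>i<n. A $$ (i, j) * cnj (A $$ (i, k))))
       = (\<Sum>k<n. if k = j then v $ j * cnj (v $ k) else 0)"
      using j by (intro sum.cong refl) (auto simp: orth)
    then show "(\<Sum>k<n. v $ j * cnj (v $ k) * (\<Sum>i<n. A $$ (i, j) * cnj (A $$ (i, k)))) = v $ j * cnj (v $ j)"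
      using j by simp
  qed
  finally have "(\<Sum>i<n. a * cnj a * (v $ i * cnj (v $ i))) = (\<Sum>j<n. v $ j * cnj (v $ j))"
    by (simp add: algebra_simps)
  then have "a * cnj a * (\<Sum>i<n. v $ i * cnj (v $ i)) = (\<Sum>j<n. v $ j * cnj (v $ j))"
    by (simp add: sum_distrib_left)
  then have "complex_of_real ((norm a)\<^sup>2 * (\<Sum>i<n. (norm (v $ i))\<^sup>2)) = of_real (\<Sum>i<n. (norm (v $ i))\<^sup>2)"
    by (simp add: complex_norm_square[symmetric] del: of_real_power) 
  then have "(norm a)\<^sup>2 * (\<Sum>i<n. (norm (v $ i))\<^sup>2) = (\<Sum>i<n. (norm (v $ i))\<^sup>2)"
    by (metis of_real_eq_iff)
  moreover have "(\<Sum>i<n. (norm (v $ i))\<^sup>2) \<noteq> 0"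
  proof
    assume "(\<Sum>i<n. (norm (v $ i))\<^sup>2) = 0"
    then have "\<forall>i<n. v $ i = 0" by (subst (asm) sum_nonneg_eq_0_iff) auto
    then have "v = 0\<^sub>v n" using v(1) by (intro eq_vecI) auto
    then show False using v(2) by simp
  qed
  ultimately have "(norm a)\<^sup>2 = 1" by simp
  then show ?thesis using norm_ge_zero[of a] by (simp add: power2_eq_1_iff)
qed

text \<open>Only the diagonal of the powers is wanted, for traces after Schur triangularization; the
  entries below it are included to make the induction go through.\<close>

lemma upper_triangular_pow:
  fixes B :: "complex mat"
  assumes B: "B \<in> carrier_mat n n" "upper_triangular B"
  shows "i < n \<Longrightarrow> j \<le> i \<Longrightarrow> (B ^\<^sub>m m) $$ (i, j) = (if i = j then (B $$ (i, i)) ^ m else 0)"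
proof (induction m arbitrary: i j)
  case 0 then show ?case using B by auto
next
  case (Suc m)
  have "(B ^\<^sub>m Suc m) $$ (i, j) = (\<Sum>k<n. (B ^\<^sub>m m) $$ (i, k) * B $$ (k, j))"
    unfolding pow_mat.simps using Suc.prems B by (intro mult_mat_index) auto
  also have "\<dots> = (\<Sum>k<n. if k = i then (if i = j then B $$ (i, i) ^ m * B $$ (i, i) else 0) else 0)"
  proof (intro sum.cong refl)
    fix k assume k: "k \<in> {..<n}"
    consider "k < i" | "k = i" | "k > i" by linarith
    then show "(B ^\<^sub>m m) $$ (i, k) * B $$ (k, j) = (if k = i then (if i = j then B $$ (i, i) ^ m * B $$ (i, i) else 0) else 0)"
    proof cases
      case 1 then show ?thesis using Suc by simp
    next
      case 2 then show ?thesis using Suc B upper_triangularD[OF B(2), of j i] by auto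
    next
      case 3 then show ?thesis using Suc.prems k B upper_triangularD[OF B(2), of j k] by auto
    qed
  qed
  also have "\<dots> = (if i = j then B $$ (i, i) ^ Suc m else 0)" using Suc.prems by simp
  finally show ?case .
qed

lemma mat_adjoint_pow:
  fixes A :: "complex mat"
  assumes A: "A \<in> carrier_mat n n"
  shows "mat_adjoint (A ^\<^sub>m m) = mat_adjoint A ^\<^sub>m m"
proof (induction m)
  case 0
  then show ?case using A by (intro eq_matI) (auto simp: mat_adjoint_index[of _ n n])
next
  case (Suc m)
  have comm: "A * A ^\<^sub>m k = A ^\<^sub>m k * A" for k
  proof (induction k)
    case (Suc k)
    have "A * A ^\<^sub>m Suc k = (A * A ^\<^sub>m k) * A" using A by (simp add: assoc_mult_mat[of A n n "A ^\<^sub>m k" n A n])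
    then show ?case using Suc by simp
  qed (use A in auto)
  have "mat_adjoint (A ^\<^sub>m Suc m) = mat_adjoint (A * A ^\<^sub>m m)" by (simp add: comm)
  also have "\<dots> = mat_adjoint (A ^\<^sub>m m) * mat_adjoint A" using A by (intro mat_adjoint_mult) auto
  finally show ?case using Suc by simp
qed

text \<open>Traces of nonnegative powers come from Schur triangularization, those of negative powers
  by complex conjugation. The sum is symmetric in the eigenvalues, so the order of the list is
  irrelevant to it.\<close>

lemma eigenangles_unitary:
  assumes A: "A \<in> unitary_group n"
  shows "length (eigenangles A) = n"
    and "i < n \<Longrightarrow> eigenangles A ! i \<in> {0..<2*pi}"
    and "mtr n A k = (\<Sum>i<n. cis (of_int k * eigenangles A ! i))"
proof -
  note a = unitary_groupD[OF A]
  show len: "length (eigenangles A) = n" using length_eigenangles[OF a(1)] .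
  obtain as where as: "char_poly A = (\<Prod>a\<leftarrow>as. [:- a, 1:])" "length as = n"
    using char_poly_factorized[OF a(1)] by blast
  have "proots (\<Prod>a\<leftarrow>bs. [:- a, 1:]) = mset bs" for bs :: "complex list"
  proof (induction bs)
    case (Cons b bs)
    have nz: "(\<Prod>a\<leftarrow>bs. [:- a, 1:]) \<noteq> 0"
      by (auto simp: prod_list_zero_iff)
    have "proots [:- b, 1:] = {#b#}"
      using proots_linear_factor[of "b"] by simp
    then show ?case using Cons proots_mult[of "[:- b, 1:]" "\<Prod>a\<leftarrow>bs. [:- a, 1:]"] nz by simp
  qed simp
  then have pr: "proots (char_poly A) = mset as" using as by simp
  have mset: "mset (eigenangles A) = image_mset Arg2pi (mset as)"
    unfolding eigenangles_def pr by simp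
  have norm1: "norm a = 1" if "a \<in> set as" for a
  proof -
    have "poly (char_poly A) a = 0" unfolding as(1) poly_prod_list
      using that by (auto simp: prod_list_zero_iff image_iff intro!: bexI[of _ a])
    then show ?thesis using eigenvalue_root_char_poly[OF a(1)] unitary_eigenvalue_norm[OF A] by simp
  qed
  show "eigenangles A ! i \<in> {0..<2*pi}" if "i < n"
  proof -
    have "eigenangles A ! i \<in># mset (eigenangles A)" using that len by simp
    then obtain z where "eigenangles A ! i = Arg2pi z" unfolding mset by auto
    then show ?thesis using Arg2pi_ge_0[of z] Arg2pi_lt_2pi[of z] by simp
  qed
  have sumeq: "(\<Sum>i<n. h (eigenangles A ! i)) = (\<Sum>a\<leftarrow>as. h (Arg2pi a))" for h :: "real \<Rightarrow> complex"
  proof -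
    have "(\<Sum>i<n. h (eigenangles A ! i)) = sum_list (map h (eigenangles A))"
      using len by (simp add: sum_list_sum_nth atLeast0LessThan)
    also have "\<dots> = sum_mset (image_mset h (mset (eigenangles A)))"
      by (metis mset_map sum_mset_sum_list)
    also have "\<dots> = (\<Sum>a\<leftarrow>as. h (Arg2pi a))" unfolding mset
      by (metis (no_types, lifting) image_mset.compositionality mset_map sum_mset_sum_list comp_apply map_eq_conv)
    finally show ?thesis .
  qed
  \<comment> \<open>Invariance of the trace under similarity: the factor \<open>Q\<close> is moved
    cyclically to the front of \<open>P * B ^\<^sub>m m * Q\<close>, where it cancels
    \<open>P\<close>.\<close>
  have pow: "mtr n A (int m) = (\<Sum>a\<leftarrow>as. a ^ m)" for m
  proof -
    obtain B P Q where sd: "schur_decomposition A as = (B, P, Q)" by (cases "schur_decomposition A as") auto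
    from schur_decomposition[OF a(1) as(1) sd]
    have wit: "similar_mat_wit A B P Q" and ut: "upper_triangular B" and dg: "diag_mat B = as" by auto
    from similar_mat_witD2[OF a(1) wit]
    have c: "B \<in> carrier_mat n n" "P \<in> carrier_mat n n" "Q \<in> carrier_mat n n" and QP: "Q * P = 1\<^sub>m n" by auto
    have Am: "A ^\<^sub>m m = P * B ^\<^sub>m m * Q" by (rule similar_mat_wit_pow_id[OF wit])
    have "mtr n A (int m) = (\<Sum>i<n. \<Sum>k<n. (P * B ^\<^sub>m m) $$ (i, k) * Q $$ (k, i))"
      unfolding mtr_def upow_def using c by (simp add: Am mult_mat_index[of _ n n _ n] del: index_mult_mat)
    also have "\<dots> = (\<Sum>k<n. \<Sum>i<n. Q $$ (k, i) * (P * B ^\<^sub>m m) $$ (i, k))"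
      by (subst sum.swap) (simp add: mult.commute)
    also have "\<dots> = (\<Sum>k<n. (Q * (P * B ^\<^sub>m m)) $$ (k, k))"
      using c by (intro sum.cong refl mult_mat_index[symmetric]) auto
    also have "Q * (P * B ^\<^sub>m m) = (Q * P) * B ^\<^sub>m m"
      by (rule assoc_mult_mat[symmetric]) (use c in auto)
    also have "\<dots> = B ^\<^sub>m m" using QP c by simp
    also have "(\<Sum>k<n. (B ^\<^sub>m m) $$ (k, k)) = (\<Sum>k<n. (B $$ (k, k)) ^ m)"
      using upper_triangular_pow[OF c(1) ut] by (intro sum.cong) auto
    also have "\<dots> = (\<Sum>a\<leftarrow>as. a ^ m)"
      unfolding dg[symmetric] diag_mat_def using c(1) by (simp add: sum_list_sum_nth atLeast0LessThan)
    finally show ?thesis .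
  qed
  have cis_pow: "cis (real m * Arg2pi a) = a ^ m" if "a \<in> set as" for a m
    using cis_Arg2pi[OF norm1[OF that]] Complex.DeMoivre[of "Arg2pi a" m] by simp
  show "mtr n A k = (\<Sum>i<n. cis (of_int k * eigenangles A ! i))"
  proof (cases "k \<ge> 0")
    case True
    then obtain m where m: "k = int m" using nonneg_int_cases by blast
    have "(\<Sum>a\<leftarrow>as. a ^ m) = (\<Sum>a\<leftarrow>as. cis (real m * Arg2pi a))"
      by (intro arg_cong[where f = sum_list] map_cong refl) (simp add: cis_pow)
    then show ?thesis unfolding m pow using sumeq[of "\<lambda>t. cis (real m * t)"] by simp
  next
    case False
    define m where "m = nat (- k)"
    have m: "k = - int m" using False by (simp add: m_def)
    have "mtr n A k = (\<Sum>c<n. (mat_adjoint A ^\<^sub>m m) $$ (c, c))"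
      unfolding mtr_def upow_def using False m by simp
    also have "\<dots> = (\<Sum>c<n. cnj ((A ^\<^sub>m m) $$ (c, c)))"
      unfolding mat_adjoint_pow[OF a(1), symmetric] using a(1)
      by (intro sum.cong refl) (auto simp: mat_adjoint_index[of _ n n])
    also have "\<dots> = cnj (mtr n A (int m))" by (simp add: mtr_def upow_def)
    also have "mtr n A (int m) = (\<Sum>a\<leftarrow>as. cis (real m * Arg2pi a))"
      unfolding pow by (intro arg_cong[where f = sum_list] map_cong refl) (simp add: cis_pow)
    also have "cnj \<dots> = (\<Sum>i<n. cnj (cis (real m * eigenangles A ! i)))"
      unfolding cnj_sum[symmetric] using sumeq[of "\<lambda>t. cis (real m * t)"] by simp
    also have "\<dots> = (\<Sum>i<n. cis (of_int k * eigenangles A ! i))" by (simp add: cis_cnj m)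
    finally show ?thesis .
  qed
qed

section \<open>The Dunkl equation\<close>

text \<open>The quotient of \<open>x * (x powi a * y powi b - x powi b * y powi a)\<close> by
  \<open>x - y\<close>, written as an oriented geometric sum so that it also makes sense at
  \<open>x = y\<close>.\<close>

definition tsym :: "complex \<Rightarrow> complex \<Rightarrow> int \<Rightarrow> int \<Rightarrow> complex" where
  "tsym x y a b = isum (a - b) (\<lambda>l. x powi (a - l) * y powi (b + l))"

lemma isum_geometric:
  assumes "x \<noteq> 0" "y \<noteq> 0"
  shows "(x - y) * isum k (\<lambda>l. x powi (a - l) * y powi (b + l)) = x * (x powi a * y powi b - x powi (a - k) * y powi (b + k))"
proof (induction k rule: int_induct[where k = 0])
  case base then show ?case by simp
next
  case (step1 k)
  have 1: "x powi (a - k) = x * x powi (a - (k + 1))" 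
    using power_int_add[of x 1 "a - (k + 1)"] assms by simp
  have 2: "y powi (b + (k + 1)) = y powi (b + k) * y" 
    using power_int_add[of y "b + k" 1] assms by (simp add: algebra_simps)
  show ?case unfolding isum_Suc distrib_left step1 unfolding 1 2 by (simp add: algebra_simps)
next
  case (step2 k)
  have 1: "x powi (a - (k - 1)) = x * x powi (a - k)" 
    using power_int_add[of x 1 "a - k"] assms by (simp add: algebra_simps)
  have 2: "y powi (b + k) = y powi (b + (k - 1)) * y" 
    using power_int_add[of y "b + (k - 1)" 1] assms by (simp add: algebra_simps)
  show ?case unfolding isum_pred right_diff_distrib[of "x - y"] step2 unfolding 1 2 by (simp add: algebra_simps)
qed

lemma tsym_mult: "x \<noteq> 0 \<Longrightarrow> y \<noteq> 0 \<Longrightarrow> (x - y) * tsym x y a b = x * (x powi a * y powi b - x powi b * y powi a)"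
  unfolding tsym_def using isum_geometric[of x y "a - b" a b] by simp

lemma tsym_same: "x \<noteq> 0 \<Longrightarrow> tsym x x a b = of_int (a - b) * x powi (a + b)"
proof -
  assume x: "x \<noteq> 0"
  have "x powi (a - l) * x powi (b + l) = x powi (a + b)" for l
    using power_int_add[of x "a - l" "b + l"] x by (simp add: algebra_simps)
  then show ?thesis unfolding tsym_def by (simp add: isum_const)
qed

text \<open>Multiplication by a function symmetric in \<open>x\<close> and \<open>y\<close> commutes
  with the divided difference. The diagonal is done from the explicit value, since the factor
  \<open>x - y\<close> cannot be cancelled there.\<close>

lemma tsym_shift:
  assumes "x \<noteq> 0" "y \<noteq> 0"
  shows "tsym x y (a + k) b + tsym x y a (b + k) = (x powi k + y powi k) * tsym x y a b"
proof (cases "x = y")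
  case True
  show ?thesis using assms unfolding True tsym_same[OF assms(2)]
    by (simp add: power_int_add algebra_simps)
next
  case False
  have "(x - y) * (tsym x y (a + k) b + tsym x y a (b + k)) = (x - y) * ((x powi k + y powi k) * tsym x y a b)"
    unfolding distrib_left mult.left_commute[of "x - y"] tsym_mult[OF assms]
    using assms by (simp add: power_int_add algebra_simps)
  then show ?thesis using False by simp
qed

text \<open>Multiplying a monomial by the power sum of exponent \<open>j\<close> adds
  \<open>j\<close> to one of its exponents in all \<open>n\<close> ways. \<open>ssum\<close> is the
  dual of this: a function \<open>g\<close> of the exponents is evaluated on the monomial of
  \<open>\<kappa>\<close> times a list of power sums.\<close>

fun ssum :: "nat \<Rightarrow> ((nat \<Rightarrow> int) \<Rightarrow> complex) \<Rightarrow> (nat \<Rightarrow> int) \<Rightarrow> int list \<Rightarrow> complex" where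
  "ssum n g \<kappa> [] = g \<kappa>"
| "ssum n g \<kappa> (j # js) = (\<Sum>i<n. ssum n g (\<kappa>(i := \<kappa> i + j)) js)"

lemma ssum_add: "ssum n (\<lambda>\<kappa>. f \<kappa> + g \<kappa>) \<kappa> js = ssum n f \<kappa> js + ssum n g \<kappa> js"
  by (induction js arbitrary: \<kappa>) (auto simp: sum.distrib)

lemma ssum_sum: "ssum n (\<lambda>\<kappa>. \<Sum>a\<in>I. f a \<kappa>) \<kappa> js = (\<Sum>a\<in>I. ssum n (f a) \<kappa> js)"
proof (induction js arbitrary: \<kappa>)
  case (Cons j js)
  show ?case unfolding ssum.simps Cons by (rule sum.swap)
qed simp

definition mono_z :: "nat \<Rightarrow> (nat \<Rightarrow> complex) \<Rightarrow> (nat \<Rightarrow> int) \<Rightarrow> complex" where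
  "mono_z n z \<kappa> = (\<Prod>i<n. z i powi \<kappa> i)"

definition psum :: "nat \<Rightarrow> (nat \<Rightarrow> complex) \<Rightarrow> int \<Rightarrow> complex" where
  "psum n z k = (\<Sum>i<n. z i powi k)"

text \<open>The Euler derivative in the variable \<open>z i\<close>, that is \<open>z i\<close>
  times the partial derivative, of the product of the power sums in the list.\<close>

fun dpsum :: "nat \<Rightarrow> (nat \<Rightarrow> complex) \<Rightarrow> nat \<Rightarrow> int list \<Rightarrow> complex" where
  "dpsum n z i [] = 0"
| "dpsum n z i (j # js) = of_int j * z i powi j * (\<Prod>j\<leftarrow>js. psum n z j) + psum n z j * dpsum n z i js"

lemma mono_z_upd:
  assumes "i < n" "\<And>i. i < n \<Longrightarrow> z i \<noteq> 0"
  shows "mono_z n z (\<kappa>(i := \<kappa> i + j)) = mono_z n z \<kappa> * z i powi j"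
proof -
  have "mono_z n z (\<kappa>(i := \<kappa> i + j)) = (\<Prod>i'<n. z i' powi \<kappa> i' * (if i' = i then z i powi j else 1))"
    unfolding mono_z_def using assms by (intro prod.cong) (auto simp: power_int_add)
  also have "\<dots> = mono_z n z \<kappa> * z i powi j"
    unfolding prod.distrib mono_z_def using assms(1) by simp
  finally show ?thesis .
qed

text \<open>The Leibniz rule for the Euler derivative in the variable \<open>a\<close>, applied to a
  monomial times a product of power sums.\<close>

lemma ssum_euler:
  assumes z: "\<And>i. i < n \<Longrightarrow> z i \<noteq> 0" and a: "a < n"
  shows "ssum n (\<lambda>\<kappa>. of_int (\<kappa> a) * mono_z n z \<kappa>) \<kappa> js
     = mono_z n z \<kappa> * (of_int (\<kappa> a) * (\<Prod>j\<leftarrow>js. psum n z j) + dpsum n z a js)"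
proof (induction js arbitrary: \<kappa>)
  case (Cons j js)
  have "ssum n (\<lambda>\<kappa>. of_int (\<kappa> a) * mono_z n z \<kappa>) \<kappa> (j # js)
    = (\<Sum>i<n. mono_z n z \<kappa> * z i powi j * (of_int (\<kappa> a) * (\<Prod>j\<leftarrow>js. psum n z j) + dpsum n z a js)
         + (if i = a then mono_z n z \<kappa> * z i powi j * of_int j * (\<Prod>j\<leftarrow>js. psum n z j) else 0))"
    unfolding ssum.simps Cons
  proof (intro sum.cong refl)
    fix i assume "i \<in> {..<n}"
    then have "i < n" by simp
    from mono_z_upd[OF this z]
    have m: "mono_z n z (\<kappa>(i := \<kappa> i + j)) = mono_z n z \<kappa> * z i powi j" .
    show "mono_z n z (\<kappa>(i := \<kappa> i + j)) * (of_int ((\<kappa>(i := \<kappa> i + j)) a) * (\<Prod>j\<leftarrow>js. psum n z j) + dpsum n z a js)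
      = mono_z n z \<kappa> * z i powi j * (of_int (\<kappa> a) * (\<Prod>j\<leftarrow>js. psum n z j) + dpsum n z a js)
         + (if i = a then mono_z n z \<kappa> * z i powi j * of_int j * (\<Prod>j\<leftarrow>js. psum n z j) else 0)"
      unfolding m by (cases "i = a") (simp_all add: algebra_simps)
  qed
  also have "\<dots> = mono_z n z \<kappa> * psum n z j * (of_int (\<kappa> a) * (\<Prod>j\<leftarrow>js. psum n z j) + dpsum n z a js)
      + mono_z n z \<kappa> * z a powi j * of_int j * (\<Prod>j\<leftarrow>js. psum n z j)"
    unfolding sum.distrib psum_def using a by (simp add: sum_distrib_left sum_distrib_right)
  finally show ?case by (simp add: algebra_simps)
qed simp

text \<open>The term of the Dunkl operator that exchanges the variables \<open>a\<close> and
  \<open>b\<close>, applied to a monomial; \<open>exch_eq_tsym\<close> identifies it as a divided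
  difference in these two variables.\<close>

definition exch :: "nat \<Rightarrow> (nat \<Rightarrow> complex) \<Rightarrow> nat \<Rightarrow> nat \<Rightarrow> (nat \<Rightarrow> int) \<Rightarrow> complex" where
  "exch n z a b \<kappa> = isum (\<kappa> a - \<kappa> b) (\<lambda>l. mono_z n z (\<kappa>(a := \<kappa> a - l, b := \<kappa> b + l)))"

lemma exch_eq_tsym:
  assumes "a < n" "b < n" "a \<noteq> b"
  shows "exch n z a b \<kappa> = tsym (z a) (z b) (\<kappa> a) (\<kappa> b) * (\<Prod>i\<in>{..<n} - {a, b}. z i powi \<kappa> i)"
proof -
  have "mono_z n z (\<kappa>(a := \<kappa> a - l, b := \<kappa> b + l))
     = z a powi (\<kappa> a - l) * z b powi (\<kappa> b + l) * (\<Prod>i\<in>{..<n} - {a, b}. z i powi \<kappa> i)" for l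
  proof -
    have "mono_z n z (\<kappa>(a := \<kappa> a - l, b := \<kappa> b + l))
      = (\<Prod>i\<in>insert a (insert b ({..<n} - {a, b})). z i powi ((\<kappa>(a := \<kappa> a - l, b := \<kappa> b + l)) i))"
      unfolding mono_z_def using assms by (intro prod.cong) auto
    also have "\<dots> = z a powi (\<kappa> a - l) * (z b powi (\<kappa> b + l) * (\<Prod>i\<in>{..<n} - {a, b}. z i powi ((\<kappa>(a := \<kappa> a - l, b := \<kappa> b + l)) i)))"
      using assms by simp
    also have "(\<Prod>i\<in>{..<n} - {a, b}. z i powi ((\<kappa>(a := \<kappa> a - l, b := \<kappa> b + l)) i)) = (\<Prod>i\<in>{..<n} - {a, b}. z i powi \<kappa> i)"
      by (intro prod.cong) auto
    finally show ?thesis by (simp only: mult.assoc)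
  qed
  then show ?thesis unfolding exch_def tsym_def isum_cmult by simp
qed

text \<open>Power sums are symmetric in \<open>z a\<close> and \<open>z b\<close>, so they pass
  through the divided difference: the contributions of \<open>a\<close> and \<open>b\<close> combine
  by \<open>tsym_shift\<close>, and every other variable is a mere factor.\<close>

lemma ssum_exch:
  assumes z: "\<And>i. i < n \<Longrightarrow> z i \<noteq> 0" and ab: "a < n" "b < n" "a \<noteq> b"
  shows "ssum n (exch n z a b) \<kappa> js = exch n z a b \<kappa> * (\<Prod>j\<leftarrow>js. psum n z j)"
proof (induction js arbitrary: \<kappa>)
  case (Cons j js)
  define R where "R \<kappa> = (\<Prod>i\<in>{..<n} - {a, b}. z i powi \<kappa> i)" for \<kappa> :: "nat \<Rightarrow> int"
  have e: "exch n z a b \<kappa> = tsym (z a) (z b) (\<kappa> a) (\<kappa> b) * R \<kappa>" for \<kappa>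
    unfolding R_def by (rule exch_eq_tsym[OF ab])
  have Ra: "R (\<kappa>(a := x)) = R \<kappa>" "R (\<kappa>(b := x)) = R \<kappa>" for x
    unfolding R_def by (auto intro!: prod.cong)
  have Ri: "R (\<kappa>(i := \<kappa> i + j)) = R \<kappa> * z i powi j" if "i \<in> {..<n} - {a, b}" for i
  proof -
    have "R (\<kappa>(i := \<kappa> i + j)) = (\<Prod>i'\<in>{..<n} - {a, b}. z i' powi \<kappa> i' * (if i' = i then z i powi j else 1))"
      unfolding R_def using z that by (intro prod.cong) (auto simp: power_int_add)
    then show ?thesis unfolding prod.distrib R_def using that by simp
  qed
  have "(\<Sum>i<n. exch n z a b (\<kappa>(i := \<kappa> i + j)))
    = exch n z a b (\<kappa>(a := \<kappa> a + j)) + exch n z a b (\<kappa>(b := \<kappa> b + j)) + (\<Sum>i\<in>{..<n} - {a, b}. exch n z a b (\<kappa>(i := \<kappa> i + j)))"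
  proof -
    have "{..<n} = insert a (insert b ({..<n} - {a, b}))" using ab by auto
    then have "(\<Sum>i<n. exch n z a b (\<kappa>(i := \<kappa> i + j))) = (\<Sum>i\<in>insert a (insert b ({..<n} - {a, b})). exch n z a b (\<kappa>(i := \<kappa> i + j)))"
      by simp
    then show ?thesis using ab by (simp add: add.assoc)
  qed
  also have "exch n z a b (\<kappa>(a := \<kappa> a + j)) + exch n z a b (\<kappa>(b := \<kappa> b + j)) = (z a powi j + z b powi j) * exch n z a b \<kappa>"
    unfolding e Ra distrib_right[symmetric] using ab tsym_shift[OF z[OF ab(1)] z[OF ab(2)], of "\<kappa> a" j "\<kappa> b"] by simp
  also have "(\<Sum>i\<in>{..<n} - {a, b}. exch n z a b (\<kappa>(i := \<kappa> i + j))) = (\<Sum>i\<in>{..<n} - {a, b}. z i powi j) * exch n z a b \<kappa>"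
    unfolding sum_distrib_right e using Ri by (intro sum.cong) (auto simp: algebra_simps)
  also have "(z a powi j + z b powi j) * exch n z a b \<kappa> + (\<Sum>i\<in>{..<n} - {a, b}. z i powi j) * exch n z a b \<kappa> = psum n z j * exch n z a b \<kappa>"
  proof -
    have "{..<n} = insert a (insert b ({..<n} - {a, b}))" using ab by auto
    then have "psum n z j = (\<Sum>i\<in>insert a (insert b ({..<n} - {a, b})). z i powi j)" unfolding psum_def by simp
    also have "\<dots> = z a powi j + z b powi j + (\<Sum>i\<in>{..<n} - {a, b}. z i powi j)" using ab by (simp add: add.assoc)
    finally show ?thesis by (simp add: algebra_simps)
  qed
  finally have 1: "(\<Sum>i<n. exch n z a b (\<kappa>(i := \<kappa> i + j))) = psum n z j * exch n z a b \<kappa>" .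
  have "ssum n (exch n z a b) \<kappa> (j # js) = (\<Sum>i<n. exch n z a b (\<kappa>(i := \<kappa> i + j))) * (\<Prod>j\<leftarrow>js. psum n z j)"
    unfolding ssum.simps Cons sum_distrib_right ..
  then show ?case unfolding 1 by (simp add: mult_ac)
qed simp

text \<open>The Dunkl-type operator \<open>z\<^sub>a \<partial>\<^sub>a + \<Sum>\<^sub>b z\<^sub>a (1 - s\<^sub>a\<^sub>b) / (z\<^sub>a - z\<^sub>b)\<close>, written on the exponents of
  Laurent monomials and dualized to a function \<open>c\<close> of the exponents.\<close>

definition dunkl :: "nat \<Rightarrow> ((nat \<Rightarrow> int) \<Rightarrow> complex) \<Rightarrow> (nat \<Rightarrow> int) \<Rightarrow> complex" where
  "dunkl n c \<kappa> = of_int (\<kappa> 0) * c \<kappa>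
     + (\<Sum>b\<in>{..<n} - {0}. isum (\<kappa> 0 - \<kappa> b) (\<lambda>l. c (\<kappa>(0 := \<kappa> 0 - l, b := \<kappa> b + l))))"

text \<open>Powers of one variable times power sums are the only test functions that the loop
  equations reach; this is the Dunkl operator on them.\<close>

lemma ssum_dunkl_mono:
  assumes z: "\<And>i. i < n \<Longrightarrow> z i \<noteq> 0" and n: "0 < n"
  shows "ssum n (dunkl n (mono_z n z)) ((\<lambda>_. 0)(0 := k)) js
    = (of_int k * z 0 powi k + (\<Sum>b\<in>{..<n} - {0}. tsym (z 0) (z b) k 0)) * (\<Prod>j\<leftarrow>js. psum n z j)
      + z 0 powi k * dpsum n z 0 js"
proof -
  have m: "mono_z n z ((\<lambda>_. 0)(0 := k)) = z 0 powi k"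
    using mono_z_upd[where z = z and i = 0 and n = n and \<kappa> = "\<lambda>_. 0" and j = k, OF n z] by (simp add: mono_z_def)
  have "dunkl n (mono_z n z) = (\<lambda>\<kappa>. of_int (\<kappa> 0) * mono_z n z \<kappa> + (\<Sum>b\<in>{..<n} - {0}. exch n z 0 b \<kappa>))"
    by (simp add: dunkl_def exch_def fun_eq_iff)
  then have "ssum n (dunkl n (mono_z n z)) ((\<lambda>_. 0)(0 := k)) js
    = z 0 powi k * (of_int k * (\<Prod>j\<leftarrow>js. psum n z j) + dpsum n z 0 js)
     + (\<Sum>b\<in>{..<n} - {0}. exch n z 0 b ((\<lambda>_. 0)(0 := k)) * (\<Prod>j\<leftarrow>js. psum n z j))"
    by (simp add: ssum_add ssum_sum ssum_euler[OF z n] m ssum_exch[OF z n])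
  also have "(\<Sum>b\<in>{..<n} - {0}. exch n z 0 b ((\<lambda>_. 0)(0 := k)) * (\<Prod>j\<leftarrow>js. psum n z j))
     = (\<Sum>b\<in>{..<n} - {0}. tsym (z 0) (z b) k 0) * (\<Prod>j\<leftarrow>js. psum n z j)"
    unfolding sum_distrib_right
  proof (intro sum.cong refl)
    fix b assume b: "b \<in> {..<n} - {0}"
    have "(\<Prod>i\<in>{..<n} - {0, b}. z i powi ((\<lambda>_. 0)(0 := k)) i) = 1" by (intro prod.neutral) auto
    then show "exch n z 0 b ((\<lambda>_. 0)(0 := k)) * (\<Prod>j\<leftarrow>js. psum n z j) = tsym (z 0) (z b) k 0 * (\<Prod>j\<leftarrow>js. psum n z j)"
      using b n by (subst exch_eq_tsym) auto
  qed
  finally show ?thesis by (simp only: distrib_left distrib_right mult_ac add_ac)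
qed

section \<open>Uniqueness of symmetric solutions of the Dunkl equation\<close>

locale dunkl_sym =
  fixes n :: nat and c :: "(nat \<Rightarrow> int) \<Rightarrow> complex"
  assumes n: "0 < n"
    and sym: "\<And>\<kappa> i j. i < n \<Longrightarrow> j < n \<Longrightarrow> c (\<kappa> \<circ> Transposition.transpose i j) = c \<kappa>"
begin

lemma comp_transpose_upd: "(\<kappa> \<circ> Transposition.transpose i j)(a := v) = (\<kappa>(Transposition.transpose i j a := v)) \<circ> Transposition.transpose i j"
  by (auto simp: fun_eq_iff dest: arg_cong[where f = "Transposition.transpose i j"])

text \<open>The operator singles out the variable 0, so symmetry survives only among the other
  coordinates.\<close>

lemma dunkl_comp:
  assumes "0 < i" "i < n" "0 < j" "j < n"
  shows "dunkl n c (\<kappa> \<circ> Transposition.transpose i j) = dunkl n c \<kappa>"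
proof -
  let ?t = "Transposition.transpose i j"
  have t0: "?t 0 = 0" using assms by (simp add: transpose_def)
  have bij: "bij_betw ?t ({..<n} - {0}) ({..<n} - {0})"
    by (rule bij_betw_byWitness[where f' = ?t]) (use assms in \<open>auto simp: Transposition.transpose_def split: if_splits\<close>)
  have "(\<Sum>b\<in>{..<n} - {0}. isum ((\<kappa> \<circ> ?t) 0 - (\<kappa> \<circ> ?t) b) (\<lambda>l. c ((\<kappa> \<circ> ?t)(0 := (\<kappa> \<circ> ?t) 0 - l, b := (\<kappa> \<circ> ?t) b + l))))
      = (\<Sum>b\<in>{..<n} - {0}. isum (\<kappa> 0 - \<kappa> (?t b)) (\<lambda>l. c (\<kappa>(0 := \<kappa> 0 - l, ?t b := \<kappa> (?t b) + l))))"
    unfolding comp_transpose_upd sym[OF assms(2,4)] by (simp add: t0)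
  also have "\<dots> = (\<Sum>b\<in>{..<n} - {0}. isum (\<kappa> 0 - \<kappa> b) (\<lambda>l. c (\<kappa>(0 := \<kappa> 0 - l, b := \<kappa> b + l))))"
    by (rule sum.reindex_bij_betw[OF bij])
  finally show ?thesis unfolding dunkl_def using sym[OF assms(2,4), of \<kappa>] by (simp add: t0)
qed

lemma ssum_dunkl_comp:
  assumes "0 < i" "i < n" "0 < j" "j < n"
  shows "ssum n (dunkl n c) (\<kappa> \<circ> Transposition.transpose i j) js = ssum n (dunkl n c) \<kappa> js"
proof (induction js arbitrary: \<kappa>)
  case Nil then show ?case using dunkl_comp[OF assms] by (simp only: ssum.simps)
next
  case (Cons k js)
  let ?t = "Transposition.transpose i j"
  have bij: "bij_betw ?t {..<n} {..<n}"
    by (rule bij_betw_byWitness[where f' = ?t]) (use assms in \<open>auto simp: Transposition.transpose_def split: if_splits\<close>)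
  have "ssum n (dunkl n c) (\<kappa> \<circ> ?t) (k # js) = (\<Sum>b<n. ssum n (dunkl n c) (\<kappa>(?t b := \<kappa> (?t b) + k)) js)"
    unfolding ssum.simps comp_transpose_upd Cons by simp
  also have "\<dots> = (\<Sum>b<n. ssum n (dunkl n c) (\<kappa>(b := \<kappa> b + k)) js)"
    by (rule sum.reindex_bij_betw[OF bij])
  finally show ?case by (simp only: ssum.simps)
qed

text \<open>Induction on the number \<open>m\<close> of leading coordinates that may be nonzero.
  Remove the last exponent and put it back as a power sum: this yields the original exponents, their
  transposes into later positions, which give the same value by symmetry away from 0, and terms with
  fewer coordinates, which vanish by induction. The original value thus appears with the nonzero
  factor \<open>n - m\<close>.\<close>

lemma dunkl_eq_0:
  assumes base: "\<And>k js. ssum n (dunkl n c) ((\<lambda>_. 0)(0 := k)) js = 0"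
    and supp: "\<And>i. i \<ge> n \<Longrightarrow> \<kappa> i = 0"
  shows "dunkl n c \<kappa> = 0"
proof -
  have "ssum n (dunkl n c) \<kappa> js = 0" if "1 \<le> m" "m \<le> n" "\<And>i. i \<ge> m \<Longrightarrow> \<kappa> i = 0" for m \<kappa> js
    using that
  proof (induction m arbitrary: \<kappa> js rule: nat_induct_at_least)
    case base
    have "\<kappa> = (\<lambda>_. 0)(0 := \<kappa> 0)" using base(2) by (auto simp: fun_eq_iff)
    then show ?case using assms(1)[of "\<kappa> 0" js] by simp
  next
    case (Suc m)
    define \<kappa>' where "\<kappa>' = \<kappa>(m := 0)"
    have "0 = ssum n (dunkl n c) \<kappa>' (\<kappa> m # js)"
      by (rule Suc.IH[symmetric]) (use Suc.prems in \<open>auto simp: \<kappa>'_def\<close>)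
    also have "\<dots> = (\<Sum>i<n. ssum n (dunkl n c) (\<kappa>'(i := \<kappa>' i + \<kappa> m)) js)" by simp
    \<comment> \<open>Added to a coordinate below \<open>m\<close>, the exponent leaves the support
      inside the first \<open>m\<close> coordinates, where the induction hypothesis applies.\<close>
    also have "\<dots> = (\<Sum>i\<in>{m..<n}. ssum n (dunkl n c) (\<kappa>'(i := \<kappa>' i + \<kappa> m)) js)"
    proof (intro sum.mono_neutral_right ballI)
      fix i assume "i \<in> {..<n} - {m..<n}"
      then show "ssum n (dunkl n c) (\<kappa>'(i := \<kappa>' i + \<kappa> m)) js = 0"
        by (intro Suc.IH) (use Suc.prems in \<open>auto simp: \<kappa>'_def\<close>)
    qed auto
    also have "\<dots> = (\<Sum>i\<in>{m..<n}. ssum n (dunkl n c) \<kappa> js)"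
    proof (intro sum.cong refl)
      fix i assume i: "i \<in> {m..<n}"
      have "\<kappa>'(i := \<kappa>' i + \<kappa> m) = \<kappa> \<circ> Transposition.transpose i m"
        using i Suc.prems by (auto simp: fun_eq_iff \<kappa>'_def Transposition.transpose_def)
      then show "ssum n (dunkl n c) (\<kappa>'(i := \<kappa>' i + \<kappa> m)) js = ssum n (dunkl n c) \<kappa> js"
        using ssum_dunkl_comp[of i m \<kappa> js] i Suc.hyps Suc.prems by simp
    qed
    also have "\<dots> = of_nat (n - m) * ssum n (dunkl n c) \<kappa> js" by simp
    finally show ?case using Suc.prems by simp
  qed
  from this[of n \<kappa> "[]"] show ?thesis using n supp by simp
qed

text \<open>Descent on the sum of squares of the exponents. With the largest exponent moved to
  position 0, an exchange term keeps the sum of two exponents and moves them strictly closer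
  together, which lowers the sum of squares; only the terms with \<open>l = 0\<close> survive. If
  just negative exponents are available, conjugation reverses all signs first.\<close>

lemma eq_0:
  assumes dunkl: "\<And>\<kappa>. (\<And>i. i \<ge> n \<Longrightarrow> \<kappa> i = 0) \<Longrightarrow> dunkl n c \<kappa> = 0"
    and cnj: "\<And>\<kappa>. c (\<lambda>i. - \<kappa> i) = cnj (c \<kappa>)" and zero: "c (\<lambda>_. 0) = 0"
    and supp: "\<And>i. i \<ge> n \<Longrightarrow> \<kappa> i = 0"
  shows "c \<kappa> = 0"
  using supp
proof (induction "nat (\<Sum>i<n. (\<kappa> i)\<^sup>2)" arbitrary: \<kappa> rule: less_induct)
  case less
  have pos: "c \<kappa> = 0" if i: "i < n" "\<kappa> i > 0" and IH: "\<And>\<kappa>'. (\<Sum>i<n. (\<kappa>' i)\<^sup>2) < (\<Sum>i<n. (\<kappa> i)\<^sup>2) \<Longrightarrow> (\<And>i. i \<ge> n \<Longrightarrow> \<kappa>' i = 0) \<Longrightarrow> c \<kappa>' = 0"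
    and s: "\<And>i. i \<ge> n \<Longrightarrow> \<kappa> i = 0" for i \<kappa>
  proof -
    obtain a where a: "a < n" "\<And>j. j < n \<Longrightarrow> \<kappa> j \<le> \<kappa> a"
    proof -
      have "Max (\<kappa> ` {..<n}) \<in> \<kappa> ` {..<n}" using i by (intro Max_in) auto
      then obtain a where "a < n" "\<kappa> a = Max (\<kappa> ` {..<n})" by auto
      then show ?thesis using that[of a] by simp
    qed
    define \<mu> where "\<mu> = \<kappa> \<circ> Transposition.transpose 0 a"
    have \<mu>: "\<mu> 0 > 0" "\<And>j. j < n \<Longrightarrow> \<mu> j \<le> \<mu> 0" "c \<mu> = c \<kappa>"
      using a i n sym[OF n a(1), of \<kappa>] order.strict_trans2[OF i(2) a(2)[OF i(1)]]
      by (auto simp: \<mu>_def Transposition.transpose_def)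
    have \<mu>s: "\<mu> j = 0" if "j \<ge> n" for j using that s a n by (auto simp: \<mu>_def Transposition.transpose_def)
    have bij: "bij_betw (Transposition.transpose 0 a) {..<n} {..<n}"
      by (rule bij_betw_byWitness[where f' = "Transposition.transpose 0 a"]) (use a n in \<open>auto simp: Transposition.transpose_def split: if_splits\<close>)
    have sq: "(\<Sum>i<n. (\<mu> i)\<^sup>2) = (\<Sum>i<n. (\<kappa> i)\<^sup>2)"
      using sum.reindex_bij_betw[OF bij, of "\<lambda>i. (\<kappa> i)\<^sup>2"] by (simp add: \<mu>_def)
    have "isum (\<mu> 0 - \<mu> b) (\<lambda>l. c (\<mu>(0 := \<mu> 0 - l, b := \<mu> b + l))) = (if \<mu> b < \<mu> 0 then c \<mu> else 0)"
      if b: "b \<in> {..<n} - {0}" for b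
    proof (cases "\<mu> b < \<mu> 0")
      case False
      then show ?thesis using \<mu>(2)[of b] b by simp
    next
      case True
      have "isum (\<mu> 0 - \<mu> b) (\<lambda>l. c (\<mu>(0 := \<mu> 0 - l, b := \<mu> b + l)))
         = (\<Sum>l\<in>{0..<\<mu> 0 - \<mu> b}. c (\<mu>(0 := \<mu> 0 - l, b := \<mu> b + l)))"
        using True by (simp add: isum_def)
      also have "\<dots> = (\<Sum>l\<in>{0}. c (\<mu>(0 := \<mu> 0 - l, b := \<mu> b + l)))"
      proof (intro sum.mono_neutral_right ballI)
        fix l assume "l \<in> {0..<\<mu> 0 - \<mu> b} - {0}"
        then have l: "0 < l" "l < \<mu> 0 - \<mu> b" by auto
        let ?v = "\<mu>(0 := \<mu> 0 - l, b := \<mu> b + l)"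
        have spl: "(\<Sum>i<n. (f i)\<^sup>2) = (f 0)\<^sup>2 + (f b)\<^sup>2 + (\<Sum>i\<in>{..<n} - {0, b}. (f i)\<^sup>2)" for f :: "nat \<Rightarrow> int"
        proof -
          have "{..<n} = insert 0 (insert b ({..<n} - {0, b}))" using n b by auto
          then have "(\<Sum>i<n. (f i)\<^sup>2) = (\<Sum>i\<in>insert 0 (insert b ({..<n} - {0, b})). (f i)\<^sup>2)" by simp
          then show ?thesis using b by simp
        qed
        have "(\<Sum>i\<in>{..<n} - {0, b}. (?v i)\<^sup>2) = (\<Sum>i\<in>{..<n} - {0, b}. (\<mu> i)\<^sup>2)" by (intro sum.cong) auto
        moreover have "(\<mu> 0 - l)\<^sup>2 + (\<mu> b + l)\<^sup>2 = (\<mu> 0)\<^sup>2 + (\<mu> b)\<^sup>2 - 2 * (l * (\<mu> 0 - \<mu> b - l))"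
          by (simp add: power2_eq_square algebra_simps)
        moreover have "l * (\<mu> 0 - \<mu> b - l) > 0" using l by simp
        ultimately have "(\<Sum>i<n. (?v i)\<^sup>2) < (\<Sum>i<n. (\<mu> i)\<^sup>2)"
          unfolding spl using b by simp
        then show "c ?v = 0" using IH[of ?v] sq \<mu>s b n by auto
      qed (use True in auto)
      also have "\<dots> = c \<mu>" by simp
      finally show ?thesis using True by simp
    qed
    \<comment> \<open>The Euler part contributes the positive \<open>\<mu> 0\<close> and every
      coordinate smaller than it contributes 1, so the total coefficient of \<open>c \<mu>\<close>
      is positive.\<close>
    then have "dunkl n c \<mu> = of_int (\<mu> 0) * c \<mu> + (\<Sum>b\<in>{..<n} - {0}. (if \<mu> b < \<mu> 0 then c \<mu> else 0))"
      unfolding dunkl_def by simp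
    also have "\<dots> = of_int (\<mu> 0 + int (card {b \<in> {..<n} - {0}. \<mu> b < \<mu> 0})) * c \<mu>"
      by (subst sum.inter_filter[symmetric]) (auto simp: algebra_simps)
    finally have "of_int (\<mu> 0 + int (card {b \<in> {..<n} - {0}. \<mu> b < \<mu> 0})) * c \<mu> = 0"
      using dunkl[of \<mu>] \<mu>s by simp
    moreover have "\<mu> 0 + int (card {b \<in> {..<n} - {0}. \<mu> b < \<mu> 0}) \<noteq> 0" using \<mu>(1) by linarith
    ultimately have "c \<mu> = 0" by (simp only: mult_eq_0_iff of_int_eq_0_iff) simp
    then show ?thesis using \<mu>(3) by simp
  qed
  have IH: "c \<kappa>' = 0" if "(\<Sum>i<n. (\<kappa>' i)\<^sup>2) < (\<Sum>i<n. (\<kappa> i)\<^sup>2)" "\<And>i. i \<ge> n \<Longrightarrow> \<kappa>' i = 0" for \<kappa>'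
  proof (rule less.hyps)
    have "(\<Sum>i<n. (\<kappa>' i)\<^sup>2) \<ge> 0" by (intro sum_nonneg) auto
    then show "nat (\<Sum>i<n. (\<kappa>' i)\<^sup>2) < nat (\<Sum>i<n. (\<kappa> i)\<^sup>2)" using that(1) by simp
  qed (rule that(2))
  consider i where "i < n" "\<kappa> i > 0" | i where "i < n" "\<kappa> i < 0" | "\<forall>i<n. \<kappa> i = 0"
    by (metis linorder_neqE)
  then show ?case
  proof cases
    case 1 then show ?thesis using pos[of _ \<kappa>] IH less.prems by blast
  next
    case 2
    have "c (\<lambda>i. - \<kappa> i) = 0"
      by (rule pos[of _ "\<lambda>i. - \<kappa> i"]) (use 2 IH less.prems in auto)
    then show ?thesis using cnj[of \<kappa>] by simp
  next
    case 3
    then have "\<kappa> = (\<lambda>_. 0)" using less.prems by (metis not_le)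
    then show ?thesis using zero by simp
  qed
qed

end

section \<open>Fourier determination of laws on the torus\<close>

text \<open>Trigonometric polynomials, as a predicate on real-valued functions because the
  Stone-Weierstrass theorem is applied to a real algebra. Values off the unit circle are left
  free.\<close>

definition trig_fun :: "(complex \<Rightarrow> real) \<Rightarrow> bool" where
  "trig_fun f \<longleftrightarrow> (\<exists>(K :: int set) a. finite K \<and> (\<forall>z. norm z = 1 \<longrightarrow> complex_of_real (f z) = (\<Sum>k\<in>K. a k * z powi k)))"

lemma trig_fun_add:
  assumes "trig_fun f" "trig_fun g" shows "trig_fun (\<lambda>z. f z + g z)"
proof -
  obtain K a where K: "finite K" "\<And>z. norm z = 1 \<Longrightarrow> complex_of_real (f z) = (\<Sum>k\<in>K. a k * z powi k)"
    using assms(1) unfolding trig_fun_def by blast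
  obtain L b where L: "finite L" "\<And>z. norm z = 1 \<Longrightarrow> complex_of_real (g z) = (\<Sum>k\<in>L. b k * z powi k)"
    using assms(2) unfolding trig_fun_def by blast
  define a' where "a' k = (if k \<in> K then a k else 0)" for k
  define b' where "b' k = (if k \<in> L then b k else 0)" for k
  have "complex_of_real (f z + g z) = (\<Sum>k\<in>K \<union> L. (a' k + b' k) * z powi k)" if "norm z = 1" for z
  proof -
    have "(\<Sum>k\<in>K. a k * z powi k) = (\<Sum>k\<in>K \<union> L. a' k * z powi k)"
      using K L by (intro sum.mono_neutral_cong_left) (auto simp: a'_def)
    moreover have "(\<Sum>k\<in>L. b k * z powi k) = (\<Sum>k\<in>K \<union> L. b' k * z powi k)"
      using K L by (intro sum.mono_neutral_cong_left) (auto simp: b'_def)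
    ultimately show ?thesis using K L that by (simp add: distrib_right sum.distrib)
  qed
  then show ?thesis unfolding trig_fun_def using K L by (intro exI[of _ "K \<union> L"] exI[of _ "\<lambda>k. a' k + b' k"]) auto
qed

lemma trig_fun_mult:
  assumes "trig_fun f" "trig_fun g" shows "trig_fun (\<lambda>z. f z * g z)"
proof -
  obtain K a where K: "finite K" "\<And>z. norm z = 1 \<Longrightarrow> complex_of_real (f z) = (\<Sum>k\<in>K. a k * z powi k)"
    using assms(1) unfolding trig_fun_def by blast
  obtain L b where L: "finite L" "\<And>z. norm z = 1 \<Longrightarrow> complex_of_real (g z) = (\<Sum>k\<in>L. b k * z powi k)"
    using assms(2) unfolding trig_fun_def by blast
  define h where "h = (\<lambda>p :: int \<times> int. fst p + snd p)"
  define c where "c m = (\<Sum>p\<in>{p \<in> K \<times> L. h p = m}. a (fst p) * b (snd p))" for m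
  have fin: "finite (h ` (K \<times> L))" "finite (K \<times> L)" using K L by auto
  have "complex_of_real (f z * g z) = (\<Sum>m\<in>h ` (K \<times> L). c m * z powi m)" if z: "norm z = 1" for z
  proof -
    have nz: "z \<noteq> 0" using z by auto
    have "complex_of_real (f z * g z) = (\<Sum>p\<in>K \<times> L. a (fst p) * b (snd p) * z powi h p)"
      using K L z nz by (simp add: sum_product sum.cartesian_product h_def power_int_add case_prod_beta mult_ac)
    also have "\<dots> = (\<Sum>m\<in>h ` (K \<times> L). \<Sum>p\<in>{p \<in> K \<times> L. h p = m}. a (fst p) * b (snd p) * z powi h p)"
      using fin by (intro sum.group[symmetric]) auto
    also have "\<dots> = (\<Sum>m\<in>h ` (K \<times> L). c m * z powi m)"
      unfolding c_def sum_distrib_right by (intro sum.cong) auto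
    finally show ?thesis .
  qed
  then show ?thesis unfolding trig_fun_def using fin by (intro exI[of _ "h ` (K \<times> L)"] exI[of _ c]) auto
qed

lemma inverse_unit_complex: "norm z = 1 \<Longrightarrow> inverse z = cnj (z :: complex)"
  by (intro inverse_unique) (simp add: complex_norm_square[symmetric])

text \<open>Stone-Weierstrass on the circle. There the inverse is the conjugate, so
  \<open>Re\<close> and \<open>Im\<close> are trigonometric polynomials, and they separate
  points.\<close>

lemma trig_approx:
  fixes f :: "complex \<Rightarrow> real"
  assumes f: "continuous_on (sphere 0 1) f" and e: "0 < e"
  obtains g where "trig_fun g" "\<And>z. norm z = 1 \<Longrightarrow> \<bar>f z - g z\<bar> < e"
proof -
  have "\<exists>g. (trig_fun g \<and> continuous_on (sphere 0 1) g) \<and> (\<forall>x\<in>sphere 0 1. \<bar>f x - g x\<bar> < e)"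
  proof (rule Stone_Weierstrass_HOL)
    show "compact (sphere (0 :: complex) 1)" by simp
    show "trig_fun (\<lambda>x. c) \<and> continuous_on (sphere 0 1) (\<lambda>x :: complex. c)" for c
      unfolding trig_fun_def by (auto intro!: exI[of _ "{0::int}"] exI[of _ "\<lambda>_. complex_of_real c"])
    show "\<exists>f. (trig_fun f \<and> continuous_on (sphere 0 1) f) \<and> f x \<noteq> f y" if xy: "x \<in> sphere 0 1 \<and> y \<in> sphere 0 1 \<and> x \<noteq> y" for x y :: complex
    proof -
      have re: "trig_fun Re" unfolding trig_fun_def
      proof (intro exI[of _ "{1, -1 :: int}"] exI[of _ "\<lambda>_. 1/2"] conjI allI impI)
        fix z :: complex assume "norm z = 1"
        then show "complex_of_real (Re z) = (\<Sum>k\<in>{1, -1}. 1 / 2 * z powi k)"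
          by (simp add: inverse_unit_complex complex_eq_iff)
      qed auto
      have im: "trig_fun Im" unfolding trig_fun_def
      proof (intro exI[of _ "{1, -1 :: int}"] exI[of _ "\<lambda>k. of_int k * (- \<i> / 2)"] conjI allI impI)
        fix z :: complex assume "norm z = 1"
        then show "complex_of_real (Im z) = (\<Sum>k\<in>{1, -1}. of_int k * (- \<i> / 2) * z powi k)"
          by (simp add: inverse_unit_complex complex_eq_iff)
      qed auto
      have "Re x \<noteq> Re y \<or> Im x \<noteq> Im y" using xy by (auto simp: complex_eq_iff)
      moreover have "continuous_on (sphere 0 1) Re" "continuous_on (sphere 0 1) Im" by (intro continuous_intros)+
      ultimately show ?thesis using re im by blast
    qed
  qed (use f e in \<open>auto intro!: trig_fun_add trig_fun_mult continuous_intros\<close>)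
  then show ?thesis using that by auto
qed

text \<open>Continuous functions that decrease to the indicator of the closed set \<open>S\<close>
  as \<open>m\<close> grows. The empty set is split off because \<open>infdist\<close> to it is 0 by
  convention.\<close>

definition bump :: "complex set \<Rightarrow> nat \<Rightarrow> complex \<Rightarrow> real" where
  "bump S m z = (if S = {} then 0 else max 0 (1 - real m * infdist z S))"

lemma bump_continuous: "continuous_on T (bump S m)"
  unfolding bump_def by (cases "S = {}") (auto intro!: continuous_intros continuous_on_infdist)

lemma bump_bounds: "0 \<le> bump S m z" "bump S m z \<le> 1"
  by (auto simp: bump_def infdist_nonneg)

lemma bump_tendsto:
  assumes "closed S"
  shows "(\<lambda>m. bump S m z) \<longlonglongrightarrow> indicator S z"
proof (cases "S = {} \<or> z \<in> S")
  case True
  then show ?thesis by (auto simp: bump_def intro!: tendsto_eventually)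
next
  case False
  then have d: "infdist z S > 0"
    using assms infdist_pos_not_in_closed by auto
  have "\<forall>\<^sub>F m in sequentially. bump S m z = 0"
  proof -
    obtain N where N: "1 / infdist z S < real N" using reals_Archimedean2 by blast
    have "bump S m z = 0" if "m \<ge> N" for m
    proof -
      have "1 < real N * infdist z S" using N d by (simp add: field_simps)
      also have "\<dots> \<le> real m * infdist z S" using that d by (intro mult_right_mono) auto
      finally show ?thesis by (simp add: bump_def)
    qed
    then show ?thesis by (auto simp: eventually_sequentially)
  qed
  then show ?thesis using False by (auto intro!: tendsto_eventually)
qed

lemma cis_eq_imp_eq:
  assumes "x \<in> {0..<2*pi}" "y \<in> {0..<2*pi}" "cis x = cis y"
  shows "x = y"
proof -
  have "sin x = sin y \<and> cos x = cos y" using assms(3) by (auto simp: complex_eq_iff)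
  then obtain k :: int where k: "y = x + 2 * pi * of_int k" using sin_cos_eq_iff[of y x] by auto
  have "\<not> k \<ge> 1"
  proof
    assume "k \<ge> 1"
    then have "2 * pi * 1 \<le> 2 * pi * of_int k" by (intro mult_left_mono) auto
    then show False using k assms(1,2) unfolding atLeastLessThan_iff by linarith
  qed
  moreover have "\<not> k \<le> -1"
  proof
    assume "k \<le> -1"
    then have "2 * pi * of_int k \<le> 2 * pi * (- 1)" by (intro mult_left_mono) auto
    then show False using k assms(1,2) unfolding atLeastLessThan_iff by linarith
  qed
  ultimately have "k = 0" by linarith
  then show ?thesis using k by simp
qed

lemma closed_arc: "closed (cis ` {0..a})"
  by (intro compact_imp_closed compact_continuous_image continuous_intros) auto

text \<open>For angles in \<open>{0..<2*pi}\<close> a half line corresponds to a closed arc, so its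
  indicator becomes a function on the circle, within reach of trigonometric approximation.\<close>

lemma arc_indicator:
  assumes "x \<in> {0..<2*pi}"
  shows "indicator {..a} x = (indicator (cis ` {0..a}) (cis x) :: 'a::zero_neq_one)"
proof -
  have "x \<le> a" if "cis x = cis y" "0 \<le> y" "y \<le> a" for y
  proof (cases "y < 2 * pi")
    case True
    then have "x = y" using cis_eq_imp_eq[OF assms, of y] that by auto
    then show ?thesis using that by simp
  next
    case False then show ?thesis using assms that by auto
  qed
  then have "x \<le> a \<longleftrightarrow> cis x \<in> cis ` {0..a}" using assms by auto
  then show ?thesis by (auto simp: indicator_def)
qed

text \<open>Symmetric sums of trigonometric polynomials in the angles are combinations of the
  measurable traces; limits extend this to continuous functions and then to arcs, so the number of
  angles up to \<open>a\<close> is measurable. Since the list is sorted, its entry \<open>i\<close>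
  is at most \<open>a\<close> exactly when more than \<open>i\<close> angles are.\<close>

lemma (in haar_unitary) eigenangle_measurable [measurable]:
  assumes i: "i < n"
  shows "(\<lambda>A. eigenangles A ! i) \<in> borel_measurable M"
proof -
  let ?t = "\<lambda>A i. eigenangles A ! i"
  have trig: "(\<lambda>A. \<Sum>i<n. g (cis (?t A i))) \<in> borel_measurable M" if "trig_fun g" for g
  proof -
    obtain K a where K: "finite K" "\<And>z. norm z = 1 \<Longrightarrow> complex_of_real (g z) = (\<Sum>k\<in>K. a k * z powi k)"
      using \<open>trig_fun g\<close> unfolding trig_fun_def by blast
    have "(\<Sum>i<n. g (cis (?t A i))) = Re (\<Sum>k\<in>K. a k * mtr n A k)" if "A \<in> space M" for A
    proof -
      have "complex_of_real (\<Sum>i<n. g (cis (?t A i))) = (\<Sum>i<n. \<Sum>k\<in>K. a k * cis (of_int k * ?t A i))"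
        using K(2) by (simp add: cis_power_int)
      also have "\<dots> = (\<Sum>k\<in>K. a k * mtr n A k)"
        using eigenangles_unitary(3)[of A n] that by (subst sum.swap) (simp add: sum_distrib_left)
      finally show ?thesis by (metis Re_complex_of_real)
    qed
    moreover have "(\<lambda>A. Re (\<Sum>k\<in>K. a k * mtr n A k)) \<in> borel_measurable M" by measurable
    ultimately show ?thesis by (subst measurable_cong)
  qed
  have cont: "(\<lambda>A. \<Sum>i<n. f (cis (?t A i))) \<in> borel_measurable M" if f: "continuous_on (sphere 0 1) f" for f :: "complex \<Rightarrow> real"
  proof -
    have "\<exists>g. trig_fun g \<and> (\<forall>z. norm z = 1 \<longrightarrow> \<bar>f z - g z\<bar> < inverse (real (Suc m)))" for m
      using trig_approx[OF f, of "inverse (real (Suc m))"] by (metis inverse_positive_iff_positive of_nat_0_less_iff zero_less_Suc)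
    then obtain g where g: "\<And>m. trig_fun (g m)" "\<And>m z. norm z = 1 \<Longrightarrow> \<bar>f z - g m z\<bar> < inverse (real (Suc m))"
      by metis
    have lim: "(\<lambda>m. g m z) \<longlonglongrightarrow> f z" if "norm z = 1" for z
    proof (rule LIMSEQ_I)
      fix r :: real assume "r > 0"
      then obtain N where N: "inverse (real (Suc N)) < r" using reals_Archimedean by blast
      show "\<exists>N. \<forall>m\<ge>N. norm (g m z - f z) < r"
      proof (intro exI[of _ N] allI impI)
        fix m assume m: "m \<ge> N"
        have "inverse (real (Suc m)) \<le> inverse (real (Suc N))" using m by (intro le_imp_inverse_le) auto
        from less_trans[OF less_le_trans[OF g(2)[OF that, of m] this] N]
        show "norm (g m z - f z) < r" by (simp add: abs_minus_commute)
      qed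
    qed
    show ?thesis
      by (rule borel_measurable_LIMSEQ_real[where u = "\<lambda>m A. \<Sum>i<n. g m (cis (?t A i))"])
         (auto intro!: tendsto_sum lim trig g(1))
  qed
  have count: "(\<lambda>A. \<Sum>i<n. indicator {..a} (?t A i) :: real) \<in> borel_measurable M" for a
  proof -
    have "(\<lambda>A. \<Sum>i<n. indicator (cis ` {0..a}) (cis (?t A i)) :: real) \<in> borel_measurable M"
      by (rule borel_measurable_LIMSEQ_real[where u = "\<lambda>m A. \<Sum>i<n. bump (cis ` {0..a}) m (cis (?t A i))"])
         (auto intro!: tendsto_sum bump_tendsto closed_arc cont bump_continuous)
    moreover have "(\<Sum>i<n. indicator {..a} (?t A i) :: real) = (\<Sum>i<n. indicator (cis ` {0..a}) (cis (?t A i)))" if "A \<in> space M" for A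
      using eigenangles_unitary(2)[of A n] that by (intro sum.cong refl arc_indicator) auto
    ultimately show ?thesis by (subst measurable_cong)
  qed
  have iff: "?t A i \<le> a \<longleftrightarrow> real i < (\<Sum>i<n. indicator {..a} (?t A i))" if A: "A \<in> space M" for A a
  proof -
    have srt: "sorted (eigenangles A)" unfolding eigenangles_def by simp
    have len: "length (eigenangles A) = n" using eigenangles_unitary(1)[of A n] A by simp
    let ?J = "{..<n} \<inter> {j. ?t A j \<le> a}"
    have "(\<Sum>i<n. indicator {..a} (?t A i)) = (\<Sum>i<n. if ?t A i \<le> a then 1 else 0 :: real)"
      by (intro sum.cong) (auto simp: indicator_def)
    then have cd: "(\<Sum>i<n. indicator {..a} (?t A i)) = real (card ?J)"
      by (simp add: sum.If_cases)
    have mono: "?t A i \<le> ?t A j" if "i \<le> j" "j < n" for i j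
      using sorted_nth_mono[OF srt] that len by simp
    show ?thesis
    proof
      assume le: "?t A i \<le> a"
      have "{..i} \<subseteq> ?J"
      proof
        fix j assume "j \<in> {..i}"
        then show "j \<in> ?J" using i le mono[of j i] by simp
      qed
      then have "card {..i} \<le> card ?J" by (intro card_mono) auto
      then show "real i < (\<Sum>i<n. indicator {..a} (?t A i))" unfolding cd by simp
    next
      assume lt: "real i < (\<Sum>i<n. indicator {..a} (?t A i))"
      show "?t A i \<le> a"
      proof (rule ccontr)
        assume no: "\<not> ?t A i \<le> a"
        have "?J \<subseteq> {..<i}"
        proof
          fix j assume j: "j \<in> ?J"
          show "j \<in> {..<i}"
          proof (rule ccontr)
            assume "j \<notin> {..<i}"
            then show False using mono[of i j] j no by simp
          qed
        qed
        then have "card ?J \<le> card {..<i}" by (intro card_mono) auto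
        then show False using lt unfolding cd by simp
      qed
    qed
  qed
  show ?thesis
  proof (rule borel_measurable_iff_le[THEN iffD2], intro allI)
    fix a
    have "{A \<in> space M. ?t A i \<le> a} = {A \<in> space M. real i < (\<Sum>i<n. indicator {..a} (?t A i))}"
      using iff by blast
    also have "\<dots> \<in> sets M" using count[of a] by measurable
    finally show "{A \<in> space M. ?t A i \<le> a} \<in> sets M" .
  qed
qed

text \<open>One coordinate at a time: Fourier coefficients of \<open>X\<close> under a bounded complex weight.\<close>

lemma fourier_weighted:
  fixes X :: "'a \<Rightarrow> real" and W :: "'a \<Rightarrow> complex" and X' :: "'b \<Rightarrow> real" and W' :: "'b \<Rightarrow> complex"
  assumes fin: "finite_measure M" "finite_measure M'"
    and [measurable]: "X \<in> borel_measurable M" "W \<in> borel_measurable M" "X' \<in> borel_measurable M'" "W' \<in> borel_measurable M'"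
    and bdd: "\<And>x. norm (W x) \<le> 1" "\<And>x. norm (W' x) \<le> 1"
    and range: "AE x in M. X x \<in> {0..<2*pi}" "AE x in M'. X' x \<in> {0..<2*pi}"
    and fourier: "\<And>k :: int. (\<integral>x. cis (of_int k * X x) * W x \<partial>M) = (\<integral>x. cis (of_int k * X' x) * W' x \<partial>M')"
    and B: "B \<in> sets borel"
  shows "(\<integral>x. indicator B (X x) * W x \<partial>M) = (\<integral>x. indicator B (X' x) * W' x \<partial>M')"
proof -
  interpret M: finite_measure M by (rule fin)
  interpret M': finite_measure M' by (rule fin)
  have int: "integrable M (\<lambda>x. h (X x) * W x)" if [measurable]: "h \<in> borel_measurable borel" and "\<And>t. norm (h t) \<le> C" for h :: "real \<Rightarrow> complex" and C
  proof (rule M.integrable_const_bound[where B = C])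
    show "AE x in M. norm (h (X x) * W x) \<le> C"
      using mult_mono[OF that(2) bdd(1) order_trans[OF norm_ge_zero that(2)] norm_ge_zero] by (auto simp: norm_mult)
  qed measurable
  have int': "integrable M' (\<lambda>x. h (X' x) * W' x)" if [measurable]: "h \<in> borel_measurable borel" and "\<And>t. norm (h t) \<le> C" for h :: "real \<Rightarrow> complex" and C
  proof (rule M'.integrable_const_bound[where B = C])
    show "AE x in M'. norm (h (X' x) * W' x) \<le> C"
      using mult_mono[OF that(2) bdd(2) order_trans[OF norm_ge_zero that(2)] norm_ge_zero] by (auto simp: norm_mult)
  qed measurable
  \<comment> \<open>Equality of the two weighted integrals is extended through growing classes of
    test functions: trigonometric polynomials, continuous functions on the circle, arcs, and finally
    Borel sets by a generator stable under intersection.\<close>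
  define eqf where "eqf h \<longleftrightarrow> (\<integral>x. h (X x) * W x \<partial>M) = (\<integral>x. h (X' x) * W' x \<partial>M')" for h :: "real \<Rightarrow> complex"
  have lim: "eqf h" if h: "h \<in> borel_measurable borel" "\<And>m :: nat. u m \<in> borel_measurable borel" "\<And>m t. norm (u m t) \<le> C"
       "\<And>t. (\<lambda>m. u m t) \<longlonglongrightarrow> h t" "\<And>m. eqf (u m)" for h u and C :: real
  proof -
    note [measurable] = h(1,2)
    have b: "norm (u m (X x) * W x) \<le> C" "norm (u m (X' y) * W' y) \<le> C" for m x y
      using mult_mono[OF h(3) bdd(1) order_trans[OF norm_ge_zero h(3)] norm_ge_zero]
        mult_mono[OF h(3) bdd(2) order_trans[OF norm_ge_zero h(3)] norm_ge_zero] by (auto simp: norm_mult)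
    have 1: "(\<lambda>m. \<integral>x. u m (X x) * W x \<partial>M) \<longlonglongrightarrow> (\<integral>x. h (X x) * W x \<partial>M)"
      by (rule integral_dominated_convergence[where w = "\<lambda>_. C"]) (auto intro!: tendsto_intros h(4) b)
    have 2: "(\<lambda>m. \<integral>x. u m (X' x) * W' x \<partial>M') \<longlonglongrightarrow> (\<integral>x. h (X' x) * W' x \<partial>M')"
      by (rule integral_dominated_convergence[where w = "\<lambda>_. C"]) (auto intro!: tendsto_intros h(4) b)
    have "(\<lambda>m. \<integral>x. u m (X x) * W x \<partial>M) \<longlonglongrightarrow> (\<integral>x. h (X' x) * W' x \<partial>M')"
      using 2 h(5) unfolding eqf_def by simp
    then show ?thesis unfolding eqf_def using LIMSEQ_unique[OF 1] by blast
  qed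
  have trig: "eqf (\<lambda>t. complex_of_real (g (cis t)))" if "trig_fun g" for g
  proof -
    obtain K a where K: "finite K" "\<And>z. norm z = 1 \<Longrightarrow> complex_of_real (g z) = (\<Sum>k\<in>K. a k * z powi k)"
      using \<open>trig_fun g\<close> unfolding trig_fun_def by blast
    have eq: "(\<lambda>t. complex_of_real (g (cis t))) = (\<lambda>t. \<Sum>k\<in>K. a k * cis (of_int k * t))"
      using K(2) by (simp add: cis_power_int fun_eq_iff)
    have cm: "(\<lambda>t. cis (of_int k * t)) \<in> borel_measurable borel" for k :: int
      by (intro borel_measurable_continuous_onI continuous_intros)
    have i1: "integrable M (\<lambda>x. a k * (cis (of_int k * X x) * W x))" for k
      by (rule integrable_mult_right) (rule int[where C = 1 and h = "\<lambda>t. cis (of_int k * t)", OF cm], simp)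
    have i2: "integrable M' (\<lambda>x. a k * (cis (of_int k * X' x) * W' x))" for k
      by (rule integrable_mult_right) (rule int'[where C = 1 and h = "\<lambda>t. cis (of_int k * t)", OF cm], simp)
    have "(\<integral>x. (\<Sum>k\<in>K. a k * cis (of_int k * X x)) * W x \<partial>M) = (\<Sum>k\<in>K. a k * (\<integral>x. cis (of_int k * X x) * W x \<partial>M))"
      unfolding sum_distrib_right mult.assoc
      using i1 by (subst Bochner_Integration.integral_sum) auto
    moreover have "(\<integral>x. (\<Sum>k\<in>K. a k * cis (of_int k * X' x)) * W' x \<partial>M') = (\<Sum>k\<in>K. a k * (\<integral>x. cis (of_int k * X' x) * W' x \<partial>M'))"
      unfolding sum_distrib_right mult.assoc
      using i2 by (subst Bochner_Integration.integral_sum) auto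
    ultimately show ?thesis unfolding eqf_def fun_cong[OF eq] using fourier by simp
  qed
  have cis_meas: "(\<lambda>t. f (cis t)) \<in> borel_measurable borel" if "continuous_on (sphere 0 1) f" for f :: "complex \<Rightarrow> real"
    by (intro borel_measurable_continuous_onI continuous_on_compose2[OF that]) (auto intro!: continuous_intros)
  have trig_cont: "(\<lambda>t. complex_of_real (g (cis t))) \<in> borel_measurable borel" if "trig_fun g" for g
  proof -
    obtain K a where K: "finite K" "\<And>z. norm z = 1 \<Longrightarrow> complex_of_real (g z) = (\<Sum>k\<in>K. a k * z powi k)"
      using \<open>trig_fun g\<close> unfolding trig_fun_def by blast
    have "(\<lambda>t. complex_of_real (g (cis t))) = (\<lambda>t. \<Sum>k\<in>K. a k * cis (of_int k * t))"
      using K(2) by (simp add: cis_power_int fun_eq_iff)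
    then show ?thesis by (simp, intro borel_measurable_continuous_onI continuous_intros)
  qed
  have cont: "eqf (\<lambda>t. complex_of_real (f (cis t)))" if f: "continuous_on (sphere 0 1) f" and f1: "\<And>z. \<bar>f z\<bar> \<le> 1" for f
  proof -
    have "\<exists>g. trig_fun g \<and> (\<forall>z. norm z = 1 \<longrightarrow> \<bar>f z - g z\<bar> < inverse (real (Suc m)))" for m
      using trig_approx[OF f, of "inverse (real (Suc m))"] by (metis inverse_positive_iff_positive of_nat_0_less_iff zero_less_Suc)
    then obtain g where g: "\<And>m. trig_fun (g m)" "\<And>m z. norm z = 1 \<Longrightarrow> \<bar>f z - g m z\<bar> < inverse (real (Suc m))"
      by metis
    have inv1: "inverse (real (Suc m)) \<le> 1" for m by (simp add: field_simps)
    show ?thesis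
    proof (rule lim[where u = "\<lambda>m t. complex_of_real (g m (cis t))" and C = 2])
      show "norm (complex_of_real (g m (cis t))) \<le> 2" for m t
        using g(2)[of "cis t" m] f1[of "cis t"] inv1[of m] by (simp add: abs_if split: if_splits)
      show "(\<lambda>m. complex_of_real (g m (cis t))) \<longlonglongrightarrow> complex_of_real (f (cis t))" for t
      proof (intro tendsto_of_real LIMSEQ_I)
        fix r :: real assume "r > 0"
        then obtain N where N: "inverse (real (Suc N)) < r" using reals_Archimedean by blast
        show "\<exists>N. \<forall>m\<ge>N. norm (g m (cis t) - f (cis t)) < r"
        proof (intro exI[of _ N] allI impI)
          fix m assume m: "m \<ge> N"
          have "inverse (real (Suc m)) \<le> inverse (real (Suc N))" using m by (intro le_imp_inverse_le) auto
          from less_trans[OF less_le_trans[OF g(2)[where z = "cis t" and m = m, OF norm_cis] this] N]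
          show "norm (g m (cis t) - f (cis t)) < r" by (simp add: abs_minus_commute)
        qed
      qed
      show "(\<lambda>t. complex_of_real (f (cis t))) \<in> borel_measurable borel" using cis_meas[OF f] by simp
    qed (auto intro!: trig trig_cont g(1))
  qed
  have arc: "eqf (indicator {..a})" for a
  proof -
    have S: "eqf (\<lambda>t. indicator (cis ` {0..a}) (cis t))"
    proof (rule lim[where u = "\<lambda>m t. complex_of_real (bump (cis ` {0..a}) m (cis t))" and C = 1])
      have [measurable]: "cis \<in> borel_measurable borel" by (intro borel_measurable_continuous_onI continuous_intros)
      have [measurable]: "cis ` {0..a} \<in> sets borel" using closed_arc by simp
      show "(\<lambda>t. indicator (cis ` {0..a}) (cis t) :: complex) \<in> borel_measurable borel" by measurable
      show "(\<lambda>t. complex_of_real (bump (cis ` {0..a}) m (cis t))) \<in> borel_measurable borel" for m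
        using cis_meas[OF bump_continuous] by simp
      show "(\<lambda>m. complex_of_real (bump (cis ` {0..a}) m (cis t))) \<longlonglongrightarrow> indicator (cis ` {0..a}) (cis t)" for t
        using tendsto_of_real[OF bump_tendsto[OF closed_arc[of a], of "cis t"], where 'a = complex]
        by (cases "cis t \<in> cis ` {0..a}") simp_all
      show "eqf (\<lambda>t. complex_of_real (bump (cis ` {0..a}) m (cis t)))" for m
        by (rule cont) (auto simp: bump_bounds bump_continuous abs_of_nonneg)
    qed (auto simp: bump_bounds abs_of_nonneg)
    have [measurable]: "cis \<in> borel_measurable borel" by (intro borel_measurable_continuous_onI continuous_intros)
    have [measurable]: "cis ` {0..a} \<in> sets borel" using closed_arc by simp
    have "(\<integral>x. indicator {..a} (X x) * W x \<partial>M) = (\<integral>x. indicator (cis ` {0..a}) (cis (X x)) * W x \<partial>M)"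
      using range(1) by (intro integral_cong_AE) (auto simp: arc_indicator)
    moreover have "(\<integral>x. indicator {..a} (X' x) * W' x \<partial>M') = (\<integral>x. indicator (cis ` {0..a}) (cis (X' x)) * W' x \<partial>M')"
      using range(2) by (intro integral_cong_AE) (auto simp: arc_indicator)
    ultimately show ?thesis using S unfolding eqf_def by simp
  qed
  have one: "eqf (\<lambda>_. 1)" using fourier[of 0] unfolding eqf_def by simp
  have ind1: "norm (indicator A t :: complex) \<le> 1" for A and t :: real by (simp add: indicator_def)
  have meas_ind: "(indicator A :: real \<Rightarrow> complex) \<in> borel_measurable borel" if "A \<in> sets borel" for A using that by measurable
  have "Int_stable (range (atMost :: real \<Rightarrow> real set))"
  proof (rule Int_stableI)
    fix S T :: "real set" assume "S \<in> range atMost" "T \<in> range atMost"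
    then obtain a b where "S = {..a}" "T = {..b}" by auto
    then have "S \<inter> T = {..min a b}" by auto
    then show "S \<inter> T \<in> range atMost" by simp
  qed
  moreover have "range (atMost :: real \<Rightarrow> real set) \<subseteq> Pow UNIV" by simp
  moreover have "B \<in> sigma_sets UNIV (range atMost)" using B unfolding borel_eq_atMost by (simp add: sets_measure_of)
  ultimately have "eqf (indicator B)"
  proof (induction rule: sigma_sets_induct_disjoint)
    case (compl A)
    have A: "A \<in> sets borel" using compl unfolding borel_eq_atMost by (simp add: sets_measure_of)
    have e: "indicator (UNIV - A) = (\<lambda>t. 1 - indicator A t :: complex)" by (auto simp: indicator_def fun_eq_iff)
    have "(\<integral>x. (1 - indicator A (X x)) * W x \<partial>M) = (\<integral>x. 1 * W x \<partial>M) - (\<integral>x. indicator A (X x) * W x \<partial>M)"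
      unfolding left_diff_distrib
      by (rule Bochner_Integration.integral_diff) (rule int[where C = 1 and h = "\<lambda>_. 1"] int[where C = 1], auto simp: meas_ind A ind1)+
    moreover have "(\<integral>x. (1 - indicator A (X' x)) * W' x \<partial>M') = (\<integral>x. 1 * W' x \<partial>M') - (\<integral>x. indicator A (X' x) * W' x \<partial>M')"
      unfolding left_diff_distrib
      by (rule Bochner_Integration.integral_diff) (rule int'[where C = 1 and h = "\<lambda>_. 1"] int'[where C = 1], auto simp: meas_ind A ind1)+
    ultimately show ?case using compl one unfolding eqf_def e by simp
  next
    case (union F)
    have F: "F i \<in> sets borel" for i using union(2) unfolding borel_eq_atMost by (simp add: sets_measure_of subset_eq)
    have fs: "indicator (\<Union>i<m. F i) = (\<lambda>t. \<Sum>i<m. indicator (F i) t :: complex)" for m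
      using union(1) by (intro ext indicator_UN_disjoint) (auto simp: disjoint_family_on_def)
    show ?case
    proof (rule lim[where u = "\<lambda>m. indicator (\<Union>i<m. F i)" and C = 1])
      show "eqf (indicator (\<Union>i<m. F i))" for m
      proof -
        have "(\<integral>x. (\<Sum>i<m. indicator (F i) (X x)) * W x \<partial>M) = (\<Sum>i<m. \<integral>x. indicator (F i) (X x) * W x \<partial>M)"
          unfolding sum_distrib_right
          by (rule Bochner_Integration.integral_sum) (rule int[where C = 1], auto simp: meas_ind F ind1)
        moreover have "(\<integral>x. (\<Sum>i<m. indicator (F i) (X' x)) * W' x \<partial>M') = (\<Sum>i<m. \<integral>x. indicator (F i) (X' x) * W' x \<partial>M')"
          unfolding sum_distrib_right
          by (rule Bochner_Integration.integral_sum) (rule int'[where C = 1], auto simp: meas_ind F ind1)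
        ultimately show ?thesis using union(3) unfolding eqf_def fs by simp
      qed
      show "(\<lambda>m. indicator (\<Union>i<m. F i) t) \<longlonglongrightarrow> (indicator (\<Union> (range F)) t :: complex)" for t
        by (rule LIMSEQ_indicator_UN)
    qed (auto simp: F ind1 intro!: meas_ind sets.countable_UN)
  next
    case empty
    show ?case by (simp add: eqf_def)
  next
    case (basic A)
    then show ?case using arc by auto
  qed
  then show ?thesis unfolding eqf_def .
qed

text \<open>The coordinates are converted from characters to indicators one at a time; in each step
  all other coordinates, converted or not, form the bounded weight of
  \<open>fourier_weighted\<close>.\<close>

lemma fourier_determines_PiM:
  fixes N N' :: "(nat \<Rightarrow> real) measure"
  assumes fin: "finite_measure N" "finite_measure N'"
    and sets [measurable_cong]: "sets N = sets (PiM {..<n} (\<lambda>_. borel))" "sets N' = sets (PiM {..<n} (\<lambda>_. borel))"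
    and range: "AE x in N. \<forall>i<n. x i \<in> {0..<2*pi}" "AE x in N'. \<forall>i<n. x i \<in> {0..<2*pi}"
    and fourier: "\<And>\<kappa> :: nat \<Rightarrow> int. (\<integral>x. (\<Prod>i<n. cis (of_int (\<kappa> i) * x i)) \<partial>N) = (\<integral>x. (\<Prod>i<n. cis (of_int (\<kappa> i) * x i)) \<partial>N')"
  shows "N = N'"
proof -
  interpret N: finite_measure N by (rule fin)
  interpret N': finite_measure N' by (rule fin)
  have [measurable]: "cis \<in> borel_measurable borel" by (intro borel_measurable_continuous_onI continuous_intros)
  have step: "(\<integral>x. (\<Prod>i<n. if i < m then indicator (B i) (x i) else cis (of_int (\<kappa> i) * x i)) \<partial>N)
     = (\<integral>x. (\<Prod>i<n. if i < m then indicator (B i) (x i) else cis (of_int (\<kappa> i) * x i)) \<partial>N')"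
    if "m \<le> n" "\<And>i. i < m \<Longrightarrow> B i \<in> sets borel" for m B and \<kappa> :: "nat \<Rightarrow> int"
    using that
  proof (induction m arbitrary: \<kappa>)
    case 0 then show ?case using fourier by simp
  next
    case (Suc m)
    have m: "m < n" using Suc by simp
    define W where "W x = (\<Prod>i\<in>{..<n} - {m}. if i < m then indicator (B i) (x i) else cis (of_int (\<kappa> i) * x i))" for x :: "nat \<Rightarrow> real"
    have [measurable]: "i < m \<Longrightarrow> B i \<in> sets borel" for i using Suc by simp
    have Wm [measurable]: "W \<in> borel_measurable (PiM {..<n} (\<lambda>_. borel))" unfolding W_def
    proof (rule borel_measurable_prod)
      fix i assume "i \<in> {..<n} - {m}"
      then have [measurable]: "i \<in> {..<n}" by simp
      show "(\<lambda>x. if i < m then indicator (B i) (x i) else cis (of_int (\<kappa> i) * x i)) \<in> borel_measurable (PiM {..<n} (\<lambda>_. borel))"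
        by (cases "i < m") simp_all
    qed
    have spl: "(\<Prod>i<n. f i) = f m * (\<Prod>i\<in>{..<n} - {m}. f i)" for f :: "nat \<Rightarrow> complex"
      using m by (simp add: prod.remove)
    have b: "norm (W x) \<le> 1" for x unfolding W_def prod_norm[symmetric]
      by (intro prod_le_1) (auto simp: indicator_def)
    have "(\<integral>x. indicator (B m) (x m) * W x \<partial>N) = (\<integral>x. indicator (B m) (x m) * W x \<partial>N')"
    proof (rule fourier_weighted[OF fin])
      fix k :: int
      have "(\<lambda>x. \<Prod>i<n. if i < m then indicator (B i) (x i) else cis (of_int ((\<kappa>(m := k)) i) * x i))
          = (\<lambda>x. cis (of_int k * x m) * W x)"
        unfolding spl W_def by (intro ext arg_cong2[where f = "(*)"] prod.cong refl) auto
      then show "(\<integral>x. cis (of_int k * x m) * W x \<partial>N) = (\<integral>x. cis (of_int k * x m) * W x \<partial>N')"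
        using Suc.IH[of "\<kappa>(m := k)"] Suc.prems by simp
    next
      have [measurable]: "m \<in> {..<n}" using m by simp
      show "(\<lambda>x. x m) \<in> borel_measurable N" "(\<lambda>x. x m) \<in> borel_measurable N'" by measurable
      show "W \<in> borel_measurable N" "W \<in> borel_measurable N'" by measurable
    qed (use b m Suc.prems range in auto)
    moreover have "(\<lambda>x. \<Prod>i<n. if i < Suc m then indicator (B i) (x i) else cis (of_int (\<kappa> i) * x i))
        = (\<lambda>x. indicator (B m) (x m) * W x)"
      unfolding spl W_def by (intro ext arg_cong2[where f = "(*)"] prod.cong refl) auto
    ultimately show ?case by simp
  qed
  show ?thesis
  proof (rule measure_eqI_PiM_finite[where A = "\<lambda>_. PiE {..<n} (\<lambda>_. UNIV)", OF _ sets])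
    fix B :: "nat \<Rightarrow> real set" assume B: "\<And>i. i \<in> {..<n} \<Longrightarrow> B i \<in> sets borel"
    have BE: "PiE {..<n} B \<in> sets (PiM {..<n} (\<lambda>_. borel))" using B by (intro sets_PiM_I_finite) auto
    have ind: "(\<Prod>i<n. if i < n then indicator (B i) (x i) else cis (of_int 0 * x i)) = complex_of_real (indicator (PiE {..<n} B) x)"
      if x: "x \<in> space (PiM {..<n} (\<lambda>_. borel))" for x
    proof (cases "x \<in> PiE {..<n} B")
      case True
      then have "(\<Prod>i<n. if i < n then indicator (B i) (x i) else cis (of_int 0 * x i)) = 1"
        by (intro prod.neutral ballI) (simp add: PiE_iff)
      then show ?thesis using True by simp
    next
      case False
      then obtain i where "i < n" "x i \<notin> B i" using x by (auto simp: space_PiM PiE_iff)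
      then have "(\<Prod>i<n. if i < n then indicator (B i) (x i) else cis (of_int 0 * x i)) = 0"
        by (intro prod_zero bexI[of _ i]) auto
      then show ?thesis using False by simp
    qed
    have "(\<integral>x. complex_of_real (indicator (PiE {..<n} B) x) \<partial>N) = (\<integral>x. (\<Prod>i<n. if i < n then indicator (B i) (x i) else cis (of_int 0 * x i)) \<partial>N)"
      using ind sets_eq_imp_space_eq[OF sets(1)] by (intro Bochner_Integration.integral_cong) auto
    also have "\<dots> = (\<integral>x. (\<Prod>i<n. if i < n then indicator (B i) (x i) else cis (of_int 0 * x i)) \<partial>N')"
      using step[of n B "\<lambda>_. 0"] B by simp
    also have "\<dots> = (\<integral>x. complex_of_real (indicator (PiE {..<n} B) x) \<partial>N')"
      using ind sets_eq_imp_space_eq[OF sets(2)] by (intro Bochner_Integration.integral_cong) auto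
    finally have "measure N (PiE {..<n} B) = measure N' (PiE {..<n} B)"
      using BE sets by (simp add: integral_complex_of_real)
    then show "emeasure N (PiE {..<n} B) = emeasure N' (PiE {..<n} B)"
      by (simp add: N.emeasure_eq_measure N'.emeasure_eq_measure)
  next
    show "range (\<lambda>_ :: nat. PiE {..<n} (\<lambda>_. UNIV)) \<subseteq> prod_algebra {..<n} (\<lambda>_. borel :: real measure)"
      by (auto intro!: prod_algebraI_finite)
  qed (auto simp: space_PiM)
qed

section \<open>The Dunkl equation for the symmetrized eigenangles\<close>

lemma mono_z_measurable:
  assumes "\<And>i. i < n \<Longrightarrow> (\<lambda>A. t A i) \<in> borel_measurable M"
  shows "(\<lambda>A. mono_z n (\<lambda>i. cis (t A i)) \<kappa>) \<in> borel_measurable M"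
proof -
  have c: "(\<lambda>x. cis (of_int k * x)) \<in> borel_measurable borel" for k :: int
    by (intro borel_measurable_continuous_onI continuous_intros)
  show ?thesis unfolding mono_z_def cis_power_int
    by (intro borel_measurable_prod measurable_compose[OF _ c] assms) auto
qed

lemma norm_mono_z: "norm (mono_z n (\<lambda>i. cis (t i)) \<kappa>) = 1"
  unfolding mono_z_def prod_norm[symmetric] by (intro prod.neutral ballI) (simp add: cis_power_int)

lemma mono_z_cnj: "mono_z n (\<lambda>i. cis (t i)) (\<lambda>i. - \<kappa> i) = cnj (mono_z n (\<lambda>i. cis (t i)) \<kappa>)"
  unfolding mono_z_def cnj_prod by (intro prod.cong refl) (simp add: cis_power_int cis_cnj)

lemma integrable_isum:
  assumes "\<And>l. integrable M (f l)"
  shows "integrable M (\<lambda>x. isum k (\<lambda>l. f l x))" "(\<integral>x. isum k (\<lambda>l. f l x) \<partial>M) = isum k (\<lambda>l. \<integral>x. f l x \<partial>M)"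
  unfolding isum_def using assms
  by (auto simp: Bochner_Integration.integral_diff Bochner_Integration.integral_sum)

lemma integral_dunkl:
  assumes "\<And>\<kappa>. integrable M (\<lambda>x. f x \<kappa>)"
  shows "integrable M (\<lambda>x. dunkl n (f x) \<kappa>)" "(\<integral>x. dunkl n (f x) \<kappa> \<partial>M) = dunkl n (\<lambda>\<kappa>. \<integral>x. f x \<kappa> \<partial>M) \<kappa>"
proof -
  have i: "integrable M (\<lambda>x. \<Sum>b\<in>{..<n} - {0}. isum (\<kappa> 0 - \<kappa> b) (\<lambda>l. f x (\<kappa>(0 := \<kappa> 0 - l, b := \<kappa> b + l))))"
    by (intro Bochner_Integration.integrable_sum integrable_isum assms)
  show "integrable M (\<lambda>x. dunkl n (f x) \<kappa>)"
    unfolding dunkl_def by (intro Bochner_Integration.integrable_add integrable_mult_right assms i)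
  show "(\<integral>x. dunkl n (f x) \<kappa> \<partial>M) = dunkl n (\<lambda>\<kappa>. \<integral>x. f x \<kappa> \<partial>M) \<kappa>"
    unfolding dunkl_def
    by (subst Bochner_Integration.integral_add[OF integrable_mult_right[OF assms] i],
        subst Bochner_Integration.integral_sum[OF integrable_isum(1)[OF assms]])
       (simp add: integrable_isum(2)[OF assms])
qed

lemma integral_ssum:
  assumes "\<And>\<kappa>. integrable M (\<lambda>x. f x \<kappa>)"
  shows "integrable M (\<lambda>x. ssum n (f x) \<kappa> js) \<and> (\<integral>x. ssum n (f x) \<kappa> js \<partial>M) = ssum n (\<lambda>\<kappa>. \<integral>x. f x \<kappa> \<partial>M) \<kappa> js"
proof (induction js arbitrary: \<kappa>)
  case (Cons j js)
  have i: "integrable M (\<lambda>x. ssum n (f x) (\<kappa>(i := \<kappa> i + j)) js)" for i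
    using Cons by blast
  have "(\<integral>x. (\<Sum>i<n. ssum n (f x) (\<kappa>(i := \<kappa> i + j)) js) \<partial>M) = (\<Sum>i<n. \<integral>x. ssum n (f x) (\<kappa>(i := \<kappa> i + j)) js \<partial>M)"
    by (rule Bochner_Integration.integral_sum) (rule i)
  also have "\<dots> = (\<Sum>i<n. ssum n (\<lambda>\<kappa>. \<integral>x. f x \<kappa> \<partial>M) (\<kappa>(i := \<kappa> i + j)) js)"
    by (intro sum.cong refl conjunct2[OF Cons])
  finally show ?case unfolding ssum.simps using i by (intro conjI Bochner_Integration.integrable_sum) simp_all
qed (use assms in auto)

lemma dunkl_sum: "dunkl n (\<lambda>\<kappa>. \<Sum>s\<in>S. f s \<kappa>) \<kappa> = (\<Sum>s\<in>S. dunkl n (f s) \<kappa>)"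
  unfolding dunkl_def sum.distrib isum_sum by (subst sum.swap) (simp add: sum_distrib_left)

lemma dunkl_diff_cmult: "dunkl n (\<lambda>\<kappa>. a * f \<kappa> - b * g \<kappa>) \<kappa> = a * dunkl n f \<kappa> - b * dunkl n g \<kappa>"
proof -
  have lin: "isum k (\<lambda>l. a * u l - b * v l) = a * isum k u - b * isum k v" for k u v
    unfolding isum_def by (simp add: sum_subtractf sum_distrib_left algebra_simps)
  show ?thesis unfolding dunkl_def lin by (simp add: sum_subtractf sum_distrib_left algebra_simps)
qed

text \<open>Under a uniformly random permutation the image of 0 is uniform on
  \<open>{..<n}\<close>.\<close>

lemma sum_permutes_point:
  fixes H :: "nat \<Rightarrow> complex"
  assumes n: "0 < n"
  shows "of_nat n * (\<Sum>\<sigma> | \<sigma> permutes {..<n}. H (\<sigma> 0)) = fact n * (\<Sum>i<n. H i)"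
proof -
  have eq: "(\<Sum>\<sigma> | \<sigma> permutes {..<n}. H (\<sigma> i)) = (\<Sum>\<sigma> | \<sigma> permutes {..<n}. H (\<sigma> 0))" if "i < n" for i
  proof -
    have t: "Transposition.transpose 0 i permutes {..<n}" using n that by (intro permutes_swap_id) auto
    have "(\<Sum>\<sigma> | \<sigma> permutes {..<n}. H (\<sigma> 0)) = (\<Sum>\<sigma> | \<sigma> permutes {..<n}. H ((\<sigma> \<circ> Transposition.transpose 0 i) 0))"
      using sum_permutations_compose_right[OF t, of "\<lambda>\<sigma>. H (\<sigma> 0)"] by simp
    then show ?thesis by simp
  qed
  have "of_nat n * (\<Sum>\<sigma> | \<sigma> permutes {..<n}. H (\<sigma> 0)) = (\<Sum>i<n. \<Sum>\<sigma> | \<sigma> permutes {..<n}. H (\<sigma> i))"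
  proof -
    have "(\<Sum>i<n. \<Sum>\<sigma> | \<sigma> permutes {..<n}. H (\<sigma> i)) = (\<Sum>i<n. \<Sum>\<sigma> | \<sigma> permutes {..<n}. H (\<sigma> 0))"
      by (intro sum.cong[OF refl] eq) auto
    then show ?thesis by simp
  qed
  also have "\<dots> = (\<Sum>\<sigma> | \<sigma> permutes {..<n}. \<Sum>i<n. H (\<sigma> i))" by (rule sum.swap)
  also have "\<dots> = (\<Sum>\<sigma> | \<sigma> permutes {..<n}. \<Sum>i<n. H i)"
  proof (rule sum.cong[OF refl])
    fix \<sigma> assume "\<sigma> \<in> {\<sigma>. \<sigma> permutes {..<n}}"
    then have "bij_betw \<sigma> {..<n} {..<n}" by (auto intro: permutes_imp_bij)
    then show "(\<Sum>i<n. H (\<sigma> i)) = (\<Sum>i<n. H i)" by (rule sum.reindex_bij_betw)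
  qed
  also have "\<dots> = fact n * (\<Sum>i<n. H i)"
    using card_permutations[of "{..<n}" n] by simp
  finally show ?thesis .
qed

lemma merge_sum_dpsum: "(\<Sum>i<n. z i powi k * dpsum n z i js) = merge_sum (psum n z) k js"
  if "\<And>i. i < n \<Longrightarrow> z i \<noteq> 0"
proof (induction js)
  case (Cons j js)
  have "(\<Sum>i<n. z i powi k * dpsum n z i (j # js))
     = (\<Sum>i<n. of_int j * (\<Prod>j\<leftarrow>js. psum n z j) * z i powi (k + j) + psum n z j * (z i powi k * dpsum n z i js))"
    using that by (intro sum.cong refl) (simp add: power_int_add algebra_simps)
  also have "\<dots> = merge_sum (psum n z) k (j # js)"
    unfolding sum.distrib sum_distrib_left[symmetric] Cons by (simp add: psum_def algebra_simps)
  finally show ?case .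
qed simp

text \<open>Summing over permutations lets every variable play the part of variable 0 equally often,
  and the integrand of the loop equation appears. The exchange terms lack the diagonal
  \<open>b = i\<close> of the double sum; the Euler term supplies it, because
  \<open>tsym x x k 0\<close> is \<open>k\<close> times \<open>x powi k\<close>.\<close>

lemma ssum_dunkl_symmetrized:
  assumes z: "\<And>i. i < n \<Longrightarrow> z i \<noteq> 0" and n: "0 < n"
  shows "of_nat n * ssum n (dunkl n (\<lambda>\<kappa>. \<Sum>\<sigma> | \<sigma> permutes {..<n}. mono_z n (\<lambda>i. z (\<sigma> i)) \<kappa>)) ((\<lambda>_. 0)(0 := k)) js
    = fact n * (isum k (\<lambda>l. psum n z l * psum n z (k - l)) * (\<Prod>j\<leftarrow>js. psum n z j) + merge_sum (psum n z) k js)"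
proof -
  define p where "p = (\<Prod>j\<leftarrow>js. psum n z j)"
  define H where "H i = (of_int k * z i powi k + (\<Sum>b\<in>{..<n} - {i}. tsym (z i) (z b) k 0)) * p + z i powi k * dpsum n z i js" for i
  have one: "ssum n (dunkl n (mono_z n (\<lambda>i. z (\<sigma> i)))) ((\<lambda>_. 0)(0 := k)) js = H (\<sigma> 0)"
    if s: "\<sigma> \<in> {\<sigma>. \<sigma> permutes {..<n}}" for \<sigma>
  proof -
    have s: "\<sigma> permutes {..<n}" using s by simp
    have bij: "bij_betw \<sigma> {..<n} {..<n}" using s by (rule permutes_imp_bij)
    have ps: "psum n (\<lambda>i. z (\<sigma> i)) j = psum n z j" for j
      unfolding psum_def using sum.reindex_bij_betw[OF bij, of "\<lambda>i. z i powi j"] .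
    have dps: "dpsum n (\<lambda>i. z (\<sigma> i)) 0 js = dpsum n z (\<sigma> 0) js" for js
    proof -
      have "psum n (\<lambda>i. z (\<sigma> i)) = psum n z" by (rule ext) (rule ps)
      then show ?thesis by (induction js) simp_all
    qed
    have z': "z (\<sigma> i) \<noteq> 0" if "i < n" for i using z permutes_in_image[OF s, of i] that by auto
    have bij0: "bij_betw \<sigma> ({..<n} - {0}) ({..<n} - {\<sigma> 0})"
      unfolding bij_betw_def
      using image_set_diff[OF permutes_inj[OF s], of "{..<n}" "{0}"] permutes_image[OF s] inj_on_subset[OF permutes_inj[OF s]]
      by simp
    have "(\<Sum>b\<in>{..<n} - {0}. tsym (z (\<sigma> 0)) (z (\<sigma> b)) k 0) = (\<Sum>b\<in>{..<n} - {\<sigma> 0}. tsym (z (\<sigma> 0)) (z b) k 0)"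
      by (rule sum.reindex_bij_betw[OF bij0])
    then show ?thesis
      using ssum_dunkl_mono[of n "\<lambda>i. z (\<sigma> i)" k js] z' n by (simp add: H_def ps dps p_def)
  qed
  have "of_nat n * ssum n (dunkl n (\<lambda>\<kappa>. \<Sum>\<sigma> | \<sigma> permutes {..<n}. mono_z n (\<lambda>i. z (\<sigma> i)) \<kappa>)) ((\<lambda>_. 0)(0 := k)) js
     = of_nat n * (\<Sum>\<sigma> | \<sigma> permutes {..<n}. H (\<sigma> 0))"
    unfolding dunkl_sum ssum_sum by (intro arg_cong2[where f = "(*)"] refl sum.cong one)
  also have "\<dots> = fact n * (\<Sum>i<n. H i)" by (rule sum_permutes_point[OF n])
  also have "(\<Sum>i<n. H i) = (\<Sum>i<n. \<Sum>b<n. tsym (z i) (z b) k 0) * p + (\<Sum>i<n. z i powi k * dpsum n z i js)"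
  proof -
    have row: "of_int k * z i powi k + (\<Sum>b\<in>{..<n} - {i}. tsym (z i) (z b) k 0) = (\<Sum>b<n. tsym (z i) (z b) k 0)"
      if "i < n" for i
      using that z[OF that] by (subst sum.remove[of "{..<n}" i]) (auto simp: tsym_same)
    have "(\<Sum>i<n. H i) = (\<Sum>i<n. (\<Sum>b<n. tsym (z i) (z b) k 0) * p + z i powi k * dpsum n z i js)"
      unfolding H_def by (intro sum.cong refl) (simp add: row)
    then show ?thesis by (simp add: sum.distrib sum_distrib_right)
  qed
  also have "(\<Sum>i<n. \<Sum>b<n. tsym (z i) (z b) k 0) = isum k (\<lambda>l. psum n z l * psum n z (k - l))"
  proof -
    have "(\<Sum>i<n. \<Sum>b<n. tsym (z i) (z b) k 0) = isum k (\<lambda>l. \<Sum>i<n. \<Sum>b<n. z i powi (k - l) * z b powi l)"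
      unfolding tsym_def by (simp add: isum_sum)
    also have "\<dots> = isum k (\<lambda>l. psum n z l * psum n z (k - l))"
    proof -
      have "(\<Sum>i<n. \<Sum>b<n. z i powi (k - l) * z b powi l) = psum n z l * psum n z (k - l)" for l
        by (subst mult.commute) (simp add: psum_def sum_product)
      then show ?thesis by simp
    qed
    finally show ?thesis .
  qed
  also have "(\<Sum>i<n. z i powi k * dpsum n z i js) = merge_sum (psum n z) k js" by (rule merge_sum_dpsum[OF z])
  finally show ?thesis by (simp only: p_def)
qed

context haar_unitary
begin

text \<open>Up to the factor \<open>fact n\<close>, the Fourier coefficients of the eigenangles in
  uniformly random order, as \<open>fourier_sym_law\<close> shows.\<close>

definition sym_coeff :: "(nat \<Rightarrow> int) \<Rightarrow> complex" where
  "sym_coeff \<kappa> = (\<integral>A. (\<Sum>\<sigma> | \<sigma> permutes {..<n}. mono_z n (\<lambda>i. cis (eigenangles A ! \<sigma> i)) \<kappa>) \<partial>M)"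

lemma integrable_mono_z:
  assumes "\<sigma> permutes {..<n}"
  shows "integrable M (\<lambda>A. mono_z n (\<lambda>i. cis (eigenangles A ! \<sigma> i)) \<kappa>)"
proof (rule integrable_const_bound[where B = 1])
  show "(\<lambda>A. mono_z n (\<lambda>i. cis (eigenangles A ! \<sigma> i)) \<kappa>) \<in> borel_measurable M"
    using permutes_in_image[OF assms] by (intro mono_z_measurable eigenangle_measurable) auto
qed (simp add: norm_mono_z)

lemma psum_eigenangles:
  "A \<in> unitary_group n \<Longrightarrow> psum n (\<lambda>i. cis (eigenangles A ! i)) k = mtr n A k"
  by (simp add: psum_def cis_power_int eigenangles_unitary(3))

lemma dunkl_sym_sym_coeff: "0 < n \<Longrightarrow> dunkl_sym n sym_coeff"
proof
  fix \<kappa> i j assume ij: "i < n" "j < n"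
  let ?t = "Transposition.transpose i j"
  have t: "?t permutes {..<n}" using ij by (intro permutes_swap_id) auto
  have bij: "bij_betw ?t {..<n} {..<n}" using t by (rule permutes_imp_bij)
  have sw: "(\<Sum>\<sigma> | \<sigma> permutes {..<n}. mono_z n (\<lambda>i. w (\<sigma> i)) (\<kappa> \<circ> ?t)) = (\<Sum>\<sigma> | \<sigma> permutes {..<n}. mono_z n (\<lambda>i. w (\<sigma> i)) \<kappa>)"
    for w :: "nat \<Rightarrow> complex"
  proof -
    have "mono_z n (\<lambda>i. w (\<sigma> i)) (\<kappa> \<circ> ?t) = mono_z n (\<lambda>i. w ((\<sigma> \<circ> ?t) i)) \<kappa>" for \<sigma>
      using prod.reindex_bij_betw[OF bij, of "\<lambda>i. w (\<sigma> (?t i)) powi \<kappa> i"] by (simp add: mono_z_def)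
    then have "(\<Sum>\<sigma> | \<sigma> permutes {..<n}. mono_z n (\<lambda>i. w (\<sigma> i)) (\<kappa> \<circ> ?t))
      = (\<Sum>\<sigma> | \<sigma> permutes {..<n}. mono_z n (\<lambda>i. w ((\<sigma> \<circ> ?t) i)) \<kappa>)" by simp
    also have "\<dots> = (\<Sum>\<sigma> | \<sigma> permutes {..<n}. mono_z n (\<lambda>i. w (\<sigma> i)) \<kappa>)"
      by (rule sum_permutations_compose_right[OF t, symmetric, of "\<lambda>\<sigma>. mono_z n (\<lambda>i. w (\<sigma> i)) \<kappa>"])
    finally show ?thesis .
  qed
  show "sym_coeff (\<kappa> \<circ> ?t) = sym_coeff \<kappa>" unfolding sym_coeff_def
    by (rule Bochner_Integration.integral_cong[OF refl]) (rule sw[of "\<lambda>j. cis (eigenangles A ! j)" for A])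
qed

text \<open>Integration commutes with the finite sums in \<open>dunkl\<close> and
  \<open>ssum\<close>, so the hypothesis of \<open>dunkl_eq_0\<close> about powers of one variable
  becomes the loop equation.\<close>

lemma dunkl_sym_coeff:
  assumes n: "0 < n" and "\<And>i. i \<ge> n \<Longrightarrow> \<kappa> i = 0"
  shows "dunkl n sym_coeff \<kappa> = 0"
proof (rule dunkl_sym.dunkl_eq_0[OF dunkl_sym_sym_coeff[OF n]])
  fix k js
  define F where "F A \<kappa> = (\<Sum>\<sigma> | \<sigma> permutes {..<n}. mono_z n (\<lambda>i. cis (eigenangles A ! \<sigma> i)) \<kappa>)" for A \<kappa>
  have Fi: "integrable M (\<lambda>A. F A \<kappa>)" for \<kappa>
    unfolding F_def by (intro Bochner_Integration.integrable_sum integrable_mono_z) auto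
  have "of_nat n * ssum n (dunkl n sym_coeff) ((\<lambda>_. 0)(0 := k)) js
     = (\<integral>A. of_nat n * ssum n (dunkl n (F A)) ((\<lambda>_. 0)(0 := k)) js \<partial>M)"
  proof -
    have "sym_coeff = (\<lambda>\<kappa>. \<integral>A. F A \<kappa> \<partial>M)" by (simp add: sym_coeff_def F_def fun_eq_iff)
    then have "dunkl n sym_coeff = (\<lambda>\<kappa>. \<integral>A. dunkl n (F A) \<kappa> \<partial>M)"
      by (intro ext) (simp only: integral_dunkl(2)[OF Fi])
    then show ?thesis
      by (simp only: conjunct2[OF integral_ssum[OF integral_dunkl(1)[OF Fi]], symmetric] integral_mult_right_zero)
  qed
  also have "\<dots> = (\<integral>A. fact n * (isum k (\<lambda>l. mtr n A l * mtr n A (k - l)) * (\<Prod>j\<leftarrow>js. mtr n A j) + merge_sum (mtr n A) k js) \<partial>M)"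
  proof (intro Bochner_Integration.integral_cong refl)
    fix A assume "A \<in> space M"
    then have A: "A \<in> unitary_group n" by simp
    have "psum n (\<lambda>i. cis (eigenangles A ! i)) = mtr n A" using psum_eigenangles[OF A] by (simp add: fun_eq_iff)
    then show "of_nat n * ssum n (dunkl n (F A)) ((\<lambda>_. 0)(0 := k)) js
      = fact n * (isum k (\<lambda>l. mtr n A l * mtr n A (k - l)) * (\<Prod>j\<leftarrow>js. mtr n A j) + merge_sum (mtr n A) k js)"
      using ssum_dunkl_symmetrized[of n "\<lambda>i. cis (eigenangles A ! i)" k js] n unfolding F_def by simp
  qed
  also have "\<dots> = 0" using loop_equation[of k js] by simp
  finally show "ssum n (dunkl n sym_coeff) ((\<lambda>_. 0)(0 := k)) js = 0" using n by simp
qed (fact assms(2))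

lemma sym_coeff_cnj: "sym_coeff (\<lambda>i. - \<kappa> i) = cnj (sym_coeff \<kappa>)"
proof -
  have "cnj (sym_coeff \<kappa>) = (\<integral>A. cnj (\<Sum>\<sigma> | \<sigma> permutes {..<n}. mono_z n (\<lambda>i. cis (eigenangles A ! \<sigma> i)) \<kappa>) \<partial>M)"
    unfolding sym_coeff_def by (rule Bochner_Integration.integral_cnj[symmetric])
  then show ?thesis unfolding sym_coeff_def cnj_sum mono_z_cnj[symmetric] by simp
qed

lemma sym_coeff_0: "sym_coeff (\<lambda>_. 0) = fact n"
  using card_permutations[of "{..<n}" n] by (simp add: sym_coeff_def mono_z_def)

end

section \<open>The determinantal correlation functions\<close>

text \<open>A measure on all reals with total mass \<open>2 * pi\<close>, so that products of it
  live on the Borel sets of real vectors.\<close>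

definition circ :: "real measure" where
  "circ = density lborel (\<lambda>x. ennreal (indicator {0..<2 * pi} x))"

lemma sets_circ [measurable_cong, simp]: "sets circ = sets borel"
  by (simp add: circ_def)

lemma space_circ [simp]: "space circ = UNIV"
  by (simp add: circ_def)

lemma emeasure_circ: "B \<in> sets borel \<Longrightarrow> emeasure circ B = emeasure lborel (B \<inter> {0..<2 * pi})"
  unfolding circ_def by (subst emeasure_density) (auto simp: nn_integral_indicator[symmetric] indicator_inter_arith mult.commute ennreal_indicator intro!: nn_integral_cong)

lemma emeasure_circ_UNIV: "emeasure circ UNIV = ennreal (2 * pi)"
  by (simp add: emeasure_circ)

interpretation circ: finite_measure circ
  by standard (simp add: emeasure_circ_UNIV)

interpretation circ_prod: product_sigma_finite "\<lambda>_ :: nat. circ"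
  by standard

lemma integral_circ:
  fixes f :: "real \<Rightarrow> 'a :: {banach, second_countable_topology}"
  assumes [measurable]: "f \<in> borel_measurable borel"
  shows "(\<integral>x. f x \<partial>circ) = (\<integral>x. indicator {0..2 * pi} x *\<^sub>R f x \<partial>lborel)"
proof -
  have "(\<integral>x. f x \<partial>circ) = (\<integral>x. indicator {0..<2 * pi} x *\<^sub>R f x \<partial>lborel)"
    unfolding circ_def by (rule integral_density) auto
  also have "\<dots> = (\<integral>x. indicator {0..2 * pi} x *\<^sub>R f x \<partial>lborel)"
    using AE_lborel_singleton[of "2 * pi"] by (intro integral_cong_AE) (auto simp: indicator_def)
  finally show ?thesis .
qed

lemma integral_circ_FTC:
  fixes f :: "real \<Rightarrow> 'a :: euclidean_space"
  assumes "\<And>t. (F has_vector_derivative f t) (at t)" "continuous_on UNIV f"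
  shows "(\<integral>x. f x \<partial>circ) = F (2 * pi) - F 0"
proof -
  have [measurable]: "f \<in> borel_measurable borel" by (intro borel_measurable_continuous_onI assms)
  have "has_bochner_integral lborel (\<lambda>x. indicator {0..2 * pi} x *\<^sub>R f x) (F (2 * pi) - F 0)"
    using assms by (intro has_bochner_integral_FTC_Icc)
      (auto intro: has_vector_derivative_at_within continuous_on_subset)
  then show ?thesis unfolding integral_circ[OF \<open>f \<in> _\<close>] by (rule has_bochner_integral_integral_eq)
qed

lemma integral_circ_cis: "(\<integral>x. cis (of_int k * x) \<partial>circ) = (if k = 0 then 2 * pi else 0)"
proof (cases "k = 0")
  case True
  have "(\<integral>x. (1 :: complex) \<partial>circ) = of_real (measure circ UNIV)" by (simp add: scaleR_conv_of_real)
  then show ?thesis using True by (simp add: measure_def emeasure_circ_UNIV)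
next
  case False
  have "(\<integral>x. cis (of_int k * x) \<partial>circ) = cis (of_int k * (2 * pi)) / (\<i> * of_int k) - cis (of_int k * 0) / (\<i> * of_int k)"
  proof (rule integral_circ_FTC[where F = "\<lambda>x. cis (of_int k * x) / (\<i> * of_int k)"])
    fix t :: real
    have "((\<lambda>z. exp (\<i> * of_int k * z) / (\<i> * of_int k)) has_field_derivative exp (\<i> * of_int k * of_real t)) (at (of_real t))"
      using False by (auto intro!: derivative_eq_intros)
    from has_vector_derivative_real_field[OF this]
    show "((\<lambda>x. cis (of_int k * x) / (\<i> * of_int k)) has_vector_derivative cis (of_int k * t)) (at t)"
      by (simp add: cis_conv_exp mult.assoc)
  qed (intro continuous_intros)
  also have "cis (of_int k * (2 * pi)) = 1" using cis_multiple_2pi[of "of_int k"] by (simp add: mult.commute)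
  finally show ?thesis using False by simp
qed

lemma bounded_integrable_circ:
  assumes [measurable]: "f \<in> borel_measurable borel" and "\<And>x. norm (f x) \<le> C"
  shows "integrable circ (f :: real \<Rightarrow> complex)"
  by (rule circ.integrable_const_bound[where B = C]) (use assms in auto)

text \<open>The kernel of the orthogonal projection onto the first \<open>n\<close> characters. The
  usual real kernel uses symmetric frequencies; it differs from this one by a factor
  \<open>g x / g y\<close>, which the determinants below do not see.\<close>

definition dker :: "nat \<Rightarrow> real \<Rightarrow> real \<Rightarrow> complex" where
  "dker n x y = (\<Sum>l<n. cis (real l * (x - y))) / (2 * pi)"

lemma dker_bound: "norm (dker n x y) \<le> real n / (2 * pi)"
proof -
  have "norm (\<Sum>l<n. cis (real l * (x - y))) \<le> (\<Sum>l<n. 1)"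
    by (intro sum_norm_le) auto
  then show ?thesis unfolding dker_def by (simp add: norm_divide divide_right_mono)
qed

lemma dker_measurable [measurable]:
  assumes [measurable]: "f \<in> borel_measurable M" "g \<in> borel_measurable M"
  shows "(\<lambda>x. dker n (f x) (g x)) \<in> borel_measurable M"
proof -
  have [measurable]: "cis \<in> borel_measurable borel" by (intro borel_measurable_continuous_onI continuous_intros)
  show ?thesis unfolding dker_def by measurable
qed

lemma dker_diag: "dker n x x = of_nat n / (2 * pi)"
  by (simp add: dker_def)

text \<open>The reproducing property of a projection kernel, from the orthogonality of
  characters.\<close>

lemma dker_convolution: "(\<integral>t. dker n x t * dker n t y \<partial>circ) = dker n x y"
proof -
  have [measurable]: "cis \<in> borel_measurable borel" by (intro borel_measurable_continuous_onI continuous_intros)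
  have e: "dker n x t * dker n t y = (\<Sum>l<n. \<Sum>k<n. (cis (real l * x) * cis (- (real k * y)) / (4 * pi\<^sup>2)) * cis (of_int (int k - int l) * t))" for t
  proof -
    have "dker n x t * dker n t y = (\<Sum>l<n. \<Sum>k<n. cis (real l * (x - t)) * cis (real k * (t - y))) / (2 * pi * (2 * pi))"
      by (simp add: dker_def sum_product)
    also have "\<dots> = (\<Sum>l<n. \<Sum>k<n. (cis (real l * x) * cis (- (real k * y)) / (4 * pi\<^sup>2)) * cis (of_int (int k - int l) * t))"
      unfolding sum_divide_distrib
      by (intro sum.cong refl) (simp add: cis_mult algebra_simps power2_eq_square)
    finally show ?thesis .
  qed
  have i: "integrable circ (\<lambda>t. c * cis (of_int k * t))" for k :: int and c
    by (intro integrable_mult_right bounded_integrable_circ[where C = 1]) auto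
  have "(\<integral>t. dker n x t * dker n t y \<partial>circ)
     = (\<Sum>l<n. \<Sum>k<n. (cis (real l * x) * cis (- (real k * y)) / (4 * pi\<^sup>2)) * (if k = l then 2 * pi else 0))"
    unfolding e using i integral_circ_cis
    by (simp only: Bochner_Integration.integral_sum Bochner_Integration.integrable_sum integral_mult_right_zero) (simp add: i)
  also have "\<dots> = (\<Sum>l<n. (cis (real l * x) * cis (- (real l * y)) / (4 * pi\<^sup>2)) * (2 * pi))"
    by (intro sum.cong refl) (simp add: if_distrib[where f = "\<lambda>z. _ * z"] if_distrib[where f = "\<lambda>z. of_real z"] cong: if_cong)
  also have "\<dots> = dker n x y"
    unfolding dker_def sum_divide_distrib by (intro sum.cong refl) (simp add: cis_mult power2_eq_square right_diff_distrib)
  finally show ?thesis .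
qed

definition kmat :: "nat \<Rightarrow> nat \<Rightarrow> (nat \<Rightarrow> real) \<Rightarrow> complex mat" where
  "kmat n m x = mat m m (\<lambda>(a, b). dker n (x a) (x b))"

definition rho :: "nat \<Rightarrow> nat \<Rightarrow> (nat \<Rightarrow> real) \<Rightarrow> real" where
  "rho n m x = Re (Determinant.det (kmat n m x))"

lemma det_kmat: "Determinant.det (kmat n m x) = (\<Sum>p | p permutes {..<m}. of_int (sign p) * (\<Prod>a<m. dker n (x a) (x (p a))))"
proof -
  have "Determinant.det (kmat n m x) = (\<Sum>p | p permutes {0..<m}. of_int (sign p) * (\<Prod>a = 0..<m. kmat n m x $$ (a, p a)))"
    by (simp add: Determinant.det_def kmat_def)
  also have "\<dots> = (\<Sum>p | p permutes {0..<m}. of_int (sign p) * (\<Prod>a = 0..<m. dker n (x a) (x (p a))))"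
    by (intro sum.cong refl arg_cong2[where f = "(*)"] prod.cong) (auto simp: kmat_def dest: permutes_in_image)
  finally show ?thesis by (simp add: atLeast0LessThan)
qed

lemma det_kmat_cong: "(\<And>a. a < m \<Longrightarrow> x a = y a) \<Longrightarrow> Determinant.det (kmat n m x) = Determinant.det (kmat n m y)"
  unfolding kmat_def by (intro arg_cong[where f = Determinant.det] cong_mat) auto

lemma rho_cong: "(\<And>a. a < m \<Longrightarrow> x a = y a) \<Longrightarrow> rho n m x = rho n m y"
  unfolding rho_def using det_kmat_cong by metis

lemma det_kmat_measurable [measurable]:
  assumes "\<And>a. a < m \<Longrightarrow> (\<lambda>x. f x a) \<in> borel_measurable M"
  shows "(\<lambda>x. Determinant.det (kmat n m (f x))) \<in> borel_measurable M"
  unfolding det_kmat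
  by (intro borel_measurable_sum borel_measurable_times borel_measurable_prod dker_measurable assms)
     (auto dest: permutes_in_image)

lemma rho_measurable [measurable]: "rho n m \<in> borel_measurable (PiM {..<m} (\<lambda>_. circ))"
proof -
  have "(\<lambda>x. Determinant.det (kmat n m x)) \<in> borel_measurable (PiM {..<m} (\<lambda>_. circ))"
    by (rule det_kmat_measurable) measurable
  then show ?thesis unfolding rho_def by measurable
qed

text \<open>The integration lemma of Dyson and Gaudin. Permutations of \<open>Suc m\<close> points
  are sorted by the image of the last point. If it is fixed, the integral is the trace
  \<open>n\<close> of the projection; otherwise the reproducing property removes the point from its
  cycle, in \<open>m\<close> ways and with a change of sign.\<close>

lemma integral_det_kmat:
  shows "integrable circ (\<lambda>t. Determinant.det (kmat n (Suc m) (x(m := t))))"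
    "(\<integral>t. Determinant.det (kmat n (Suc m) (x(m := t))) \<partial>circ) = (of_nat n - of_nat m) * Determinant.det (kmat n m x)"
proof -
  define f where "f t p = of_int (sign p) * (\<Prod>a<Suc m. dker n ((x(m := t)) a) ((x(m := t)) (p a)))" for t and p :: "nat \<Rightarrow> nat"
  have fm: "(\<lambda>t. f t p) \<in> borel_measurable borel" for p
  proof -
    have [measurable]: "(\<lambda>t. (x(m := t)) a) \<in> borel_measurable borel" for a by (cases "a = m") auto
    show ?thesis unfolding f_def by measurable
  qed
  have fi: "integrable circ (\<lambda>t. f t p)" for p
  proof (rule bounded_integrable_circ[OF fm])
    fix t
    have "norm (\<Prod>a<Suc m. dker n ((x(m := t)) a) ((x(m := t)) (p a))) \<le> (\<Prod>a<Suc m. real n / (2 * pi))"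
      unfolding prod_norm[symmetric] by (intro prod_mono) (auto simp: dker_bound)
    moreover have "norm (of_int (sign p) :: complex) = 1" by (simp add: sign_def)
    ultimately show "norm (f t p) \<le> (\<Prod>a<Suc m. real n / (2 * pi))" unfolding f_def norm_mult by simp
  qed
  define P where "P q = (\<Prod>a<m. dker n (x a) (x (q a)))" for q
  have S: "{..<Suc m} = insert m {..<m}" by auto
  have det: "Determinant.det (kmat n (Suc m) (x(m := t)))
      = (\<Sum>b\<in>insert m {..<m}. \<Sum>q | q permutes {..<m}. f t (Transposition.transpose m b \<circ> q))" for t
    unfolding det_kmat f_def[symmetric] unfolding S by (rule sum_over_permutations_insert) auto
  show "integrable circ (\<lambda>t. Determinant.det (kmat n (Suc m) (x(m := t))))"
    unfolding det by (intro Bochner_Integration.integrable_sum fi)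
  have diag: "(\<integral>t. f t (Transposition.transpose m m \<circ> q) \<partial>circ) = of_nat n * (of_int (sign q) * P q)" if q: "q permutes {..<m}" for q
  proof -
    have qm: "q m = m" using q by (simp add: permutes_not_in)
    have "f t (Transposition.transpose m m \<circ> q) = of_int (sign q) * P q * (of_nat n / (2 * pi))" for t
    proof -
      have "(\<Prod>a<m. dker n ((x(m := t)) a) ((x(m := t)) (q a))) = P q"
        unfolding P_def using permutes_in_image[OF q] by (intro prod.cong) auto
      then show ?thesis unfolding f_def by (simp add: qm dker_diag)
    qed
    then have "(\<integral>t. f t (Transposition.transpose m m \<circ> q) \<partial>circ) = of_int (sign q) * P q * (of_nat n / (2 * pi)) * of_real (measure circ UNIV)"
      by (simp add: scaleR_conv_of_real mult.commute)
    then show ?thesis by (simp add: measure_def emeasure_circ_UNIV)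
  qed
  have off: "(\<integral>t. f t (Transposition.transpose m b \<circ> q) \<partial>circ) = - (of_int (sign q) * P q)" if b: "b < m" and q: "q permutes {..<m}" for b q
  proof -
    \<comment> \<open>The predecessor of \<open>b\<close> under \<open>q\<close>: after composition
      with the transposition, its cycle passes through \<open>a0\<close>, \<open>m\<close>,
      \<open>b\<close> in this order, and integrating over the point \<open>m\<close> joins
      \<open>a0\<close> to \<open>b\<close> again.\<close>
    define a0 where "a0 = inv_into UNIV q b"
    have a0: "a0 < m" "q a0 = b"
      using q b permutes_in_image[OF permutes_inv[OF q], of b] by (auto simp: a0_def permutes_inverses)
    have qm: "q m = m" using q by (simp add: permutes_not_in)
    have sgn: "sign (Transposition.transpose m b \<circ> q) = - sign q"
    proof -
      have "permutation q" using q by (auto simp: permutation_permutes)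
      then show ?thesis using b by (simp add: sign_compose permutation_swap_id sign_swap_id)
    qed
    define R where "R = (\<Prod>a\<in>{..<m} - {a0}. dker n (x a) (x (q a)))"
    have f: "f t (Transposition.transpose m b \<circ> q) = - (of_int (sign q) * R) * (dker n (x a0) t * dker n t (x b))" for t
    proof -
      have "(\<Prod>a<m. dker n ((x(m := t)) a) ((x(m := t)) ((Transposition.transpose m b \<circ> q) a)))
        = dker n (x a0) t * (\<Prod>a\<in>{..<m} - {a0}. dker n ((x(m := t)) a) ((x(m := t)) ((Transposition.transpose m b \<circ> q) a)))"
        using a0 by (subst prod.remove[of _ a0]) auto
      also have "(\<Prod>a\<in>{..<m} - {a0}. dker n ((x(m := t)) a) ((x(m := t)) ((Transposition.transpose m b \<circ> q) a))) = R"
        unfolding R_def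
      proof (intro prod.cong refl)
        fix a assume a: "a \<in> {..<m} - {a0}"
        have "q a \<noteq> b" using a a0 permutes_inj[OF q] by (auto simp: inj_eq)
        moreover have "q a < m" using permutes_in_image[OF q, of a] a by auto
        ultimately show "dker n ((x(m := t)) a) ((x(m := t)) ((Transposition.transpose m b \<circ> q) a)) = dker n (x a) (x (q a))"
          using a by (simp add: Transposition.transpose_def)
      qed
      finally show ?thesis unfolding f_def sgn using b by (simp add: qm)
    qed
    have "(\<integral>t. f t (Transposition.transpose m b \<circ> q) \<partial>circ) = - (of_int (sign q) * R) * dker n (x a0) (x b)"
      unfolding f by (simp add: dker_convolution del: mult_minus_left)
    moreover have "P q = R * dker n (x a0) (x b)"
      unfolding P_def R_def using a0 by (subst prod.remove[of "{..<m}" a0]) auto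
    ultimately show ?thesis by (simp add: mult.assoc)
  qed
  have "(\<integral>t. Determinant.det (kmat n (Suc m) (x(m := t))) \<partial>circ)
     = (\<Sum>b\<in>insert m {..<m}. \<Sum>q | q permutes {..<m}. \<integral>t. f t (Transposition.transpose m b \<circ> q) \<partial>circ)"
    unfolding det using fi by (simp only: Bochner_Integration.integral_sum Bochner_Integration.integrable_sum)
  also have "\<dots> = (\<Sum>q | q permutes {..<m}. of_nat n * (of_int (sign q) * P q))
      + (\<Sum>b<m. \<Sum>q | q permutes {..<m}. - (of_int (sign q) * P q))"
    using diag off by (subst sum.insert) (auto intro!: arg_cong2[where f = "(+)"] sum.cong)
  also have "\<dots> = (of_nat n - of_nat m) * Determinant.det (kmat n m x)"
    unfolding det_kmat P_def[symmetric] by (simp add: sum_distrib_left[symmetric] sum_negf algebra_simps)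
  finally show "(\<integral>t. Determinant.det (kmat n (Suc m) (x(m := t))) \<partial>circ) = (of_nat n - of_nat m) * Determinant.det (kmat n m x)" .
qed

lemma integral_rho:
  "integrable circ (\<lambda>t. rho n (Suc m) (x(m := t)))"
  "(\<integral>t. rho n (Suc m) (x(m := t)) \<partial>circ) = (real n - real m) * rho n m x"
proof -
  show "integrable circ (\<lambda>t. rho n (Suc m) (x(m := t)))"
    unfolding rho_def using integral_det_kmat(1) by (rule integrable_Re)
  show "(\<integral>t. rho n (Suc m) (x(m := t)) \<partial>circ) = (real n - real m) * rho n m x"
    unfolding rho_def using integral_det_kmat[of n m x] by simp
qed

section \<open>The Vandermonde determinant and positivity\<close>

definition vand :: "nat \<Rightarrow> (nat \<Rightarrow> complex) \<Rightarrow> complex mat" where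
  "vand n z = mat n n (\<lambda>(i, l). z i ^ l)"

text \<open>Changing from powers to the monic polynomials with roots \<open>z k\<close> for
  \<open>k < j\<close> is a unitriangular column operation. The value of such a polynomial at
  \<open>z i\<close> is 0 for \<open>i < j\<close>, so the new matrix is lower triangular.\<close>

lemma det_vand: "Determinant.det (vand n z) = (\<Prod>i<n. \<Prod>k<i. z i - z k)"
proof -
  define p where "p j = (\<Prod>k<j. [:- z k, 1:])" for j
  have deg: "degree (p j) = j" and mon: "coeff (p j) j = 1" for j
  proof -
    show "degree (p j) = j" unfolding p_def by (subst degree_prod_eq_sum_degree) auto
    moreover have "lead_coeff (p j) = 1" unfolding p_def by (subst lead_coeff_prod) auto
    ultimately show "coeff (p j) j = 1" by simp
  qed
  define U where "U = mat n n (\<lambda>(l, j). coeff (p j) l)"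
  define L where "L = mat n n (\<lambda>(i, j). \<Prod>k<j. z i - z k)"
  have c: "U \<in> carrier_mat n n" "L \<in> carrier_mat n n" "vand n z \<in> carrier_mat n n"
    by (auto simp: U_def L_def vand_def)
  have "L = vand n z * U"
  proof (rule eq_matI)
    fix i j assume "i < dim_row (vand n z * U)" "j < dim_col (vand n z * U)"
    then have ij: "i < n" "j < n" using c by auto
    have "(vand n z * U) $$ (i, j) = (\<Sum>l<n. z i ^ l * coeff (p j) l)"
      using ij by (auto simp: vand_def U_def scalar_prod_def atLeast0LessThan)
    also have "\<dots> = (\<Sum>l\<le>j. z i ^ l * coeff (p j) l)"
      using ij deg coeff_eq_0[of "p j"] by (intro sum.mono_neutral_right) auto
    also have "\<dots> = poly (p j) (z i)" unfolding poly_altdef deg by (simp add: mult.commute)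
    also have "\<dots> = (\<Prod>k<j. z i - z k)" unfolding p_def by (simp add: poly_prod)
    finally show "L $$ (i, j) = (vand n z * U) $$ (i, j)" using ij by (simp add: L_def)
  qed (use c in auto)
  then have "Determinant.det L = Determinant.det (vand n z) * Determinant.det U" using det_mult[OF c(3,1)] by simp
  moreover have "Determinant.det U = 1"
  proof -
    have "upper_triangular U" unfolding U_def upper_triangular_def by (auto intro!: coeff_eq_0 simp: deg)
    from det_upper_triangular[OF this c(1)] show ?thesis
      by (auto simp: prod_list_diag_prod U_def mon intro!: prod.neutral)
  qed
  moreover have "Determinant.det L = (\<Prod>i<n. \<Prod>k<i. z i - z k)"
  proof -
    have "Determinant.det L = prod_list (diag_mat L)"
    proof (rule det_lower_triangular[OF _ c(2)])
      fix i j assume "i < j" "j < n"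
      then show "L $$ (i, j) = 0" unfolding L_def by (auto intro!: prod_zero)
    qed
    then show ?thesis by (simp add: prod_list_diag_prod L_def atLeast0LessThan)
  qed
  ultimately show ?thesis by simp
qed

definition vdm2 :: "nat \<Rightarrow> (nat \<Rightarrow> real) \<Rightarrow> real" where
  "vdm2 n x = (\<Prod>i<n. \<Prod>k<i. (norm (cis (x i) - cis (x k)))\<^sup>2)"

text \<open>With all \<open>n\<close> points present the kernel matrix is the Vandermonde matrix
  times its adjoint, over \<open>2 * pi\<close>. This links the kernel to Weyl's density.\<close>

lemma rho_eq_vdm2: "rho n n x = vdm2 n x / (2 * pi) ^ n"
proof -
  define V where "V = vand n (\<lambda>i. cis (x i))"
  define W where "W = map_mat cnj (transpose_mat V)"
  have c: "V \<in> carrier_mat n n" "W \<in> carrier_mat n n" by (auto simp: V_def W_def vand_def)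
  define c0 where "c0 = 1 / (2 * complex_of_real pi)"
  have "kmat n n x = c0 \<cdot>\<^sub>m (V * W)"
  proof (rule eq_matI)
    fix a b assume "a < dim_row (c0 \<cdot>\<^sub>m (V * W))" "b < dim_col (c0 \<cdot>\<^sub>m (V * W))"
    then have ab: "a < n" "b < n" using c by auto
    show "kmat n n x $$ (a, b) = (c0 \<cdot>\<^sub>m (V * W)) $$ (a, b)"
      using ab by (simp add: c0_def kmat_def V_def W_def vand_def scalar_prod_def dker_def atLeast0LessThan
        Complex.DeMoivre cis_cnj cis_mult right_diff_distrib)
  qed (use c in \<open>auto simp: kmat_def\<close>)
  then have "Determinant.det (kmat n n x) = c0 ^ n * (Determinant.det V * Determinant.det W)"
    using c by (simp add: det_smult det_mult)
  also have "Determinant.det W = cnj (Determinant.det V)"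
  proof -
    have "Determinant.det W = cnj (Determinant.det (transpose_mat V))"
      unfolding W_def Determinant.det_def using c by (auto simp: cnj_sum cnj_prod intro!: sum.cong prod.cong dest: permutes_in_image)
    then show ?thesis using det_transpose[OF c(1)] by simp
  qed
  also have "Determinant.det V * cnj (Determinant.det V) = of_real ((norm (Determinant.det V))\<^sup>2)"
    by (simp add: complex_norm_square[symmetric] del: of_real_power)
  also have "(norm (Determinant.det V))\<^sup>2 = vdm2 n x"
    unfolding V_def det_vand vdm2_def by (simp add: prod_norm[symmetric] prod_power_distrib)
  finally have "Determinant.det (kmat n n x) = of_real (vdm2 n x / (2 * pi) ^ n)" by (simp add: c0_def power_one_over)
  then show ?thesis unfolding rho_def by simp
qed

text \<open>Positivity descends from \<open>m = n\<close>, where the determinant is a squared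
  modulus: integrating out one point multiplies by the positive number \<open>n - m\<close>.\<close>

lemma rho_nonneg: "m \<le> n \<Longrightarrow> 0 \<le> rho n m x"
proof (induction "n - m" arbitrary: m x)
  case 0
  then show ?case using rho_eq_vdm2[of n x] by (auto simp: vdm2_def intro!: divide_nonneg_nonneg prod_nonneg)
next
  case (Suc d)
  have "0 \<le> (\<integral>t. rho n (Suc m) (x(m := t)) \<partial>circ)"
    using Suc by (intro Bochner_Integration.integral_nonneg) auto
  then have nn: "0 \<le> (real n - real m) * rho n m x" by (simp add: integral_rho)
  have "0 < real n - real m" using Suc.hyps(2) by simp
  from mult_le_cancel_left_pos[OF this, of 0 "rho n m x"] nn show ?case by simp
qed

lemma nn_integral_rho:
  assumes "m < n"
  shows "(\<integral>\<^sup>+t. ennreal (rho n (Suc m) (x(m := t))) \<partial>circ) = of_nat (n - m) * ennreal (rho n m x)"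
proof -
  have "(\<integral>\<^sup>+t. ennreal (rho n (Suc m) (x(m := t))) \<partial>circ) = ennreal (\<integral>t. rho n (Suc m) (x(m := t)) \<partial>circ)"
    using assms by (intro nn_integral_eq_integral integral_rho(1)) (auto intro!: rho_nonneg)
  also have "\<dots> = ennreal (real (n - m) * rho n m x)" using assms by (simp add: integral_rho of_nat_diff)
  also have "\<dots> = of_nat (n - m) * ennreal (rho n m x)"
    using assms by (simp add: ennreal_mult ennreal_of_nat_eq_real_of_nat rho_nonneg)
  finally show ?thesis .
qed

text \<open>The surplus points are integrated out one at a time, and the factors collected on the
  way multiply up to \<open>fact (n - m)\<close>.\<close>

lemma nn_integral_marginal:
  assumes "m \<le> n" and g [measurable]: "g \<in> borel_measurable (PiM {..<m} (\<lambda>_. circ))"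
  shows "(\<integral>\<^sup>+x. g (restrict x {..<m}) * ennreal (rho n n x) \<partial>PiM {..<n} (\<lambda>_. circ))
    = of_nat (fact (n - m)) * (\<integral>\<^sup>+x. g x * ennreal (rho n m x) \<partial>PiM {..<m} (\<lambda>_. circ))"
proof -
  have "(\<integral>\<^sup>+x. g (restrict x {..<m}) * ennreal (rho n n x) \<partial>PiM {..<n} (\<lambda>_. circ))
    = of_nat (fact (n - k)) * (\<integral>\<^sup>+x. g (restrict x {..<m}) * ennreal (rho n k x) \<partial>PiM {..<k} (\<lambda>_. circ))"
    if "m \<le> k" "k \<le> n" for k
    using that
  proof (induction "n - k" arbitrary: k)
    case 0 then show ?case by simp
  next
    case (Suc d)
    have kn: "k < n" using Suc by simp
    have [measurable]: "(\<lambda>x. restrict x {..<m}) \<in> measurable (PiM {..<k'} (\<lambda>_. circ)) (PiM {..<m} (\<lambda>_. circ))" if "m \<le> k'" for k'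
      using that by (intro measurable_restrict_subset) auto
    have gm: "(\<lambda>x. g (restrict x {..<m}) * ennreal (rho n k' x)) \<in> borel_measurable (PiM {..<k'} (\<lambda>_. circ))" if "m \<le> k'" for k'
      using that by measurable
    have S: "{..<Suc k} = insert k {..<k}" by auto
    have "(\<integral>\<^sup>+x. g (restrict x {..<m}) * ennreal (rho n n x) \<partial>PiM {..<n} (\<lambda>_. circ))
     = of_nat (fact (n - Suc k)) * (\<integral>\<^sup>+x. g (restrict x {..<m}) * ennreal (rho n (Suc k) x) \<partial>PiM {..<Suc k} (\<lambda>_. circ))"
      using Suc by (intro Suc.hyps(1)) auto
    also have "(\<integral>\<^sup>+x. g (restrict x {..<m}) * ennreal (rho n (Suc k) x) \<partial>PiM {..<Suc k} (\<lambda>_. circ))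
      = (\<integral>\<^sup>+x. \<integral>\<^sup>+t. g (restrict (x(k := t)) {..<m}) * ennreal (rho n (Suc k) (x(k := t))) \<partial>circ \<partial>PiM {..<k} (\<lambda>_. circ))"
      using gm[of "Suc k"] Suc.prems unfolding S by (intro circ_prod.product_nn_integral_insert) auto
    also have "\<dots> = (\<integral>\<^sup>+x. of_nat (n - k) * (g (restrict x {..<m}) * ennreal (rho n k x)) \<partial>PiM {..<k} (\<lambda>_. circ))"
    proof (intro nn_integral_cong)
      fix x :: "nat \<Rightarrow> real"
      have "restrict (x(k := t)) {..<m} = restrict x {..<m}" for t
        using Suc.prems by (auto simp: restrict_def fun_eq_iff)
      moreover have "(\<lambda>t. ennreal (rho n (Suc k) (x(k := t)))) \<in> borel_measurable circ"
        using borel_measurable_integrable[OF integral_rho(1)[of n k x]] by measurable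
      ultimately show "(\<integral>\<^sup>+t. g (restrict (x(k := t)) {..<m}) * ennreal (rho n (Suc k) (x(k := t))) \<partial>circ)
        = of_nat (n - k) * (g (restrict x {..<m}) * ennreal (rho n k x))"
        by (simp add: nn_integral_cmult nn_integral_rho[OF kn] mult_ac)
    qed
    also have "\<dots> = of_nat (n - k) * (\<integral>\<^sup>+x. g (restrict x {..<m}) * ennreal (rho n k x) \<partial>PiM {..<k} (\<lambda>_. circ))"
      using Suc.prems gm[of k] by (intro nn_integral_cmult) auto
    also have "of_nat (fact (n - Suc k)) * (of_nat (n - k) * Y) = of_nat (fact (n - k)) * (Y :: ennreal)" for Y
    proof -
      have "fact (n - k) = (n - k) * (fact (n - Suc k) :: nat)" using kn by (metis Suc_diff_Suc fact_Suc of_nat_id)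
      then show ?thesis by (simp only: of_nat_mult mult_ac)
    qed
    finally show ?case .
  qed
  from this[of m] have "(\<integral>\<^sup>+x. g (restrict x {..<m}) * ennreal (rho n n x) \<partial>PiM {..<n} (\<lambda>_. circ))
    = of_nat (fact (n - m)) * (\<integral>\<^sup>+x. g (restrict x {..<m}) * ennreal (rho n m x) \<partial>PiM {..<m} (\<lambda>_. circ))"
    using assms(1) by simp
  also have "(\<integral>\<^sup>+x. g (restrict x {..<m}) * ennreal (rho n m x) \<partial>PiM {..<m} (\<lambda>_. circ)) = (\<integral>\<^sup>+x. g x * ennreal (rho n m x) \<partial>PiM {..<m} (\<lambda>_. circ))"
    by (intro nn_integral_cong) (simp add: space_PiM PiE_restrict)
  finally show ?thesis .
qed

section \<open>Weyl integration formula\<close>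

lemma cis_measurable [measurable]: "cis \<in> borel_measurable borel"
  by (intro borel_measurable_continuous_onI continuous_intros)

abbreviation torus :: "nat \<Rightarrow> (nat \<Rightarrow> real) measure" where
  "torus n \<equiv> PiM {..<n} (\<lambda>_. circ)"

lemma finite_measure_torus: "finite_measure (torus n)"
proof
  have "emeasure (torus n) (PiE {..<n} (\<lambda>_. UNIV)) = (\<Prod>i<n. emeasure circ UNIV)"
    by (intro circ_prod.emeasure_PiM) auto
  then show "emeasure (torus n) (space (torus n)) \<noteq> \<infinity>"
    by (simp add: space_PiM emeasure_circ_UNIV ennreal_power power_less_top_ennreal)
qed

lemma permute_torus_measurable:
  assumes "\<sigma> permutes {..<n}"
  shows "(\<lambda>x. restrict (x \<circ> \<sigma>) {..<n}) \<in> measurable (torus n) (torus n)"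
  unfolding comp_def using permutes_in_image[OF assms]
  by (intro measurable_restrict measurable_component_singleton) auto

lemma distr_torus_permute:
  assumes s: "\<sigma> permutes {..<n}"
  shows "distr (torus n) (torus n) (\<lambda>x. restrict (x \<circ> \<sigma>) {..<n}) = torus n"
proof (rule circ_prod.PiM_eqI)
  fix A :: "nat \<Rightarrow> real set" assume A: "\<And>i. i \<in> {..<n} \<Longrightarrow> A i \<in> sets circ"
  have bij: "bij_betw (inv_into UNIV \<sigma>) {..<n} {..<n}" using permutes_inv[OF s] by (rule permutes_imp_bij)
  have "(\<lambda>x. restrict (x \<circ> \<sigma>) {..<n}) -` PiE {..<n} A \<inter> space (torus n) = PiE {..<n} (\<lambda>i. A (inv_into UNIV \<sigma> i))"
  proof (intro equalityI subsetI)
    fix x assume x: "x \<in> (\<lambda>x. restrict (x \<circ> \<sigma>) {..<n}) -` PiE {..<n} A \<inter> space (torus n)"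
    have "x i \<in> A (inv_into UNIV \<sigma> i)" if "i < n" for i
    proof -
      have "inv_into UNIV \<sigma> i < n" using permutes_in_image[OF permutes_inv[OF s], of i] that by simp
      then have "x (\<sigma> (inv_into UNIV \<sigma> i)) \<in> A (inv_into UNIV \<sigma> i)" using x by (auto simp: PiE_iff)
      then show ?thesis by (simp add: permutes_inverses[OF s])
    qed
    then show "x \<in> PiE {..<n} (\<lambda>i. A (inv_into UNIV \<sigma> i))" using x by (auto simp: PiE_iff space_PiM)
  next
    fix x assume x: "x \<in> PiE {..<n} (\<lambda>i. A (inv_into UNIV \<sigma> i))"
    have "x (\<sigma> i) \<in> A i" if "i < n" for i
    proof -
      have "\<sigma> i < n" using permutes_in_image[OF s, of i] that by simp
      then have "x (\<sigma> i) \<in> A (inv_into UNIV \<sigma> (\<sigma> i))" using x by (auto simp: PiE_iff)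
      then show ?thesis by (simp add: permutes_inverses[OF s])
    qed
    then show "x \<in> (\<lambda>x. restrict (x \<circ> \<sigma>) {..<n}) -` PiE {..<n} A \<inter> space (torus n)"
      using x by (auto simp: PiE_iff space_PiM)
  qed
  moreover have "PiE {..<n} A \<in> sets (torus n)" using A by (intro sets_PiM_I_finite) auto
  ultimately have "emeasure (distr (torus n) (torus n) (\<lambda>x. restrict (x \<circ> \<sigma>) {..<n})) (PiE {..<n} A)
     = emeasure (torus n) (PiE {..<n} (\<lambda>i. A (inv_into UNIV \<sigma> i)))"
    by (simp add: emeasure_distr permute_torus_measurable[OF s])
  also have "\<dots> = (\<Prod>i<n. emeasure circ (A (inv_into UNIV \<sigma> i)))"
    using A permutes_in_image[OF permutes_inv[OF s]] by (intro circ_prod.emeasure_PiM) auto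
  also have "\<dots> = (\<Prod>i<n. emeasure circ (A i))"
    by (rule prod.reindex_bij_betw[OF bij])
  finally show "emeasure (distr (torus n) (torus n) (\<lambda>x. restrict (x \<circ> \<sigma>) {..<n})) (PiE {..<n} A)
     = (\<Prod>i<n. emeasure circ (A i))" .
qed auto

text \<open>Each unordered pair occurs twice among the ordered ones, which accounts for the square.
  In this form the invariance under permutations is visible.\<close>

lemma vdm2_symmetric: "vdm2 n x = (\<Prod>i<n. \<Prod>k\<in>{..<n} - {i}. norm (cis (x i) - cis (x k)))"
proof (induction n)
  case 0 then show ?case by (simp add: vdm2_def)
next
  case (Suc n)
  let ?g = "\<lambda>i k. norm (cis (x i) - cis (x k))"
  have "(\<Prod>i<Suc n. \<Prod>k\<in>{..<Suc n} - {i}. ?g i k) = (\<Prod>i<n. \<Prod>k\<in>{..<Suc n} - {i}. ?g i k) * (\<Prod>k\<in>{..<Suc n} - {n}. ?g n k)"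
    by simp
  also have "{..<Suc n} - {n} = {..<n}" by auto
  also have "(\<Prod>i<n. \<Prod>k\<in>{..<Suc n} - {i}. ?g i k) = (\<Prod>i<n. ?g i n * (\<Prod>k\<in>{..<n} - {i}. ?g i k))"
  proof (rule prod.cong[OF refl])
    fix i assume i: "i \<in> {..<n}"
    have "{..<Suc n} - {i} = insert n ({..<n} - {i})" using i by auto
    then show "(\<Prod>k\<in>{..<Suc n} - {i}. ?g i k) = ?g i n * (\<Prod>k\<in>{..<n} - {i}. ?g i k)" by simp
  qed
  also have "\<dots> = (\<Prod>i<n. ?g n i) * vdm2 n x"
    unfolding prod.distrib Suc by (simp add: norm_minus_commute)
  also have "\<dots> * (\<Prod>k<n. ?g n k) = vdm2 (Suc n) x"
    by (simp add: vdm2_def power2_eq_square prod.distrib)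
  finally show ?case by simp
qed

lemma vdm2_permute:
  assumes s: "\<sigma> permutes {..<n}"
  shows "vdm2 n (\<lambda>i. x (\<sigma> i)) = vdm2 n x"
proof -
  let ?g = "\<lambda>i k. norm (cis (x i) - cis (x k))"
  have bij: "bij_betw \<sigma> {..<n} {..<n}" using s by (rule permutes_imp_bij)
  have "(\<Prod>k\<in>{..<n} - {i}. ?g (\<sigma> i) (\<sigma> k)) = (\<Prod>k\<in>{..<n} - {\<sigma> i}. ?g (\<sigma> i) k)" for i
  proof (rule prod.reindex_bij_betw)
    show "bij_betw \<sigma> ({..<n} - {i}) ({..<n} - {\<sigma> i})"
      unfolding bij_betw_def
      using image_set_diff[OF permutes_inj[OF s], of "{..<n}" "{i}"] permutes_image[OF s] inj_on_subset[OF permutes_inj[OF s]]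
      by simp
  qed
  then have "vdm2 n (\<lambda>i. x (\<sigma> i)) = (\<Prod>i<n. \<Prod>k\<in>{..<n} - {\<sigma> i}. ?g (\<sigma> i) k)"
    unfolding vdm2_symmetric by simp
  also have "\<dots> = vdm2 n x"
    unfolding vdm2_symmetric by (rule prod.reindex_bij_betw[OF bij])
  finally show ?thesis .
qed

lemma vdm2_cong: "(\<And>i. i < n \<Longrightarrow> x i = y i) \<Longrightarrow> vdm2 n x = vdm2 n y"
  unfolding vdm2_def by (intro prod.cong refl) auto

lemma vdm2_nonneg: "0 \<le> vdm2 n x"
  unfolding vdm2_def by (intro prod_nonneg) auto

lemma vdm2_measurable [measurable]: "vdm2 n \<in> borel_measurable (torus n)"
proof -
  have m: "(\<lambda>x. x i) \<in> borel_measurable (torus n)" if "i < n" for i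
    using measurable_component_singleton[of i "{..<n}" "\<lambda>_. circ"] that by simp
  have c: "(\<lambda>x. cis (x i)) \<in> borel_measurable (torus n)" if "i < n" for i
    using measurable_compose[OF m[OF that] cis_measurable] .
  show ?thesis unfolding vdm2_def
    by (intro borel_measurable_prod borel_measurable_power borel_measurable_norm borel_measurable_diff c) auto
qed

lemma dist_cis_le: "norm (cis a - cis b) \<le> 2"
  using norm_triangle_ineq4[of "cis a" "cis b"] by simp

text \<open>Isolates the double zero where two points meet, with a bounded cofactor. It is what
  makes a quotient by \<open>cis (x 0) - cis (x j)\<close> integrable against
  \<open>vdm2\<close>.\<close>

lemma vdm2_split:
  assumes "0 < j" "j < n"
  obtains R where "vdm2 n x = (norm (cis (x 0) - cis (x j)))\<^sup>2 * R" "0 \<le> R" "R \<le> 4 ^ (n * n)"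
proof -
  let ?f = "\<lambda>(i, k). (norm (cis (x i) - cis (x k)))\<^sup>2"
  let ?S = "SIGMA i:{..<n}. {..<i}"
  have eq: "vdm2 n x = prod ?f ?S"
    unfolding vdm2_def by (subst prod.Sigma) auto
  also have "\<dots> = ?f (j, 0) * prod ?f (?S - {(j, 0)})"
    using assms by (subst prod.remove[of _ "(j, 0)"]) auto
  finally have 1: "vdm2 n x = (norm (cis (x 0) - cis (x j)))\<^sup>2 * prod ?f (?S - {(j, 0)})"
    by (simp add: norm_minus_commute)
  have "prod ?f (?S - {(j, 0)}) \<le> (\<Prod>p\<in>?S - {(j, 0)}. 4)"
  proof (intro prod_mono conjI)
    fix p :: "nat \<times> nat"
    have "(norm (cis (x (fst p)) - cis (x (snd p))))\<^sup>2 \<le> 2\<^sup>2" by (intro power_mono dist_cis_le) auto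
    then show "?f p \<le> 4" by (simp add: case_prod_beta)
  qed (auto simp: case_prod_beta)
  also have "\<dots> = 4 ^ card (?S - {(j, 0)})" by simp
  also have "\<dots> \<le> 4 ^ (n * n)"
  proof (rule power_increasing)
    have "card (?S - {(j, 0)}) \<le> card ({..<n} \<times> {..<n})" by (intro card_mono) auto
    then show "card (?S - {(j, 0)}) \<le> n * n" by simp
  qed simp
  finally show ?thesis using 1 by (intro that[of "prod ?f (?S - {(j, 0)})"] prod_nonneg) auto
qed

lemma vdm2_bound: "vdm2 n x \<le> 4 ^ (n * n)"
proof -
  have "vdm2 n x \<le> (\<Prod>i<n. \<Prod>k<i. 4)" unfolding vdm2_def
  proof (intro prod_mono conjI prod_nonneg ballI)
    fix i k
    have "(norm (cis (x i) - cis (x k)))\<^sup>2 \<le> 2\<^sup>2" by (intro power_mono dist_cis_le) auto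
    then show "(norm (cis (x i) - cis (x k)))\<^sup>2 \<le> 4" by simp
  qed auto
  also have "\<dots> \<le> (\<Prod>i<n. 4 ^ n)" by (intro prod_mono conjI) (auto intro: power_increasing)
  also have "\<dots> = 4 ^ (n * n)" by (simp add: power_mult)
  finally show ?thesis .
qed

section \<open>The Dunkl equation for the Vandermonde density\<close>

definition weyl_coeff :: "nat \<Rightarrow> (nat \<Rightarrow> int) \<Rightarrow> complex" where
  "weyl_coeff n \<kappa> = (\<integral>x. mono_z n (\<lambda>i. cis (x i)) \<kappa> * of_real (vdm2 n x) \<partial>torus n)"

lemma component_torus: "i < n \<Longrightarrow> (\<lambda>x. x i) \<in> borel_measurable (torus n)"
  using measurable_component_singleton[of i "{..<n}" "\<lambda>_. circ"] by simp

lemma mono_torus: "(\<lambda>x. mono_z n (\<lambda>i. cis (x i)) \<kappa>) \<in> borel_measurable (torus n)"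
  by (intro mono_z_measurable component_torus)

lemma integrable_torus:
  fixes f :: "(nat \<Rightarrow> real) \<Rightarrow> complex"
  assumes "f \<in> borel_measurable (torus n)" "\<And>x. norm (f x) \<le> C"
  shows "integrable (torus n) f"
  by (rule finite_measure.integrable_const_bound[OF finite_measure_torus, where B = C]) (use assms in auto)

lemma integrable_weyl: "integrable (torus n) (\<lambda>x. mono_z n (\<lambda>i. cis (x i)) \<kappa> * of_real (vdm2 n x))"
proof (rule integrable_torus[where C = "4 ^ (n * n)"])
  show "(\<lambda>x. mono_z n (\<lambda>i. cis (x i)) \<kappa> * of_real (vdm2 n x)) \<in> borel_measurable (torus n)"
    using mono_torus by measurable
qed (simp add: norm_mult norm_mono_z vdm2_nonneg vdm2_bound)

lemma torus_swap:
  fixes f :: "(nat \<Rightarrow> real) \<Rightarrow> complex"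
  assumes s: "\<sigma> permutes {..<n}" and f: "f \<in> borel_measurable (torus n)"
    and g: "\<And>x. f (restrict (x \<circ> \<sigma>) {..<n}) = g x"
  shows "(\<integral>x. f x \<partial>torus n) = (\<integral>x. g x \<partial>torus n)"
  using integral_distr[OF permute_torus_measurable[OF s] f] by (simp add: distr_torus_permute[OF s] g)

lemma mono_z_cong: "(\<And>i. i < n \<Longrightarrow> z i = w i) \<Longrightarrow> mono_z n z \<kappa> = mono_z n w \<kappa>"
  unfolding mono_z_def by (intro prod.cong) auto

lemma mono_z_permute:
  assumes s: "\<sigma> permutes {..<n}"
  shows "mono_z n (\<lambda>i. z (\<sigma> i)) (\<kappa> \<circ> \<sigma>) = mono_z n z \<kappa>"
  unfolding mono_z_def using prod.reindex_bij_betw[OF permutes_imp_bij[OF s], of "\<lambda>i. z i powi \<kappa> i"] by simp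

lemma weyl_coeff_swap:
  assumes ij: "i < n" "j < n"
  shows "weyl_coeff n (\<kappa> \<circ> Transposition.transpose i j) = weyl_coeff n \<kappa>"
proof -
  let ?t = "Transposition.transpose i j"
  have t: "?t permutes {..<n}" using ij by (intro permutes_swap_id) auto
  show ?thesis unfolding weyl_coeff_def
  proof (rule torus_swap[OF t])
    show "(\<lambda>x. mono_z n (\<lambda>i. cis (x i)) (\<kappa> \<circ> ?t) * of_real (vdm2 n x)) \<in> borel_measurable (torus n)"
      using mono_torus by measurable
    fix x :: "nat \<Rightarrow> real"
    have "mono_z n (\<lambda>i. cis (restrict (x \<circ> ?t) {..<n} i)) (\<kappa> \<circ> ?t) = mono_z n (\<lambda>i. cis (x (?t i))) (\<kappa> \<circ> ?t)"
      by (rule mono_z_cong) simp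
    moreover have "vdm2 n (restrict (x \<circ> ?t) {..<n}) = vdm2 n (\<lambda>i. x (?t i))" by (rule vdm2_cong) simp
    ultimately show "mono_z n (\<lambda>i. cis (restrict (x \<circ> ?t) {..<n} i)) (\<kappa> \<circ> ?t) * of_real (vdm2 n (restrict (x \<circ> ?t) {..<n}))
      = mono_z n (\<lambda>i. cis (x i)) \<kappa> * of_real (vdm2 n x)"
      using mono_z_permute[OF t, of "\<lambda>i. cis (x i)" \<kappa>] vdm2_permute[OF t, of x] by simp
  qed
qed

text \<open>The divided difference is \<open>q\<close> times the difference of a monomial and its
  transpose. Swapping the two variables in the second half, under which \<open>vdm2\<close> is
  invariant, restores the monomial and turns \<open>q\<close> into \<open>q'\<close>; and
  \<open>q - q'\<close> is the quotient of sum and difference.\<close>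

lemma integral_exch:
  assumes j: "0 < j" "j < n"
  shows "(\<integral>x. exch n (\<lambda>i. cis (x i)) 0 j \<kappa> * of_real (vdm2 n x) \<partial>torus n)
    = (\<integral>x. (cis (x 0) + cis (x j)) / (cis (x 0) - cis (x j)) * (mono_z n (\<lambda>i. cis (x i)) \<kappa> * of_real (vdm2 n x)) \<partial>torus n)"
    and "integrable (torus n) (\<lambda>x. (cis (x 0) + cis (x j)) / (cis (x 0) - cis (x j)) * (mono_z n (\<lambda>i. cis (x i)) \<kappa> * of_real (vdm2 n x)))"
proof -
  let ?t = "Transposition.transpose 0 j"
  have n: "0 < n" using j by simp
  have t: "?t permutes {..<n}" using j by (intro permutes_swap_id) auto
  define W where "W \<mu> x = mono_z n (\<lambda>i. cis (x i)) \<mu> * of_real (vdm2 n x)" for \<mu> and x :: "nat \<Rightarrow> real"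
  define q where "q x = cis (x 0) / (cis (x 0) - cis (x j))" for x :: "nat \<Rightarrow> real"
  define q' where "q' x = cis (x j) / (cis (x j) - cis (x 0))" for x :: "nat \<Rightarrow> real"
  have [measurable]: "(\<lambda>x. x 0) \<in> borel_measurable (torus n)" "(\<lambda>x. x j) \<in> borel_measurable (torus n)"
    using component_torus n j by auto
  have Wm [measurable]: "W \<mu> \<in> borel_measurable (torus n)" for \<mu>
    unfolding W_def using mono_torus by measurable
  have qm [measurable]: "q \<in> borel_measurable (torus n)" "q' \<in> borel_measurable (torus n)"
    unfolding q_def q'_def by measurable
  have bd: "norm (q x * W \<mu> x) \<le> 2 * 4 ^ (n * n) \<and> norm (q' x * W \<mu> x) \<le> 2 * 4 ^ (n * n)" for x \<mu>
  proof -
    obtain R where R: "vdm2 n x = (norm (cis (x 0) - cis (x j)))\<^sup>2 * R" "0 \<le> R" "R \<le> 4 ^ (n * n)"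
      using vdm2_split[OF j] by blast
    have "1 / d * (d\<^sup>2 * R) \<le> 2 * 4 ^ (n * n)" if "0 \<le> d" "d \<le> 2" for d
    proof (cases "d = 0")
      case False
      then have "1 / d * (d\<^sup>2 * R) = d * R" by (simp add: power2_eq_square)
      also have "\<dots> \<le> 2 * 4 ^ (n * n)" using that R by (intro mult_mono) auto
      finally show ?thesis .
    qed simp
    from this[of "norm (cis (x 0) - cis (x j))"] have "1 / norm (cis (x 0) - cis (x j)) * vdm2 n x \<le> 2 * 4 ^ (n * n)"
      unfolding R by (simp add: dist_cis_le)
    then show ?thesis unfolding q_def q'_def W_def
      by (simp add: norm_mult norm_divide norm_mono_z vdm2_nonneg norm_minus_commute[of "cis (x j)"])
  qed
  have i: "integrable (torus n) (\<lambda>x. q x * W \<mu> x)" "integrable (torus n) (\<lambda>x. q' x * W \<mu> x)" for \<mu>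
    using bd by (auto intro!: integrable_torus[where C = "2 * 4 ^ (n * n)"])
  have U: "(cis (x 0) + cis (x j)) / (cis (x 0) - cis (x j)) * (mono_z n (\<lambda>i. cis (x i)) \<kappa> * of_real (vdm2 n x)) = q x * W \<kappa> x - q' x * W \<kappa> x" for x
  proof -
    have "q' x = - cis (x j) / (cis (x 0) - cis (x j))"
      unfolding q'_def by (metis minus_diff_eq minus_divide_divide)
    then show ?thesis unfolding q_def W_def by (simp add: add_divide_distrib algebra_simps)
  qed
  have E: "exch n (\<lambda>i. cis (x i)) 0 j \<kappa> * of_real (vdm2 n x) = q x * W \<kappa> x - q x * W (\<kappa> \<circ> ?t) x" for x
  proof (cases "cis (x 0) = cis (x j)")
    \<comment> \<open>Where the two points coincide, \<open>vdm2\<close> vanishes and both sides are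
      0.\<close>
    case True
    obtain R where R: "vdm2 n x = (norm (cis (x 0) - cis (x j)))\<^sup>2 * R" using vdm2_split[OF j] by blast
    then show ?thesis using True by (simp add: W_def)
  next
    case False
    have 1: "mono_z n z \<mu> = z 0 powi \<mu> 0 * z j powi \<mu> j * (\<Prod>i\<in>{..<n} - {0, j}. z i powi \<mu> i)" for z \<mu>
    proof -
      have "mono_z n z \<mu> = (\<Prod>i\<in>insert 0 (insert j ({..<n} - {0, j})). z i powi \<mu> i)"
        unfolding mono_z_def using j by (intro prod.cong) auto
      then show ?thesis using j by simp
    qed
    have 2: "(\<Prod>i\<in>{..<n} - {0, j}. z i powi (\<kappa> \<circ> ?t) i) = (\<Prod>i\<in>{..<n} - {0, j}. z i powi \<kappa> i)" for z :: "nat \<Rightarrow> complex"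
      by (intro prod.cong refl) (auto simp: Transposition.transpose_def)
    let ?z = "\<lambda>i. cis (x i)"
    have "(?z 0 - ?z j) * exch n ?z 0 j \<kappa> = ?z 0 * (mono_z n ?z \<kappa> - mono_z n ?z (\<kappa> \<circ> ?t))"
      unfolding exch_eq_tsym[OF n j(2) less_imp_neq[OF j(1)]] mult.assoc[symmetric] tsym_mult[OF cis_neq_zero cis_neq_zero]
      unfolding 1[of _ \<kappa>] 1[of _ "\<kappa> \<circ> ?t"] 2 by (simp add: algebra_simps)
    then have ex: "exch n ?z 0 j \<kappa> = q x * (mono_z n ?z \<kappa> - mono_z n ?z (\<kappa> \<circ> ?t))"
      using False unfolding q_def by (simp add: field_simps)
    show ?thesis unfolding W_def ex by (simp add: algebra_simps)
  qed
  have "(\<integral>x. q x * W (\<kappa> \<circ> ?t) x \<partial>torus n) = (\<integral>x. q' x * W \<kappa> x \<partial>torus n)"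
  proof (rule torus_swap[OF t])
    fix x :: "nat \<Rightarrow> real"
    have "mono_z n (\<lambda>i. cis (restrict (x \<circ> ?t) {..<n} i)) (\<kappa> \<circ> ?t) = mono_z n (\<lambda>i. cis (x (?t i))) (\<kappa> \<circ> ?t)"
      by (rule mono_z_cong) simp
    moreover have "vdm2 n (restrict (x \<circ> ?t) {..<n}) = vdm2 n (\<lambda>i. x (?t i))" by (rule vdm2_cong) simp
    ultimately show "q (restrict (x \<circ> ?t) {..<n}) * W (\<kappa> \<circ> ?t) (restrict (x \<circ> ?t) {..<n}) = q' x * W \<kappa> x"
      using mono_z_permute[OF t, of "\<lambda>i. cis (x i)" \<kappa>] vdm2_permute[OF t, of x] n j by (simp add: q_def q'_def W_def)
  qed measurable
  then show "(\<integral>x. exch n (\<lambda>i. cis (x i)) 0 j \<kappa> * of_real (vdm2 n x) \<partial>torus n)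
    = (\<integral>x. (cis (x 0) + cis (x j)) / (cis (x 0) - cis (x j)) * (mono_z n (\<lambda>i. cis (x i)) \<kappa> * of_real (vdm2 n x)) \<partial>torus n)"
    unfolding E U using i by simp
  show "integrable (torus n) (\<lambda>x. (cis (x 0) + cis (x j)) / (cis (x 0) - cis (x j)) * (mono_z n (\<lambda>i. cis (x i)) \<kappa> * of_real (vdm2 n x)))"
    unfolding U using i by simp
qed

text \<open>The squared distance of two points on the circle is a trigonometric polynomial in the
  angle. Its logarithmic derivative is the quotient produced by \<open>integral_exch\<close>, up to
  \<open>\<i>\<close>; the product form also holds where the points meet, both sides being
  0.\<close>

lemma norm_sq_cis_deriv:
  fixes w :: complex
  assumes w: "norm w = 1"
  shows "((\<lambda>y. complex_of_real ((norm (w - cis y))\<^sup>2)) has_vector_derivative \<i> * (w * cis (- t) - cnj w * cis t)) (at t)"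
    and "\<i> * (w * cis (- t) - cnj w * cis t) = \<i> * ((cis t + w) / (cis t - w)) * complex_of_real ((norm (w - cis t))\<^sup>2)"
proof -
  have ww: "w * cnj w = 1" using w complex_norm_square[of w] by simp
  have e: "complex_of_real ((norm (w - cis y))\<^sup>2) = 2 - w * cis (- y) - cnj w * cis y" for y
    unfolding complex_norm_square using ww by (simp add: cis_cnj algebra_simps cis_mult)
  have "((\<lambda>z. 2 - w * exp (- \<i> * z) - cnj w * exp (\<i> * z)) has_field_derivative \<i> * (w * exp (- \<i> * of_real t) - cnj w * exp (\<i> * of_real t))) (at (of_real t))"
    by (auto intro!: derivative_eq_intros simp: algebra_simps)
  from has_vector_derivative_real_field[OF this]
  show "((\<lambda>y. complex_of_real ((norm (w - cis y))\<^sup>2)) has_vector_derivative \<i> * (w * cis (- t) - cnj w * cis t)) (at t)"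
    unfolding e by (simp add: cis_conv_exp)
  show "\<i> * (w * cis (- t) - cnj w * cis t) = \<i> * ((cis t + w) / (cis t - w)) * complex_of_real ((norm (w - cis t))\<^sup>2)"
  proof (cases "cis t = w")
    case True
    have "cis (- t) = cnj w" using True by (simp add: cis_cnj[symmetric])
    then show ?thesis using True by (simp add: mult.commute)
  next
    case False
    have key: "(cis t - w) * (w * cis (- t) - cnj w * cis t) = (cis t + w) * (2 - w * cis (- t) - cnj w * cis t)"
    proof -
      have "(z + w) * (2 - w * z' - w' * z) - (z - w) * (w * z' - w' * z) = 2 * z * (1 - w * w') + 2 * w * (1 - z * z')"
        for z z' w' :: complex by (simp add: algebra_simps)
      from this[of "cis t" "cis (- t)" "cnj w"] show ?thesis using ww by (simp add: cis_mult)
    qed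
    have "w * cis (- t) - cnj w * cis t = (cis t + w) * (2 - w * cis (- t) - cnj w * cis t) / (cis t - w)"
      unfolding key[symmetric] using False by simp
    then have "\<i> * (w * cis (- t) - cnj w * cis t) = \<i> * ((cis t + w) * (2 - w * cis (- t) - cnj w * cis t) / (cis t - w))"
      by (simp only:)
    then show ?thesis unfolding e by (simp only: times_divide_eq_left times_divide_eq_right mult.assoc)
  qed
qed

text \<open>Up to the factor \<open>\<i>\<close> the integrand is the derivative of
  \<open>G\<close>, which takes equal values at 0 and \<open>2 * pi\<close>.\<close>

lemma integral_circ_logderiv:
  fixes x :: "nat \<Rightarrow> real" and k :: int
  assumes "finite J"
  shows "(\<integral>y. (of_int k + (\<Sum>j\<in>J. (cis y + cis (x j)) / (cis y - cis (x j)))) *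
     (cis (of_int k * y) * (\<Prod>j\<in>J. complex_of_real ((norm (cis (x j) - cis y))\<^sup>2))) \<partial>circ) = 0"
proof -
  define h where "h j y = complex_of_real ((norm (cis (x j) - cis y))\<^sup>2)" for j y
  define d where "d j y = \<i> * (cis (x j) * cis (- y) - cnj (cis (x j)) * cis y)" for j y
  define G where "G y = cis (of_int k * y) * (\<Prod>j\<in>J. h j y)" for y
  define G' where "G' y = cis (of_int k * y) * (\<Sum>j\<in>J. d j y * (\<Prod>l\<in>J - {j}. h l y)) + (\<i> * of_int k * cis (of_int k * y)) * (\<Prod>j\<in>J. h j y)" for y
  have hd: "(h j has_vector_derivative d j t) (at t)" for j t
    unfolding h_def d_def by (rule norm_sq_cis_deriv(1)) simp
  have hc: "continuous_on UNIV (h j)" for j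
    by (rule continuous_at_imp_continuous_on) (use hd has_vector_derivative_continuous in blast)
  have pd: "((\<lambda>y. \<Prod>j\<in>J. h j y) has_vector_derivative (\<Sum>j\<in>J. d j t * (\<Prod>l\<in>J - {j}. h l t))) (at t)" for t
  proof -
    have "((\<lambda>y. \<Prod>j\<in>J. h j y) has_derivative (\<lambda>y. \<Sum>j\<in>J. (y *\<^sub>R d j t) * (\<Prod>l\<in>J - {j}. h l t))) (at t)"
      using hd unfolding has_vector_derivative_def by (intro has_derivative_prod) auto
    then show ?thesis unfolding has_vector_derivative_def by (simp add: scaleR_sum_right)
  qed
  have cd: "((\<lambda>y. cis (of_int k * y)) has_vector_derivative \<i> * of_int k * cis (of_int k * t)) (at t)" for t
  proof -
    have "((\<lambda>z. exp (\<i> * of_int k * z)) has_field_derivative \<i> * of_int k * exp (\<i> * of_int k * of_real t)) (at (of_real t))"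
      by (auto intro!: derivative_eq_intros)
    from has_vector_derivative_real_field[OF this] show ?thesis by (simp add: cis_conv_exp mult.assoc)
  qed
  have Gd: "(G has_vector_derivative G' t) (at t)" for t
    unfolding G_def G'_def using has_vector_derivative_mult[OF cd pd] .
  have G'c: "continuous_on UNIV G'" unfolding G'_def
    by (intro continuous_intros hc) (auto simp: d_def intro!: continuous_intros)
  have per: "G (2 * pi) = G 0"
  proof -
    have "cis (of_int k * (2 * pi)) = 1" using cis_multiple_2pi[of "of_int k"] by (simp add: mult.commute)
    then show ?thesis unfolding G_def h_def by simp
  qed
  have "(\<integral>y. G' y \<partial>circ) = 0" using integral_circ_FTC[OF Gd G'c] per by simp
  moreover have "G' y = \<i> * ((of_int k + (\<Sum>j\<in>J. (cis y + cis (x j)) / (cis y - cis (x j)))) * (cis (of_int k * y) * (\<Prod>j\<in>J. h j y)))" for y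
  proof -
    have "d j y * (\<Prod>l\<in>J - {j}. h l y) = \<i> * ((cis y + cis (x j)) / (cis y - cis (x j))) * (\<Prod>l\<in>J. h l y)" if "j \<in> J" for j
      using that assms norm_sq_cis_deriv(2)[of "cis (x j)" y] by (simp add: d_def h_def prod.remove[of J j] mult.assoc)
    then have "(\<Sum>j\<in>J. d j y * (\<Prod>l\<in>J - {j}. h l y)) = (\<Sum>j\<in>J. \<i> * ((cis y + cis (x j)) / (cis y - cis (x j))) * (\<Prod>l\<in>J. h l y))"
      by (rule sum.cong[OF refl])
    then show ?thesis unfolding G'_def by (simp add: sum_distrib_left sum_distrib_right algebra_simps)
  qed
  ultimately show ?thesis unfolding h_def by simp
qed

text \<open>By Fubini the variable \<open>x 0\<close> is integrated first. The factors of the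
  monomial and of \<open>vdm2\<close> that contain it have the shape of
  \<open>integral_circ_logderiv\<close>; the rest is the constant \<open>C\<close>.\<close>

lemma integral_torus_logderiv:
  assumes n: "0 < n"
  shows "(\<integral>x. (of_int (\<kappa> 0) + (\<Sum>j\<in>{..<n} - {0}. (cis (x 0) + cis (x j)) / (cis (x 0) - cis (x j)))) *
     (mono_z n (\<lambda>i. cis (x i)) \<kappa> * of_real (vdm2 n x)) \<partial>torus n) = 0" (is "(\<integral>x. ?F x \<partial>_) = 0")
proof -
  let ?J = "{..<n} - {0}"
  have int: "integrable (torus n) ?F"
    unfolding distrib_right sum_distrib_right
    by (intro Bochner_Integration.integrable_add Bochner_Integration.integrable_sum integrable_mult_right integrable_weyl integral_exch(2)) auto
  have tor: "torus n = PiM (insert 0 ?J) (\<lambda>_. circ)"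
    using n by (intro arg_cong2[where f = PiM]) auto
  have "(\<integral>x. ?F x \<partial>torus n) = (\<integral>x. \<integral>y. ?F (x(0 := y)) \<partial>circ \<partial>PiM ?J (\<lambda>_. circ))"
    using int unfolding tor by (intro circ_prod.product_integral_insert) auto
  also have "\<dots> = (\<integral>x. 0 \<partial>PiM ?J (\<lambda>_. circ))"
  proof (rule Bochner_Integration.integral_cong[OF refl])
    fix x :: "nat \<Rightarrow> real"
    define C where "C = (\<Prod>i\<in>?J. cis (x i) powi \<kappa> i) * of_real (\<Prod>i<n. \<Prod>k\<in>{1..<i}. (norm (cis (x i) - cis (x k)))\<^sup>2)"
    have v: "vdm2 n (x(0 := y)) = (\<Prod>j\<in>?J. (norm (cis (x j) - cis y))\<^sup>2) * (\<Prod>i<n. \<Prod>k\<in>{1..<i}. (norm (cis (x i) - cis (x k)))\<^sup>2)" for y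
    proof -
      have "vdm2 n (x(0 := y)) = (\<Prod>i<n. (if i = 0 then 1 else (norm (cis (x i) - cis y))\<^sup>2) * (\<Prod>k\<in>{1..<i}. (norm (cis (x i) - cis (x k)))\<^sup>2))"
        unfolding vdm2_def
      proof (rule prod.cong[OF refl])
        fix i assume "i \<in> {..<n}"
        show "(\<Prod>k<i. (norm (cis ((x(0 := y)) i) - cis ((x(0 := y)) k)))\<^sup>2)
          = (if i = 0 then 1 else (norm (cis (x i) - cis y))\<^sup>2) * (\<Prod>k\<in>{1..<i}. (norm (cis (x i) - cis (x k)))\<^sup>2)"
        proof (cases "i = 0")
          case False
          then have "{..<i} = insert 0 {1..<i}" by auto
          then show ?thesis using False by simp
        qed simp
      qed
      also have "\<dots> = (\<Prod>i<n. (if i = 0 then 1 else (norm (cis (x i) - cis y))\<^sup>2)) * (\<Prod>i<n. \<Prod>k\<in>{1..<i}. (norm (cis (x i) - cis (x k)))\<^sup>2)"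
        by (rule prod.distrib)
      also have "(\<Prod>i<n. (if i = 0 then 1 else (norm (cis (x i) - cis y))\<^sup>2)) = (\<Prod>j\<in>?J. (norm (cis (x j) - cis y))\<^sup>2)"
        by (rule prod.mono_neutral_cong_right) auto
      finally show ?thesis .
    qed
    have m: "mono_z n (\<lambda>i. cis ((x(0 := y)) i)) \<kappa> = cis (of_int (\<kappa> 0) * y) * (\<Prod>i\<in>?J. cis (x i) powi \<kappa> i)" for y
      unfolding mono_z_def using n by (subst prod.remove[of _ 0]) (auto simp: cis_power_int intro!: prod.cong)
    have Fe: "?F (x(0 := y)) = (of_int (\<kappa> 0) + (\<Sum>j\<in>?J. (cis y + cis (x j)) / (cis y - cis (x j)))) *
     (cis (of_int (\<kappa> 0) * y) * (\<Prod>j\<in>?J. complex_of_real ((norm (cis (x j) - cis y))\<^sup>2))) * C" for y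
      unfolding m v C_def by (simp add: mult_ac)
    have "(\<integral>y. ?F (x(0 := y)) \<partial>circ) = (\<integral>y. (of_int (\<kappa> 0) + (\<Sum>j\<in>?J. (cis y + cis (x j)) / (cis y - cis (x j)))) *
     (cis (of_int (\<kappa> 0) * y) * (\<Prod>j\<in>?J. complex_of_real ((norm (cis (x j) - cis y))\<^sup>2))) * C \<partial>circ)"
      by (rule Bochner_Integration.integral_cong[OF refl]) (rule Fe)
    also have "\<dots> = 0"
      using integral_circ_logderiv[of ?J "\<kappa> 0" x] by (simp only: integral_mult_left_zero) simp
    finally show "(\<integral>y. ?F (x(0 := y)) \<partial>circ) = 0" .
  qed
  finally show ?thesis by simp
qed

text \<open>The Euler term is the logarithmic derivative of the monomial in \<open>x 0\<close>, and
  by \<open>integral_exch\<close> the exchange terms integrate like that of \<open>vdm2\<close>.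
  Together they form a total derivative.\<close>

lemma dunkl_weyl_coeff:
  assumes n: "0 < n"
  shows "dunkl n (weyl_coeff n) \<kappa> = 0"
proof -
  let ?z = "\<lambda>x i. cis (x i)"
  have "dunkl n (weyl_coeff n) \<kappa> = (\<integral>x. dunkl n (\<lambda>\<kappa>. mono_z n (?z x) \<kappa> * of_real (vdm2 n x)) \<kappa> \<partial>torus n)"
    using integral_dunkl(2)[where M = "torus n" and f = "\<lambda>x \<kappa>. mono_z n (\<lambda>i. cis (x i)) \<kappa> * of_real (vdm2 n x)"
      and n = n and \<kappa> = \<kappa>, OF integrable_weyl]
    by (simp add: weyl_coeff_def[abs_def])
  also have "\<dots> = (\<integral>x. of_int (\<kappa> 0) * (mono_z n (?z x) \<kappa> * of_real (vdm2 n x)) + (\<Sum>j\<in>{..<n} - {0}. exch n (?z x) 0 j \<kappa> * of_real (vdm2 n x)) \<partial>torus n)"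
    unfolding dunkl_def exch_def isum_cmult(2) ..
  also have "\<dots> = of_int (\<kappa> 0) * weyl_coeff n \<kappa> + (\<Sum>j\<in>{..<n} - {0}. \<integral>x. exch n (?z x) 0 j \<kappa> * of_real (vdm2 n x) \<partial>torus n)"
  proof -
    have e: "integrable (torus n) (\<lambda>x. exch n (?z x) 0 j \<kappa> * of_real (vdm2 n x))" for j
      unfolding exch_def isum_cmult(2) by (intro integrable_isum(1) integrable_weyl)
    show ?thesis
      by (subst Bochner_Integration.integral_add) (auto intro!: integrable_weyl e Bochner_Integration.integrable_sum simp: weyl_coeff_def Bochner_Integration.integral_sum[OF e])
  qed
  also have "\<dots> = (\<integral>x. of_int (\<kappa> 0) * (mono_z n (?z x) \<kappa> * of_real (vdm2 n x)) + (\<Sum>j\<in>{..<n} - {0}. (?z x 0 + ?z x j) / (?z x 0 - ?z x j) * (mono_z n (?z x) \<kappa> * of_real (vdm2 n x))) \<partial>torus n)"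
  proof -
    have e: "integrable (torus n) (\<lambda>x. (?z x 0 + ?z x j) / (?z x 0 - ?z x j) * (mono_z n (?z x) \<kappa> * of_real (vdm2 n x)))" if "j \<in> {..<n} - {0}" for j
      using integral_exch(2)[of j n \<kappa>] that by simp
    have "(\<Sum>j\<in>{..<n} - {0}. \<integral>x. exch n (?z x) 0 j \<kappa> * of_real (vdm2 n x) \<partial>torus n)
       = (\<Sum>j\<in>{..<n} - {0}. \<integral>x. (?z x 0 + ?z x j) / (?z x 0 - ?z x j) * (mono_z n (?z x) \<kappa> * of_real (vdm2 n x)) \<partial>torus n)"
      using integral_exch(1) by (intro sum.cong) auto
    also have "\<dots> = (\<integral>x. (\<Sum>j\<in>{..<n} - {0}. (?z x 0 + ?z x j) / (?z x 0 - ?z x j) * (mono_z n (?z x) \<kappa> * of_real (vdm2 n x))) \<partial>torus n)"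
      by (rule Bochner_Integration.integral_sum[symmetric]) (rule e)
    finally have 1: "(\<Sum>j\<in>{..<n} - {0}. \<integral>x. exch n (?z x) 0 j \<kappa> * of_real (vdm2 n x) \<partial>torus n)
      = (\<integral>x. (\<Sum>j\<in>{..<n} - {0}. (?z x 0 + ?z x j) / (?z x 0 - ?z x j) * (mono_z n (?z x) \<kappa> * of_real (vdm2 n x))) \<partial>torus n)" .
    have es: "integrable (torus n) (\<lambda>x. \<Sum>j\<in>{..<n} - {0}. (?z x 0 + ?z x j) / (?z x 0 - ?z x j) * (mono_z n (?z x) \<kappa> * of_real (vdm2 n x)))"
      by (rule Bochner_Integration.integrable_sum) (rule e)
    have i0: "integrable (torus n) (\<lambda>x. of_int (\<kappa> 0) * (mono_z n (?z x) \<kappa> * of_real (vdm2 n x)))"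
      by (intro integrable_mult_right integrable_weyl)
    show ?thesis unfolding 1 weyl_coeff_def using Bochner_Integration.integral_add[OF i0 es] by simp
  qed
  also have "\<dots> = (\<integral>x. (of_int (\<kappa> 0) + (\<Sum>j\<in>{..<n} - {0}. (?z x 0 + ?z x j) / (?z x 0 - ?z x j))) * (mono_z n (?z x) \<kappa> * of_real (vdm2 n x)) \<partial>torus n)"
    by (simp only: distrib_right sum_distrib_right)
  also have "\<dots> = 0" by (rule integral_torus_logderiv[OF n])
  finally show ?thesis .
qed

lemma weyl_coeff_cnj: "weyl_coeff n (\<lambda>i. - \<kappa> i) = cnj (weyl_coeff n \<kappa>)"
proof -
  have "cnj (weyl_coeff n \<kappa>) = (\<integral>x. cnj (mono_z n (\<lambda>i. cis (x i)) \<kappa> * of_real (vdm2 n x)) \<partial>torus n)"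
    unfolding weyl_coeff_def by (rule Bochner_Integration.integral_cnj[symmetric])
  then show ?thesis unfolding weyl_coeff_def mono_z_cnj by simp
qed

text \<open>Both Fourier transforms are killed by the Dunkl operator, which determines them up to scaling.\<close>

lemma (in haar_unitary) sym_coeff_eq_weyl_coeff:
  assumes n: "0 < n" and s: "\<And>i. i \<ge> n \<Longrightarrow> \<kappa> i = 0"
  shows "weyl_coeff n (\<lambda>_. 0) * sym_coeff \<kappa> = fact n * weyl_coeff n \<kappa>"
proof -
  \<comment> \<open>The weights make \<open>d\<close> vanish at exponent 0, where
    \<open>sym_coeff\<close> equals \<open>fact n\<close>; this is the normalization that
    \<open>eq_0\<close> asks for.\<close>
  define d where "d \<kappa> = weyl_coeff n (\<lambda>_. 0) * sym_coeff \<kappa> - fact n * weyl_coeff n \<kappa>" for \<kappa>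
  interpret S: dunkl_sym n sym_coeff by (rule dunkl_sym_sym_coeff[OF n])
  interpret dunkl_sym n d
    by standard (simp_all add: n d_def weyl_coeff_swap S.sym)
  have real: "cnj (weyl_coeff n (\<lambda>_. 0)) = weyl_coeff n (\<lambda>_. 0)"
    using weyl_coeff_cnj[of n "\<lambda>_. 0"] by simp
  have "d \<kappa> = 0"
  proof (rule eq_0)
    fix \<kappa> :: "nat \<Rightarrow> int" assume k: "\<And>i. n \<le> i \<Longrightarrow> \<kappa> i = 0"
    show "dunkl n d \<kappa> = 0" unfolding d_def dunkl_diff_cmult
      using dunkl_sym_coeff[OF n k] dunkl_weyl_coeff[OF n] by simp
  next
    fix \<kappa>
    show "d (\<lambda>i. - \<kappa> i) = cnj (d \<kappa>)" by (simp add: d_def weyl_coeff_cnj sym_coeff_cnj real)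
  qed (use s in \<open>auto simp: d_def sym_coeff_0\<close>)
  then show ?thesis by (simp add: d_def)
qed

lemma sets_torus: "sets (torus n) = sets (PiM {..<n} (\<lambda>_. borel))"
  by (intro sets_PiM_cong) auto

definition weyl_measure :: "nat \<Rightarrow> (nat \<Rightarrow> real) measure" where
  "weyl_measure n = density (torus n) (\<lambda>x. ennreal (rho n n x / fact n))"

lemma rho_0: "rho n 0 x = 1"
  by (simp add: rho_def kmat_def Determinant.det_def)

lemma nn_integral_torus_0: "(\<integral>\<^sup>+x. f x \<partial>torus 0) = f (\<lambda>_. undefined)"
  using circ_prod.nn_integral_empty[of f] by simp

lemma nn_integral_rho_full: "(\<integral>\<^sup>+x. ennreal (rho n n x) \<partial>torus n) = of_nat (fact n)"
  using nn_integral_marginal[of 0 n "\<lambda>_. 1"] unfolding nn_integral_torus_0 rho_0 by simp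

lemma nn_integral_weyl_measure:
  assumes [measurable]: "f \<in> borel_measurable (torus n)"
  shows "of_nat (fact n) * (\<integral>\<^sup>+x. f x \<partial>weyl_measure n) = (\<integral>\<^sup>+x. f x * ennreal (rho n n x) \<partial>torus n)"
proof -
  have "of_nat (fact n) * (\<integral>\<^sup>+x. f x \<partial>weyl_measure n) = (\<integral>\<^sup>+x. of_nat (fact n) * (ennreal (rho n n x / fact n) * f x) \<partial>torus n)"
    unfolding weyl_measure_def by (subst nn_integral_density) (auto simp: nn_integral_cmult)
  also have "\<dots> = (\<integral>\<^sup>+x. f x * ennreal (rho n n x) \<partial>torus n)"
  proof (intro nn_integral_cong)
    fix x
    have "of_nat (fact n) * ennreal (rho n n x / fact n) = ennreal (real (fact n) * (rho n n x / fact n))"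
      by (subst ennreal_mult) (auto simp: rho_nonneg ennreal_of_nat_eq_real_of_nat)
    also have "\<dots> = ennreal (rho n n x)" by simp
    finally show "of_nat (fact n) * (ennreal (rho n n x / fact n) * f x) = f x * ennreal (rho n n x)"
      by (metis mult.assoc mult.commute)
  qed
  finally show ?thesis .
qed

lemma sets_weyl_measure [measurable_cong, simp]: "sets (weyl_measure n) = sets (torus n)"
  by (simp add: weyl_measure_def)

lemma space_weyl_measure: "space (weyl_measure n) = space (torus n)"
  by (simp add: weyl_measure_def)

lemma ennreal_fact_cancel: "of_nat (fact n) * x = of_nat (fact n) * y \<Longrightarrow> x = (y :: ennreal)"
  by (subst (asm) ennreal_mult_cancel_left) (auto simp: of_nat_eq_0_iff)

lemma prob_space_weyl_measure: "prob_space (weyl_measure n)"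
proof
  have "of_nat (fact n) * (\<integral>\<^sup>+x. 1 \<partial>weyl_measure n) = of_nat (fact n) * 1"
    by (subst nn_integral_weyl_measure) (auto simp: nn_integral_rho_full)
  then show "emeasure (weyl_measure n) (space (weyl_measure n)) = 1"
    using ennreal_fact_cancel by fastforce
qed

lemma rho_permute:
  assumes "\<sigma> permutes {..<n}" shows "rho n n (restrict (x \<circ> \<sigma>) {..<n}) = rho n n x"
proof -
  have "rho n n (restrict (x \<circ> \<sigma>) {..<n}) = rho n n (\<lambda>i. x (\<sigma> i))" by (rule rho_cong) simp
  then show ?thesis by (simp add: rho_eq_vdm2 vdm2_permute[OF assms])
qed

lemma nn_integral_weyl_permute:
  assumes s: "\<sigma> permutes {..<n}" and [measurable]: "f \<in> borel_measurable (torus n)"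
  shows "(\<integral>\<^sup>+x. f (restrict (x \<circ> \<sigma>) {..<n}) \<partial>weyl_measure n) = (\<integral>\<^sup>+x. f x \<partial>weyl_measure n)"
proof (rule ennreal_fact_cancel)
  note [measurable] = permute_torus_measurable[OF s]
  have "of_nat (fact n) * (\<integral>\<^sup>+x. f (restrict (x \<circ> \<sigma>) {..<n}) \<partial>weyl_measure n)
    = (\<integral>\<^sup>+x. f (restrict (x \<circ> \<sigma>) {..<n}) * ennreal (rho n n (restrict (x \<circ> \<sigma>) {..<n})) \<partial>torus n)"
    unfolding rho_permute[OF s] by (rule nn_integral_weyl_measure) measurable
  also have "\<dots> = (\<integral>\<^sup>+x. f x * ennreal (rho n n x) \<partial>distr (torus n) (torus n) (\<lambda>x. restrict (x \<circ> \<sigma>) {..<n}))"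
    by (subst nn_integral_distr) (auto simp: permute_torus_measurable[OF s])
  also have "\<dots> = of_nat (fact n) * (\<integral>\<^sup>+x. f x \<partial>weyl_measure n)"
    unfolding distr_torus_permute[OF s] by (rule nn_integral_weyl_measure[symmetric]) measurable
  finally show "of_nat (fact n) * (\<integral>\<^sup>+x. f (restrict (x \<circ> \<sigma>) {..<n}) \<partial>weyl_measure n) = of_nat (fact n) * (\<integral>\<^sup>+x. f x \<partial>weyl_measure n)" .
qed

section \<open>Correlation functions as expected numbers of tuples\<close>

definition injections :: "nat \<Rightarrow> nat \<Rightarrow> (nat \<Rightarrow> nat) set" where
  "injections m n = {f \<in> {..<m} \<rightarrow>\<^sub>E {..<n}. inj_on f {..<m}}"

lemma finite_injections [simp]: "finite (injections m n)"
  unfolding injections_def by (rule finite_subset[of _ "{..<m} \<rightarrow>\<^sub>E {..<n}"]) (auto intro: finite_PiE)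

lemma card_injections: "m \<le> n \<Longrightarrow> card (injections m n) * fact (n - m) = fact n"
proof -
  assume mn: "m \<le> n"
  have "card (injections m n) = prod ((-) n) {0..<m}"
    unfolding injections_def using card_inj_on_subset_funcset[of "{..<m}" "{..<n}" "{..<m}"] by simp
  moreover have "prod ((-) n) {0..<m} * fact (n - m) = fact n" using mn
  proof (induction m)
    case (Suc m)
    have "fact (n - m) = (n - m) * (fact (n - Suc m) :: nat)" using Suc.prems by (metis Suc_diff_Suc Suc_le_lessD fact_Suc of_nat_id)
    then show ?case using Suc by (simp add: mult.assoc)
  qed simp
  ultimately show ?thesis by simp
qed

lemma injection_extends:
  assumes f: "f \<in> injections m n"
  obtains \<sigma> where "\<sigma> permutes {..<n}" "\<And>i. i < m \<Longrightarrow> \<sigma> i = f i"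
proof -
  have inj: "inj_on f {..<m}" and im: "f ` {..<m} \<subseteq> {..<n}" using f by (auto simp: injections_def)
  have cf: "card (f ` {..<m}) = m" using card_image[OF inj] by simp
  have mn: "m \<le> n" using card_mono[OF _ im] cf by simp
  have "card ({..<n} - {..<m}) = card ({..<n} - f ` {..<m})"
    using mn im cf by (simp add: card_Diff_subset)
  then obtain g where g: "bij_betw g ({..<n} - {..<m}) ({..<n} - f ` {..<m})"
    using finite_same_card_bij[of "{..<n} - {..<m}" "{..<n} - f ` {..<m}"] by auto
  define \<sigma> where "\<sigma> i = (if i < m then f i else if i < n then g i else i)" for i
  have "bij_betw \<sigma> {..<m} (f ` {..<m})"
    by (rule bij_betw_cong[THEN iffD1, of _ f]) (use inj in \<open>auto simp: \<sigma>_def bij_betw_def\<close>)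
  moreover have "bij_betw \<sigma> ({..<n} - {..<m}) ({..<n} - f ` {..<m})"
    by (rule bij_betw_cong[THEN iffD1, of _ g]) (use g in \<open>auto simp: \<sigma>_def\<close>)
  ultimately have "bij_betw \<sigma> ({..<m} \<union> ({..<n} - {..<m})) (f ` {..<m} \<union> ({..<n} - f ` {..<m}))"
    by (rule bij_betw_combine) auto
  moreover have "{..<m} \<union> ({..<n} - {..<m}) = {..<n}" "f ` {..<m} \<union> ({..<n} - f ` {..<m}) = {..<n}" using mn im by auto
  ultimately have "bij_betw \<sigma> {..<n} {..<n}" by simp
  then have "\<sigma> permutes {..<n}" by (rule bij_imp_permutes) (use mn in \<open>auto simp: \<sigma>_def\<close>)
  then show ?thesis by (rule that) (simp add: \<sigma>_def)
qed

text \<open>The characteristic property of correlation functions. An injection extends to a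
  permutation, under which the law is invariant, so every tuple of distinct indices contributes the
  same marginal; the number of tuples cancels the factorials in \<open>weyl_measure\<close> and
  \<open>nn_integral_marginal\<close>.\<close>

lemma nn_integral_count_injections:
  assumes mn: "m \<le> n" and Q [measurable]: "Q \<in> sets (torus m)"
  shows "(\<integral>\<^sup>+x. of_nat (card {f \<in> injections m n. restrict (x \<circ> f) {..<m} \<in> Q}) \<partial>weyl_measure n)
    = (\<integral>\<^sup>+y. indicator Q y * ennreal (rho n m y) \<partial>torus m)" (is "?L = ?R")
proof (rule ennreal_fact_cancel[of "n - m"])
  have r [measurable]: "(\<lambda>x. restrict x {..<m}) \<in> measurable (torus n) (torus m)"
    using mn by (intro measurable_restrict_subset) auto
  have one: "of_nat (fact n) * (\<integral>\<^sup>+x. indicator Q (restrict (x \<circ> f) {..<m}) \<partial>weyl_measure n) = of_nat (fact (n - m)) * ?R"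
    if f: "f \<in> injections m n" for f
  proof -
    obtain \<sigma> where s: "\<sigma> permutes {..<n}" "\<And>i. i < m \<Longrightarrow> \<sigma> i = f i" using injection_extends[OF f] by metis
    have "restrict (x \<circ> f) {..<m} = restrict (restrict (x \<circ> \<sigma>) {..<n}) {..<m}" for x :: "nat \<Rightarrow> real"
      using s mn by (auto simp: fun_eq_iff restrict_def)
    then have "(\<integral>\<^sup>+x. indicator Q (restrict (x \<circ> f) {..<m}) \<partial>weyl_measure n)
      = (\<integral>\<^sup>+x. indicator Q (restrict (restrict (x \<circ> \<sigma>) {..<n}) {..<m}) \<partial>weyl_measure n)" by simp
    also have "\<dots> = (\<integral>\<^sup>+x. indicator Q (restrict x {..<m}) \<partial>weyl_measure n)"
      by (rule nn_integral_weyl_permute[OF s(1)]) measurable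
    finally have eq: "(\<integral>\<^sup>+x. indicator Q (restrict (x \<circ> f) {..<m}) \<partial>weyl_measure n)
      = (\<integral>\<^sup>+x. indicator Q (restrict x {..<m}) \<partial>weyl_measure n)" .
    have mm: "(\<lambda>x. indicator Q (restrict x {..<m}) :: ennreal) \<in> borel_measurable (torus n)" by measurable
    show ?thesis unfolding eq
      by (simp only: nn_integral_weyl_measure[OF mm] nn_integral_marginal[OF mn borel_measurable_indicator[OF Q]])
  qed
  have meas: "(\<lambda>x. indicator Q (restrict (x \<circ> f) {..<m}) :: ennreal) \<in> borel_measurable (weyl_measure n)" if f: "f \<in> injections m n" for f
  proof -
    have "(\<lambda>x. restrict (x \<circ> f) {..<m}) \<in> measurable (torus n) (torus m)"
      unfolding comp_def using f by (intro measurable_restrict measurable_component_singleton) (auto simp: injections_def)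
    then show ?thesis by measurable
  qed
  have "?L = (\<integral>\<^sup>+x. (\<Sum>f\<in>injections m n. indicator Q (restrict (x \<circ> f) {..<m})) \<partial>weyl_measure n)"
    by (intro nn_integral_cong) (simp add: indicator_def sum.If_cases Int_def)
  also have "\<dots> = (\<Sum>f\<in>injections m n. \<integral>\<^sup>+x. indicator Q (restrict (x \<circ> f) {..<m}) \<partial>weyl_measure n)"
    by (rule nn_integral_sum) (rule meas)
  finally have L: "?L = (\<Sum>f\<in>injections m n. \<integral>\<^sup>+x. indicator Q (restrict (x \<circ> f) {..<m}) \<partial>weyl_measure n)" .
  have "of_nat (fact n) * ?L = (\<Sum>f\<in>injections m n. of_nat (fact (n - m)) * ?R)"
    unfolding L sum_distrib_left by (intro sum.cong refl one)
  also have "\<dots> = of_nat (card (injections m n) * fact (n - m)) * ?R"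
    by (simp only: sum_constant of_nat_mult mult.assoc)
  also have "\<dots> = of_nat (fact n) * ?R" unfolding card_injections[OF mn] ..
  finally have "?L = ?R" by (rule ennreal_fact_cancel)
  then show "of_nat (fact (n - m)) * ?L = of_nat (fact (n - m)) * ?R" by simp
qed

lemma AE_torus: "AE x in torus n. \<forall>i<n. x i \<in> {0..<2 * pi}"
proof -
  have "AE x in torus n. x i \<in> {0..<2 * pi}" if i: "i < n" for i
  proof -
    let ?B = "PiE {..<n} (\<lambda>j. if j = i then - {0..<2 * pi} else UNIV)"
    have B: "?B \<in> sets (torus n)" by (intro sets_PiM_I_finite) auto
    have "emeasure circ (- {0..<2 * pi}) = 0" by (simp add: emeasure_circ)
    then have "emeasure (torus n) ?B = 0"
      using i by (subst circ_prod.emeasure_PiM) (auto intro!: prod_zero)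
    then have "?B \<in> null_sets (torus n)" using B by auto
    moreover have "{x \<in> space (torus n). \<not> x i \<in> {0..<2 * pi}} \<subseteq> ?B"
      by (auto simp: space_PiM PiE_def Pi_def)
    ultimately show ?thesis by (rule AE_I')
  qed
  then have "AE x in torus n. i < n \<longrightarrow> x i \<in> {0..<2 * pi}" for i
    by (cases "i < n") simp_all
  then show ?thesis unfolding AE_all_countable by blast
qed

text \<open>The density vanishes where two coordinates coincide. This allows close pairs to be
  defined with a strict inequality, although a double eigenvalue would have spacing 0.\<close>

lemma AE_weyl_distinct: "AE x in weyl_measure n. \<forall>i<n. \<forall>j<n. i \<noteq> j \<longrightarrow> x i \<noteq> x j"
proof -
  have "AE x in torus n. 0 < ennreal (rho n n x / fact n) \<longrightarrow> (\<forall>i<n. \<forall>j<n. i \<noteq> j \<longrightarrow> x i \<noteq> x j)"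
  proof (intro AE_I2 impI allI)
    fix x i j assume r: "0 < ennreal (rho n n x / fact n)" and ij: "i < n" "j < n" "i \<noteq> j"
    show "x i \<noteq> x j"
    proof
      assume "x i = x j"
      then have "(\<Prod>k\<in>{..<n} - {i}. norm (cis (x i) - cis (x k))) = 0"
        using ij by (intro prod_zero bexI[of _ j]) auto
      then have "vdm2 n x = 0" unfolding vdm2_symmetric using ij(1) by (intro prod_zero[OF finite_lessThan] bexI[of _ i]) simp_all
      then show False using r by (simp add: rho_eq_vdm2)
    qed
  qed
  then show ?thesis unfolding weyl_measure_def by (subst AE_density) auto
qed

section \<open>Weyl's formula for the symmetrized law\<close>

context haar_unitary
begin

text \<open>The sorted list composed with an independent uniform permutation: sorting breaks
  exchangeability, and a comparison with \<open>weyl_measure\<close> has to restore it.\<close>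

definition sym_law :: "(nat \<Rightarrow> real) measure" where
  "sym_law = distr (uniform_count_measure {\<sigma>. \<sigma> permutes {..<n}} \<Otimes>\<^sub>M M) (PiM {..<n} (\<lambda>_. borel))
     (\<lambda>(\<sigma>, A). \<lambda>i\<in>{..<n}. eigenangles A ! \<sigma> i)"

lemma sym_law_map_measurable:
  "(\<lambda>(\<sigma>, A). \<lambda>i\<in>{..<n}. eigenangles A ! \<sigma> i)
     \<in> measurable (uniform_count_measure {\<sigma>. \<sigma> permutes {..<n}} \<Otimes>\<^sub>M M) (PiM {..<n} (\<lambda>_. borel))"
proof -
  let ?P = "{\<sigma>. \<sigma> permutes {..<n}}"
  have "(\<lambda>(\<sigma>, A). \<lambda>i\<in>{..<n}. eigenangles A ! \<sigma> i) \<in> measurable (count_space ?P \<Otimes>\<^sub>M M) (PiM {..<n} (\<lambda>_. borel))"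
  proof (rule measurable_pair_measure_countable1)
    show "countable ?P" by (intro countable_finite finite_permutations) simp
    fix \<sigma> assume "\<sigma> \<in> ?P"
    then show "(\<lambda>A. case (\<sigma>, A) of (\<sigma>, A) \<Rightarrow> \<lambda>i\<in>{..<n}. eigenangles A ! \<sigma> i) \<in> measurable M (PiM {..<n} (\<lambda>_. borel))"
      using permutes_in_image[of \<sigma> "{..<n}"] by (auto intro!: measurable_restrict eigenangle_measurable)
  qed
  moreover have "sets (uniform_count_measure ?P \<Otimes>\<^sub>M M) = sets (count_space ?P \<Otimes>\<^sub>M M)"
    by (intro sets_pair_measure_cong sets_uniform_count_measure_count_space refl)
  ultimately show ?thesis using measurable_cong_sets by blast
qed

lemma prob_space_perms: "prob_space (uniform_count_measure {\<sigma>. \<sigma> permutes {..<n}})"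
  by (rule prob_space_uniform_count_measure) (auto intro: finite_permutations permutes_id)

lemma prob_space_sym_law: "prob_space sym_law"
proof -
  interpret Q: prob_space "uniform_count_measure {\<sigma>. \<sigma> permutes {..<n}}" by (rule prob_space_perms)
  interpret PP: pair_prob_space "uniform_count_measure {\<sigma>. \<sigma> permutes {..<n}}" M ..
  show ?thesis unfolding sym_law_def by (rule PP.P.prob_space_distr) (rule sym_law_map_measurable)
qed

lemma fourier_sym_law:
  "(\<integral>x. (\<Prod>i<n. cis (of_int (\<kappa> i) * x i)) \<partial>sym_law) = sym_coeff \<kappa> / fact n"
proof -
  let ?P = "{\<sigma>. \<sigma> permutes {..<n}}"
  interpret P: prob_space "uniform_count_measure ?P" by (rule prob_space_perms)
  interpret PP: pair_prob_space "uniform_count_measure ?P" M ..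
  note fin = finite_permutations[of "{..<n}", simplified]
  have pm: "(\<lambda>x. \<Prod>i<n. cis (of_int (\<kappa> i) * x i)) \<in> borel_measurable (PiM {..<n} (\<lambda>_. borel))"
  proof (rule borel_measurable_prod)
    fix i assume [measurable]: "i \<in> {..<n}"
    show "(\<lambda>x. cis (of_int (\<kappa> i) * x i)) \<in> borel_measurable (PiM {..<n} (\<lambda>_. borel))" by measurable
  qed
  have "(\<integral>x. (\<Prod>i<n. cis (of_int (\<kappa> i) * x i)) \<partial>sym_law)
    = (\<integral>p. (\<Prod>i<n. cis (of_int (\<kappa> i) * (case p of (\<sigma>, A) \<Rightarrow> \<lambda>i\<in>{..<n}. eigenangles A ! \<sigma> i) i)) \<partial>(uniform_count_measure ?P \<Otimes>\<^sub>M M))"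
    unfolding sym_law_def by (rule integral_distr[OF sym_law_map_measurable pm])
  also have "\<dots> = (\<integral>\<sigma>. \<integral>A. (\<Prod>i<n. cis (of_int (\<kappa> i) * (case (\<sigma>, A) of (\<sigma>, A) \<Rightarrow> \<lambda>i\<in>{..<n}. eigenangles A ! \<sigma> i) i)) \<partial>M \<partial>uniform_count_measure ?P)"
  proof (rule PP.integral_fst'[symmetric])
    show "integrable (uniform_count_measure ?P \<Otimes>\<^sub>M M) (\<lambda>p. \<Prod>i<n. cis (of_int (\<kappa> i) * (case p of (\<sigma>, A) \<Rightarrow> \<lambda>i\<in>{..<n}. eigenangles A ! \<sigma> i) i))"
    proof (rule PP.P.integrable_const_bound[where B = 1])
      show "(\<lambda>p. \<Prod>i<n. cis (of_int (\<kappa> i) * (case p of (\<sigma>, A) \<Rightarrow> \<lambda>i\<in>{..<n}. eigenangles A ! \<sigma> i) i)) \<in> borel_measurable (uniform_count_measure ?P \<Otimes>\<^sub>M M)"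
        by (rule measurable_compose[OF sym_law_map_measurable pm])
    qed (auto simp: prod_norm[symmetric])
  qed
  also have "\<dots> = (\<integral>\<sigma>. \<integral>A. mono_z n (\<lambda>i. cis (eigenangles A ! \<sigma> i)) \<kappa> \<partial>M \<partial>uniform_count_measure ?P)"
    by (intro Bochner_Integration.integral_cong refl) (auto simp: mono_z_def cis_power_int intro!: prod.cong)
  also have "\<dots> = (\<Sum>\<sigma>\<in>?P. (1 / card ?P) *\<^sub>R (\<integral>A. mono_z n (\<lambda>i. cis (eigenangles A ! \<sigma> i)) \<kappa> \<partial>M))"
    unfolding uniform_count_measure_def using fin by (subst lebesgue_integral_point_measure_finite) auto
  also have "\<dots> = sym_coeff \<kappa> / fact n"
    unfolding sym_coeff_def using card_permutations[of "{..<n}" n] integrable_mono_z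
    by (subst Bochner_Integration.integral_sum) (auto simp: scaleR_conv_of_real sum_divide_distrib)
  finally show ?thesis .
qed

lemma weyl_coeff_0: "weyl_coeff n (\<lambda>_. 0) = of_real ((2 * pi) ^ n * fact n)"
proof -
  have "(\<integral>x. vdm2 n x \<partial>torus n) = enn2real (\<integral>\<^sup>+x. ennreal (vdm2 n x) \<partial>torus n)"
    by (rule integral_eq_nn_integral) (auto simp: vdm2_nonneg)
  also have "(\<integral>\<^sup>+x. ennreal (vdm2 n x) \<partial>torus n) = (\<integral>\<^sup>+x. ennreal ((2 * pi) ^ n) * ennreal (rho n n x) \<partial>torus n)"
    by (intro nn_integral_cong) (simp add: rho_eq_vdm2 ennreal_mult[symmetric] vdm2_nonneg)
  also have "\<dots> = ennreal ((2 * pi) ^ n) * of_nat (fact n)"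
    by (simp add: nn_integral_cmult nn_integral_rho_full)
  also have "\<dots> = ennreal ((2 * pi) ^ n * fact n)" by (simp add: ennreal_mult ennreal_of_nat_eq_real_of_nat)
  finally have "(\<integral>x. vdm2 n x \<partial>torus n) = (2 * pi) ^ n * fact n" by simp
  then show ?thesis unfolding weyl_coeff_def by (simp add: mono_z_def integral_complex_of_real)
qed

text \<open>Both laws live on the torus, and uniqueness for the Dunkl equation identifies their
  Fourier coefficients once both are divided by their value at exponent 0.\<close>

theorem sym_law_eq_weyl:
  assumes n: "0 < n"
  shows "sym_law = weyl_measure n"
proof (rule fourier_determines_PiM[where n = n])
  interpret L: prob_space sym_law by (rule prob_space_sym_law)
  interpret W: prob_space "weyl_measure n" by (rule prob_space_weyl_measure)
  show "finite_measure sym_law" by (rule L.finite_measure_axioms)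
  show "finite_measure (weyl_measure n)" by (rule W.finite_measure_axioms)
  show "sets sym_law = sets (PiM {..<n} (\<lambda>_. borel))" by (simp add: sym_law_def)
  show "sets (weyl_measure n) = sets (PiM {..<n} (\<lambda>_. borel))" by (simp add: sets_torus)
  show "AE x in sym_law. \<forall>i<n. x i \<in> {0..<2*pi}"
    unfolding sym_law_def
  proof (rule AE_distr_iff[OF sym_law_map_measurable, THEN iffD2])
    have "{x \<in> space (PiM {..<n} (\<lambda>_. borel)). \<forall>i<n. x i \<in> {0..<2*pi}} = PiE {..<n} (\<lambda>_. {0..<2*pi})"
      by (auto simp: space_PiM PiE_def Pi_def)
    then show "{x \<in> space (PiM {..<n} (\<lambda>_. borel)). \<forall>i<n. x i \<in> {0..<2*pi}} \<in> sets (PiM {..<n} (\<lambda>_. borel))"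
      by (simp only:) (intro sets_PiM_I_finite, auto)
    show "AE p in uniform_count_measure {\<sigma>. \<sigma> permutes {..<n}} \<Otimes>\<^sub>M M. \<forall>i<n. (case p of (\<sigma>, A) \<Rightarrow> \<lambda>i\<in>{..<n}. eigenangles A ! \<sigma> i) i \<in> {0..<2*pi}"
    proof (rule AE_I2, clarify)
      fix \<sigma> A i assume "(\<sigma>, A) \<in> space (uniform_count_measure {\<sigma>. \<sigma> permutes {..<n}} \<Otimes>\<^sub>M M)" and i: "i < n"
      then have "\<sigma> permutes {..<n}" "A \<in> unitary_group n" by (auto simp: space_pair_measure space_uniform_count_measure)
      then show "(\<lambda>i\<in>{..<n}. eigenangles A ! \<sigma> i) i \<in> {0..<2*pi}"
        using eigenangles_unitary(2)[of A n "\<sigma> i"] permutes_in_image[of \<sigma> "{..<n}" i] i by simp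
    qed
  qed
  show "AE x in weyl_measure n. \<forall>i<n. x i \<in> {0..<2*pi}"
  proof -
    have "AE x in torus n. 0 < ennreal (rho n n x / fact n) \<longrightarrow> (\<forall>i<n. x i \<in> {0..<2*pi})"
      using AE_torus[of n] by eventually_elim simp
    then show ?thesis unfolding weyl_measure_def by (subst AE_density) auto
  qed
  fix \<kappa> :: "nat \<Rightarrow> int"
  \<comment> \<open>The uniqueness result concerns exponents supported on \<open>{..<n}\<close>; the
    products over \<open>i<n\<close> do not notice the truncation.\<close>
  define \<mu> where "\<mu> i = (if i < n then \<kappa> i else 0)" for i
  have eq: "(\<Prod>i<n. cis (of_int (\<kappa> i) * x i)) = mono_z n (\<lambda>i. cis (x i)) \<mu>" for x :: "nat \<Rightarrow> real"
    unfolding mono_z_def \<mu>_def by (intro prod.cong) (auto simp: cis_power_int)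
  have "(\<integral>x. (\<Prod>i<n. cis (of_int (\<kappa> i) * x i)) \<partial>sym_law) = (\<integral>x. (\<Prod>i<n. cis (of_int (\<mu> i) * x i)) \<partial>sym_law)"
    by (intro Bochner_Integration.integral_cong refl prod.cong) (auto simp: \<mu>_def)
  also have "\<dots> = sym_coeff \<mu> / fact n" by (rule fourier_sym_law)
  also have "\<dots> = weyl_coeff n \<mu> / weyl_coeff n (\<lambda>_. 0)"
    using sym_coeff_eq_weyl_coeff[OF n, of \<mu>] weyl_coeff_0 by (simp add: \<mu>_def field_simps)
  also have "\<dots> = (\<integral>x. mono_z n (\<lambda>i. cis (x i)) \<mu> \<partial>weyl_measure n)"
  proof -
    have "(\<integral>x. mono_z n (\<lambda>i. cis (x i)) \<mu> \<partial>weyl_measure n) = (\<integral>x. (rho n n x / fact n) *\<^sub>R mono_z n (\<lambda>i. cis (x i)) \<mu> \<partial>torus n)"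
      unfolding weyl_measure_def using mono_torus by (intro integral_density) (auto simp: rho_nonneg)
    also have "\<dots> = (\<integral>x. mono_z n (\<lambda>i. cis (x i)) \<mu> * of_real (vdm2 n x) / ((2 * pi) ^ n * fact n) \<partial>torus n)"
      by (intro Bochner_Integration.integral_cong refl) (simp add: rho_eq_vdm2 scaleR_conv_of_real)
    also have "\<dots> = weyl_coeff n \<mu> / weyl_coeff n (\<lambda>_. 0)"
      unfolding weyl_coeff_0 by (simp add: weyl_coeff_def)
    finally show ?thesis ..
  qed
  finally show "(\<integral>x. (\<Prod>i<n. cis (of_int (\<kappa> i) * x i)) \<partial>sym_law) = (\<integral>x. (\<Prod>i<n. cis (of_int (\<kappa> i) * x i)) \<partial>weyl_measure n)"
    unfolding eq by simp
qed

text \<open>A permutation-invariant event does not see the random permutation: its preimage is a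
  full set of permutations times an event of the sorted list. So the sorted list may be evaluated
  under \<open>weyl_measure\<close>.\<close>

lemma emeasure_symmetric_event:
  assumes n: "0 < n" and E: "E \<in> sets (torus n)"
    and sym: "\<And>\<sigma> x. \<sigma> permutes {..<n} \<Longrightarrow> restrict (x \<circ> \<sigma>) {..<n} \<in> E \<longleftrightarrow> restrict x {..<n} \<in> E"
  shows "{A \<in> space M. (\<lambda>i\<in>{..<n}. eigenangles A ! i) \<in> E} \<in> sets M"
    "emeasure M {A \<in> space M. (\<lambda>i\<in>{..<n}. eigenangles A ! i) \<in> E} = emeasure (weyl_measure n) E"
proof -
  let ?P = "{\<sigma>. \<sigma> permutes {..<n}}" and ?S = "{A \<in> space M. (\<lambda>i\<in>{..<n}. eigenangles A ! i) \<in> E}"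
  interpret P: prob_space "uniform_count_measure ?P" by (rule prob_space_perms)
  interpret PP: pair_prob_space "uniform_count_measure ?P" M ..
  have [measurable]: "(\<lambda>A. \<lambda>i\<in>{..<n}. eigenangles A ! i) \<in> measurable M (torus n)"
    by (intro measurable_restrict) (auto intro!: eigenangle_measurable)
  show S: "?S \<in> sets M" using E by measurable
  have E': "E \<in> sets (PiM {..<n} (\<lambda>_. borel))" using E by (simp add: sets_torus)
  have pre: "(\<lambda>(\<sigma>, A). \<lambda>i\<in>{..<n}. eigenangles A ! \<sigma> i) -` E \<inter> space (uniform_count_measure ?P \<Otimes>\<^sub>M M) = ?P \<times> ?S"
    using sym[of _ "\<lambda>i. eigenangles _ ! i"]
    by (auto simp: space_pair_measure space_uniform_count_measure comp_def)
  have "emeasure (weyl_measure n) E = emeasure (uniform_count_measure ?P \<Otimes>\<^sub>M M) (?P \<times> ?S)"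
    unfolding sym_law_eq_weyl[OF n, symmetric] sym_law_def
    by (simp only: emeasure_distr[OF sym_law_map_measurable E'] pre)
  also have "\<dots> = emeasure (uniform_count_measure ?P) ?P * emeasure M ?S"
    using S by (intro emeasure_pair_measure_Times) (auto simp: sets_uniform_count_measure)
  also have "emeasure (uniform_count_measure ?P) ?P = 1"
    using P.emeasure_space_1 by (simp add: space_uniform_count_measure)
  finally show "emeasure M ?S = emeasure (weyl_measure n) E" by (simp only: mult_1)
qed

end

section \<open>Correlation functions at close pairs\<close>

text \<open>Each product in the Leibniz formula changes by at most the sum of the changes of its
  factors, because all entries are bounded by 1.\<close>

lemma norm_det_diff_le:
  fixes A B :: "complex mat"
  assumes A: "A \<in> carrier_mat m m" and B: "B \<in> carrier_mat m m"
    and bd: "\<And>i j. i < m \<Longrightarrow> j < m \<Longrightarrow> norm (A $$ (i, j)) \<le> 1" "\<And>i j. i < m \<Longrightarrow> j < m \<Longrightarrow> norm (B $$ (i, j)) \<le> 1"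
  shows "norm (Determinant.det A - Determinant.det B) \<le> fact m * (\<Sum>i<m. \<Sum>j<m. norm (A $$ (i, j) - B $$ (i, j)))"
proof -
  let ?d = "\<lambda>i j. norm (A $$ (i, j) - B $$ (i, j))"
  have "Determinant.det A - Determinant.det B
    = (\<Sum>p | p permutes {..<m}. of_int (sign p) * ((\<Prod>i<m. A $$ (i, p i)) - (\<Prod>i<m. B $$ (i, p i))))"
    using A B by (simp add: Determinant.det_def atLeast0LessThan sum_subtractf right_diff_distrib)
  also have "norm \<dots> \<le> (\<Sum>p | p permutes {..<m}. (\<Sum>i<m. \<Sum>j<m. ?d i j))"
  proof (rule sum_norm_le)
    fix p assume "p \<in> {p. p permutes {..<m}}"
    then have p: "p i < m" if "i < m" for i using permutes_in_image[of p "{..<m}" i] that by auto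
    have "norm (of_int (sign p) * ((\<Prod>i<m. A $$ (i, p i)) - (\<Prod>i<m. B $$ (i, p i)))) = norm ((\<Prod>i<m. A $$ (i, p i)) - (\<Prod>i<m. B $$ (i, p i)))"
      by (simp add: norm_mult sign_def)
    also have "\<dots> \<le> (\<Sum>i<m. ?d i (p i))"
      using p bd by (intro norm_prod_diff) auto
    also have "\<dots> \<le> (\<Sum>i<m. \<Sum>j<m. ?d i j)"
    proof (rule sum_mono)
      fix i assume "i \<in> {..<m}"
      then show "?d i (p i) \<le> (\<Sum>j<m. ?d i j)" using p by (intro member_le_sum) auto
    qed
    finally show "norm (of_int (sign p) * ((\<Prod>i<m. A $$ (i, p i)) - (\<Prod>i<m. B $$ (i, p i)))) \<le> (\<Sum>i<m. \<Sum>j<m. ?d i j)" .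
  qed
  also have "\<dots> = fact m * (\<Sum>i<m. \<Sum>j<m. ?d i j)"
    using card_permutations[of "{..<m}" m] by simp
  finally show ?thesis .
qed

lemma norm_det_le:
  fixes A :: "complex mat"
  assumes A: "A \<in> carrier_mat m m" and bd: "\<And>i j. i < m \<Longrightarrow> j < m \<Longrightarrow> norm (A $$ (i, j)) \<le> 1"
  shows "norm (Determinant.det A) \<le> fact m"
proof -
  have "Determinant.det A = (\<Sum>p | p permutes {..<m}. of_int (sign p) * (\<Prod>i<m. A $$ (i, p i)))"
    using A by (simp add: Determinant.det_def atLeast0LessThan)
  also have "norm \<dots> \<le> (\<Sum>p | p permutes {..<m}. 1)"
  proof (rule sum_norm_le)
    fix p assume "p \<in> {p. p permutes {..<m}}"
    then have p: "p i < m" if "i < m" for i using permutes_in_image[of p "{..<m}" i] that by auto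
    have "norm (\<Prod>i<m. A $$ (i, p i)) \<le> 1"
      unfolding prod_norm[symmetric] using p bd by (intro prod_le_1) auto
    then show "norm (of_int (sign p) * (\<Prod>i<m. A $$ (i, p i))) \<le> 1" by (simp add: norm_mult sign_def)
  qed
  also have "\<dots> = fact m" using card_permutations[of "{..<m}" m] by simp
  finally show ?thesis .
qed

text \<open>Conjugating the entries amounts to transposing the matrix. It ensures that real parts of
  Gram determinants multiply in \<open>rho_factorization\<close>.\<close>

lemma det_hermitian_real:
  fixes A :: "complex mat"
  assumes A: "A \<in> carrier_mat m m" and h: "\<And>i j. i < m \<Longrightarrow> j < m \<Longrightarrow> cnj (A $$ (i, j)) = A $$ (j, i)"
  shows "Im (Determinant.det A) = 0"
proof -
  have e: "map_mat cnj A = transpose_mat A" using A h by (intro eq_matI) auto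
  have "cnj (Determinant.det A) = Determinant.det (map_mat cnj A)"
    unfolding Determinant.det_def using A by (auto simp: cnj_sum cnj_prod intro!: sum.cong prod.cong dest: permutes_in_image)
  also have "\<dots> = Determinant.det A" unfolding e using det_transpose[OF A] .
  finally show ?thesis by (simp add: complex_eq_iff)
qed

text \<open>Each of the first \<open>r\<close> pairs \<open>(x (2 q), x (2 q + 1))\<close> of close points contributes the feature vector
  of its first point and a divided difference, scaled to have norm at most 1; this extracts the factor
  \<open>(x (2 q + 1) - x (2 q))\<^sup>2\<close> from the determinant.\<close>

definition gvec :: "nat \<Rightarrow> nat \<Rightarrow> (nat \<Rightarrow> real) \<Rightarrow> nat \<Rightarrow> nat \<Rightarrow> complex" where
  "gvec n r x a l = (if a < 2 * r \<and> odd a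
     then (cis (real l * x a) - cis (real l * x (a - 1))) / of_real ((x a - x (a - 1)) * (real n * sqrt (real n)))
     else cis (real l * x a) / of_real (sqrt (real n)))"

definition gram :: "nat \<Rightarrow> nat \<Rightarrow> (nat \<Rightarrow> real) \<Rightarrow> nat \<Rightarrow> nat \<Rightarrow> complex" where
  "gram n r x a b = (\<Sum>l<n. gvec n r x a l * cnj (gvec n r x b l))"

definition gmat :: "nat \<Rightarrow> nat \<Rightarrow> nat \<Rightarrow> (nat \<Rightarrow> real) \<Rightarrow> complex mat" where
  "gmat n r m x = mat m m (\<lambda>(a, b). gram n r x a b)"

lemma norm_cis_diff_le: "norm (cis a - cis b) \<le> \<bar>a - b\<bar>"
proof -
  have "norm (cis a - cis b) = norm (cis b * (cis (a - b) - 1))" by (simp add: right_diff_distrib cis_mult)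
  also have "\<dots> = norm (cis (a - b) - 1)" by (simp add: norm_mult)
  also have "\<dots> \<le> \<bar>a - b\<bar>"
    using iexp_approx1[of "a - b" 0] by (simp add: cis_conv_exp)
  finally show ?thesis .
qed

text \<open>The chord between the two features of frequency \<open>l < n\<close> is at most
  \<open>n\<close> times the distance of the points, so the extra factor \<open>n\<close> in the
  scaling makes a divided difference no larger than an ordinary feature. For coinciding points
  division by 0 gives 0.\<close>

lemma gvec_bound:
  assumes n: "0 < n" and l: "l < n"
  shows "norm (gvec n r x a l) \<le> 1 / sqrt (real n)"
proof (cases "a < 2 * r \<and> odd a")
  case False
  then have "gvec n r x a l = cis (real l * x a) / of_real (sqrt (real n))" unfolding gvec_def by (rule if_not_P)
  then show ?thesis by (simp add: norm_divide)
next
  case True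
  define s where "s = x a - x (a - 1)"
  have g: "gvec n r x a l = (cis (real l * x a) - cis (real l * x (a - 1))) / of_real (s * (real n * sqrt (real n)))"
    unfolding gvec_def s_def using True by (rule if_P)
  show ?thesis
  proof (cases "s = 0")
    case True then show ?thesis unfolding g by simp
  next
    case False
    have "norm (cis (real l * x a) - cis (real l * x (a - 1))) \<le> \<bar>real l * x a - real l * x (a - 1)\<bar>" by (rule norm_cis_diff_le)
    also have "\<dots> = real l * \<bar>s\<bar>" unfolding s_def by (simp add: right_diff_distrib[symmetric] abs_mult)
    also have "\<dots> \<le> real n * \<bar>s\<bar>" using l by (intro mult_right_mono) auto
    finally have "norm (gvec n r x a l) \<le> real n * \<bar>s\<bar> / (\<bar>s\<bar> * (real n * sqrt (real n)))"
      unfolding g norm_divide norm_of_real abs_mult by (intro frac_le) (use False n in auto)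
    also have "\<dots> = 1 / sqrt (real n)" using False n by simp
    finally show ?thesis .
  qed
qed

lemma gram_bound: "0 < n \<Longrightarrow> norm (gram n r x a b) \<le> 1"
proof -
  assume n: "0 < n"
  have "norm (gram n r x a b) \<le> (\<Sum>l<n. 1 / sqrt (real n) * (1 / sqrt (real n)))"
    unfolding gram_def
  proof (rule sum_norm_le)
    fix l assume "l \<in> {..<n}"
    then have l: "l < n" by simp
    show "norm (gvec n r x a l * cnj (gvec n r x b l)) \<le> 1 / sqrt (real n) * (1 / sqrt (real n))"
      unfolding norm_mult complex_mod_cnj by (intro mult_mono gvec_bound[OF n l]) auto
  qed
  also have "\<dots> = 1" using n by simp
  finally show ?thesis .
qed

lemma gram_cnj: "cnj (gram n r x a b) = gram n r x b a"
  by (simp add: gram_def mult.commute)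

lemma gmat_carrier [simp]: "gmat n r m x \<in> carrier_mat m m"
  by (simp add: gmat_def)

lemma det_gmat_real: "Im (Determinant.det (gmat n r m x)) = 0"
  by (rule det_hermitian_real[OF gmat_carrier]) (simp add: gmat_def gram_cnj)

lemma det_gmat_bound: "0 < n \<Longrightarrow> norm (Determinant.det (gmat n r m x)) \<le> fact m"
  by (rule norm_det_le[OF gmat_carrier]) (simp add: gmat_def gram_bound)

text \<open>The factor \<open>(n / (2 \<pi>))\<^sup>2\<close> of the two kernel rows times the square of the scaling \<open>n (b - a)\<close> in \<open>gvec\<close>.\<close>

definition gpw :: "nat \<Rightarrow> real \<Rightarrow> real \<Rightarrow> real" where
  "gpw n a b = real n ^ 4 * (b - a)\<^sup>2 / (4 * pi\<^sup>2)"

definition hprod :: "nat \<Rightarrow> nat \<Rightarrow> (nat \<Rightarrow> real) \<Rightarrow> real" where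
  "hprod n r x = (\<Prod>q<r. gpw n (x (2 * q)) (x (2 * q + 1)))"

lemma prod_pairs: "(\<Prod>a<2 * r. f a) = (\<Prod>q<r. f (2 * q) * f (2 * q + 1))" for f :: "nat \<Rightarrow> 'a :: comm_monoid_mult"
  by (induction r) (simp_all add: mult.assoc)

text \<open>A lower triangular \<open>T\<close> recovers the plain characters from
  \<open>gvec\<close>: the feature of a second point is that of its partner plus their distance
  times the divided difference. The square of the determinant of \<open>T\<close> gives the
  prefactor.\<close>

lemma rho_eq_gmat:
  assumes n: "0 < n" and m: "2 * r \<le> m"
  shows "rho n m x = (real n / (2 * pi)) ^ (m - 2 * r) * hprod n r x * Re (Determinant.det (gmat n r m x))"
proof -
  define t where "t a = (if a < 2 * r \<and> odd a then (x a - x (a - 1)) * (real n * sqrt (real n)) else sqrt (real n))" for a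
  define T where "T = mat m m (\<lambda>(a, c). complex_of_real (if c = a then t a else if a < 2 * r \<and> odd a \<and> c = a - 1 then sqrt (real n) else 0))"
  have T: "T \<in> carrier_mat m m" by (simp add: T_def)
  have phi: "(\<Sum>c<m. T $$ (a, c) * gvec n r x c l) = cis (real l * x a)" if a: "a < m" for a l
  proof (cases "a < 2 * r \<and> odd a")
    case False
    then have g: "gvec n r x a l = cis (real l * x a) / of_real (sqrt (real n))" unfolding gvec_def by (rule if_not_P)
    have ta: "t a = sqrt (real n)" unfolding t_def using False by (rule if_not_P)
    have "(\<Sum>c<m. T $$ (a, c) * gvec n r x c l) = (\<Sum>c<m. if c = a then of_real (t a) * gvec n r x a l else 0)"
      using a False by (intro sum.cong) (auto simp: T_def)
    also have "\<dots> = of_real (sqrt (real n)) * gvec n r x a l" using a by (simp add: ta)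
    finally show ?thesis unfolding g using n by simp
  next
    case True
    define s where "s = x a - x (a - 1)"
    have "a > 0" using True by (auto intro: odd_pos)
    then have a1: "odd a" "a > 0" "a - 1 < m" "a - 1 \<noteq> a" using True a by auto
    have g: "gvec n r x a l = (cis (real l * x a) - cis (real l * x (a - 1))) / of_real (s * (real n * sqrt (real n)))"
      unfolding gvec_def s_def using True by (rule if_P)
    have ta: "t a = s * (real n * sqrt (real n))" unfolding t_def s_def using True by (rule if_P)
    have g1: "gvec n r x (a - 1) l = cis (real l * x (a - 1)) / of_real (sqrt (real n))" 
      unfolding gvec_def using a1 by simp
    have "(\<Sum>c<m. T $$ (a, c) * gvec n r x c l)
      = (\<Sum>c<m. (if c = a then of_real (t a) * gvec n r x a l else 0) + (if c = a - 1 then of_real (sqrt (real n)) * gvec n r x (a - 1) l else 0))"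
      using a a1 True by (intro sum.cong) (auto simp: T_def)
    also have "\<dots> = of_real (t a) * gvec n r x a l + of_real (sqrt (real n)) * gvec n r x (a - 1) l"
      using a a1 by (simp add: sum.distrib)
    also have "of_real (sqrt (real n)) * gvec n r x (a - 1) l = cis (real l * x (a - 1))" unfolding g1 using n by simp
    also have "of_real (t a) * gvec n r x a l = cis (real l * x a) - cis (real l * x (a - 1))"
    proof (cases "s = 0")
      case False then show ?thesis unfolding g ta using n by simp
    next
      case s0: True
      then have "x a = x (a - 1)" by (simp add: s_def)
      then show ?thesis unfolding g by simp
    qed
    finally show ?thesis by simp
  qed
  define G where "G = gmat n r m x"
  have G: "G \<in> carrier_mat m m" by (simp add: G_def)
  define c0 where "c0 = 1 / (2 * complex_of_real pi)"
  have "kmat n m x = c0 \<cdot>\<^sub>m (T * G * transpose_mat T)"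
  proof (rule eq_matI)
    fix a b assume "a < dim_row (c0 \<cdot>\<^sub>m (T * G * transpose_mat T))" "b < dim_col (c0 \<cdot>\<^sub>m (T * G * transpose_mat T))"
    then have ab: "a < m" "b < m" using T G by auto
    have cT: "cnj (T $$ (b, d)) = T $$ (b, d)" if "d < m" for d using ab that by (simp add: T_def)
    have "(T * G * transpose_mat T) $$ (a, b) = (\<Sum>d<m. (\<Sum>c<m. T $$ (a, c) * gram n r x c d) * T $$ (b, d))"
      using ab T G by (simp add: scalar_prod_def atLeast0LessThan G_def gmat_def)
    also have "\<dots> = (\<Sum>d<m. \<Sum>c<m. \<Sum>l<n. T $$ (a, c) * gvec n r x c l * (T $$ (b, d) * cnj (gvec n r x d l)))"
      unfolding gram_def sum_distrib_left sum_distrib_right by (intro sum.cong refl) (simp add: mult_ac)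
    also have "\<dots> = (\<Sum>l<n. (\<Sum>c<m. T $$ (a, c) * gvec n r x c l) * (\<Sum>d<m. T $$ (b, d) * cnj (gvec n r x d l)))"
      unfolding sum_product by (subst sum.swap, subst (2) sum.swap, subst sum.swap) (intro sum.cong refl sum.swap)
    also have "\<dots> = (\<Sum>l<n. cis (real l * x a) * cnj (cis (real l * x b)))"
    proof (intro sum.cong refl arg_cong2[where f = "(*)"] phi ab)
      fix l
      have "(\<Sum>d<m. T $$ (b, d) * cnj (gvec n r x d l)) = cnj (\<Sum>d<m. T $$ (b, d) * gvec n r x d l)"
        unfolding cnj_sum by (intro sum.cong refl) (simp add: cT)
      then show "(\<Sum>d<m. T $$ (b, d) * cnj (gvec n r x d l)) = cnj (cis (real l * x b))" using phi[OF ab(2)] by simp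
    qed
    finally show "kmat n m x $$ (a, b) = (c0 \<cdot>\<^sub>m (T * G * transpose_mat T)) $$ (a, b)"
      using ab T G by (simp add: kmat_def dker_def c0_def cis_cnj cis_mult right_diff_distrib)
  qed (use T G in \<open>auto simp: kmat_def\<close>)
  then have "Determinant.det (kmat n m x) = c0 ^ m * (Determinant.det T * Determinant.det G * Determinant.det T)"
    using T G by (simp add: det_smult det_mult[of _ m] det_transpose)
  also have "Determinant.det T = of_real (\<Prod>a<m. t a)"
  proof -
    have "Determinant.det T = prod_list (diag_mat T)"
    proof (rule det_lower_triangular[OF _ T])
      fix i j assume "i < j" "j < m"
      then show "T $$ (i, j) = 0" unfolding T_def by auto
    qed
    then show ?thesis by (simp add: prod_list_diag_prod T_def atLeast0LessThan)
  qed
  also have "c0 = of_real (1 / (2 * pi))" by (simp add: c0_def)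
  also have "of_real (1 / (2 * pi)) ^ m * (of_real (\<Prod>a<m. t a) * Determinant.det G * of_real (\<Prod>a<m. t a))
    = of_real ((1 / (2 * pi)) ^ m * (\<Prod>a<m. t a)\<^sup>2) * Determinant.det G"
    by (simp add: power2_eq_square)
  finally have e: "Determinant.det (kmat n m x) = of_real ((1 / (2 * pi)) ^ m * (\<Prod>a<m. t a)\<^sup>2) * Determinant.det G" .
  have re: "Re (of_real u * z) = u * Re z" for u z by simp
  have "rho n m x = ((1 / (2 * pi)) ^ m * (\<Prod>a<m. t a)\<^sup>2) * Re (Determinant.det G)"
    unfolding rho_def e re ..
  also have "(1 / (2 * pi)) ^ m * (\<Prod>a<m. t a)\<^sup>2 = (\<Prod>a<m. (t a)\<^sup>2 / (2 * pi))"
  proof -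
    have "(\<Prod>a<m. (t a)\<^sup>2 / (2 * pi)) = (\<Prod>a<m. 1 / (2 * pi) * (t a)\<^sup>2)" by simp
    then show ?thesis by (simp only: prod.distrib prod_constant card_lessThan prod_power_distrib)
  qed
  also have "\<dots> = (\<Prod>a<2 * r. (t a)\<^sup>2 / (2 * pi)) * (\<Prod>a\<in>{2 * r..<m}. (t a)\<^sup>2 / (2 * pi))"
  proof -
    have "{..<m} = {..<2 * r} \<union> {2 * r..<m}" using m by auto
    then have "(\<Prod>a<m. (t a)\<^sup>2 / (2 * pi)) = (\<Prod>a\<in>{..<2 * r} \<union> {2 * r..<m}. (t a)\<^sup>2 / (2 * pi))"
      by (rule arg_cong[where f = "prod (\<lambda>a. (t a)\<^sup>2 / (2 * pi))"])
    also have "\<dots> = (\<Prod>a<2 * r. (t a)\<^sup>2 / (2 * pi)) * (\<Prod>a\<in>{2 * r..<m}. (t a)\<^sup>2 / (2 * pi))"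
      by (rule prod.union_disjoint) auto
    finally show ?thesis .
  qed
  also have "(\<Prod>a\<in>{2 * r..<m}. (t a)\<^sup>2 / (2 * pi)) = (real n / (2 * pi)) ^ (m - 2 * r)"
  proof -
    have "(\<Prod>a\<in>{2 * r..<m}. (t a)\<^sup>2 / (2 * pi)) = (\<Prod>a\<in>{2 * r..<m}. real n / (2 * pi))"
      by (rule prod.cong[OF refl]) (auto simp: t_def)
    then show ?thesis by (simp only: prod_constant card_atLeastLessThan)
  qed
  also have "(\<Prod>a<2 * r. (t a)\<^sup>2 / (2 * pi)) = hprod n r x"
    unfolding prod_pairs hprod_def
  proof (rule prod.cong[OF refl])
    fix q assume "q \<in> {..<r}"
    then have q: "2 * q + 1 < 2 * r" by simp
    have t0: "(t (2 * q))\<^sup>2 = real n" by (simp add: t_def)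
    have "t (2 * q + 1) = (x (2 * q + 1) - x (2 * q)) * (real n * sqrt (real n))" using q by (simp add: t_def)
    then have t1: "(t (2 * q + 1))\<^sup>2 = (x (2 * q + 1) - x (2 * q))\<^sup>2 * (real n ^ 2 * real n)"
      by (simp add: power_mult_distrib)
    have p4: "real n ^ 4 = real n * (real n ^ 2 * real n)" by (simp add: power2_eq_square power4_eq_xxxx)
    show "(t (2 * q))\<^sup>2 / (2 * pi) * ((t (2 * q + 1))\<^sup>2 / (2 * pi)) = gpw n (x (2 * q)) (x (2 * q + 1))"
      unfolding t0 t1 gpw_def p4 by (simp add: power2_eq_square)
  qed
  finally show ?thesis by (simp add: G_def mult_ac)
qed

lemma gpw_shift: "gpw n a (a + s) = real n ^ 4 / (4 * pi\<^sup>2) * s\<^sup>2"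
  by (simp add: gpw_def)

lemma gpw_nonneg: "0 \<le> gpw n a b"
  by (simp add: gpw_def)

lemma hprod_nonneg: "0 \<le> hprod n r x"
  by (auto simp: hprod_def intro!: prod_nonneg gpw_nonneg)

lemma rho_even_bound:
  assumes "0 < n" shows "rho n (2 * r) x \<le> fact (2 * r) * hprod n r x"
proof -
  have "Re (Determinant.det (gmat n r (2 * r) x)) \<le> fact (2 * r)"
    using det_gmat_bound[OF assms, of r "2 * r" x] complex_Re_le_cmod order_trans by blast
  from mult_left_mono[OF this hprod_nonneg[of n r x]] show ?thesis
    using rho_eq_gmat[OF assms, of r "2 * r" x] by (simp add: mult.commute)
qed

lemma rho_odd_bound:
  assumes "0 < n" shows "rho n (2 * r + 1) x \<le> real n / (2 * pi) * (fact (2 * r + 1) * hprod n r x)"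
proof -
  have "Re (Determinant.det (gmat n r (2 * r + 1) x)) \<le> fact (2 * r + 1)"
    using det_gmat_bound[OF assms, of r "2 * r + 1" x] complex_Re_le_cmod order_trans by blast
  from mult_left_mono[OF this, of "real n / (2 * pi) * hprod n r x"] show ?thesis
    using rho_eq_gmat[OF assms, of r "2 * r + 1" x] hprod_nonneg[of n r x] by (simp add: mult_ac)
qed

text \<open>Measures the coupling of the last pair to the earlier ones: half the entrywise distance
  between the Gram matrix of \<open>Suc r\<close> pairs and its block diagonal part.\<close>

definition off_block :: "nat \<Rightarrow> nat \<Rightarrow> (nat \<Rightarrow> real) \<Rightarrow> real" where
  "off_block n r x = (\<Sum>c<2 * r. norm (gram n (Suc r) x c (2 * r)) + norm (gram n (Suc r) x c (2 * r + 1)))"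

text \<open>The Gram matrix is compared with the block diagonal matrix of the first \<open>r\<close>
  pairs and the last one. The prefactors multiply exactly, so the error comes from the coupling
  entries alone and keeps the full smallness of \<open>hprod\<close> and \<open>gpw\<close>.\<close>

lemma rho_factorization:
  assumes n: "0 < n"
  shows "\<bar>rho n (2 * Suc r) x - rho n (2 * r) x * rho n 2 (\<lambda>a. x (2 * r + a))\<bar>
     \<le> 2 * fact (2 * Suc r) * (hprod n r x * gpw n (x (2 * r)) (x (2 * r + 1)) * off_block n r x)"
proof -
  define m where "m = 2 * r"
  define y where "y a = x (m + a)" for a
  define G where "G = gmat n (Suc r) (m + 2) x"
  define G1 where "G1 = gmat n r m x"
  define G2 where "G2 = gmat n 1 2 y"
  define B where "B = four_block_mat G1 (0\<^sub>m m 2) (0\<^sub>m 2 m) G2"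
  have c: "G \<in> carrier_mat (m + 2) (m + 2)" "G1 \<in> carrier_mat m m" "G2 \<in> carrier_mat 2 2"
    by (simp_all add: G_def G1_def G2_def)
  have Bc: "B \<in> carrier_mat (m + 2) (m + 2)" unfolding B_def using c by auto
  have detB: "Determinant.det B = Determinant.det G1 * Determinant.det G2"
    unfolding B_def using c by (intro det_four_block_mat_upper_right_zero) auto
  have g1: "gram n r x a b = gram n (Suc r) x a b" if "a < m" "b < m" for a b
    using that unfolding gram_def gvec_def m_def by simp
  have g2: "gram n 1 y a b = gram n (Suc r) x (m + a) (m + b)" if "a < 2" "b < 2" for a b
  proof -
    have "gvec n 1 y a l = gvec n (Suc r) x (m + a) l" if "a < 2" for a l
    proof -
      have "a = 0 \<or> a = 1" using that by auto
      then show ?thesis by (auto simp: gvec_def y_def m_def)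
    qed
    then show ?thesis using that unfolding gram_def by simp
  qed
  have Bij: "B $$ (i, j) = (if (i < m) = (j < m) then G $$ (i, j) else 0)" if "i < m + 2" "j < m + 2" for i j
  proof -
    have "G2 $$ (i - m, j - m) = gram n (Suc r) x i j" if "\<not> i < m" "\<not> j < m"
      using that \<open>i < m + 2\<close> \<open>j < m + 2\<close> g2[of "i - m" "j - m"] by (simp add: G2_def gmat_def)
    then show ?thesis unfolding B_def using that c by (auto simp: G_def G1_def gmat_def g1)
  qed
  have bG: "norm (G $$ (i, j)) \<le> 1" if "i < m + 2" "j < m + 2" for i j
    using that by (simp add: G_def gmat_def gram_bound[OF n])
  have bB: "norm (B $$ (i, j)) \<le> 1" if "i < m + 2" "j < m + 2" for i j
    using that bG Bij by simp
  have off: "(\<Sum>i<m + 2. \<Sum>j<m + 2. norm (G $$ (i, j) - B $$ (i, j))) = 2 * off_block n r x"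
  proof -
    define g where "g i j = norm (gram n (Suc r) x i j)" for i j
    have gs: "g i j = g j i" for i j unfolding g_def by (metis complex_mod_cnj gram_cnj)
    have "(\<Sum>i<m + 2. \<Sum>j<m + 2. norm (G $$ (i, j) - B $$ (i, j))) = (\<Sum>i<m + 2. \<Sum>j<m + 2. if (i < m) = (j < m) then 0 else g i j)"
      by (intro sum.cong refl) (auto simp: Bij G_def gmat_def g_def)
    also have "\<dots> = (\<Sum>i<m. g i m + g i (Suc m)) + (\<Sum>j<m. g m j) + (\<Sum>j<m. g (Suc m) j)"
      by (simp add: add.assoc)
    also have "\<dots> = 2 * (\<Sum>i<m. g i m + g i (Suc m))"
      by (simp add: gs[of m] gs[of "Suc m"] sum.distrib)
    finally show ?thesis by (simp add: off_block_def g_def m_def)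
  qed
  have "norm (Determinant.det G - Determinant.det B) \<le> fact (m + 2) * (2 * off_block n r x)"
    using norm_det_diff_le[OF c(1) Bc bG bB] unfolding off .
  moreover have "Re (Determinant.det B) = Re (Determinant.det G1) * Re (Determinant.det G2)"
    unfolding detB using det_gmat_real[of n r m x] by (simp add: G1_def)
  ultimately have d: "\<bar>Re (Determinant.det G) - Re (Determinant.det G1) * Re (Determinant.det G2)\<bar> \<le> fact (m + 2) * (2 * off_block n r x)"
    using abs_Re_le_cmod[of "Determinant.det G - Determinant.det B"] by simp
  define h where "h = hprod n r x" define p where "p = gpw n (x (2 * r)) (x (2 * r + 1))"
  have hp: "h \<ge> 0" "p \<ge> 0" by (simp_all add: h_def p_def hprod_nonneg gpw_nonneg)
  have 1: "rho n (2 * Suc r) x = h * p * Re (Determinant.det G)"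
    using rho_eq_gmat[OF n, of "Suc r" "2 * Suc r" x] by (simp add: h_def p_def hprod_def G_def m_def)
  have 2: "rho n (2 * r) x = h * Re (Determinant.det G1)"
    using rho_eq_gmat[OF n, of r "2 * r" x] by (simp add: h_def G1_def m_def)
  have 3: "rho n 2 y = p * Re (Determinant.det G2)"
    using rho_eq_gmat[OF n, of 1 2 y] by (simp add: p_def hprod_def G2_def y_def m_def)
  have "\<bar>rho n (2 * Suc r) x - rho n (2 * r) x * rho n 2 y\<bar> = h * p * \<bar>Re (Determinant.det G) - Re (Determinant.det G1) * Re (Determinant.det G2)\<bar>"
  proof -
    have "h * p * Re (Determinant.det G) - h * Re (Determinant.det G1) * (p * Re (Determinant.det G2))
      = h * p * (Re (Determinant.det G) - Re (Determinant.det G1) * Re (Determinant.det G2))"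
      by (simp add: algebra_simps)
    then show ?thesis unfolding 1 2 3 using hp by (simp only: abs_mult abs_of_nonneg)
  qed
  also have "\<dots> \<le> h * p * (fact (m + 2) * (2 * off_block n r x))" using d hp by (intro mult_left_mono) auto
  finally show ?thesis by (simp add: h_def p_def y_def[abs_def] m_def mult_ac)
qed

lemma nn_integral_circ:
  assumes [measurable]: "f \<in> borel_measurable borel"
  shows "(\<integral>\<^sup>+x. f x \<partial>circ) = (\<integral>\<^sup>+x. indicator {0..<2 * pi} x * f x \<partial>lborel)"
  unfolding circ_def by (subst nn_integral_density) (auto simp: ennreal_indicator)

lemma nn_integral_square:
  assumes "0 \<le> c" "0 < d"
  shows "(\<integral>\<^sup>+s. ennreal (c * s\<^sup>2) * indicator {0<..d} s \<partial>lborel) = ennreal (c * d ^ 3 / 3)"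
proof -
  have "(\<integral>\<^sup>+s. ennreal (c * s\<^sup>2) * indicator {0<..d} s \<partial>lborel) = (\<integral>\<^sup>+s. ennreal (c * s\<^sup>2) * indicator {0..d} s \<partial>lborel)"
    using AE_lborel_singleton[of 0] by (intro nn_integral_cong_AE) (auto simp: indicator_def)
  also have "\<dots> = ennreal (c * d ^ 3 / 3 - c * 0 ^ 3 / 3)"
    using assms by (intro nn_integral_FTC_Icc[where F = "\<lambda>s. c * s ^ 3 / 3"])
      (auto intro!: derivative_eq_intros simp: power2_eq_square)
  finally show ?thesis by simp
qed

text \<open>Parseval: \<open>n\<close> coefficients of size at most \<open>1 / n\<close> have square
  sum at most \<open>1 / n\<close>. The pointwise bound is only 1, so decoupling is visible in the
  mean square and not uniformly.\<close>

lemma nn_integral_trig_square: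
  assumes n: "0 < n" and g: "\<And>l. l < n \<Longrightarrow> norm (\<gamma> l) \<le> 1 / real n"
  shows "(\<integral>\<^sup>+a. ennreal ((norm (\<Sum>l<n. \<gamma> l * cis (real l * a)))\<^sup>2) \<partial>circ) \<le> ennreal (2 * pi / real n)"
proof -
  define S where "S a = (\<Sum>l<n. \<gamma> l * cis (real l * a))" for a
  have Sm: "S \<in> borel_measurable borel" unfolding S_def
    by (intro borel_measurable_continuous_onI continuous_intros)
  have Sb: "norm (S a) \<le> 1" for a
  proof -
    have "norm (S a) \<le> (\<Sum>l<n. 1 / real n)" unfolding S_def using g by (intro sum_norm_le) (auto simp: norm_mult)
    then show ?thesis using n by simp
  qed
  have e: "complex_of_real ((norm (S a))\<^sup>2) = (\<Sum>l<n. \<Sum>k<n. (\<gamma> l * cnj (\<gamma> k)) * cis (of_int (int l - int k) * a))" for a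
    unfolding complex_norm_square S_def cnj_sum sum_product
    by (intro sum.cong refl) (simp add: cis_cnj cis_mult algebra_simps)
  have i: "integrable circ (\<lambda>t. c * cis (of_int k * t))" for k :: int and c
    by (intro integrable_mult_right bounded_integrable_circ[where C = 1]) (auto intro!: borel_measurable_continuous_onI continuous_intros)
  have int: "integrable circ (\<lambda>a. (norm (S a))\<^sup>2)"
    by (rule circ.integrable_const_bound[where B = 1]) (use Sb Sm in \<open>auto simp: abs_square_le_1 power_le_one\<close>)
  have "complex_of_real (\<integral>a. (norm (S a))\<^sup>2 \<partial>circ) = (\<integral>a. complex_of_real ((norm (S a))\<^sup>2) \<partial>circ)"
    by (simp add: integral_complex_of_real del: of_real_power)
  also have "\<dots> = (\<Sum>l<n. \<Sum>k<n. (\<gamma> l * cnj (\<gamma> k)) * (if l = k then 2 * pi else 0))"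
    unfolding e using i integral_circ_cis
    by (simp only: Bochner_Integration.integral_sum Bochner_Integration.integrable_sum integral_mult_right_zero) simp
  also have "\<dots> = (\<Sum>l<n. complex_of_real ((norm (\<gamma> l))\<^sup>2 * (2 * pi)))"
    by (intro sum.cong refl) (simp add: if_distrib[where f = "\<lambda>z. _ * z"] if_distrib[where f = "\<lambda>z. of_real z"] complex_norm_square[symmetric] del: of_real_power cong: if_cong)
  finally have "(\<integral>a. (norm (S a))\<^sup>2 \<partial>circ) = (\<Sum>l<n. (norm (\<gamma> l))\<^sup>2 * (2 * pi))"
    unfolding of_real_sum[symmetric] of_real_eq_iff .
  also have "\<dots> \<le> (\<Sum>l<n. (1 / real n)\<^sup>2 * (2 * pi))"
    using g by (intro sum_mono mult_right_mono power_mono) auto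
  also have "\<dots> = 2 * pi / real n" using n by (simp add: power2_eq_square)
  finally have "(\<integral>a. (norm (S a))\<^sup>2 \<partial>circ) \<le> 2 * pi / real n" .
  moreover have "(\<integral>\<^sup>+a. ennreal ((norm (S a))\<^sup>2) \<partial>circ) = ennreal (\<integral>a. (norm (S a))\<^sup>2 \<partial>circ)"
    by (intro nn_integral_eq_integral int) auto
  ultimately show ?thesis unfolding S_def by (simp add: ennreal_leI)
qed

lemma gvec_measurable:
  assumes "\<And>a. a < m \<Longrightarrow> (\<lambda>y. X y a) \<in> borel_measurable N" "a < m"
  shows "(\<lambda>y. gvec n r (X y) a l) \<in> borel_measurable N"
proof -
  have [measurable]: "(\<lambda>y. X y a) \<in> borel_measurable N" "(\<lambda>y. X y (a - 1)) \<in> borel_measurable N"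
    using assms(1)[of a] assms(1)[of "a - 1"] assms(2) by auto
  note [measurable] = cis_measurable
  show ?thesis unfolding gvec_def by (cases "a < 2 * r \<and> odd a") (simp_all only: if_True if_False, measurable)
qed

lemma gram_measurable:
  assumes "\<And>a. a < m \<Longrightarrow> (\<lambda>y. X y a) \<in> borel_measurable N" "a < m" "b < m"
  shows "(\<lambda>y. gram n r (X y) a b) \<in> borel_measurable N"
proof -
  have "(\<lambda>y. cnj (gvec n r (X y) b l)) \<in> borel_measurable N" for l
    using measurable_compose[OF gvec_measurable[OF assms(1,3)] borel_measurable_continuous_onI[of cnj]] by (simp add: continuous_on_cnj)
  then show ?thesis unfolding gram_def
    by (intro borel_measurable_sum borel_measurable_times gvec_measurable[OF assms(1,2)])
qed

lemma off_block_measurable: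
  assumes "\<And>a. a < 2 * Suc r \<Longrightarrow> (\<lambda>y. X y a) \<in> borel_measurable N"
  shows "(\<lambda>y. off_block n r (X y)) \<in> borel_measurable N"
  unfolding off_block_def
proof (intro borel_measurable_sum borel_measurable_add measurable_compose[OF _ borel_measurable_norm])
  fix c assume "c \<in> {..<2 * r}"
  then have c: "c < 2 * Suc r" by simp
  show "(\<lambda>y. gram n (Suc r) (X y) c (2 * r)) \<in> borel_measurable N"
    by (rule gram_measurable[where m = "2 * Suc r", OF assms c]) simp_all
  show "(\<lambda>y. gram n (Suc r) (X y) c (2 * r + 1)) \<in> borel_measurable N"
    by (rule gram_measurable[where m = "2 * Suc r", OF assms c]) simp_all
qed

lemma hprod_measurable:
  assumes "\<And>a. a < 2 * r \<Longrightarrow> (\<lambda>y. X y a) \<in> borel_measurable N"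
  shows "(\<lambda>y. hprod n r (X y)) \<in> borel_measurable N"
  unfolding hprod_def gpw_def
proof (rule borel_measurable_prod)
  fix q assume "q \<in> {..<r}"
  then have [measurable]: "(\<lambda>y. X y (2 * q)) \<in> borel_measurable N" "(\<lambda>y. X y (2 * q + 1)) \<in> borel_measurable N"
    using assms by auto
  show "(\<lambda>y. real n ^ 4 * (X y (2 * q + 1) - X y (2 * q))\<^sup>2 / (4 * pi\<^sup>2)) \<in> borel_measurable N" by measurable
qed

lemma nn_integral_torus_Suc:
  assumes f: "f \<in> borel_measurable (torus (Suc m))"
  shows "(\<integral>\<^sup>+x. f x \<partial>torus (Suc m)) = (\<integral>\<^sup>+x. \<integral>\<^sup>+t. f (x(m := t)) \<partial>circ \<partial>torus m)"
proof -
  have S: "torus (Suc m) = PiM (insert m {..<m}) (\<lambda>_. circ)" by (simp add: lessThan_Suc)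
  show ?thesis using f unfolding S by (intro circ_prod.product_nn_integral_insert) auto
qed

lemma torus_Suc_section_measurable:
  assumes f: "f \<in> borel_measurable (torus (Suc m))"
  shows "(\<lambda>x. \<integral>\<^sup>+t. f (x(m := t)) \<partial>circ) \<in> borel_measurable (torus m)"
proof -
  have "(\<lambda>p. (fst p)(m := snd p)) \<in> measurable (torus m \<Otimes>\<^sub>M circ) (torus (Suc m))"
    using measurable_add_dim[of m "{..<m}" "\<lambda>_. circ"] by (simp add: lessThan_Suc case_prod_beta')
  from measurable_compose[OF this f] have "(\<lambda>(x, t). f (x(m := t))) \<in> borel_measurable (torus m \<Otimes>\<^sub>M circ)"
    by (simp add: case_prod_beta')
  then show ?thesis by (rule circ.borel_measurable_nn_integral)
qed

lemma nn_integral_torus_pair: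
  assumes f: "f \<in> borel_measurable (torus (Suc (Suc m)))"
  shows "(\<integral>\<^sup>+x. f x \<partial>torus (Suc (Suc m))) = (\<integral>\<^sup>+x. \<integral>\<^sup>+a. \<integral>\<^sup>+b. f (x(m := a, Suc m := b)) \<partial>circ \<partial>circ \<partial>torus m)"
  unfolding nn_integral_torus_Suc[OF f] by (rule nn_integral_torus_Suc) (rule torus_Suc_section_measurable[OF f])

section \<open>Integration over close pairs\<close>

locale close_pairs =
  fixes n :: nat and \<delta> :: real and I :: "real set"
  assumes n: "0 < n" and d: "0 < \<delta>" and I [measurable]: "I \<in> sets borel" and sub: "I \<subseteq> {0..<2 * pi}"
    and Lpos: "0 < measure lborel I"
begin

definition L :: real where "L = measure lborel I"

lemma emeasure_I: "emeasure lborel I = ennreal L"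
proof -
  have "emeasure lborel I \<le> emeasure lborel {0..<2 * pi}" using sub by (intro emeasure_mono) auto
  then have "emeasure lborel I \<noteq> \<infinity>" by (auto simp: top_unique)
  then show ?thesis unfolding L_def by (simp add: emeasure_eq_ennreal_measure)
qed

lemma L_pos: "0 < L" using Lpos by (simp add: L_def)

text \<open>Ordered, so that each pair of points counts once.\<close>

definition pr :: "real \<Rightarrow> real \<Rightarrow> bool" where
  "pr a b \<longleftrightarrow> a < b \<and> b - a \<le> \<delta> \<and> (a + b) / 2 \<in> I"

definition ipr :: "real \<Rightarrow> real \<Rightarrow> ennreal" where
  "ipr a b = (if pr a b then 1 else 0)"

lemma pr_measurable [measurable]:
  assumes [measurable]: "f \<in> borel_measurable N" "g \<in> borel_measurable N"
  shows "Measurable.pred N (\<lambda>x. pr (f x) (g x))"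
  unfolding pr_def by measurable

lemma ipr_measurable [measurable]:
  assumes [measurable]: "f \<in> borel_measurable N" "g \<in> borel_measurable N"
  shows "(\<lambda>x. ipr (f x) (g x)) \<in> borel_measurable N"
  unfolding ipr_def by measurable

text \<open>The substitution \<open>b = a + s\<close> makes the separation the outer variable and
  the average \<open>a + s / 2\<close>, so that for fixed \<open>s\<close> the window condition is a
  translate of \<open>I\<close>.\<close>

lemma pair_integral_eq:
  fixes f :: "real \<Rightarrow> real \<Rightarrow> ennreal"
  assumes f: "(\<lambda>p. f (fst p) (snd p)) \<in> borel_measurable (borel \<Otimes>\<^sub>M borel)"
  shows "(\<integral>\<^sup>+a. \<integral>\<^sup>+b. ipr a b * f a b \<partial>circ \<partial>circ) =
    (\<integral>\<^sup>+s. indicator {0<..\<delta>} s * (\<integral>\<^sup>+a. indicator I (a + s / 2) * (indicator {0..<2 * pi} a * (indicator {0..<2 * pi} (a + s) * f a (a + s))) \<partial>lborel) \<partial>lborel)"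
proof -
  have fm [measurable]: "(\<lambda>x. f (u x) (v x)) \<in> borel_measurable N" if "u \<in> borel_measurable N" "v \<in> borel_measurable N" for u v N
    using measurable_compose[OF measurable_Pair[OF that] f] by simp
  define g where "g a s = indicator I (a + s / 2) * (indicator {0..<2 * pi} a * (indicator {0..<2 * pi} (a + s) * f a (a + s)))" for a s :: real
  have gm [measurable]: "(\<lambda>x. g (u x) (v x)) \<in> borel_measurable N" if [measurable]: "u \<in> borel_measurable N" "v \<in> borel_measurable N" for u v N
    unfolding g_def by measurable
  have inner: "indicator {0..<2 * pi} a * (\<integral>\<^sup>+b. ipr a b * f a b \<partial>circ) = (\<integral>\<^sup>+s. indicator {0<..\<delta>} s * g a s \<partial>lborel)" for a
  proof -
    have "(\<integral>\<^sup>+b. ipr a b * f a b \<partial>circ) = (\<integral>\<^sup>+b. indicator {0..<2 * pi} b * (ipr a b * f a b) \<partial>lborel)"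
      by (rule nn_integral_circ) measurable
    also have "\<dots> = (\<integral>\<^sup>+s. indicator {0..<2 * pi} (a + s) * (ipr a (a + s) * f a (a + s)) \<partial>lborel)"
      using nn_integral_real_affine[of "\<lambda>b. indicator {0..<2 * pi} b * (ipr a b * f a b)" 1 a] by simp
    finally have "indicator {0..<2 * pi} a * (\<integral>\<^sup>+b. ipr a b * f a b \<partial>circ)
      = (\<integral>\<^sup>+s. indicator {0..<2 * pi} a * (indicator {0..<2 * pi} (a + s) * (ipr a (a + s) * f a (a + s))) \<partial>lborel)"
      by (simp add: nn_integral_cmult)
    also have "\<dots> = (\<integral>\<^sup>+s. indicator {0<..\<delta>} s * g a s \<partial>lborel)"
    proof (intro nn_integral_cong)
      fix s :: real
      have h: "(a + (a + s)) / 2 = a + s / 2" by (simp add: field_simps)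
      have "ipr a (a + s) = indicator {0<..\<delta>} s * indicator I (a + s / 2)"
        unfolding ipr_def pr_def h by (auto simp: indicator_def)
      then show "indicator {0..<2 * pi} a * (indicator {0..<2 * pi} (a + s) * (ipr a (a + s) * f a (a + s))) = indicator {0<..\<delta>} s * g a s"
        unfolding g_def by (simp add: mult_ac)
    qed
    finally show ?thesis .
  qed
  have "(\<integral>\<^sup>+a. \<integral>\<^sup>+b. ipr a b * f a b \<partial>circ \<partial>circ) = (\<integral>\<^sup>+a. indicator {0..<2 * pi} a * (\<integral>\<^sup>+b. ipr a b * f a b \<partial>circ) \<partial>lborel)"
  proof (rule nn_integral_circ)
    have "(\<lambda>(a, b). ipr a b * f a b) \<in> borel_measurable (borel \<Otimes>\<^sub>M circ)" by measurable
    then show "(\<lambda>a. \<integral>\<^sup>+b. ipr a b * f a b \<partial>circ) \<in> borel_measurable borel" by (rule circ.borel_measurable_nn_integral)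
  qed
  also have "\<dots> = (\<integral>\<^sup>+a. \<integral>\<^sup>+s. indicator {0<..\<delta>} s * g a s \<partial>lborel \<partial>lborel)" by (simp only: inner)
  also have "\<dots> = (\<integral>\<^sup>+s. \<integral>\<^sup>+a. indicator {0<..\<delta>} s * g a s \<partial>lborel \<partial>lborel)"
    by (rule lborel_pair.Fubini'[symmetric]) measurable
  also have "\<dots> = (\<integral>\<^sup>+s. indicator {0<..\<delta>} s * (\<integral>\<^sup>+a. g a s \<partial>lborel) \<partial>lborel)"
    by (intro nn_integral_cong nn_integral_cmult) measurable
  finally show ?thesis unfolding g_def .
qed

lemma gpw_measurable [measurable]:
  assumes [measurable]: "f \<in> borel_measurable N" "g \<in> borel_measurable N"
  shows "(\<lambda>x. gpw n (f x) (g x)) \<in> borel_measurable N"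
  unfolding gpw_def by measurable

text \<open>\<open>gpw\<close> is \<open>n ^ 4 / (4 * pi\<^sup>2)\<close> times the square of the
  separation, whose integral up to \<open>\<delta>\<close> is \<open>\<delta> ^ 3 / 3\<close>; the
  remaining factor is controlled by \<open>K\<close> uniformly in the separation.\<close>

lemma pair_integral_bound:
  fixes F :: "real \<Rightarrow> real \<Rightarrow> ennreal"
  assumes F: "(\<lambda>p. F (fst p) (snd p)) \<in> borel_measurable (borel \<Otimes>\<^sub>M borel)" and K: "0 \<le> K"
    and b: "\<And>s. 0 < s \<Longrightarrow> s \<le> \<delta> \<Longrightarrow> (\<integral>\<^sup>+a. indicator I (a + s / 2) * (indicator {0..<2 * pi} a * F s a) \<partial>lborel) \<le> ennreal K"
  shows "(\<integral>\<^sup>+a. \<integral>\<^sup>+b. ipr a b * (ennreal (gpw n a b) * F (b - a) a) \<partial>circ \<partial>circ) \<le> ennreal (real n ^ 4 * \<delta> ^ 3 / (12 * pi\<^sup>2) * K)"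
proof -
  have Fm [measurable]: "(\<lambda>x. F (u x) (v x)) \<in> borel_measurable N" if "u \<in> borel_measurable N" "v \<in> borel_measurable N" for u v N
    using measurable_compose[OF measurable_Pair[OF that] F] by simp
  define c where "c = real n ^ 4 / (4 * pi\<^sup>2)"
  have c: "0 \<le> c" by (simp add: c_def)
  have "(\<integral>\<^sup>+a. \<integral>\<^sup>+b. ipr a b * (ennreal (gpw n a b) * F (b - a) a) \<partial>circ \<partial>circ)
    = (\<integral>\<^sup>+s. indicator {0<..\<delta>} s * (\<integral>\<^sup>+a. indicator I (a + s / 2) * (indicator {0..<2 * pi} a * (indicator {0..<2 * pi} (a + s) * (ennreal (gpw n a (a + s)) * F (a + s - a) a))) \<partial>lborel) \<partial>lborel)"
    by (rule pair_integral_eq) measurable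
  also have "\<dots> \<le> (\<integral>\<^sup>+s. ennreal (c * K * s\<^sup>2) * indicator {0<..\<delta>} s \<partial>lborel)"
  proof (intro nn_integral_mono)
    fix s :: real
    show "indicator {0<..\<delta>} s * (\<integral>\<^sup>+a. indicator I (a + s / 2) * (indicator {0..<2 * pi} a * (indicator {0..<2 * pi} (a + s) * (ennreal (gpw n a (a + s)) * F (a + s - a) a))) \<partial>lborel)
       \<le> ennreal (c * K * s\<^sup>2) * indicator {0<..\<delta>} s"
    proof (cases "s \<in> {0<..\<delta>}")
      case True
      have "(\<integral>\<^sup>+a. indicator I (a + s / 2) * (indicator {0..<2 * pi} a * (indicator {0..<2 * pi} (a + s) * (ennreal (gpw n a (a + s)) * F (a + s - a) a))) \<partial>lborel)
        \<le> (\<integral>\<^sup>+a. ennreal (c * s\<^sup>2) * (indicator I (a + s / 2) * (indicator {0..<2 * pi} a * F s a)) \<partial>lborel)"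
        unfolding gpw_shift c_def[symmetric]
        by (intro nn_integral_mono) (auto simp: indicator_def)
      also have "\<dots> = ennreal (c * s\<^sup>2) * (\<integral>\<^sup>+a. indicator I (a + s / 2) * (indicator {0..<2 * pi} a * F s a) \<partial>lborel)"
        by (rule nn_integral_cmult) measurable
      also have "\<dots> \<le> ennreal (c * s\<^sup>2) * ennreal K" using b[of s] True by (intro mult_left_mono) auto
      also have "\<dots> = ennreal (c * K * s\<^sup>2)" using c K by (simp add: ennreal_mult[symmetric] mult_ac)
      finally show ?thesis using True by simp
    qed simp
  qed
  also have "\<dots> = ennreal (c * K * \<delta> ^ 3 / 3)" using c K d by (intro nn_integral_square) auto
  finally show ?thesis by (simp add: c_def mult_ac)
qed

lemma nn_integral_shift_I: "(\<integral>\<^sup>+a. indicator I (a + t) \<partial>lborel) = ennreal L"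
proof -
  have "(\<integral>\<^sup>+a. indicator I a \<partial>lborel) = (\<integral>\<^sup>+a. indicator I (t + a) \<partial>lborel)"
    using nn_integral_real_affine[of "indicator I" 1 t] by simp
  then show ?thesis by (simp add: emeasure_I add.commute)
qed

lemma window_integral_const_le: "(\<integral>\<^sup>+a. indicator I (a + s / 2) * (indicator {0..<2 * pi} a * ennreal c) \<partial>lborel) \<le> ennreal (c * L)" if "0 \<le> c"
proof -
  have "(\<integral>\<^sup>+a. indicator I (a + s / 2) * (indicator {0..<2 * pi} a * ennreal c) \<partial>lborel) \<le> (\<integral>\<^sup>+a. ennreal c * indicator I (a + s / 2) \<partial>lborel)"
    by (intro nn_integral_mono) (auto simp: indicator_def)
  also have "\<dots> = ennreal c * ennreal L" by (simp add: nn_integral_cmult nn_integral_shift_I)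
  finally show ?thesis using that L_pos by (simp add: ennreal_mult)
qed

lemma window_integral_near_le: "(\<integral>\<^sup>+a. indicator I (a + s / 2) * (indicator {0..<2 * pi} a * indicator {u - e..u + e} a) \<partial>lborel) \<le> ennreal (2 * e)" if "0 \<le> e"
proof -
  have "(\<integral>\<^sup>+a. indicator I (a + s / 2) * (indicator {0..<2 * pi} a * indicator {u - e..u + e} a) \<partial>lborel) \<le> (\<integral>\<^sup>+a. indicator {u - e..u + e} a \<partial>lborel)"
    by (intro nn_integral_mono) (auto simp: indicator_def)
  also have "\<dots> = ennreal (2 * e)" using that by simp
  finally show ?thesis .
qed

text \<open>The rate at which different pairs decouple on average over the window; its constant
  comes out of the proof of \<open>window_integral_trig_le\<close>.\<close>

definition eps :: real where "eps = (1 / 2 + pi) / sqrt (real n * L)"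

text \<open>A first moment over the window from a second moment over the circle, by
  \<open>S \<le> \<tau> / 2 + S\<^sup>2 / (2 * \<tau>)\<close>. The first part costs
  \<open>\<tau> * L / 2\<close>, the second \<open>pi / (\<tau> * n)\<close>; taking
  \<open>\<tau>\<close> as \<open>1 / sqrt (n * L)\<close> balances them.\<close>

lemma window_integral_trig_le:
  assumes g: "\<And>l. l < n \<Longrightarrow> norm (\<gamma> l) \<le> 1 / real n"
  shows "(\<integral>\<^sup>+a. indicator I (a + s / 2) * (indicator {0..<2 * pi} a * ennreal (norm (\<Sum>l<n. \<gamma> l * cis (real l * a)))) \<partial>lborel) \<le> ennreal (L * eps)"
proof -
  define S where "S a = norm (\<Sum>l<n. \<gamma> l * cis (real l * a))" for a
  have Sm [measurable]: "S \<in> borel_measurable borel" unfolding S_def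
    by (intro borel_measurable_continuous_onI continuous_intros)
  define \<tau> where "\<tau> = 1 / sqrt (real n * L)"
  have nL: "0 < real n * L" using n L_pos by simp
  have t: "0 < \<tau>" using nL by (simp add: \<tau>_def)
  have am: "S a \<le> \<tau> / 2 + 1 / (2 * \<tau>) * (S a)\<^sup>2" for a
  proof -
    have "0 \<le> (\<tau> - S a)\<^sup>2 / (2 * \<tau>)" using t by simp
    also have "\<dots> = \<tau> / 2 + 1 / (2 * \<tau>) * (S a)\<^sup>2 - S a" using t by (simp add: power2_eq_square field_simps)
    finally show ?thesis by simp
  qed
  have "(\<integral>\<^sup>+a. indicator I (a + s / 2) * (indicator {0..<2 * pi} a * ennreal (S a)) \<partial>lborel)
    \<le> (\<integral>\<^sup>+a. indicator I (a + s / 2) * (indicator {0..<2 * pi} a * ennreal (\<tau> / 2)) + ennreal (1 / (2 * \<tau>)) * (indicator {0..<2 * pi} a * ennreal ((S a)\<^sup>2)) \<partial>lborel)"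
  proof (intro nn_integral_mono)
    fix a
    have "ennreal (S a) \<le> ennreal (\<tau> / 2) + ennreal (1 / (2 * \<tau>)) * ennreal ((S a)\<^sup>2)"
      using am[of a] t by (simp add: ennreal_mult[symmetric] ennreal_plus[symmetric] del: ennreal_plus)
    then show "indicator I (a + s / 2) * (indicator {0..<2 * pi} a * ennreal (S a))
      \<le> indicator I (a + s / 2) * (indicator {0..<2 * pi} a * ennreal (\<tau> / 2)) + ennreal (1 / (2 * \<tau>)) * (indicator {0..<2 * pi} a * ennreal ((S a)\<^sup>2))"
      by (auto simp: indicator_def)
  qed
  also have "\<dots> = (\<integral>\<^sup>+a. indicator I (a + s / 2) * (indicator {0..<2 * pi} a * ennreal (\<tau> / 2)) \<partial>lborel) + ennreal (1 / (2 * \<tau>)) * (\<integral>\<^sup>+a. ennreal ((S a)\<^sup>2) \<partial>circ)"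
    by (subst nn_integral_add) (auto simp: nn_integral_cmult nn_integral_circ)
  also have "\<dots> \<le> ennreal (\<tau> / 2 * L) + ennreal (1 / (2 * \<tau>)) * ennreal (2 * pi / real n)"
    using t nn_integral_trig_square[OF n g] unfolding S_def by (intro add_mono window_integral_const_le mult_left_mono) auto
  also have "\<dots> = ennreal (\<tau> / 2 * L + 1 / (2 * \<tau>) * (2 * pi / real n))"
    using t L_pos by (simp add: ennreal_mult[symmetric] ennreal_plus[symmetric] del: ennreal_plus)
  also have "\<tau> / 2 * L + 1 / (2 * \<tau>) * (2 * pi / real n) = L * eps"
  proof -
    define w where "w = sqrt (real n * L)"
    have w: "w > 0" "w * w = real n * L" using nL by (auto simp: w_def)
    have "pi * w / real n = L * pi / w" using w n by (simp add: field_simps)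
    then show ?thesis using w by (simp add: \<tau>_def eps_def w_def[symmetric] algebra_simps add_divide_distrib)
  qed
  finally show ?thesis unfolding S_def .
qed

text \<open>For fixed separation both features of the new pair are characters in \<open>a\<close>
  with constant coefficients, so every coupling entry is a trigonometric polynomial with
  coefficients at most \<open>1 / n\<close>. There are \<open>4 * r\<close> entries:
  \<open>2 * r\<close> earlier points against two features.\<close>

lemma window_integral_off_block_le:
  fixes x :: "nat \<Rightarrow> real"
  assumes s: "0 < s"
  shows "(\<integral>\<^sup>+a. indicator I (a + s / 2) * (indicator {0..<2 * pi} a * ennreal (off_block n r (x(2 * r := a, 2 * r + 1 := a + s)))) \<partial>lborel)
     \<le> ennreal (4 * real r * (L * eps))"
proof -
  let ?X = "\<lambda>a. x(2 * r := a, 2 * r + 1 := a + s)"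
  have e0: "0 \<le> L * eps" using L_pos n by (simp add: eps_def)
  define T where "T c e a = norm (gram n (Suc r) (?X a) c (2 * r + e))" for c e a
  have Xm: "(\<lambda>a. ?X a i) \<in> borel_measurable borel" for i
    by (cases "i = 2 * r + 1"; cases "i = 2 * r") auto
  have Tm [measurable]: "(\<lambda>a. T c e a) \<in> borel_measurable borel" for c e
    unfolding T_def
    by (intro measurable_compose[OF _ borel_measurable_norm] gram_measurable[where m = "Suc (c + (2 * r + e))" and X = ?X, OF Xm]) auto
  have one: "(\<integral>\<^sup>+a. indicator I (a + s / 2) * (indicator {0..<2 * pi} a * ennreal (T c e a)) \<partial>lborel) \<le> ennreal (L * eps)"
    if c: "c < 2 * r" and e: "e < 2" for c e
  proof -
    define v where "v l = gvec n (Suc r) x c l" for l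
    define k where "k l = (if e = 0 then 1 / of_real (sqrt (real n)) else (cis (real l * s) - 1) / of_real (s * (real n * sqrt (real n))))" for l :: nat
    have vX: "gvec n (Suc r) (?X a) c l = v l" for a l
    proof -
      have "c - Suc 0 \<noteq> 2 * r" "c - Suc 0 \<noteq> Suc (2 * r)" "c \<noteq> 2 * r" "c \<noteq> Suc (2 * r)" using c by auto
      then show ?thesis by (simp add: gvec_def v_def)
    qed
    have kX: "gvec n (Suc r) (?X a) (2 * r + e) l = k l * cis (real l * a)" for a l
    proof (cases "e = 0")
      case True then show ?thesis by (simp add: gvec_def k_def)
    next
      case False
      then have "e = 1" using e by simp
      then show ?thesis by (simp add: gvec_def k_def left_diff_distrib cis_mult distrib_left add.commute)
    qed
    have kb: "norm (k l) \<le> 1 / sqrt (real n)" if l: "l < n" for l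
    proof -
      have "norm (k l * cis (real l * 0)) \<le> 1 / sqrt (real n)"
        unfolding kX[symmetric] by (rule gvec_bound[OF n l])
      then show ?thesis by simp
    qed
    define \<gamma> where "\<gamma> l = cnj (v l) * k l" for l
    have "norm (\<gamma> l) \<le> 1 / real n" if l: "l < n" for l
    proof -
      have "norm (\<gamma> l) \<le> 1 / sqrt (real n) * (1 / sqrt (real n))"
        unfolding \<gamma>_def norm_mult complex_mod_cnj v_def by (intro mult_mono gvec_bound[OF n l] kb[OF l]) auto
      then show ?thesis by simp
    qed
    moreover have "T c e a = norm (\<Sum>l<n. \<gamma> l * cis (real l * a))" for a
    proof -
      have "T c e a = norm (cnj (\<Sum>l<n. v l * cnj (k l * cis (real l * a))))"
        unfolding T_def gram_def vX kX by (simp only: complex_mod_cnj)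
      then show ?thesis by (simp add: \<gamma>_def mult.assoc)
    qed
    ultimately show ?thesis using window_integral_trig_le[of \<gamma> s] by simp
  qed
  have eq: "ennreal (off_block n r (?X a)) = (\<Sum>c<2 * r. ennreal (T c 0 a) + ennreal (T c 1 a))" for a
    unfolding off_block_def T_def add_0_right
    by (subst sum_ennreal[symmetric]) (simp_all only: ennreal_plus norm_ge_zero add_nonneg_nonneg)
  have "(\<integral>\<^sup>+a. indicator I (a + s / 2) * (indicator {0..<2 * pi} a * ennreal (off_block n r (?X a))) \<partial>lborel)
    = (\<integral>\<^sup>+a. (\<Sum>c<2 * r. indicator I (a + s / 2) * (indicator {0..<2 * pi} a * ennreal (T c 0 a)) + indicator I (a + s / 2) * (indicator {0..<2 * pi} a * ennreal (T c 1 a))) \<partial>lborel)"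
    unfolding eq by (intro nn_integral_cong) (simp only: sum_distrib_left distrib_left)
  also have "\<dots> = (\<Sum>c<2 * r. (\<integral>\<^sup>+a. indicator I (a + s / 2) * (indicator {0..<2 * pi} a * ennreal (T c 0 a)) \<partial>lborel) + (\<integral>\<^sup>+a. indicator I (a + s / 2) * (indicator {0..<2 * pi} a * ennreal (T c 1 a)) \<partial>lborel))"
    by (subst nn_integral_sum, measurable) (intro sum.cong refl nn_integral_add; measurable)
  also have "\<dots> \<le> (\<Sum>c<2 * r. ennreal (L * eps) + ennreal (L * eps))"
    by (intro sum_mono add_mono one) auto
  also have "\<dots> = ennreal (4 * real r * (L * eps))"
    using e0 by (simp add: ennreal_plus[symmetric] ennreal_of_nat_eq_real_of_nat ennreal_mult[symmetric] mult_ac del: ennreal_plus)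
  finally show ?thesis .
qed

definition iphi :: "nat \<Rightarrow> (nat \<Rightarrow> real) \<Rightarrow> ennreal" where
  "iphi r x = (\<Prod>q<r. ipr (x (2 * q)) (x (2 * q + 1)))"

lemma iphi_measurable:
  assumes "\<And>a. a < 2 * r \<Longrightarrow> (\<lambda>y. X y a) \<in> borel_measurable N"
  shows "(\<lambda>y. iphi r (X y)) \<in> borel_measurable N"
  unfolding iphi_def by (intro borel_measurable_prod_ennreal ipr_measurable assms) auto

lemma iphi_Suc: "iphi (Suc r) x = iphi r x * ipr (x (2 * r)) (x (2 * r + 1))"
  by (simp add: iphi_def)

lemma iphi_cong: "(\<And>a. a < 2 * r \<Longrightarrow> x a = y a) \<Longrightarrow> iphi r x = iphi r y"
  unfolding iphi_def by (intro prod.cong) auto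

lemma hprod_cong: "(\<And>a. a < 2 * r \<Longrightarrow> x a = y a) \<Longrightarrow> hprod n r x = hprod n r y"
  unfolding hprod_def by (intro prod.cong) auto

text \<open>The bound for one pair weighted by \<open>gpw\<close>. Since the two-point function is
  about \<open>gpw / 12\<close>, the expected number of close pairs is about
  \<open>H / 12\<close>.\<close>

definition H :: real where "H = real n ^ 4 * \<delta> ^ 3 * L / (12 * pi\<^sup>2)"

lemma H_nonneg: "0 \<le> H" using d L_pos by (simp add: H_def)

text \<open>Integrates out the last pair in all the inductions below. \<open>F\<close> carries the
  additional factor of that pair, as a function of the separation and the first point, and
  \<open>K\<close> bounds its mean over the window.\<close>

lemma pair_step:
  fixes U :: "(nat \<Rightarrow> real) \<Rightarrow> ennreal" and F :: "(nat \<Rightarrow> real) \<Rightarrow> real \<Rightarrow> real \<Rightarrow> ennreal"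
  assumes f: "f \<in> borel_measurable (torus (2 * Suc r))" and U: "U \<in> borel_measurable (torus (2 * r))"
    and F: "\<And>x. (\<lambda>p. F x (fst p) (snd p)) \<in> borel_measurable (borel \<Otimes>\<^sub>M borel)"
    and le: "\<And>x a b. f (x(2 * r := a, Suc (2 * r) := b)) \<le> U x * (ipr a b * (ennreal (gpw n a b) * F x (b - a) a))"
    and K: "0 \<le> K"
    and b: "\<And>x s. 0 < s \<Longrightarrow> s \<le> \<delta> \<Longrightarrow> (\<integral>\<^sup>+a. indicator I (a + s / 2) * (indicator {0..<2 * pi} a * F x s a) \<partial>lborel) \<le> ennreal (K * L)"
  shows "(\<integral>\<^sup>+x. f x \<partial>torus (2 * Suc r)) \<le> (\<integral>\<^sup>+x. U x \<partial>torus (2 * r)) * ennreal (H * K)"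
proof -
  have Fm [measurable]: "(\<lambda>y. F x (u y) (v y)) \<in> borel_measurable N" if "u \<in> borel_measurable N" "v \<in> borel_measurable N" for u v N x
    using measurable_compose[OF measurable_Pair[OF that] F] by simp
  have "(\<integral>\<^sup>+x. f x \<partial>torus (2 * Suc r)) = (\<integral>\<^sup>+x. \<integral>\<^sup>+a. \<integral>\<^sup>+b. f (x(2 * r := a, Suc (2 * r) := b)) \<partial>circ \<partial>circ \<partial>torus (2 * r))"
    using nn_integral_torus_pair[of f "2 * r"] f by simp
  also have "\<dots> \<le> (\<integral>\<^sup>+x. U x * ennreal (H * K) \<partial>torus (2 * r))"
  proof (intro nn_integral_mono)
    fix x
    have "(\<integral>\<^sup>+a. \<integral>\<^sup>+b. f (x(2 * r := a, Suc (2 * r) := b)) \<partial>circ \<partial>circ)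
      \<le> (\<integral>\<^sup>+a. \<integral>\<^sup>+b. U x * (ipr a b * (ennreal (gpw n a b) * F x (b - a) a)) \<partial>circ \<partial>circ)"
      by (intro nn_integral_mono le)
    also have "\<dots> = (\<integral>\<^sup>+a. U x * (\<integral>\<^sup>+b. ipr a b * (ennreal (gpw n a b) * F x (b - a) a) \<partial>circ) \<partial>circ)"
      by (intro nn_integral_cong nn_integral_cmult) measurable
    also have "\<dots> = U x * (\<integral>\<^sup>+a. \<integral>\<^sup>+b. ipr a b * (ennreal (gpw n a b) * F x (b - a) a) \<partial>circ \<partial>circ)"
    proof (rule nn_integral_cmult)
      have "(\<lambda>(a, b). ipr a b * (ennreal (gpw n a b) * F x (b - a) a)) \<in> borel_measurable (circ \<Otimes>\<^sub>M circ)" by measurable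
      then show "(\<lambda>a. \<integral>\<^sup>+b. ipr a b * (ennreal (gpw n a b) * F x (b - a) a) \<partial>circ) \<in> borel_measurable circ"
        by (rule circ.borel_measurable_nn_integral)
    qed
    also have "\<dots> \<le> U x * ennreal (real n ^ 4 * \<delta> ^ 3 / (12 * pi\<^sup>2) * (K * L))"
      using K L_pos by (intro mult_left_mono pair_integral_bound F b) auto
    also have "real n ^ 4 * \<delta> ^ 3 / (12 * pi\<^sup>2) * (K * L) = H * K" by (simp add: H_def)
    finally show "(\<integral>\<^sup>+a. \<integral>\<^sup>+b. f (x(2 * r := a, Suc (2 * r) := b)) \<partial>circ \<partial>circ) \<le> U x * ennreal (H * K)" .
  qed
  also have "\<dots> = (\<integral>\<^sup>+x. U x \<partial>torus (2 * r)) * ennreal (H * K)" by (rule nn_integral_multc[OF U])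
  finally show ?thesis .
qed

lemma upd_iphi: "iphi (Suc r) (x(2 * r := a, Suc (2 * r) := b)) = iphi r x * ipr a b"
  unfolding iphi_Suc by (simp add: iphi_cong[of r "x(2 * r := a, Suc (2 * r) := b)" x])

lemma upd_hprod: "hprod n (Suc r) (x(2 * r := a, Suc (2 * r) := b)) = hprod n r x * gpw n a b"
  using hprod_cong[of r "x(2 * r := a, Suc (2 * r) := b)" x] by (simp add: hprod_def)

lemma upd_hprod': "hprod n r (x(2 * r := a, Suc (2 * r) := b)) = hprod n r x"
  by (rule hprod_cong) simp

lemma iphi_hprod_measurable: "(\<lambda>x. iphi r x * ennreal (hprod n r x)) \<in> borel_measurable (torus (2 * r))"
  by (intro borel_measurable_times_ennreal iphi_measurable measurable_compose[OF hprod_measurable measurable_ennreal] component_torus)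

lemma iphi_hprod_bound: "(\<integral>\<^sup>+x. iphi r x * ennreal (hprod n r x) \<partial>torus (2 * r)) \<le> ennreal (H ^ r)"
proof (induction r)
  case 0
  have "(\<integral>\<^sup>+x. iphi 0 x * ennreal (hprod n 0 x) \<partial>torus 0) = 1"
    using circ_prod.nn_integral_empty[of "\<lambda>x. iphi 0 x * ennreal (hprod n 0 x)"] by (simp add: iphi_def hprod_def)
  then show ?case by simp
next
  case (Suc r)
  have "(\<integral>\<^sup>+x. iphi (Suc r) x * ennreal (hprod n (Suc r) x) \<partial>torus (2 * Suc r))
     \<le> (\<integral>\<^sup>+x. iphi r x * ennreal (hprod n r x) \<partial>torus (2 * r)) * ennreal (H * 1)"
  proof (rule pair_step[where F = "\<lambda>_ _ _. ennreal 1"])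
    fix x a b
    show "iphi (Suc r) (x(2 * r := a, Suc (2 * r) := b)) * ennreal (hprod n (Suc r) (x(2 * r := a, Suc (2 * r) := b)))
      \<le> iphi r x * ennreal (hprod n r x) * (ipr a b * (ennreal (gpw n a b) * ennreal 1))"
      unfolding upd_iphi upd_hprod by (simp add: ennreal_mult hprod_nonneg gpw_nonneg mult_ac)
  next
    show "(\<integral>\<^sup>+a. indicator I (a + s / 2) * (indicator {0..<2 * pi} a * ennreal 1) \<partial>lborel) \<le> ennreal (1 * L)" for s
      by (rule window_integral_const_le) simp
  qed (rule iphi_hprod_measurable, rule iphi_hprod_measurable, simp_all)
  also have "\<dots> \<le> ennreal (H ^ r) * ennreal (H * 1)" by (intro mult_right_mono Suc) auto
  also have "\<dots> = ennreal (H ^ Suc r)" using H_nonneg by (simp add: ennreal_mult[symmetric] mult.commute)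
  finally show ?case .
qed

end

section \<open>The two-point function at small distance\<close>

lemma sum_square_differences:
  "(\<Sum>k<n. \<Sum>l<n. (real k - real l)\<^sup>2) = (real n)\<^sup>2 * ((real n)\<^sup>2 - 1) / 6"
proof -
  have 1: "(\<Sum>k<n. real k) = real n * (real n - 1) / 2"
    by (induction n) (auto simp: field_simps)
  have 2: "(\<Sum>k<n. (real k)\<^sup>2) = real n * (real n - 1) * (2 * real n - 1) / 6"
    by (induction n) (auto simp: field_simps power2_eq_square)
  have "(\<Sum>k<n. \<Sum>l<n. (real k - real l)\<^sup>2) = (\<Sum>k<n. \<Sum>l<n. ((real k)\<^sup>2 + (real l)\<^sup>2) - 2 * (real k * real l))"
    by (simp add: power2_diff algebra_simps)
  also have "\<dots> = 2 * (real n * (\<Sum>k<n. (real k)\<^sup>2)) - 2 * ((\<Sum>k<n. real k) * (\<Sum>k<n. real k))"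
    by (simp add: sum_subtractf sum.distrib sum_product sum_distrib_left[symmetric])
  also have "\<dots> = (real n)\<^sup>2 * ((real n)\<^sup>2 - 1) / 6" unfolding 1 2 by (simp add: field_simps power2_eq_square)
  finally show ?thesis .
qed

lemma cos_lower_quadratic: "1 - u\<^sup>2 / 2 \<le> cos u" for u :: real
proof -
  have "(sin (u / 2))\<^sup>2 \<le> (u / 2)\<^sup>2"
    using abs_sin_x_le_abs_x[of "u / 2"] by (simp only: abs_le_square_iff)
  then show ?thesis using cos_double_sin[of "u / 2"] by (simp add: power_divide)
qed

text \<open>Two integrations of \<open>cos_lower_quadratic\<close>, carried out as monotonicity of
  the remainders, and evenness for negative arguments.\<close>

lemma cos_lower_quartic: "1 - cos u \<ge> u\<^sup>2 / 2 - u ^ 4 / 24" for u :: real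
proof -
  have *: "cos v \<le> 1 - v\<^sup>2 / 2 + v ^ 4 / 24" if v: "0 \<le> v" for v :: real
  proof -
    have s: "w - w ^ 3 / 6 \<le> sin w" if w: "0 \<le> w" for w :: real
    proof -
      let ?f = "\<lambda>w::real. sin w - w + w ^ 3 / 6"
      have "?f 0 \<le> ?f w"
      proof (rule DERIV_nonneg_imp_nondecreasing[OF w])
        fix y :: real
        have "1 - y\<^sup>2 / 2 \<le> cos y" by (rule cos_lower_quadratic)
        then show "\<exists>z. (?f has_real_derivative z) (at y) \<and> 0 \<le> z"
          by (intro exI[of _ "cos y - 1 + y\<^sup>2 / 2"]) (auto intro!: derivative_eq_intros simp: power2_eq_square)
      qed
      then show ?thesis by simp
    qed
    let ?g = "\<lambda>w::real. 1 - w\<^sup>2 / 2 + w ^ 4 / 24 - cos w"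
    have "?g 0 \<le> ?g v"
    proof (rule DERIV_nonneg_imp_nondecreasing[OF v])
      fix y :: real assume y: "0 \<le> y" "y \<le> v"
      show "\<exists>z. (?g has_real_derivative z) (at y) \<and> 0 \<le> z"
        by (rule exI[of _ "sin y - y + y ^ 3 / 6"]) (use s[OF y(1)] in \<open>auto intro!: derivative_eq_intros simp: power2_eq_square\<close>)
    qed
    then show ?thesis by simp
  qed
  show ?thesis using *[of u] *[of "- u"] by (cases "0 \<le> u") auto
qed

definition rho2 :: "nat \<Rightarrow> real \<Rightarrow> real \<Rightarrow> real" where
  "rho2 n a b = rho n 2 (\<lambda>i. if i = 0 then a else b)"

lemma rho2_measurable [measurable]:
  assumes "f \<in> borel_measurable N" "g \<in> borel_measurable N"
  shows "(\<lambda>x. rho2 n (f x) (g x)) \<in> borel_measurable N"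
proof -
  have "(\<lambda>x. Determinant.det (kmat n 2 (\<lambda>i. if i = 0 then f x else g x))) \<in> borel_measurable N"
    by (rule det_kmat_measurable) (use assms in auto)
  then show ?thesis unfolding rho2_def rho_def by measurable
qed

text \<open>The two-by-two determinant is \<open>n\<^sup>2\<close> minus the squared modulus of the
  geometric sum \<open>T\<close>, over \<open>4 * pi\<^sup>2\<close>. Expanding the modulus over
  pairs of frequencies leaves a sum of cosines.\<close>

lemma rho2_eq: "4 * pi\<^sup>2 * rho2 n a (a + s) = (\<Sum>k<n. \<Sum>l<n. 1 - cos ((real k - real l) * s))"
proof -
  have per: "{p. p permutes {..<2::nat}} = {id, Transposition.transpose 0 1}"
  proof -
    have "{..<2::nat} = {0, 1}" by auto
    then show ?thesis by (simp only: permutes_doubleton_iff) auto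
  qed
  have ne: "id \<noteq> Transposition.transpose 0 (1::nat)" by (metis id_apply transpose_apply_first zero_neq_one)
  define T where "T = (\<Sum>l<n. cis (real l * s))"
  have t: "Transposition.transpose 0 1 (0::nat) = 1" "Transposition.transpose 0 1 (1::nat) = 0" by simp_all
  have d: "dker n a (a + s) * dker n (a + s) a = cnj T * T / (2 * pi)\<^sup>2"
    by (simp add: dker_def T_def cis_cnj power2_eq_square)
  have dd: "Determinant.det (kmat n 2 (\<lambda>i. if i = 0 then a else a + s)) = dker n a a * dker n (a + s) (a + s) - dker n a (a + s) * dker n (a + s) a"
    unfolding det_kmat per using ne t by (simp add: sign_swap_id numeral_2_eq_2 sign_id)
  have "complex_of_real ((2 * pi)\<^sup>2) * Determinant.det (kmat n 2 (\<lambda>i. if i = 0 then a else a + s)) = of_nat n ^ 2 - T * cnj T"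
    unfolding dd d dker_diag by (simp add: power2_eq_square field_simps)
  then have "Re (complex_of_real ((2 * pi)\<^sup>2) * Determinant.det (kmat n 2 (\<lambda>i. if i = 0 then a else a + s))) = Re (of_nat n ^ 2 - T * cnj T)"
    by simp
  then have e: "4 * pi\<^sup>2 * rho2 n a (a + s) = (real n)\<^sup>2 - Re (T * cnj T)"
    by (simp add: rho2_def rho_def power_mult_distrib power2_eq_square)
  have "T * cnj T = (\<Sum>k<n. \<Sum>l<n. cis ((real k - real l) * s))"
    unfolding T_def cnj_sum sum_product by (simp add: cis_cnj cis_mult left_diff_distrib)
  then have "Re (T * cnj T) = (\<Sum>k<n. \<Sum>l<n. cos ((real k - real l) * s))" by simp
  then show ?thesis unfolding e by (simp add: sum_subtractf power2_eq_square)
qed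

lemma rho2_le: "rho2 n a b \<le> gpw n a b / 12"
proof -
  define s where "s = b - a"
  have "4 * pi\<^sup>2 * rho2 n a (a + s) \<le> (\<Sum>k<n. \<Sum>l<n. s\<^sup>2 / 2 * (real k - real l)\<^sup>2)"
    unfolding rho2_eq
  proof (intro sum_mono)
    fix k l
    show "1 - cos ((real k - real l) * s) \<le> s\<^sup>2 / 2 * (real k - real l)\<^sup>2"
      using cos_lower_quadratic[of "(real k - real l) * s"] by (simp add: power_mult_distrib mult_ac)
  qed
  also have "\<dots> = s\<^sup>2 / 2 * ((real n)\<^sup>2 * ((real n)\<^sup>2 - 1) / 6)"
    unfolding sum_distrib_left[symmetric] sum_square_differences ..
  also have "\<dots> \<le> s\<^sup>2 / 2 * ((real n)\<^sup>2 * (real n)\<^sup>2 / 6)"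
    by (intro mult_left_mono divide_right_mono) auto
  also have "\<dots> = 4 * pi\<^sup>2 * (gpw n a (a + s) / 12)" by (simp add: gpw_def power2_eq_square power4_eq_xxxx)
  finally show ?thesis unfolding s_def by simp
qed

text \<open>The first correction is the difference between \<open>n\<^sup>2 - 1\<close> and
  \<open>n\<^sup>2\<close> in \<open>sum_square_differences\<close>; the second is the quartic term
  of the cosine, with all frequency differences bounded by \<open>n\<close>.\<close>

lemma rho2_ge:
  assumes "\<bar>s\<bar> \<le> d"
  shows "rho2 n a (a + s) \<ge> gpw n a (a + s) / 12 * (1 - 1 / (real n)\<^sup>2 - (real n)\<^sup>2 * d\<^sup>2 / 2)"
proof (cases "n = 0")
  case True
  then show ?thesis using rho_nonneg[of 2 n] by (simp add: gpw_def rho2_def rho_def det_kmat dker_def sum.neutral permutes_def)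
next
  case False
  have "s\<^sup>2 / 2 * ((real n)\<^sup>2 * ((real n)\<^sup>2 - 1) / 6) - s\<^sup>2 * d\<^sup>2 / 24 * (\<Sum>k<n. \<Sum>l<n. (real n) ^ 4)
     = (\<Sum>k<n. \<Sum>l<n. s\<^sup>2 / 2 * (real k - real l)\<^sup>2) - (\<Sum>k<n. \<Sum>l<n. s\<^sup>2 * d\<^sup>2 / 24 * (real n) ^ 4)"
    unfolding sum_distrib_left[symmetric] sum_square_differences ..
  also have "\<dots> = (\<Sum>k<n. \<Sum>l<n. s\<^sup>2 / 2 * (real k - real l)\<^sup>2 - s\<^sup>2 * d\<^sup>2 / 24 * (real n) ^ 4)"
    by (simp add: sum_subtractf)
  also have "\<dots> \<le> 4 * pi\<^sup>2 * rho2 n a (a + s)"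
    unfolding rho2_eq
  proof (intro sum_mono)
    fix k l assume kl: "k \<in> {..<n}" "l \<in> {..<n}"
    have "\<bar>real k - real l\<bar> ^ 4 \<le> real n ^ 4" using kl by (intro power_mono) auto
    then have 1: "(real k - real l) ^ 4 \<le> real n ^ 4" by simp
    have "s\<^sup>2 * s\<^sup>2 \<le> s\<^sup>2 * d\<^sup>2" using assms by (intro mult_left_mono abs_le_square_iff[THEN iffD1]) auto
    then have 2: "s ^ 4 \<le> s\<^sup>2 * d\<^sup>2" by (simp add: power4_eq_xxxx power2_eq_square mult_ac)
    have "((real k - real l) * s) ^ 4 = s ^ 4 * (real k - real l) ^ 4" by (simp add: power_mult_distrib mult.commute)
    also have "\<dots> \<le> (s\<^sup>2 * d\<^sup>2) * real n ^ 4" by (rule mult_mono[OF 2 1]) auto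
    finally show "s\<^sup>2 / 2 * (real k - real l)\<^sup>2 - s\<^sup>2 * d\<^sup>2 / 24 * real n ^ 4 \<le> 1 - cos ((real k - real l) * s)"
      using cos_lower_quartic[of "(real k - real l) * s"] by (simp add: power_mult_distrib mult_ac)
  qed
  also have "s\<^sup>2 / 2 * ((real n)\<^sup>2 * ((real n)\<^sup>2 - 1) / 6) - s\<^sup>2 * d\<^sup>2 / 24 * (\<Sum>k<n. \<Sum>l<n. (real n) ^ 4)
    = 4 * pi\<^sup>2 * (gpw n a (a + s) / 12 * (1 - 1 / (real n)\<^sup>2 - (real n)\<^sup>2 * d\<^sup>2 / 2))"
  proof -
    define N where "N = real n"
    have N: "N \<noteq> 0" using False by (simp add: N_def)
    have "N ^ 4 * (s\<^sup>2 / 12 * (1 - 1 / N\<^sup>2 - N\<^sup>2 * d\<^sup>2 / 2)) = s\<^sup>2 / 12 * (N\<^sup>2 * (N\<^sup>2 - 1)) - s\<^sup>2 * d\<^sup>2 / 24 * (N * (N * N ^ 4))"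
      using N by (simp add: field_simps power2_eq_square power4_eq_xxxx)
    then show ?thesis unfolding N_def[symmetric] gpw_shift by (simp add: N_def mult_ac)
  qed
  finally show ?thesis by simp
qed

lemma indicator_window_measurable:
  fixes f g :: "'a \<Rightarrow> real"
  assumes [measurable]: "f \<in> borel_measurable N" "g \<in> borel_measurable N"
  shows "(\<lambda>x. indicator {f x - e..f x + e} (g x) :: ennreal) \<in> borel_measurable N"
proof -
  have *: "(\<lambda>x. indicator {f x - e..f x + e} (g x) :: ennreal) = (\<lambda>x. if f x - e \<le> g x \<and> g x \<le> f x + e then 1 else 0)"
    by (auto simp: indicator_def fun_eq_iff)
  show ?thesis unfolding * by measurable
qed

lemma of_bool_measurable:
  assumes [measurable]: "Measurable.pred N P"
  shows "(\<lambda>x. of_bool (P x) :: ennreal) \<in> borel_measurable N"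
  unfolding of_bool_def by measurable

section \<open>Factorization of the pair masses\<close>

context close_pairs
begin

text \<open>By \<open>expectation_pairs\<close>, the expected number of ordered
  \<open>r\<close>-tuples of close pairs in which no index is repeated.\<close>

definition pairs_mass :: "nat \<Rightarrow> ennreal" where
  "pairs_mass r = (\<integral>\<^sup>+x. iphi r x * ennreal (rho n (2 * r) x) \<partial>torus (2 * r))"

definition one_pair_mass :: ennreal where
  "one_pair_mass = (\<integral>\<^sup>+a. \<integral>\<^sup>+b. ipr a b * ennreal (rho2 n a b) \<partial>circ \<partial>circ)"

lemma pairs_mass_0: "pairs_mass 0 = 1"
  unfolding pairs_mass_def mult_0_right nn_integral_torus_0 by (simp add: rho_0 iphi_def)

lemma iphi_torus: "2 * r \<le> m \<Longrightarrow> iphi r \<in> borel_measurable (torus m)"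
  by (rule iphi_measurable) (rule component_torus, simp)

lemma hprod_torus: "2 * r \<le> m \<Longrightarrow> (\<lambda>x. ennreal (hprod n r x)) \<in> borel_measurable (torus m)"
  by (rule measurable_compose[OF hprod_measurable measurable_ennreal]) (rule component_torus, simp)

lemma rho_torus: "m' \<le> m \<Longrightarrow> (\<lambda>x. ennreal (rho n m' x)) \<in> borel_measurable (torus m)"
proof -
  assume "m' \<le> m"
  then have "(\<lambda>x. Determinant.det (kmat n m' x)) \<in> borel_measurable (torus m)"
    by (intro det_kmat_measurable component_torus) auto
  then show ?thesis unfolding rho_def by measurable
qed

lemma off_block_nonneg: "0 \<le> off_block n r x"
  unfolding off_block_def by (intro sum_nonneg) auto

text \<open>The combinatorial constant of \<open>rho_factorization\<close>, \<open>H ^ r\<close> for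
  the earlier pairs, and \<open>H\<close> for the last pair damped by the mean coupling
  \<open>4 * r * eps\<close>.\<close>

definition step_error :: "nat \<Rightarrow> real" where
  "step_error r = 2 * fact (2 * Suc r) * H ^ r * (H * (4 * real r * eps))"

lemma eps_nonneg: "0 \<le> eps" using n L_pos by (simp add: eps_def)

lemma step_error_nonneg: "0 \<le> step_error r"
  unfolding step_error_def using H_nonneg eps_nonneg by simp

text \<open>\<open>rho_factorization\<close> integrated against \<open>iphi\<close>. The product
  term splits by Fubini into the masses of \<open>r\<close> pairs and of one pair; the error term is
  integrated with \<open>pair_step\<close>, where the coupling contributes \<open>eps\<close>. Two
  inequalities stand for an absolute value, since subtraction in \<open>ennreal\<close> is
  truncated.\<close>

lemma factor_step:
  assumes r: "2 * Suc r \<le> n"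
  shows "pairs_mass (Suc r) \<le> pairs_mass r * one_pair_mass + ennreal (step_error r)" and "pairs_mass r * one_pair_mass \<le> pairs_mass (Suc r) + ennreal (step_error r)"
proof -
  let ?s = "\<lambda>x a. x (2 * r + a) :: real"
  let ?r2 = "\<lambda>x. rho2 n (x (2 * r)) (x (2 * r + 1))"
  have r2: "rho n 2 (?s x) = ?r2 x" for x unfolding rho2_def by (rule rho_cong) (auto simp: less_2_cases_iff)
  define P where "P x = iphi (Suc r) x * ennreal (rho n (2 * Suc r) x)" for x
  define Q where "Q x = iphi (Suc r) x * (ennreal (rho n (2 * r) x) * ennreal (?r2 x))" for x
  define D where "D x = iphi (Suc r) x * (ennreal (2 * fact (2 * Suc r)) * (ennreal (hprod n r x) * (ennreal (gpw n (x (2 * r)) (x (2 * r + 1))) * ennreal (off_block n r x))))" for x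
  have nn: "0 \<le> rho n (2 * Suc r) x" "0 \<le> rho n (2 * r) x" "0 \<le> ?r2 x" for x
    using r unfolding r2[symmetric] by (auto intro!: rho_nonneg)
  have QR: "ennreal (rho n (2 * r) x) * ennreal (?r2 x) = ennreal (rho n (2 * r) x * rho n 2 (?s x))" for x
    using nn unfolding r2 by (simp add: ennreal_mult)
  have DR: "ennreal (2 * fact (2 * Suc r)) * (ennreal (hprod n r x) * (ennreal (gpw n (x (2 * r)) (x (2 * r + 1))) * ennreal (off_block n r x)))
    = ennreal (2 * fact (2 * Suc r) * (hprod n r x * gpw n (x (2 * r)) (x (2 * r + 1)) * off_block n r x))" for x
    using hprod_nonneg[of n r x] gpw_nonneg[of n "x (2 * r)" "x (2 * r + 1)"] off_block_nonneg[of r x]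
    by (simp add: ennreal_mult[symmetric] mult.assoc del: fact_Suc mult_Suc_right)
  have f: "ennreal (rho n (2 * Suc r) x) \<le> ennreal (rho n (2 * r) x * rho n 2 (?s x)) + ennreal (2 * fact (2 * Suc r) * (hprod n r x * gpw n (x (2 * r)) (x (2 * r + 1)) * off_block n r x))"
     "ennreal (rho n (2 * r) x * rho n 2 (?s x)) \<le> ennreal (rho n (2 * Suc r) x) + ennreal (2 * fact (2 * Suc r) * (hprod n r x * gpw n (x (2 * r)) (x (2 * r + 1)) * off_block n r x))" for x
  proof -
    define p where "p = rho n (2 * Suc r) x"
    define q where "q = rho n (2 * r) x * rho n 2 (?s x)"
    define e where "e = 2 * fact (2 * Suc r) * (hprod n r x * gpw n (x (2 * r)) (x (2 * r + 1)) * off_block n r x)"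
    have "\<bar>p - q\<bar> \<le> e" unfolding p_def q_def e_def by (rule rho_factorization[OF n])
    moreover have "0 \<le> p" "0 \<le> q" using nn unfolding p_def q_def r2 by auto
    ultimately have "ennreal p \<le> ennreal q + ennreal e" "ennreal q \<le> ennreal p + ennreal e"
      by (auto simp: ennreal_plus[symmetric] intro!: ennreal_leI simp del: ennreal_plus)
    then show "ennreal (rho n (2 * Suc r) x) \<le> ennreal (rho n (2 * r) x * rho n 2 (?s x)) + ennreal (2 * fact (2 * Suc r) * (hprod n r x * gpw n (x (2 * r)) (x (2 * r + 1)) * off_block n r x))"
     "ennreal (rho n (2 * r) x * rho n 2 (?s x)) \<le> ennreal (rho n (2 * Suc r) x) + ennreal (2 * fact (2 * Suc r) * (hprod n r x * gpw n (x (2 * r)) (x (2 * r + 1)) * off_block n r x))"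
      unfolding p_def q_def e_def .
  qed
  have PQ: "P x \<le> Q x + D x" "Q x \<le> P x + D x" for x
    unfolding P_def Q_def D_def QR DR distrib_left[symmetric] by (intro mult_left_mono f zero_le)+
  have cm: "(\<lambda>x. x (2 * r)) \<in> borel_measurable (torus (2 * Suc r))" "(\<lambda>x. x (2 * r + 1)) \<in> borel_measurable (torus (2 * Suc r))"
    by (rule component_torus, simp)+
  have Pm [measurable]: "P \<in> borel_measurable (torus (2 * Suc r))"
    unfolding P_def by (intro borel_measurable_times_ennreal iphi_torus rho_torus) auto
  have Qm [measurable]: "Q \<in> borel_measurable (torus (2 * Suc r))"
    unfolding Q_def by (intro borel_measurable_times_ennreal iphi_torus rho_torus measurable_compose[OF rho2_measurable measurable_ennreal] cm) auto
  have Dm [measurable]: "D \<in> borel_measurable (torus (2 * Suc r))"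
    unfolding D_def
    by (intro borel_measurable_times_ennreal iphi_torus hprod_torus borel_measurable_const
      measurable_compose[OF gpw_measurable measurable_ennreal] measurable_compose[OF off_block_measurable measurable_ennreal] cm component_torus) auto
  have "(\<integral>\<^sup>+x. Q x \<partial>torus (2 * Suc r)) = (\<integral>\<^sup>+x. \<integral>\<^sup>+a. \<integral>\<^sup>+b. Q (x(2 * r := a, Suc (2 * r) := b)) \<partial>circ \<partial>circ \<partial>torus (2 * r))"
    using nn_integral_torus_pair[of Q "2 * r"] Qm by simp
  also have "\<dots> = (\<integral>\<^sup>+x. iphi r x * ennreal (rho n (2 * r) x) * one_pair_mass \<partial>torus (2 * r))"
  proof (intro nn_integral_cong)
    fix x
    have e: "Q (x(2 * r := a, Suc (2 * r) := b)) = iphi r x * ennreal (rho n (2 * r) x) * (ipr a b * ennreal (rho2 n a b))" for a b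
    proof -
      have "rho n (2 * r) (x(2 * r := a, Suc (2 * r) := b)) = rho n (2 * r) x" by (rule rho_cong) simp
      then show ?thesis unfolding Q_def upd_iphi by (simp add: mult_ac)
    qed
    have m: "(\<lambda>(a, b). ipr a b * ennreal (rho2 n a b)) \<in> borel_measurable (circ \<Otimes>\<^sub>M circ)" by measurable
    have "(\<integral>\<^sup>+a. \<integral>\<^sup>+b. Q (x(2 * r := a, Suc (2 * r) := b)) \<partial>circ \<partial>circ)
       = (\<integral>\<^sup>+a. iphi r x * ennreal (rho n (2 * r) x) * (\<integral>\<^sup>+b. ipr a b * ennreal (rho2 n a b) \<partial>circ) \<partial>circ)"
      unfolding e by (intro nn_integral_cong nn_integral_cmult) measurable
    also have "\<dots> = iphi r x * ennreal (rho n (2 * r) x) * one_pair_mass"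
      unfolding one_pair_mass_def by (rule nn_integral_cmult) (rule circ.borel_measurable_nn_integral[OF m])
    finally show "(\<integral>\<^sup>+a. \<integral>\<^sup>+b. Q (x(2 * r := a, Suc (2 * r) := b)) \<partial>circ \<partial>circ) = iphi r x * ennreal (rho n (2 * r) x) * one_pair_mass" .
  qed
  also have "\<dots> = pairs_mass r * one_pair_mass" unfolding pairs_mass_def
    by (rule nn_integral_multc) (intro borel_measurable_times_ennreal iphi_torus rho_torus order_refl)
  finally have Q: "(\<integral>\<^sup>+x. Q x \<partial>torus (2 * Suc r)) = pairs_mass r * one_pair_mass" .
  have "(\<integral>\<^sup>+x. D x \<partial>torus (2 * Suc r)) \<le> (\<integral>\<^sup>+x. iphi r x * ennreal (hprod n r x) * ennreal (2 * fact (2 * Suc r)) \<partial>torus (2 * r)) * ennreal (H * (4 * real r * eps))"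
  proof (rule pair_step[OF Dm, where F = "\<lambda>x s a. ennreal (off_block n r (x(2 * r := a, 2 * r + 1 := a + s)))"])
    show "(\<lambda>x. iphi r x * ennreal (hprod n r x) * ennreal (2 * fact (2 * Suc r))) \<in> borel_measurable (torus (2 * r))"
      by (intro borel_measurable_times_ennreal iphi_hprod_measurable borel_measurable_const)
    fix x :: "nat \<Rightarrow> real"
    have "(\<lambda>p. (x(2 * r := snd p, 2 * r + 1 := snd p + fst p)) i) \<in> borel_measurable (borel \<Otimes>\<^sub>M borel)" for i
      by (cases "i = 2 * r + 1"; cases "i = 2 * r") auto
    then show "(\<lambda>p. ennreal (off_block n r (x(2 * r := snd p, 2 * r + 1 := snd p + fst p)))) \<in> borel_measurable (borel \<Otimes>\<^sub>M borel)"
      by (intro measurable_compose[OF off_block_measurable measurable_ennreal])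
    fix a b
    have u: "x(2 * r := a, 2 * r + 1 := a + (b - a)) = x(2 * r := a, Suc (2 * r) := b)" by simp
    show "D (x(2 * r := a, Suc (2 * r) := b)) \<le> iphi r x * ennreal (hprod n r x) * ennreal (2 * fact (2 * Suc r)) *
        (ipr a b * (ennreal (gpw n a b) * ennreal (off_block n r (x(2 * r := a, 2 * r + 1 := a + (b - a))))))"
      unfolding D_def upd_iphi upd_hprod' u by (simp add: mult_ac del: fact_Suc mult_Suc_right)
  next
    show "0 \<le> 4 * real r * eps" using eps_nonneg by simp
    fix x :: "nat \<Rightarrow> real" and s :: real assume "0 < s"
    from window_integral_off_block_le[OF this, of r x] show "(\<integral>\<^sup>+a. indicator I (a + s / 2) * (indicator {0..<2 * pi} a * ennreal (off_block n r (x(2 * r := a, 2 * r + 1 := a + s)))) \<partial>lborel) \<le> ennreal (4 * real r * eps * L)"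
      by (simp add: mult_ac)
  qed
  also have "\<dots> = (\<integral>\<^sup>+x. iphi r x * ennreal (hprod n r x) \<partial>torus (2 * r)) * ennreal (2 * fact (2 * Suc r)) * ennreal (H * (4 * real r * eps))"
    by (subst nn_integral_multc[OF iphi_hprod_measurable]) simp
  also have "\<dots> \<le> ennreal (H ^ r) * ennreal (2 * fact (2 * Suc r)) * ennreal (H * (4 * real r * eps))"
    by (intro mult_right_mono iphi_hprod_bound) auto
  also have "\<dots> = ennreal (step_error r)"
    unfolding step_error_def using H_nonneg eps_nonneg by (simp add: ennreal_mult[symmetric] mult_ac del: fact_Suc mult_Suc_right)
  finally have D: "(\<integral>\<^sup>+x. D x \<partial>torus (2 * Suc r)) \<le> ennreal (step_error r)" .
  have "pairs_mass (Suc r) \<le> (\<integral>\<^sup>+x. Q x + D x \<partial>torus (2 * Suc r))"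
    unfolding pairs_mass_def P_def[symmetric] by (intro nn_integral_mono PQ)
  then show "pairs_mass (Suc r) \<le> pairs_mass r * one_pair_mass + ennreal (step_error r)"
    using D by (simp add: nn_integral_add Q del: mult_Suc_right) (metis add_left_mono order_trans)
  have "pairs_mass r * one_pair_mass \<le> (\<integral>\<^sup>+x. P x + D x \<partial>torus (2 * Suc r))"
    unfolding Q[symmetric] by (intro nn_integral_mono PQ)
  also have "\<dots> = pairs_mass (Suc r) + (\<integral>\<^sup>+x. D x \<partial>torus (2 * Suc r))"
    unfolding pairs_mass_def P_def[symmetric] by (rule nn_integral_add) measurable
  finally show "pairs_mass r * one_pair_mass \<le> pairs_mass (Suc r) + ennreal (step_error r)"
    using D by (metis add_left_mono order_trans)
qed

lemma one_pair_mass_le: "one_pair_mass \<le> ennreal (H / 12)"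
proof -
  have "one_pair_mass \<le> (\<integral>\<^sup>+a. \<integral>\<^sup>+b. ipr a b * (ennreal (gpw n a b) * ennreal (1 / 12)) \<partial>circ \<partial>circ)"
    unfolding one_pair_mass_def
  proof (intro nn_integral_mono mult_left_mono)
    fix a b
    have "ennreal (rho2 n a b) \<le> ennreal (gpw n a b * (1 / 12))" using rho2_le[of n a b] by (intro ennreal_leI) simp
    then show "ennreal (rho2 n a b) \<le> ennreal (gpw n a b) * ennreal (1 / 12)" using gpw_nonneg[of n a b] by (simp only: ennreal_mult)
  qed simp
  also have "\<dots> \<le> ennreal (real n ^ 4 * \<delta> ^ 3 / (12 * pi\<^sup>2) * (1 / 12 * L))"
  proof (rule pair_integral_bound)
    show "(\<integral>\<^sup>+a. indicator I (a + s / 2) * (indicator {0..<2 * pi} a * ennreal (1 / 12)) \<partial>lborel) \<le> ennreal (1 / 12 * L)" for s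
      by (rule window_integral_const_le) simp
  qed (use L_pos in simp_all)
  finally show ?thesis by (simp add: H_def mult_ac)
qed

text \<open>The first correction factor is that of \<open>rho2_ge\<close>. The second, with
  \<open>\<delta> / L\<close>, pays for averages in the window whose two points do not both lie in
  \<open>{0..<2 * pi}\<close>.\<close>

lemma one_pair_mass_ge:
  assumes k: "0 \<le> 1 - 1 / (real n)\<^sup>2 - (real n)\<^sup>2 * \<delta>\<^sup>2 / 2" and dL: "\<delta> \<le> L"
  shows "ennreal (H / 12 * (1 - 1 / (real n)\<^sup>2 - (real n)\<^sup>2 * \<delta>\<^sup>2 / 2) * (1 - \<delta> / L)) \<le> one_pair_mass"
proof -
  define k where "k = 1 - 1 / (real n)\<^sup>2 - (real n)\<^sup>2 * \<delta>\<^sup>2 / 2"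
  define c where "c = real n ^ 4 / (4 * pi\<^sup>2) / 12 * k"
  have c: "0 \<le> c" using k by (simp add: c_def k_def)
  have rm: "(\<lambda>p. ennreal (rho2 n (fst p) (snd p))) \<in> borel_measurable (borel \<Otimes>\<^sub>M borel)" by measurable
  have "H / 12 * k * (1 - \<delta> / L) = c * (L - \<delta>) * \<delta> ^ 3 / 3"
    using L_pos by (simp add: c_def H_def field_simps)
  note hk = this
  have "ennreal (H / 12 * k * (1 - \<delta> / L)) = (\<integral>\<^sup>+s. ennreal (c * (L - \<delta>) * s\<^sup>2) * indicator {0<..\<delta>} s \<partial>lborel)"
    unfolding hk using c dL d by (intro nn_integral_square[symmetric]) auto
  also have "\<dots> \<le> (\<integral>\<^sup>+s. indicator {0<..\<delta>} s * (\<integral>\<^sup>+a. indicator I (a + s / 2) * (indicator {0..<2 * pi} a * (indicator {0..<2 * pi} (a + s) * ennreal (rho2 n a (a + s)))) \<partial>lborel) \<partial>lborel)"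
  proof (intro nn_integral_mono)
    fix s :: real
    show "ennreal (c * (L - \<delta>) * s\<^sup>2) * indicator {0<..\<delta>} s \<le> indicator {0<..\<delta>} s * (\<integral>\<^sup>+a. indicator I (a + s / 2) * (indicator {0..<2 * pi} a * (indicator {0..<2 * pi} (a + s) * ennreal (rho2 n a (a + s)))) \<partial>lborel)"
    proof (cases "s \<in> {0<..\<delta>}")
      case True
      then have s: "0 < s" "s \<le> \<delta>" by auto
      define X where "X = (\<integral>\<^sup>+a. indicator I (a + s / 2) * (indicator {0..<2 * pi} a * indicator {0..<2 * pi} (a + s)) \<partial>lborel)"
      have "ennreal L = (\<integral>\<^sup>+a. indicator I (a + s / 2) \<partial>lborel)" by (rule nn_integral_shift_I[symmetric])
      \<comment> \<open>An average in \<open>I\<close> fails to give two points in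
        \<open>{0..<2 * pi}\<close> only within \<open>s / 2\<close> of an end. The two exceptional
        intervals for \<open>a\<close> have length \<open>s / 2\<close> each.\<close>
      also have "\<dots> \<le> (\<integral>\<^sup>+a. indicator I (a + s / 2) * (indicator {0..<2 * pi} a * indicator {0..<2 * pi} (a + s)) + (indicator {- (s / 2)..0} a + indicator {2 * pi - s..2 * pi - s / 2} a) \<partial>lborel)"
      proof (intro nn_integral_mono)
        fix a
        show "indicator I (a + s / 2) \<le> indicator I (a + s / 2) * (indicator {0..<2 * pi} a * indicator {0..<2 * pi} (a + s)) + (indicator {- (s / 2)..0} a + indicator {2 * pi - s..2 * pi - s / 2} a :: ennreal)"
        proof (cases "a + s / 2 \<in> I")
          case True
          then have "0 \<le> a + s / 2" "a + s / 2 < 2 * pi" using sub by auto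
          then consider "0 \<le> a" "a + s < 2 * pi" | "a \<in> {- (s / 2)..0}" | "a \<in> {2 * pi - s..2 * pi - s / 2}"
            by force
          then show ?thesis
          proof cases
            case 1 then show ?thesis using s by (auto simp: indicator_def)
          next
            case 2 then show ?thesis by (simp add: indicator_def)
          next
            case 3 then show ?thesis by (simp add: indicator_def)
          qed
        qed simp
      qed
      also have "\<dots> = X + (ennreal (s / 2) + ennreal (s / 2))"
        unfolding X_def using s by (subst nn_integral_add) (auto simp: nn_integral_add)
      also have "\<dots> = X + ennreal s" using s by (simp add: ennreal_plus[symmetric] del: ennreal_plus)
      finally have "ennreal L \<le> X + ennreal s" .
      then have "ennreal (L - s) \<le> X"
        using s L_pos by (cases X) (auto simp: ennreal_plus[symmetric] intro!: ennreal_leI simp del: ennreal_plus)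
      then have XL: "ennreal (L - \<delta>) \<le> X" using s by (meson ennreal_leI diff_left_mono order_trans)
      have "ennreal (c * (L - \<delta>) * s\<^sup>2) = ennreal (c * s\<^sup>2) * ennreal (L - \<delta>)"
        using c dL by (simp add: ennreal_mult[symmetric] mult_ac)
      also have "\<dots> \<le> ennreal (c * s\<^sup>2) * X" by (intro mult_left_mono XL) auto
      also have "\<dots> = (\<integral>\<^sup>+a. ennreal (c * s\<^sup>2) * (indicator I (a + s / 2) * (indicator {0..<2 * pi} a * indicator {0..<2 * pi} (a + s))) \<partial>lborel)"
        unfolding X_def by (rule nn_integral_cmult[symmetric]) measurable
      also have "\<dots> \<le> (\<integral>\<^sup>+a. indicator I (a + s / 2) * (indicator {0..<2 * pi} a * (indicator {0..<2 * pi} (a + s) * ennreal (rho2 n a (a + s)))) \<partial>lborel)"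
      proof (intro nn_integral_mono)
        fix a
        have "c * s\<^sup>2 \<le> rho2 n a (a + s)"
          using rho2_ge[of s \<delta> n a] s unfolding gpw_shift c_def k_def by (simp add: mult_ac)
        then show "ennreal (c * s\<^sup>2) * (indicator I (a + s / 2) * (indicator {0..<2 * pi} a * indicator {0..<2 * pi} (a + s)))
          \<le> indicator I (a + s / 2) * (indicator {0..<2 * pi} a * (indicator {0..<2 * pi} (a + s) * ennreal (rho2 n a (a + s))))"
          by (auto simp: indicator_def ennreal_leI)
      qed
      finally show ?thesis using True by simp
    qed simp
  qed
  also have "\<dots> = one_pair_mass" unfolding one_pair_mass_def by (rule pair_integral_eq[OF rm, symmetric])
  finally show ?thesis unfolding k_def .
qed

section \<open>Configurations in which a close pair is not isolated\<close>

definition triple_mass :: "nat \<Rightarrow> ennreal" where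
  "triple_mass r = (\<integral>\<^sup>+x. iphi r x * of_bool (\<exists>c<2 * r. \<bar>x (2 * r) - x c\<bar> \<le> \<delta>) * ennreal (rho n (2 * r + 1) x) \<partial>torus (2 * r + 1))"

lemma of_bool_ex_le_sum:
  fixes P :: "nat \<Rightarrow> bool"
  shows "(of_bool (\<exists>c<m. P c) :: ennreal) \<le> (\<Sum>c<m. of_bool (P c))"
proof (cases "\<exists>c<m. P c")
  case True
  then obtain c where c: "c < m" "P c" by auto
  have "(of_bool (P c) :: ennreal) \<le> (\<Sum>c<m. of_bool (P c))" using c by (intro member_le_sum) auto
  then show ?thesis using c True by simp
qed simp

text \<open>The additional point costs a factor \<open>n / (2 * pi)\<close> in the correlation
  function and is confined to \<open>2 * r\<close> intervals of length \<open>2 * \<delta>\<close>;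
  the result is of order \<open>n * \<delta>\<close>.\<close>

lemma triple_mass_le: "triple_mass r \<le> ennreal (real n / (2 * pi) * fact (2 * r + 1) * H ^ r * (2 * real r * (2 * \<delta>)))"
proof -
  define C where "C = real n / (2 * pi) * fact (2 * r + 1)"
  have C: "0 \<le> C" by (simp add: C_def)
  define g where "g x = iphi r x * ennreal (hprod n r x) * (ennreal C * (\<Sum>c<2 * r. indicator {x c - \<delta>..x c + \<delta>} (x (2 * r))))" for x
  have im: "(\<lambda>x. indicator {x c - \<delta>..x c + \<delta>} (x (2 * r)) :: ennreal) \<in> borel_measurable (torus (Suc (2 * r)))" if "c < 2 * r" for c
    by (rule indicator_window_measurable; rule component_torus) (use that in simp_all)
  have gm: "g \<in> borel_measurable (torus (Suc (2 * r)))"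
    unfolding g_def by (intro borel_measurable_times_ennreal borel_measurable_sum borel_measurable_const iphi_torus hprod_torus im) auto
  have "triple_mass r \<le> (\<integral>\<^sup>+x. g x \<partial>torus (Suc (2 * r)))"
    unfolding triple_mass_def
  proof (simp only: Suc_eq_plus1[symmetric], intro nn_integral_mono)
    fix x :: "nat \<Rightarrow> real"
    have "ennreal (rho n (Suc (2 * r)) x) \<le> ennreal (C * hprod n r x)"
      using rho_odd_bound[OF n, of r x] unfolding C_def by (intro ennreal_leI) (simp add: mult_ac del: fact_Suc)
    then have 1: "ennreal (rho n (Suc (2 * r)) x) \<le> ennreal C * ennreal (hprod n r x)"
      using C hprod_nonneg by (simp add: ennreal_mult)
    have "of_bool (\<exists>c<2 * r. \<bar>x (2 * r) - x c\<bar> \<le> \<delta>) \<le> (\<Sum>c<2 * r. of_bool (\<bar>x (2 * r) - x c\<bar> \<le> \<delta>) :: ennreal)"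
      by (rule of_bool_ex_le_sum)
    also have "\<dots> = (\<Sum>c<2 * r. indicator {x c - \<delta>..x c + \<delta>} (x (2 * r)))"
      by (intro sum.cong refl) (auto simp: indicator_def abs_le_iff)
    finally have "iphi r x * of_bool (\<exists>c<2 * r. \<bar>x (2 * r) - x c\<bar> \<le> \<delta>) * ennreal (rho n (Suc (2 * r)) x)
      \<le> iphi r x * (\<Sum>c<2 * r. indicator {x c - \<delta>..x c + \<delta>} (x (2 * r))) * (ennreal C * ennreal (hprod n r x))"
      by (intro mult_mono 1) auto
    then show "iphi r x * of_bool (\<exists>c<2 * r. \<bar>x (2 * r) - x c\<bar> \<le> \<delta>) * ennreal (rho n (Suc (2 * r)) x) \<le> g x"
      unfolding g_def by (simp only: mult_ac)
  qed
  also have "\<dots> = (\<integral>\<^sup>+x. \<integral>\<^sup>+t. g (x(2 * r := t)) \<partial>circ \<partial>torus (2 * r))"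
    by (rule nn_integral_torus_Suc[OF gm])
  also have "\<dots> \<le> (\<integral>\<^sup>+x. iphi r x * ennreal (hprod n r x) * (ennreal C * ennreal (2 * real r * (2 * \<delta>))) \<partial>torus (2 * r))"
  proof (intro nn_integral_mono)
    fix x :: "nat \<Rightarrow> real"
    have cm: "(\<lambda>t. indicator {x c - \<delta>..x c + \<delta>} t :: ennreal) \<in> borel_measurable circ" for c by measurable
    have e: "g (x(2 * r := t)) = iphi r x * ennreal (hprod n r x) * (ennreal C * (\<Sum>c<2 * r. indicator {x c - \<delta>..x c + \<delta>} t))" for t
    proof -
      have "iphi r (x(2 * r := t)) = iphi r x" "hprod n r (x(2 * r := t)) = hprod n r x"
        by (rule iphi_cong, simp) (rule hprod_cong, simp)
      moreover have "(\<Sum>c<2 * r. indicator {(x(2 * r := t)) c - \<delta>..(x(2 * r := t)) c + \<delta>} ((x(2 * r := t)) (2 * r)) :: ennreal) = (\<Sum>c<2 * r. indicator {x c - \<delta>..x c + \<delta>} t)"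
        by (intro sum.cong refl) simp
      ultimately show ?thesis unfolding g_def by simp
    qed
    have one: "(\<integral>\<^sup>+t. indicator {u - \<delta>..u + \<delta>} t \<partial>circ) \<le> ennreal (2 * \<delta>)" for u :: real
    proof -
      have "(\<integral>\<^sup>+t. indicator {u - \<delta>..u + \<delta>} t \<partial>circ) = (\<integral>\<^sup>+t. indicator {0..<2 * pi} t * indicator {u - \<delta>..u + \<delta>} t \<partial>lborel)"
        by (rule nn_integral_circ) measurable
      also have "\<dots> \<le> (\<integral>\<^sup>+t. indicator {u - \<delta>..u + \<delta>} t \<partial>lborel)" by (intro nn_integral_mono) (auto simp: indicator_def)
      also have "\<dots> = ennreal (2 * \<delta>)" using d by simp
      finally show ?thesis .
    qed
    have "(\<integral>\<^sup>+t. g (x(2 * r := t)) \<partial>circ) = iphi r x * ennreal (hprod n r x) * (ennreal C * (\<Sum>c<2 * r. \<integral>\<^sup>+t. indicator {x c - \<delta>..x c + \<delta>} t \<partial>circ))"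
      unfolding e using cm by (simp add: nn_integral_cmult nn_integral_sum)
    also have "\<dots> \<le> iphi r x * ennreal (hprod n r x) * (ennreal C * (\<Sum>c<2 * r. ennreal (2 * \<delta>)))"
      by (intro mult_left_mono sum_mono one) auto
    also have "(\<Sum>c<2 * r. ennreal (2 * \<delta>)) = ennreal (2 * real r * (2 * \<delta>))"
      using d by (subst sum_ennreal) (auto simp: mult_ac)
    finally show "(\<integral>\<^sup>+t. g (x(2 * r := t)) \<partial>circ) \<le> iphi r x * ennreal (hprod n r x) * (ennreal C * ennreal (2 * real r * (2 * \<delta>)))" .
  qed
  also have "\<dots> = (\<integral>\<^sup>+x. iphi r x * ennreal (hprod n r x) \<partial>torus (2 * r)) * (ennreal C * ennreal (2 * real r * (2 * \<delta>)))"
    by (rule nn_integral_multc[OF iphi_hprod_measurable])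
  also have "\<dots> \<le> ennreal (H ^ r) * (ennreal C * ennreal (2 * real r * (2 * \<delta>)))"
    by (intro mult_right_mono iphi_hprod_bound) auto
  also have "\<dots> = ennreal (H ^ r * (C * (2 * real r * (2 * \<delta>))))"
    using H_nonneg C d by (simp add: ennreal_mult[symmetric])
  finally show ?thesis unfolding C_def by (simp add: mult_ac del: fact_Suc)
qed

text \<open>The threshold is \<open>2 * \<delta>\<close> because the point that spoils the isolation
  of one pair may be the second point of another pair, whose first point is then within
  \<open>2 * \<delta>\<close>. Comparing the first point of a pair with all earlier points leaves
  just one new condition when a pair is added.\<close>

definition near :: "nat \<Rightarrow> (nat \<Rightarrow> real) \<Rightarrow> bool" where
  "near r x \<longleftrightarrow> (\<exists>q<r. \<exists>c<2 * q. \<bar>x (2 * q) - x c\<bar> \<le> 2 * \<delta>)"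

lemma near_cong:
  assumes "\<And>a. a < 2 * r \<Longrightarrow> x a = y a" shows "near r x = near r y"
proof -
  have "\<bar>x (2 * q) - x c\<bar> = \<bar>y (2 * q) - y c\<bar>" if "q < r" "c < 2 * q" for q c using that assms by simp
  then show ?thesis unfolding near_def by metis
qed

lemma near_measurable:
  assumes "2 * r \<le> m" shows "Measurable.pred (torus m) (near r)"
proof -
  have "Measurable.pred (torus m) (\<lambda>x. \<bar>x (2 * q) - x c\<bar> \<le> 2 * \<delta>)" if "q < r" "c < 2 * q" for q c
  proof -
    have [measurable]: "(\<lambda>x. x (2 * q)) \<in> borel_measurable (torus m)" "(\<lambda>x. x c) \<in> borel_measurable (torus m)"
      by (rule component_torus, use that assms in simp)+
    show ?thesis by measurable
  qed
  then have "Measurable.pred (torus m) (\<lambda>x. \<exists>q\<in>{..<r}. \<exists>c\<in>{..<2 * q}. \<bar>x (2 * q) - x c\<bar> \<le> 2 * \<delta>)"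
    by (intro pred_intros_finite) auto
  then show ?thesis unfolding near_def Bex_def lessThan_iff .
qed

definition near_mass :: "nat \<Rightarrow> ennreal" where
  "near_mass r = (\<integral>\<^sup>+x. iphi r x * of_bool (near r x) * ennreal (rho n (2 * r) x) \<partial>torus (2 * r))"

lemma near_term_measurable: "(\<lambda>x. iphi r x * ennreal (hprod n r x) * of_bool (near r x)) \<in> borel_measurable (torus (2 * r))"
  by (intro borel_measurable_times_ennreal iphi_hprod_measurable of_bool_measurable near_measurable order_refl)

text \<open>When a pair is added, nearness confines its first point to \<open>2 * r\<close>
  intervals of length \<open>4 * \<delta>\<close> in place of a window of length \<open>L\<close>.
  The relative losses add up to a multiple of \<open>r\<^sup>2 * \<delta> / L\<close>.\<close>

lemma near_hprod_bound:
  "(\<integral>\<^sup>+x. iphi r x * ennreal (hprod n r x) * of_bool (near r x) \<partial>torus (2 * r)) \<le> ennreal (2 * (real r)\<^sup>2 * (4 * \<delta> / L) * H ^ r)"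
proof (induction r)
  case 0
  show ?case by (simp add: near_def)
next
  case (Suc r)
  let ?t = "\<lambda>r x. iphi r x * ennreal (hprod n r x) * of_bool (near r x)"
  let ?U = "\<lambda>x. iphi r x * ennreal (hprod n r x)"
  define f1 where "f1 x = iphi (Suc r) x * ennreal (hprod n (Suc r) x) * of_bool (near r x)" for x
  define f2 where "f2 x = iphi (Suc r) x * ennreal (hprod n (Suc r) x) * (\<Sum>c<2 * r. indicator {x c - 2 * \<delta>..x c + 2 * \<delta>} (x (2 * r)))" for x
  have cm: "a < 2 * Suc r \<Longrightarrow> (\<lambda>x. x a) \<in> borel_measurable (torus (2 * Suc r))" for a by (rule component_torus)
  have f1m: "f1 \<in> borel_measurable (torus (2 * Suc r))"
    unfolding f1_def by (intro borel_measurable_times_ennreal iphi_hprod_measurable of_bool_measurable near_measurable) simp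
  have im: "(\<lambda>x. indicator {x c - 2 * \<delta>..x c + 2 * \<delta>} (x (2 * r)) :: ennreal) \<in> borel_measurable (torus (2 * Suc r))" if "c < 2 * r" for c
    by (rule indicator_window_measurable; rule cm) (use that in simp_all)
  have f2m: "f2 \<in> borel_measurable (torus (2 * Suc r))"
    unfolding f2_def by (intro borel_measurable_times_ennreal borel_measurable_sum iphi_hprod_measurable im) auto
  have nS: "of_bool (near (Suc r) x) \<le> (of_bool (near r x) + (\<Sum>c<2 * r. indicator {x c - 2 * \<delta>..x c + 2 * \<delta>} (x (2 * r))) :: ennreal)" for x
  proof -
    have "near (Suc r) x \<longleftrightarrow> near r x \<or> (\<exists>c<2 * r. \<bar>x (2 * r) - x c\<bar> \<le> 2 * \<delta>)"
      unfolding near_def by (auto simp: less_Suc_eq)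
    then have "of_bool (near (Suc r) x) \<le> (of_bool (near r x) + of_bool (\<exists>c<2 * r. \<bar>x (2 * r) - x c\<bar> \<le> 2 * \<delta>) :: ennreal)"
      by simp
    also have "\<dots> \<le> of_bool (near r x) + (\<Sum>c<2 * r. of_bool (\<bar>x (2 * r) - x c\<bar> \<le> 2 * \<delta>))"
      by (intro add_left_mono of_bool_ex_le_sum)
    also have "(\<Sum>c<2 * r. of_bool (\<bar>x (2 * r) - x c\<bar> \<le> 2 * \<delta>)) = (\<Sum>c<2 * r. indicator {x c - 2 * \<delta>..x c + 2 * \<delta>} (x (2 * r)) :: ennreal)"
      by (intro sum.cong refl) (auto simp: indicator_def abs_le_iff)
    finally show ?thesis .
  qed
  have "(\<integral>\<^sup>+x. ?t (Suc r) x \<partial>torus (2 * Suc r)) \<le> (\<integral>\<^sup>+x. f1 x + f2 x \<partial>torus (2 * Suc r))"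
    unfolding f1_def f2_def distrib_left[symmetric] by (intro nn_integral_mono mult_left_mono nS) auto
  also have "\<dots> = (\<integral>\<^sup>+x. f1 x \<partial>torus (2 * Suc r)) + (\<integral>\<^sup>+x. f2 x \<partial>torus (2 * Suc r))"
    by (rule nn_integral_add[OF f1m f2m])
  also have "(\<integral>\<^sup>+x. f1 x \<partial>torus (2 * Suc r)) \<le> (\<integral>\<^sup>+x. ?t r x \<partial>torus (2 * r)) * ennreal (H * 1)"
  proof (rule pair_step[OF f1m near_term_measurable, where F = "\<lambda>_ _ _. ennreal 1"])
    fix x a b
    have "near r (x(2 * r := a, Suc (2 * r) := b)) = near r x" by (rule near_cong) simp
    then show "f1 (x(2 * r := a, Suc (2 * r) := b)) \<le> ?t r x * (ipr a b * (ennreal (gpw n a b) * ennreal 1))"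
      unfolding f1_def upd_iphi upd_hprod by (simp add: ennreal_mult hprod_nonneg gpw_nonneg mult_ac)
  next
    show "(\<integral>\<^sup>+a. indicator I (a + s / 2) * (indicator {0..<2 * pi} a * ennreal 1) \<partial>lborel) \<le> ennreal (1 * L)" for s
      by (rule window_integral_const_le) simp
  qed simp_all
  also have "\<dots> \<le> ennreal (2 * (real r)\<^sup>2 * (4 * \<delta> / L) * H ^ r) * ennreal (H * 1)"
    by (intro mult_right_mono Suc) auto
  also have "(\<integral>\<^sup>+x. f2 x \<partial>torus (2 * Suc r)) \<le> (\<integral>\<^sup>+x. ?U x \<partial>torus (2 * r)) * ennreal (H * (2 * real r * (4 * \<delta>) / L))"
  proof (rule pair_step[OF f2m iphi_hprod_measurable, where F = "\<lambda>x _ a. \<Sum>c<2 * r. indicator {x c - 2 * \<delta>..x c + 2 * \<delta>} a"])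
    fix x :: "nat \<Rightarrow> real" and a b :: real
    show "(\<lambda>p. \<Sum>c<2 * r. indicator {x c - 2 * \<delta>..x c + 2 * \<delta>} (snd p) :: ennreal) \<in> borel_measurable (borel \<Otimes>\<^sub>M borel)"
      by measurable
    have "(\<Sum>c<2 * r. indicator {(x(2 * r := a, Suc (2 * r) := b)) c - 2 * \<delta>..(x(2 * r := a, Suc (2 * r) := b)) c + 2 * \<delta>} ((x(2 * r := a, Suc (2 * r) := b)) (2 * r)) :: ennreal)
       = (\<Sum>c<2 * r. indicator {x c - 2 * \<delta>..x c + 2 * \<delta>} a)"
      by (intro sum.cong refl) simp
    then show "f2 (x(2 * r := a, Suc (2 * r) := b)) \<le> ?U x * (ipr a b * (ennreal (gpw n a b) * (\<Sum>c<2 * r. indicator {x c - 2 * \<delta>..x c + 2 * \<delta>} a)))"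
      unfolding f2_def upd_iphi upd_hprod by (simp add: ennreal_mult hprod_nonneg gpw_nonneg mult_ac)
  next
    show "0 \<le> 2 * real r * (4 * \<delta>) / L" using d L_pos by simp
    fix x :: "nat \<Rightarrow> real" and s :: real
    have "(\<integral>\<^sup>+a. indicator I (a + s / 2) * (indicator {0..<2 * pi} a * (\<Sum>c<2 * r. indicator {x c - 2 * \<delta>..x c + 2 * \<delta>} a)) \<partial>lborel)
      = (\<Sum>c<2 * r. \<integral>\<^sup>+a. indicator I (a + s / 2) * (indicator {0..<2 * pi} a * indicator {x c - 2 * \<delta>..x c + 2 * \<delta>} a) \<partial>lborel)"
      unfolding sum_distrib_left by (rule nn_integral_sum) measurable
    also have "\<dots> \<le> (\<Sum>c<2 * r. ennreal (2 * (2 * \<delta>)))" using d by (intro sum_mono window_integral_near_le) simp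
    also have "\<dots> = ennreal (2 * real r * (4 * \<delta>))" using d by (subst sum_ennreal) auto
    finally show "(\<integral>\<^sup>+a. indicator I (a + s / 2) * (indicator {0..<2 * pi} a * (\<Sum>c<2 * r. indicator {x c - 2 * \<delta>..x c + 2 * \<delta>} a)) \<partial>lborel) \<le> ennreal (2 * real r * (4 * \<delta>) / L * L)"
      using L_pos by simp
  qed
  also have "\<dots> \<le> ennreal (H ^ r) * ennreal (H * (2 * real r * (4 * \<delta>) / L))"
    by (intro mult_right_mono iphi_hprod_bound) auto
  finally have "(\<integral>\<^sup>+x. ?t (Suc r) x \<partial>torus (2 * Suc r))
     \<le> ennreal (2 * (real r)\<^sup>2 * (4 * \<delta> / L) * H ^ r) * ennreal (H * 1) + ennreal (H ^ r) * ennreal (H * (2 * real r * (4 * \<delta>) / L))"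
    by (simp add: add_left_mono add_right_mono)
  also have "\<dots> = ennreal (2 * ((real r)\<^sup>2 + real r) * (4 * \<delta> / L) * H ^ Suc r)"
    using H_nonneg d L_pos by (simp add: ennreal_mult[symmetric] ennreal_plus[symmetric] algebra_simps add_divide_distrib del: ennreal_plus)
  also have "\<dots> \<le> ennreal (2 * (real (Suc r))\<^sup>2 * (4 * \<delta> / L) * H ^ Suc r)"
    using H_nonneg d L_pos by (intro ennreal_leI mult_right_mono mult_left_mono) (auto simp: power2_eq_square algebra_simps)
  finally show ?case .
qed

lemma near_mass_le: "near_mass r \<le> ennreal (fact (2 * r) * (2 * (real r)\<^sup>2 * (4 * \<delta> / L) * H ^ r))"
proof -
  have "near_mass r \<le> (\<integral>\<^sup>+x. ennreal (fact (2 * r)) * (iphi r x * ennreal (hprod n r x) * of_bool (near r x)) \<partial>torus (2 * r))"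
    unfolding near_mass_def
  proof (intro nn_integral_mono)
    fix x
    have "ennreal (rho n (2 * r) x) \<le> ennreal (fact (2 * r)) * ennreal (hprod n r x)"
      using rho_even_bound[OF n, of r x] hprod_nonneg[of n r x] by (simp add: ennreal_mult[symmetric] ennreal_leI)
    then have "iphi r x * of_bool (near r x) * ennreal (rho n (2 * r) x) \<le> iphi r x * of_bool (near r x) * (ennreal (fact (2 * r)) * ennreal (hprod n r x))"
      by (rule mult_left_mono) simp
    then show "iphi r x * of_bool (near r x) * ennreal (rho n (2 * r) x) \<le> ennreal (fact (2 * r)) * (iphi r x * ennreal (hprod n r x) * of_bool (near r x))"
      by (simp only: mult_ac)
  qed
  also have "\<dots> = ennreal (fact (2 * r)) * (\<integral>\<^sup>+x. iphi r x * ennreal (hprod n r x) * of_bool (near r x) \<partial>torus (2 * r))"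
    by (rule nn_integral_cmult[OF near_term_measurable])
  also have "\<dots> \<le> ennreal (fact (2 * r)) * ennreal (2 * (real r)\<^sup>2 * (4 * \<delta> / L) * H ^ r)"
    by (intro mult_left_mono near_hprod_bound) auto
  finally show ?thesis using H_nonneg d L_pos by (simp add: ennreal_mult[symmetric])
qed

end

section \<open>Factorial moments and the sieve\<close>

lemma prod_falling_binomial: "prod ((-) N) {0..<r} = fact r * (N choose r)" for N r :: nat
proof (induction r)
  case (Suc r)
  have "Suc r * (N choose Suc r) = N * ((N - 1) choose r)" using binomial_absorption[of r "N - 1"] times_binomial_minus1_eq[of "Suc r" N] by simp
  also have "\<dots> = (N - r) * (N choose r)" by (rule binomial_absorb_comp[symmetric])
  finally have "fact (Suc r) * (N choose Suc r) = fact r * ((N - r) * (N choose r))"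
    by (metis fact_Suc mult.assoc mult.commute of_nat_id)
  then show ?case using Suc by (simp add: mult_ac)
qed simp

lemma alternating_binomial_sum:
  "(\<Sum>i\<le>R. (- 1) ^ i * real (Suc N choose i)) = (- 1) ^ R * real (N choose R)"
  by (induction R) (simp_all add: algebra_simps)

text \<open>For positive \<open>N\<close> the truncated alternating sum is, up to sign, exactly
  \<open>N - 1\<close> choose \<open>R\<close>; bounding it by \<open>N\<close> choose
  \<open>R\<close> lets a single moment control the error.\<close>

lemma bonferroni: "\<bar>of_bool (N = 0) - (\<Sum>i\<le>R. (- 1) ^ i * real (N choose i))\<bar> \<le> real (N choose R)"
proof (cases N)
  case 0
  have "(\<Sum>i\<le>R. (- 1) ^ i * real (0 choose i)) = (\<Sum>i\<in>{0}. (- 1) ^ i * real (0 choose i))"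
    by (rule sum.mono_neutral_right) auto
  then show ?thesis using 0 by simp
next
  case (Suc m)
  then show ?thesis unfolding Suc alternating_binomial_sum
    by (simp add: abs_mult binomial_mono binomial_right_mono power_abs)
qed

lemma restrict_comp_in_space: "restrict (x \<circ> f) {..<m} \<in> space (torus m)"
  by (simp add: space_PiM circ_def)

lemma count_injections_measurable:
  assumes Q [measurable]: "Q \<in> sets (torus m)"
  shows "(\<lambda>x. of_nat (card {f \<in> injections m n. restrict (x \<circ> f) {..<m} \<in> Q}) :: ennreal) \<in> borel_measurable (weyl_measure n)"
proof -
  have "(\<lambda>x. indicator Q (restrict (x \<circ> f) {..<m}) :: ennreal) \<in> borel_measurable (weyl_measure n)" if f: "f \<in> injections m n" for f
  proof -
    have "(\<lambda>x. restrict (x \<circ> f) {..<m}) \<in> measurable (torus n) (torus m)"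
      unfolding comp_def using f by (intro measurable_restrict measurable_component_singleton) (auto simp: injections_def)
    then show ?thesis by measurable
  qed
  then have "(\<lambda>x. \<Sum>f\<in>injections m n. indicator Q (restrict (x \<circ> f) {..<m}) :: ennreal) \<in> borel_measurable (weyl_measure n)"
    by (rule borel_measurable_sum)
  moreover have "(\<Sum>f\<in>injections m n. indicator Q (restrict (x \<circ> f) {..<m}) :: ennreal) = of_nat (card {f \<in> injections m n. restrict (x \<circ> f) {..<m} \<in> Q})" for x
    by (simp add: indicator_def sum.If_cases Int_def)
  ultimately show ?thesis by simp
qed

section \<open>Isolated pairs and their factorial moments\<close>

context close_pairs
begin

definition pset :: "(nat \<Rightarrow> real) \<Rightarrow> (nat \<times> nat) set" where
  "pset x = {(i, j). i < n \<and> j < n \<and> pr (x i) (x j)}"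

text \<open>Isolation of the first point alone already makes distinct isolated pairs disjoint, since \<open>pr\<close> is ordered.\<close>

definition iso_pairs :: "(nat \<Rightarrow> real) \<Rightarrow> (nat \<times> nat) set" where
  "iso_pairs x = {(i, j) \<in> pset x. \<forall>k<n. k \<noteq> i \<and> k \<noteq> j \<longrightarrow> \<delta> < \<bar>x k - x i\<bar>}"

lemma finite_pset: "finite (pset x)"
  by (rule finite_subset[of _ "{..<n} \<times> {..<n}"]) (auto simp: pset_def)

lemma iso_pairs_subset: "iso_pairs x \<subseteq> pset x" by (auto simp: iso_pairs_def)

lemma finite_iso_pairs: "finite (iso_pairs x)" using finite_subset[OF iso_pairs_subset finite_pset] .

lemma pr_imp_close: "pr a b \<Longrightarrow> a < b \<and> \<bar>a - b\<bar> \<le> \<delta> \<and> \<bar>b - a\<bar> \<le> \<delta>" by (auto simp: pr_def)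

lemma iso_pairs_disjoint:
  assumes "(i, j) \<in> iso_pairs x" "(k, l) \<in> iso_pairs x" "{i, j} \<inter> {k, l} \<noteq> {}"
  shows "(i, j) = (k, l)"
proof -
  have b: "i < n" "j < n" "k < n" "l < n" "pr (x i) (x j)" "pr (x k) (x l)"
    using assms by (auto simp: iso_pairs_def pset_def)
  note p = pr_imp_close[OF b(5)] pr_imp_close[OF b(6)]
  have I1: "m < n \<Longrightarrow> m \<noteq> i \<Longrightarrow> m \<noteq> j \<Longrightarrow> \<delta> < \<bar>x m - x i\<bar>" for m using assms(1) by (auto simp: iso_pairs_def)
  have I2: "m < n \<Longrightarrow> m \<noteq> k \<Longrightarrow> m \<noteq> l \<Longrightarrow> \<delta> < \<bar>x m - x k\<bar>" for m using assms(2) by (auto simp: iso_pairs_def)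
  consider "i = k" | "i = l" | "j = k" | "j = l" using assms(3) by auto
  then show ?thesis
  proof cases
    case 1
    have "l = j"
    proof (rule ccontr)
      assume "l \<noteq> j"
      then have "\<delta> < \<bar>x l - x i\<bar>" using I1[of l] b p 1 by auto
      then show False using p 1 by (auto simp: abs_if split: if_splits)
    qed
    then show ?thesis using 1 by simp
  next
    case 2
    then have "k \<noteq> i" "k \<noteq> j" using p by auto
    then have "\<delta> < \<bar>x k - x i\<bar>" using I1[of k] b by simp
    then show ?thesis using p 2 by (auto simp: abs_if split: if_splits)
  next
    case 3
    then have "i \<noteq> k" "i \<noteq> l" using p by auto
    then have "\<delta> < \<bar>x i - x k\<bar>" using I2[of i] b by simp
    then show ?thesis using p 3 by (auto simp: abs_if split: if_splits)
  next
    \<comment> \<open>Both first points lie below the common second point by at most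
      \<open>\<delta>\<close>, hence within \<open>\<delta>\<close> of each other. Here the order
      within a pair is essential.\<close>
    case 4
    have "i = k"
    proof (rule ccontr)
      assume "i \<noteq> k"
      then have "\<delta> < \<bar>x k - x i\<bar>" using I1[of k] b p 4 by auto
      then show False using p 4 unfolding abs_le_iff by (auto simp: abs_if split: if_splits)
    qed
    then show ?thesis using 4 by simp
  qed
qed

definition pair_inj :: "(nat \<times> nat) set \<Rightarrow> nat \<Rightarrow> (nat \<Rightarrow> nat) set" where
  "pair_inj S r = {f \<in> injections (2 * r) n. \<forall>q<r. (f (2 * q), f (2 * q + 1)) \<in> S}"

text \<open>Distinct isolated pairs share no point. So an injective \<open>2 * r\<close>-tuple of
  points made of isolated pairs is the same as an injective \<open>r\<close>-tuple of isolated
  pairs, and the count is a falling factorial; overlapping pairs would spoil this.\<close>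

lemma card_pair_inj_iso: "card (pair_inj (iso_pairs x) r) = fact r * (card (iso_pairs x) choose r)"
proof -
  let ?G = "{h \<in> {..<r} \<rightarrow>\<^sub>E iso_pairs x. inj_on h {..<r}}"
  define \<phi> where "\<phi> f = (\<lambda>q\<in>{..<r}. (f (2 * q), f (2 * q + 1)))" for f :: "nat \<Rightarrow> nat"
  define \<psi> where "\<psi> h = (\<lambda>a\<in>{..<2 * r}. if even a then fst (h (a div 2)) else snd (h (a div 2)))" for h :: "nat \<Rightarrow> nat \<times> nat"
  have "bij_betw \<phi> (pair_inj (iso_pairs x) r) ?G"
  proof (rule bij_betw_byWitness[where f' = \<psi>])
    show "\<forall>f\<in>pair_inj (iso_pairs x) r. \<psi> (\<phi> f) = f"
    proof
      fix f assume f: "f \<in> pair_inj (iso_pairs x) r"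
      show "\<psi> (\<phi> f) = f"
      proof
        fix a
        show "\<psi> (\<phi> f) a = f a"
        proof (cases "a < 2 * r")
          case True
          then have "a div 2 < r" by auto
          then show ?thesis using True unfolding \<psi>_def \<phi>_def by (cases "even a") auto
        next
          case False
          then show ?thesis using f by (auto simp: \<psi>_def pair_inj_def injections_def PiE_def extensional_def)
        qed
      qed
    qed
    show "\<forall>h\<in>?G. \<phi> (\<psi> h) = h"
    proof
      fix h assume h: "h \<in> ?G"
      show "\<phi> (\<psi> h) = h"
      proof
        fix q
        show "\<phi> (\<psi> h) q = h q"
        proof (cases "q < r")
          case True
          then show ?thesis unfolding \<psi>_def \<phi>_def by simp
        next
          case False
          then show ?thesis using h by (auto simp: \<phi>_def PiE_def extensional_def)
        qed
      qed
    qed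
    show "\<phi> ` pair_inj (iso_pairs x) r \<subseteq> ?G"
    proof (intro image_subsetI CollectI conjI)
      fix f assume f: "f \<in> pair_inj (iso_pairs x) r"
      then show "\<phi> f \<in> {..<r} \<rightarrow>\<^sub>E iso_pairs x" by (auto simp: \<phi>_def pair_inj_def)
      have "inj_on f {..<2 * r}" using f by (auto simp: pair_inj_def injections_def)
      from inj_onD[OF this, of "2 * p" "2 * q" for p q] show "inj_on (\<phi> f) {..<r}"
        by (fastforce simp: \<phi>_def intro: inj_onI)
    qed
    show "\<psi> ` ?G \<subseteq> pair_inj (iso_pairs x) r"
    proof (intro image_subsetI)
      fix h assume h: "h \<in> ?G"
      then have hi: "q < r \<Longrightarrow> h q \<in> iso_pairs x" for q by auto
      have ev: "\<psi> h (2 * q) = fst (h q)" "\<psi> h (2 * q + 1) = snd (h q)" if "q < r" for q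
        using that by (auto simp: \<psi>_def)
      have mem: "\<psi> h a \<in> {fst (h (a div 2)), snd (h (a div 2))}" "a div 2 < r" if "a < 2 * r" for a
        using that by (auto simp: \<psi>_def)
      have lt: "\<psi> h a < n" if a: "a < 2 * r" for a
        using mem[OF a] hi[of "a div 2"] by (cases "h (a div 2)") (auto simp: iso_pairs_def pset_def)
      have inj: "inj_on (\<psi> h) {..<2 * r}"
      proof (rule inj_onI)
        fix a b assume ab: "a \<in> {..<2 * r}" "b \<in> {..<2 * r}" and e: "\<psi> h a = \<psi> h b"
        have la: "a < 2 * r" "b < 2 * r" using ab by auto
        obtain i j where ij: "h (a div 2) = (i, j)" by force
        obtain k l where kl: "h (b div 2) = (k, l)" by force
        have "{i, j} \<inter> {k, l} \<noteq> {}" using mem(1)[OF la(1)] mem(1)[OF la(2)] e ij kl by auto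
        then have eq: "h (a div 2) = h (b div 2)"
          using iso_pairs_disjoint[of i j x k l] hi[OF mem(2)[OF la(1)]] hi[OF mem(2)[OF la(2)]] ij kl by simp
        then have d: "a div 2 = b div 2" using h mem(2)[OF la(1)] mem(2)[OF la(2)] by (auto simp: inj_on_def)
        have "i \<noteq> j" using hi[OF mem(2)[OF la(1)]] ij by (auto simp: iso_pairs_def pset_def pr_def)
        then have "fst (h (b div 2)) \<noteq> snd (h (b div 2))" using ij eq by (metis fst_conv snd_conv)
        then have "even a \<longleftrightarrow> even b" using e la eq by (auto simp: \<psi>_def split: if_splits)
        then show "a = b" using d by (metis dvd_mult_div_cancel odd_two_times_div_two_succ)
      qed
      show "\<psi> h \<in> pair_inj (iso_pairs x) r"
        unfolding pair_inj_def injections_def using lt inj hi ev by (auto simp: \<psi>_def)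
    qed
  qed
  then have "card (pair_inj (iso_pairs x) r) = card ?G" by (rule bij_betw_same_card)
  also have "\<dots> = prod ((-) (card (iso_pairs x))) {0..<r}"
    using card_inj_on_subset_funcset[of "{..<r}" "iso_pairs x" "{..<r}"] finite_iso_pairs by simp
  also have "\<dots> = fact r * (card (iso_pairs x) choose r)" by (rule prod_falling_binomial)
  finally show ?thesis .
qed

definition near_inj :: "(nat \<Rightarrow> real) \<Rightarrow> nat \<Rightarrow> (nat \<Rightarrow> nat) set" where
  "near_inj x r = {f \<in> pair_inj (pset x) r. near r (x \<circ> f)}"

definition triple_inj :: "(nat \<Rightarrow> real) \<Rightarrow> nat \<Rightarrow> (nat \<Rightarrow> nat) set" where
  "triple_inj x r = {g \<in> injections (2 * r + 1) n. (\<forall>q<r. (g (2 * q), g (2 * q + 1)) \<in> pset x) \<and> (\<exists>c<2 * r. \<bar>x (g (2 * r)) - x (g c)\<bar> \<le> \<delta>)}"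

lemma finite_pair_inj: "finite (pair_inj S r)" unfolding pair_inj_def by (rule finite_subset[of _ "injections (2 * r) n"]) auto
lemma finite_triple_inj: "finite (triple_inj x r)" unfolding triple_inj_def by (rule finite_subset[of _ "injections (2 * r + 1) n"]) auto

text \<open>Some pair of the tuple fails to be isolated because of a point \<open>k\<close>. If
  \<open>k\<close> belongs to the tuple, two of its pairs are near; if not, appending
  \<open>k\<close> gives an element of \<open>triple_inj\<close> whose restriction is the
  tuple.\<close>

lemma pair_inj_split:
  "pair_inj (pset x) r \<subseteq> pair_inj (iso_pairs x) r \<union> (near_inj x r \<union> (\<lambda>g. restrict g {..<2 * r}) ` triple_inj x r)"
proof
  fix f assume f: "f \<in> pair_inj (pset x) r"
  show "f \<in> pair_inj (iso_pairs x) r \<union> (near_inj x r \<union> (\<lambda>g. restrict g {..<2 * r}) ` triple_inj x r)"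
  proof (cases "f \<in> pair_inj (iso_pairs x) r")
    case False
    have fi: "f \<in> injections (2 * r) n" and fp: "\<And>q. q < r \<Longrightarrow> (f (2 * q), f (2 * q + 1)) \<in> pset x"
      using f by (auto simp: pair_inj_def)
    have inj: "inj_on f {..<2 * r}" using fi by (simp add: injections_def)
    obtain q where q: "q < r" "(f (2 * q), f (2 * q + 1)) \<notin> iso_pairs x"
      using False fi by (auto simp: pair_inj_def)
    then obtain k where k: "k < n" "k \<noteq> f (2 * q)" "k \<noteq> f (2 * q + 1)" "\<bar>x k - x (f (2 * q))\<bar> \<le> \<delta>"
      using fp[OF q(1)] by (auto simp: iso_pairs_def not_less)
    show ?thesis
    proof (cases "k \<in> f ` {..<2 * r}")
      case True
      then obtain c where c: "c < 2 * r" "k = f c" by auto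
      define p where "p = c div 2"
      have p: "p < r" "c = 2 * p \<or> c = 2 * p + 1" using c by (auto simp: p_def)
      have pq: "p \<noteq> q" using p k c by auto
      have "near r (x \<circ> f)"
      proof (cases "p < q")
        case True
        then have "c < 2 * q" using p by auto
        moreover have "\<bar>x (f (2 * q)) - x (f c)\<bar> \<le> 2 * \<delta>" using k c d by auto
        ultimately show ?thesis unfolding near_def using q by auto
      next
        case False
        \<comment> \<open>The pair of \<open>k\<close> comes later, so \<open>near\<close> must
          compare its first point with an earlier point. The first point of pair \<open>q\<close>
          serves, and the way through \<open>k\<close> doubles the distance.\<close>
        then have qp: "2 * q < 2 * p" using pq by simp
        have "\<bar>x (f (2 * p)) - x (f c)\<bar> \<le> \<delta>"
          using p(2) fp[OF p(1)] d by (auto simp: pset_def dest: pr_imp_close)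
        then have "\<bar>x (f (2 * p)) - x (f (2 * q))\<bar> \<le> 2 * \<delta>" using k(4)[unfolded c(2)] by linarith
        then show ?thesis unfolding near_def comp_def using p(1) qp
          by (intro exI[of _ p] conjI exI[of _ "2 * q"]) simp_all
      qed
      then show ?thesis using f by (auto simp: near_inj_def)
    next
      case False
      define g where "g = f(2 * r := k)"
      have gi: "g \<in> injections (2 * r + 1) n"
        unfolding injections_def
      proof (intro CollectI conjI)
        show "g \<in> {..<2 * r + 1} \<rightarrow>\<^sub>E {..<n}"
          using fi k(1) unfolding g_def injections_def PiE_def extensional_def by (auto simp: less_Suc_eq)
        have "{..<2 * r + 1} = insert (2 * r) {..<2 * r}" by auto
        then show "inj_on g {..<2 * r + 1}" using inj False unfolding g_def
          by (auto simp: inj_on_def)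
      qed
      have "restrict g {..<2 * r} = f"
        using fi by (auto simp: g_def injections_def PiE_def extensional_def restrict_def fun_eq_iff)
      moreover have "g \<in> triple_inj x r"
        unfolding triple_inj_def
      proof (intro CollectI conjI gi allI impI)
        show "(g (2 * q), g (2 * q + 1)) \<in> pset x" if "q < r" for q
        proof -
          have "2 * q + 1 \<noteq> 2 * r" by presburger
          then show ?thesis using fp[OF that] that by (simp add: g_def)
        qed
        show "\<exists>c<2 * r. \<bar>x (g (2 * r)) - x (g c)\<bar> \<le> \<delta>"
          using q k by (intro exI[of _ "2 * q"]) (simp add: g_def)
      qed
      ultimately show ?thesis by blast
    qed
  qed simp
qed

lemma card_pair_inj_split:
  "card (pair_inj (pset x) r) \<le> card (pair_inj (iso_pairs x) r) + (card (near_inj x r) + card (triple_inj x r))"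
proof -
  have fn: "finite (near_inj x r)" unfolding near_inj_def using finite_pair_inj by simp
  have "card (pair_inj (pset x) r) \<le> card (pair_inj (iso_pairs x) r \<union> (near_inj x r \<union> (\<lambda>g. restrict g {..<2 * r}) ` triple_inj x r))"
    using fn finite_pair_inj finite_triple_inj by (intro card_mono pair_inj_split) auto
  also have "\<dots> \<le> card (pair_inj (iso_pairs x) r) + (card (near_inj x r) + card ((\<lambda>g. restrict g {..<2 * r}) ` triple_inj x r))"
    by (meson card_Un_le add_left_mono order_trans)
  also have "\<dots> \<le> card (pair_inj (iso_pairs x) r) + (card (near_inj x r) + card (triple_inj x r))"
    by (intro add_left_mono card_image_le finite_triple_inj)
  finally show ?thesis .
qed

lemma card_pair_inj_mono: "card (pair_inj (iso_pairs x) r) \<le> card (pair_inj (pset x) r)"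
  using iso_pairs_subset by (intro card_mono finite_pair_inj) (auto simp: pair_inj_def)

lemma iphi_indicator: "iphi r x = of_bool (\<forall>q<r. pr (x (2 * q)) (x (2 * q + 1)))"
proof (induction r)
  case (Suc r)
  then show ?case unfolding iphi_Suc by (auto simp: ipr_def less_Suc_eq)
qed (simp add: iphi_def)

lemma pairs_measurable: "2 * r \<le> m \<Longrightarrow> Measurable.pred (torus m) (\<lambda>x. \<forall>q<r. pr (x (2 * q)) (x (2 * q + 1)))"
proof -
  assume m: "2 * r \<le> m"
  have "Measurable.pred (torus m) (\<lambda>x. \<forall>q\<in>{..<r}. pr (x (2 * q)) (x (2 * q + 1)))"
  proof (intro pred_intros_finite pr_measurable)
    fix q assume "q \<in> {..<r}"
    then have "2 * q + 1 < m" using m by simp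
    then show "(\<lambda>x. x (2 * q)) \<in> borel_measurable (torus m)" "(\<lambda>x. x (2 * q + 1)) \<in> borel_measurable (torus m)"
      by (auto intro!: component_torus)
  qed simp
  then show ?thesis unfolding Ball_def lessThan_iff .
qed

lemma pset_pairs:
  assumes "f \<in> injections m n" "2 * r \<le> m"
  shows "(\<forall>q<r. (f (2 * q), f (2 * q + 1)) \<in> pset x) \<longleftrightarrow> (\<forall>q<r. pr (restrict (x \<circ> f) {..<m} (2 * q)) (restrict (x \<circ> f) {..<m} (2 * q + 1)))"
proof -
  have "f a < n" if "a < m" for a using assms(1) that by (auto simp: injections_def)
  then show ?thesis using assms(2) by (auto simp: pset_def)
qed

definition pairs_event :: "nat \<Rightarrow> (nat \<Rightarrow> real) set" where
  "pairs_event r = {y \<in> space (torus (2 * r)). \<forall>q<r. pr (y (2 * q)) (y (2 * q + 1))}"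

definition near_event :: "nat \<Rightarrow> (nat \<Rightarrow> real) set" where
  "near_event r = {y \<in> space (torus (2 * r)). (\<forall>q<r. pr (y (2 * q)) (y (2 * q + 1))) \<and> near r y}"

definition triple_event :: "nat \<Rightarrow> (nat \<Rightarrow> real) set" where
  "triple_event r = {y \<in> space (torus (2 * r + 1)). (\<forall>q<r. pr (y (2 * q)) (y (2 * q + 1))) \<and> (\<exists>c<2 * r. \<bar>y (2 * r) - y c\<bar> \<le> \<delta>)}"

lemma pairs_event_sets: "pairs_event r \<in> sets (torus (2 * r))"
  unfolding pairs_event_def by (rule predE) (rule pairs_measurable, simp)

lemma near_event_sets: "near_event r \<in> sets (torus (2 * r))"
  unfolding near_event_def by (rule predE) (intro pred_intros_logic pairs_measurable near_measurable order_refl)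

lemma triple_event_sets: "triple_event r \<in> sets (torus (2 * r + 1))"
proof -
  have "Measurable.pred (torus (2 * r + 1)) (\<lambda>y. \<bar>y (2 * r) - y c\<bar> \<le> \<delta>)" if "c < 2 * r" for c
  proof -
    have [measurable]: "(\<lambda>x. x (2 * r)) \<in> borel_measurable (torus (2 * r + 1))" "(\<lambda>x. x c) \<in> borel_measurable (torus (2 * r + 1))"
      by (rule component_torus, use that in simp)+
    show ?thesis by measurable
  qed
  then have "Measurable.pred (torus (2 * r + 1)) (\<lambda>y. \<exists>c\<in>{..<2 * r}. \<bar>y (2 * r) - y c\<bar> \<le> \<delta>)"
    by (intro pred_intros_finite) auto
  then have "Measurable.pred (torus (2 * r + 1)) (\<lambda>y. (\<forall>q<r. pr (y (2 * q)) (y (2 * q + 1))) \<and> (\<exists>c\<in>{..<2 * r}. \<bar>y (2 * r) - y c\<bar> \<le> \<delta>))"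
    by (intro pred_intros_logic pairs_measurable) auto
  from predE[OF this] show ?thesis unfolding triple_event_def Bex_def lessThan_iff .
qed

lemma pair_inj_event: "pair_inj (pset x) r = {f \<in> injections (2 * r) n. restrict (x \<circ> f) {..<2 * r} \<in> pairs_event r}"
  unfolding pair_inj_def pairs_event_def using pset_pairs[of _ "2 * r" r x] restrict_comp_in_space by blast

lemma near_inj_event: "near_inj x r = {f \<in> injections (2 * r) n. restrict (x \<circ> f) {..<2 * r} \<in> near_event r}"
proof -
  have "near r (restrict (x \<circ> f) {..<2 * r}) = near r (x \<circ> f)" for f by (rule near_cong) simp
  then show ?thesis
    unfolding near_inj_def pair_inj_def near_event_def using pset_pairs[of _ "2 * r" r x] restrict_comp_in_space by blast
qed

lemma triple_inj_event: "triple_inj x r = {f \<in> injections (2 * r + 1) n. restrict (x \<circ> f) {..<2 * r + 1} \<in> triple_event r}"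
proof -
  have "(\<exists>c<2 * r. \<bar>restrict (x \<circ> f) {..<2 * r + 1} (2 * r) - restrict (x \<circ> f) {..<2 * r + 1} c\<bar> \<le> \<delta>) \<longleftrightarrow> (\<exists>c<2 * r. \<bar>x (f (2 * r)) - x (f c)\<bar> \<le> \<delta>)" for f
    by (intro ex_cong1 conj_cong refl) simp
  then show ?thesis
    unfolding triple_inj_def triple_event_def using pset_pairs[of _ "2 * r + 1" r x] restrict_comp_in_space by fastforce
qed

lemma expectation_pairs:
  assumes "2 * r \<le> n" shows "(\<integral>\<^sup>+x. of_nat (card (pair_inj (pset x) r)) \<partial>weyl_measure n) = pairs_mass r"
proof -
  have "(\<integral>\<^sup>+x. of_nat (card (pair_inj (pset x) r)) \<partial>weyl_measure n) = (\<integral>\<^sup>+y. indicator (pairs_event r) y * ennreal (rho n (2 * r) y) \<partial>torus (2 * r))"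
    unfolding pair_inj_event by (rule nn_integral_count_injections[OF assms pairs_event_sets])
  also have "\<dots> = pairs_mass r"
    unfolding pairs_mass_def by (intro nn_integral_cong) (simp add: iphi_indicator pairs_event_def indicator_def)
  finally show ?thesis .
qed

lemma expectation_near:
  assumes "2 * r \<le> n" shows "(\<integral>\<^sup>+x. of_nat (card (near_inj x r)) \<partial>weyl_measure n) = near_mass r"
proof -
  have "(\<integral>\<^sup>+x. of_nat (card (near_inj x r)) \<partial>weyl_measure n) = (\<integral>\<^sup>+y. indicator (near_event r) y * ennreal (rho n (2 * r) y) \<partial>torus (2 * r))"
    unfolding near_inj_event by (rule nn_integral_count_injections[OF assms near_event_sets])
  also have "\<dots> = near_mass r"
    unfolding near_mass_def by (intro nn_integral_cong) (simp add: iphi_indicator near_event_def indicator_def)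
  finally show ?thesis .
qed

lemma expectation_triples:
  assumes "2 * r + 1 \<le> n" shows "(\<integral>\<^sup>+x. of_nat (card (triple_inj x r)) \<partial>weyl_measure n) = triple_mass r"
proof -
  have "(\<integral>\<^sup>+x. of_nat (card (triple_inj x r)) \<partial>weyl_measure n) = (\<integral>\<^sup>+y. indicator (triple_event r) y * ennreal (rho n (2 * r + 1) y) \<partial>torus (2 * r + 1))"
    unfolding triple_inj_event by (rule nn_integral_count_injections[OF assms triple_event_sets])
  also have "\<dots> = triple_mass r"
    unfolding triple_mass_def by (intro nn_integral_cong) (simp add: iphi_indicator triple_event_def indicator_def)
  finally show ?thesis .
qed

lemma weyl_component: "i < n \<Longrightarrow> (\<lambda>x. x i) \<in> borel_measurable (weyl_measure n)"
  using component_torus[of i n] by (simp add: measurable_cong_sets[OF sets_weyl_measure refl])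

lemma mem_pset_measurable: "Measurable.pred (weyl_measure n) (\<lambda>x. (i, j) \<in> pset x)"
proof (cases "i < n \<and> j < n")
  case True
  then have "Measurable.pred (weyl_measure n) (\<lambda>x. pr (x i) (x j))" by (intro pr_measurable weyl_component) auto
  then show ?thesis using True by (simp add: pset_def)
qed (simp add: pset_def)

lemma mem_iso_measurable: "Measurable.pred (weyl_measure n) (\<lambda>x. (i, j) \<in> iso_pairs x)"
proof (cases "i < n \<and> j < n")
  case True
  have "Measurable.pred (weyl_measure n) (\<lambda>x. \<forall>k\<in>{..<n}. k \<noteq> i \<and> k \<noteq> j \<longrightarrow> \<delta> < \<bar>x k - x i\<bar>)"
  proof (intro pred_intros_finite)
    fix k assume "k \<in> {..<n}"
    then have [measurable]: "(\<lambda>x. x k) \<in> borel_measurable (weyl_measure n)" "(\<lambda>x. x i) \<in> borel_measurable (weyl_measure n)"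
      using True by (auto intro: weyl_component)
    show "Measurable.pred (weyl_measure n) (\<lambda>x. k \<noteq> i \<and> k \<noteq> j \<longrightarrow> \<delta> < \<bar>x k - x i\<bar>)" by measurable
  qed simp
  then have "Measurable.pred (weyl_measure n) (\<lambda>x. (i, j) \<in> pset x \<and> (\<forall>k\<in>{..<n}. k \<noteq> i \<and> k \<noteq> j \<longrightarrow> \<delta> < \<bar>x k - x i\<bar>))"
    by (intro pred_intros_logic mem_pset_measurable)
  then show ?thesis by (simp add: iso_pairs_def Ball_def)
qed (simp add: iso_pairs_def pset_def)

lemma card_iso_sum: "real (card (iso_pairs x)) = (\<Sum>p\<in>{..<n} \<times> {..<n}. of_bool (p \<in> iso_pairs x))"
proof -
  have "iso_pairs x = {p \<in> {..<n} \<times> {..<n}. p \<in> iso_pairs x}" by (auto simp: iso_pairs_def pset_def)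
  then show ?thesis by (simp add: Int_def)
qed

lemma card_iso_measurable: "(\<lambda>x. card (iso_pairs x)) \<in> measurable (weyl_measure n) (count_space UNIV)"
proof -
  have "(\<lambda>x. of_bool (p \<in> iso_pairs x) :: real) \<in> borel_measurable (weyl_measure n)" for p
  proof (cases p)
    case (Pair i j)
    note [measurable] = mem_iso_measurable[of i j]
    show ?thesis unfolding Pair of_bool_def by measurable
  qed
  then have [measurable]: "(\<lambda>x. real (card (iso_pairs x))) \<in> borel_measurable (weyl_measure n)"
    unfolding card_iso_sum by (intro borel_measurable_sum)
  have "(\<lambda>x. card (iso_pairs x)) -` {a} \<inter> space (weyl_measure n) = {x \<in> space (weyl_measure n). real (card (iso_pairs x)) = real a}" for a by auto
  moreover have "{x \<in> space (weyl_measure n). real (card (iso_pairs x)) = real a} \<in> sets (weyl_measure n)" for a by measurable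
  ultimately show ?thesis by (subst measurable_count_space_eq2_countable) auto
qed

lemma card_iso_le: "card (iso_pairs x) \<le> n * n"
proof -
  have "card (iso_pairs x) \<le> card ({..<n} \<times> {..<n})" by (rule card_mono) (auto simp: iso_pairs_def pset_def)
  then show ?thesis by simp
qed

definition moment :: "nat \<Rightarrow> real" where
  "moment r = (\<integral>x. real (card (iso_pairs x) choose r) \<partial>weyl_measure n)"

lemma integrable_moment: "integrable (weyl_measure n) (\<lambda>x. real (card (iso_pairs x) choose r))"
proof -
  interpret W: prob_space "weyl_measure n" using prob_space_weyl_measure .
  show ?thesis
  proof (rule W.integrable_const_bound[where B = "real (n * n choose r)"])
    show "AE x in weyl_measure n. norm (real (card (iso_pairs x) choose r)) \<le> real (n * n choose r)"
      using card_iso_le by (intro AE_I2) (simp add: binomial_right_mono binomial_mono)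
    show "(\<lambda>x. real (card (iso_pairs x) choose r)) \<in> borel_measurable (weyl_measure n)"
      by (rule measurable_compose[OF card_iso_measurable]) simp
  qed
qed

lemma moment_nonneg: "0 \<le> moment r" unfolding moment_def by simp

lemma nn_integral_iso: "(\<integral>\<^sup>+x. of_nat (card (pair_inj (iso_pairs x) r)) \<partial>weyl_measure n) = ennreal (fact r * moment r)"
proof -
  have "(\<integral>\<^sup>+x. of_nat (card (pair_inj (iso_pairs x) r)) \<partial>weyl_measure n) = (\<integral>\<^sup>+x. ennreal (fact r * real (card (iso_pairs x) choose r)) \<partial>weyl_measure n)"
    unfolding card_pair_inj_iso by (intro nn_integral_cong) (simp add: ennreal_of_nat_eq_real_of_nat)
  also have "\<dots> = ennreal (\<integral>x. fact r * real (card (iso_pairs x) choose r) \<partial>weyl_measure n)"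
    by (intro nn_integral_eq_integral integrable_mult_right integrable_moment) simp
  also have "(\<integral>x. fact r * real (card (iso_pairs x) choose r) \<partial>weyl_measure n) = fact r * moment r"
    unfolding moment_def by simp
  finally show ?thesis .
qed

lemma moment_le: "2 * r \<le> n \<Longrightarrow> ennreal (fact r * moment r) \<le> pairs_mass r"
  unfolding nn_integral_iso[symmetric]
  by (subst expectation_pairs[symmetric], simp) (intro nn_integral_mono of_nat_mono card_pair_inj_mono)

text \<open>Together with \<open>moment_le\<close> this encloses the factorial moments of the
  isolated pairs between pair masses, up to the crowded configurations.\<close>

lemma moment_ge:
  assumes r: "2 * r + 1 \<le> n"
  shows "pairs_mass r \<le> ennreal (fact r * moment r) + (near_mass r + triple_mass r)"
proof -
  have m1: "(\<lambda>x. of_nat (card (near_inj x r)) :: ennreal) \<in> borel_measurable (weyl_measure n)"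
    unfolding near_inj_event by (rule count_injections_measurable[OF near_event_sets])
  have m2: "(\<lambda>x. of_nat (card (triple_inj x r)) :: ennreal) \<in> borel_measurable (weyl_measure n)"
    unfolding triple_inj_event by (rule count_injections_measurable[OF triple_event_sets])
  have m3: "(\<lambda>x. of_nat (card (pair_inj (iso_pairs x) r)) :: ennreal) \<in> borel_measurable (weyl_measure n)"
    unfolding card_pair_inj_iso by (rule measurable_compose[OF card_iso_measurable]) simp
  have "pairs_mass r = (\<integral>\<^sup>+x. of_nat (card (pair_inj (pset x) r)) \<partial>weyl_measure n)"
    using r by (simp add: expectation_pairs)
  also have "\<dots> \<le> (\<integral>\<^sup>+x. of_nat (card (pair_inj (iso_pairs x) r)) + (of_nat (card (near_inj x r)) + of_nat (card (triple_inj x r))) \<partial>weyl_measure n)"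
    unfolding of_nat_add[symmetric] by (intro nn_integral_mono of_nat_mono card_pair_inj_split)
  also have "\<dots> = ennreal (fact r * moment r) + (near_mass r + triple_mass r)"
    using r m1 m2 m3 by (simp add: nn_integral_add nn_integral_iso expectation_near expectation_triples)
  finally show ?thesis .
qed

lemma sieve:
  "\<bar>measure (weyl_measure n) {x \<in> space (weyl_measure n). iso_pairs x = {}} - (\<Sum>i\<le>R. (- 1) ^ i * moment i)\<bar> \<le> moment R"
proof -
  interpret W: prob_space "weyl_measure n" using prob_space_weyl_measure .
  have m0: "{x \<in> space (weyl_measure n). iso_pairs x = {}} \<in> sets (weyl_measure n)"
  proof -
    have "{x \<in> space (weyl_measure n). iso_pairs x = {}} = (\<lambda>x. card (iso_pairs x)) -` {0} \<inter> space (weyl_measure n)" using finite_iso_pairs by auto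
    then show ?thesis using measurable_sets[OF card_iso_measurable, of "{0}"] by simp
  qed
  have i0: "integrable (weyl_measure n) (\<lambda>x. indicator {x \<in> space (weyl_measure n). iso_pairs x = {}} x :: real)"
    using m0 by (simp add: W.emeasure_eq_measure)
  have isum: "integrable (weyl_measure n) (\<lambda>x. \<Sum>i\<le>R. (- 1) ^ i * real (card (iso_pairs x) choose i))"
    by (intro Bochner_Integration.integrable_sum integrable_mult_right integrable_moment)
  have "(\<Sum>i\<le>R. (- 1) ^ i * moment i) = (\<integral>x. (\<Sum>i\<le>R. (- 1) ^ i * real (card (iso_pairs x) choose i)) \<partial>weyl_measure n)"
    unfolding moment_def using integrable_moment by (subst Bochner_Integration.integral_sum) auto
  moreover have "measure (weyl_measure n) {x \<in> space (weyl_measure n). iso_pairs x = {}} = (\<integral>x. indicator {x \<in> space (weyl_measure n). iso_pairs x = {}} x \<partial>weyl_measure n)"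
    using m0 by simp
  ultimately have "measure (weyl_measure n) {x \<in> space (weyl_measure n). iso_pairs x = {}} - (\<Sum>i\<le>R. (- 1) ^ i * moment i)
     = (\<integral>x. indicator {x \<in> space (weyl_measure n). iso_pairs x = {}} x - (\<Sum>i\<le>R. (- 1) ^ i * real (card (iso_pairs x) choose i)) \<partial>weyl_measure n)"
    using i0 isum by simp
  also have "\<bar>\<dots>\<bar> \<le> (\<integral>x. \<bar>indicator {x \<in> space (weyl_measure n). iso_pairs x = {}} x - (\<Sum>i\<le>R. (- 1) ^ i * real (card (iso_pairs x) choose i))\<bar> \<partial>weyl_measure n)"
    by (rule integral_abs_bound)
  also have "\<dots> \<le> moment R"
    unfolding moment_def
  proof (rule integral_mono)
    show "integrable (weyl_measure n) (\<lambda>x. \<bar>indicator {x \<in> space (weyl_measure n). iso_pairs x = {}} x - (\<Sum>i\<le>R. (- 1) ^ i * real (card (iso_pairs x) choose i))\<bar>)"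
      by (intro integrable_abs Bochner_Integration.integrable_diff i0 isum)
    fix x assume x: "x \<in> space (weyl_measure n)"
    have "indicator {x \<in> space (weyl_measure n). iso_pairs x = {}} x = (of_bool (card (iso_pairs x) = 0) :: real)"
      using x finite_iso_pairs[of x] by (simp add: indicator_def)
    then show "\<bar>indicator {x \<in> space (weyl_measure n). iso_pairs x = {}} x - (\<Sum>i\<le>R. (- 1) ^ i * real (card (iso_pairs x) choose i))\<bar> \<le> real (card (iso_pairs x) choose R)"
      using bonferroni[of "card (iso_pairs x)" R] by simp
  qed (rule integrable_moment)
  finally show ?thesis .
qed

lemma pset_empty_sets: "{x \<in> space (weyl_measure n). pset x = {}} \<in> sets (weyl_measure n)"
proof -
  have "Measurable.pred (weyl_measure n) (\<lambda>x. \<forall>p\<in>{..<n} \<times> {..<n}. \<not> p \<in> pset x)"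
    by (intro pred_intros_finite pred_intros_logic) (auto intro: mem_pset_measurable)
  moreover have "(\<forall>p\<in>{..<n} \<times> {..<n}. \<not> p \<in> pset x) \<longleftrightarrow> pset x = {}" for x by (auto simp: pset_def)
  ultimately show ?thesis by (simp add: pred_def)
qed

text \<open>If close pairs exist but none is isolated, then \<open>triple_inj x 1\<close> is
  nonempty: for a single pair \<open>near\<close> cannot hold, so \<open>pair_inj_split\<close>
  leaves no other case. The expected number of triples bounds the probability.\<close>

lemma pset_iso_gap:
  assumes n3: "3 \<le> n" and q: "triple_mass 1 \<le> ennreal q" "0 \<le> q"
  shows "\<bar>measure (weyl_measure n) {x \<in> space (weyl_measure n). pset x = {}} - measure (weyl_measure n) {x \<in> space (weyl_measure n). iso_pairs x = {}}\<bar> \<le> q"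
proof -
  interpret W: prob_space "weyl_measure n" using prob_space_weyl_measure .
  let ?A = "{x \<in> space (weyl_measure n). pset x = {}}" and ?B = "{x \<in> space (weyl_measure n). iso_pairs x = {}}"
  have A: "?A \<in> sets (weyl_measure n)" by (rule pset_empty_sets)
  have B: "?B \<in> sets (weyl_measure n)"
  proof -
    have "?B = (\<lambda>x. card (iso_pairs x)) -` {0} \<inter> space (weyl_measure n)" using finite_iso_pairs by auto
    then show ?thesis using measurable_sets[OF card_iso_measurable, of "{0}"] by simp
  qed
  have AB: "?A \<subseteq> ?B" using iso_pairs_subset by auto
  have "emeasure (weyl_measure n) (?B - ?A) = (\<integral>\<^sup>+x. indicator (?B - ?A) x \<partial>weyl_measure n)" using A B by simp
  also have "\<dots> \<le> (\<integral>\<^sup>+x. of_nat (card (triple_inj x 1)) \<partial>weyl_measure n)"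
  proof (intro nn_integral_mono)
    fix x
    show "indicator (?B - ?A) x \<le> (of_nat (card (triple_inj x 1)) :: ennreal)"
    proof (cases "x \<in> ?B - ?A")
      case True
      then obtain i j where ij: "(i, j) \<in> pset x" "(i, j) \<notin> iso_pairs x" by auto
      define f where "f = (\<lambda>a\<in>{..<2::nat}. if a = 0 then i else j)"
      have ne: "i < n" "j < n" "i \<noteq> j" using ij by (auto simp: pset_def pr_def)
      have "f \<in> pair_inj (pset x) 1" "f \<notin> pair_inj (iso_pairs x) 1"
        using ij ne by (auto simp: pair_inj_def injections_def f_def inj_on_def)
      moreover have "f \<notin> near_inj x 1" by (simp add: near_inj_def near_def)
      ultimately have "triple_inj x 1 \<noteq> {}" using pair_inj_split[of x 1] by auto
      then have "1 \<le> card (triple_inj x 1)" using finite_triple_inj by (simp add: Suc_le_eq card_gt_0_iff)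
      then have "of_nat 1 \<le> (of_nat (card (triple_inj x 1)) :: ennreal)" by (rule of_nat_mono)
      then show ?thesis using True by simp
    qed simp
  qed
  also have "\<dots> = triple_mass 1" using n3 by (intro expectation_triples) simp
  finally have "emeasure (weyl_measure n) (?B - ?A) \<le> ennreal q" using q by order
  then have "measure (weyl_measure n) (?B - ?A) \<le> q" using q by (simp add: W.emeasure_eq_measure)
  moreover have "measure (weyl_measure n) (?B - ?A) = measure (weyl_measure n) ?B - measure (weyl_measure n) ?A"
    by (rule W.finite_measure_Diff[OF B A AB])
  moreover have "0 \<le> measure (weyl_measure n) (?B - ?A)" by simp
  ultimately show ?thesis by linarith
qed

end

text \<open>First fix \<open>R\<close> so large that the exponential series is nearly summed and its
  term of index \<open>R\<close> is small, and only then let \<open>n\<close> grow; finitely many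
  moments are involved at a time.\<close>

lemma bonferroni_limit:
  fixes a :: "nat \<Rightarrow> nat \<Rightarrow> real"
  assumes a: "\<And>r. (\<lambda>n. a r n) \<longlonglongrightarrow> c ^ r / fact r"
    and b: "\<And>R. \<forall>\<^sub>F n in sequentially. \<bar>p n - (\<Sum>i\<le>R. (- 1) ^ i * a i n)\<bar> \<le> a R n"
  shows "p \<longlonglongrightarrow> exp (- c)"
proof (rule tendstoI)
  fix e :: real assume e: "0 < e"
  define S where "S R = (\<Sum>i\<le>R. (- 1) ^ i * (c ^ i / fact i))" for R
  have "(\<lambda>i. (- c) ^ i /\<^sub>R fact i) sums exp (- c)" by (rule exp_converges)
  then have "(\<lambda>R. \<Sum>i\<le>R. (- c) ^ i /\<^sub>R fact i) \<longlonglongrightarrow> exp (- c)" by (simp add: sums_def_le)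
  moreover have "(- c) ^ i /\<^sub>R fact i = (- 1) ^ i * (c ^ i / fact i)" for i
    by (simp add: power_minus[of c] divide_inverse)
  ultimately have S: "S \<longlonglongrightarrow> exp (- c)" unfolding S_def by simp
  have "(\<lambda>R. c ^ R / fact R) \<longlonglongrightarrow> 0"
    using summable_LIMSEQ_zero[OF summable_exp[of c]] by (simp add: divide_inverse mult.commute)
  from tendsto_add[OF this tendsto_rabs[OF tendsto_diff[OF S tendsto_const[of "exp (- c)"]]]]
  have "(\<lambda>R. c ^ R / fact R + \<bar>S R - exp (- c)\<bar>) \<longlonglongrightarrow> 0" by simp
  then have "\<forall>\<^sub>F R in sequentially. c ^ R / fact R + \<bar>S R - exp (- c)\<bar> < e" by (rule order_tendstoD) (rule e)
  then obtain R where R: "c ^ R / fact R + \<bar>S R - exp (- c)\<bar> < e" by (auto simp: eventually_sequentially)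
  have "(\<lambda>n. a R n + \<bar>(\<Sum>i\<le>R. (- 1) ^ i * a i n) - exp (- c)\<bar>) \<longlonglongrightarrow> c ^ R / fact R + \<bar>S R - exp (- c)\<bar>"
    unfolding S_def by (intro tendsto_intros a)
  then have "\<forall>\<^sub>F n in sequentially. a R n + \<bar>(\<Sum>i\<le>R. (- 1) ^ i * a i n) - exp (- c)\<bar> < e" by (rule order_tendstoD) (rule R)
  with b[of R] show "\<forall>\<^sub>F n in sequentially. dist (p n) (exp (- c)) < e"
    by eventually_elim (auto simp: dist_real_def)
qed

section \<open>Real-valued estimates for the moments\<close>

context close_pairs
begin

definition pairs_real :: "nat \<Rightarrow> real" where "pairs_real r = enn2real (pairs_mass r)"
definition one_pair_real :: real where "one_pair_real = enn2real one_pair_mass"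

lemma one_pair_real_eq: "one_pair_mass = ennreal one_pair_real"
  unfolding one_pair_real_def using one_pair_mass_le by (cases one_pair_mass) (auto simp: top_unique)

lemma pairs_real_eq: "2 * r \<le> n \<Longrightarrow> pairs_mass r = ennreal (pairs_real r)"
proof (induction r)
  case (Suc r)
  then have "pairs_mass r = ennreal (pairs_real r)" by simp
  then have "pairs_mass r * one_pair_mass + ennreal (step_error r) \<noteq> \<infinity>" unfolding one_pair_real_eq by (simp add: ennreal_mult_eq_top_iff)
  then have "pairs_mass (Suc r) \<noteq> \<infinity>" using factor_step(1)[OF Suc.prems] by (auto simp: top_unique)
  then show ?case by (cases "pairs_mass (Suc r)") (simp_all add: pairs_real_def)
qed (simp add: pairs_real_def pairs_mass_0)

lemma pairs_real_nonneg: "0 \<le> pairs_real r" "0 \<le> one_pair_real" by (simp_all add: pairs_real_def one_pair_real_def)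

lemma pairs_real_0: "pairs_real 0 = 1" by (simp add: pairs_real_def pairs_mass_0)

lemma pairs_real_step:
  assumes r: "2 * Suc r \<le> n" shows "\<bar>pairs_real (Suc r) - pairs_real r * one_pair_real\<bar> \<le> step_error r"
proof -
  have "ennreal (pairs_real (Suc r)) \<le> ennreal (pairs_real r * one_pair_real + step_error r)" "ennreal (pairs_real r * one_pair_real) \<le> ennreal (pairs_real (Suc r) + step_error r)"
    using factor_step[OF r] pairs_real_eq[of r] pairs_real_eq[OF r] r pairs_real_nonneg step_error_nonneg[of r] by (simp_all add: one_pair_real_eq ennreal_mult)
  then have "pairs_real (Suc r) \<le> pairs_real r * one_pair_real + step_error r" "pairs_real r * one_pair_real \<le> pairs_real (Suc r) + step_error r"
    using pairs_real_nonneg step_error_nonneg[of r] by (simp_all only: ennreal_le_iff add_nonneg_nonneg mult_nonneg_nonneg)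
  then show ?thesis by (simp add: abs_le_iff)
qed

lemma one_pair_real_le: "one_pair_real \<le> H / 12"
  using one_pair_mass_le H_nonneg unfolding one_pair_real_eq by simp

lemma one_pair_real_ge:
  assumes "0 \<le> 1 - 1 / (real n)\<^sup>2 - (real n)\<^sup>2 * \<delta>\<^sup>2 / 2" "\<delta> \<le> L"
  shows "H / 12 * (1 - 1 / (real n)\<^sup>2 - (real n)\<^sup>2 * \<delta>\<^sup>2 / 2) * (1 - \<delta> / L) \<le> one_pair_real"
  using one_pair_mass_ge[OF assms] pairs_real_nonneg unfolding one_pair_real_eq by simp

lemma moment_approx_pairs_real:
  assumes r: "2 * r + 1 \<le> n"
  shows "\<bar>fact r * moment r - pairs_real r\<bar> \<le> fact (2 * r) * (2 * (real r)\<^sup>2 * (4 * \<delta> / L) * H ^ r)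
    + real n / (2 * pi) * fact (2 * r + 1) * H ^ r * (2 * real r * (2 * \<delta>))" (is "_ \<le> ?N + ?triple_mass")
proof -
  have nn: "0 \<le> ?N" "0 \<le> ?triple_mass" "0 \<le> fact r * moment r" using d L_pos H_nonneg moment_nonneg by simp_all
  have pairs_mass: "pairs_mass r = ennreal (pairs_real r)" using r by (intro pairs_real_eq) simp
  have "ennreal (fact r * moment r) \<le> ennreal (pairs_real r)" using moment_le[of r] r pairs_mass by simp
  then have 1: "fact r * moment r \<le> pairs_real r" using pairs_real_nonneg by simp
  have "ennreal (pairs_real r) \<le> ennreal (fact r * moment r) + (ennreal ?N + ennreal ?triple_mass)"
    unfolding pairs_mass[symmetric] by (rule order_trans[OF moment_ge[OF r]]) (intro add_left_mono add_mono near_mass_le triple_mass_le)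
  also have "\<dots> = ennreal (fact r * moment r + (?N + ?triple_mass))"
    by (simp only: nn ennreal_plus add_nonneg_nonneg)
  finally have "pairs_real r \<le> fact r * moment r + (?N + ?triple_mass)" using nn by (simp only: ennreal_le_iff add_nonneg_nonneg)
  then show ?thesis using 1 nn by simp
qed

end

section \<open>From the closest spacing to the absence of close pairs\<close>

lemma closest_spacing_greater_iff:
  assumes c: "0 < c"
  shows "ereal \<beta> < closest_spacing I A * ereal c \<longleftrightarrow>
    (\<forall>i<length (eigenangles A). \<forall>j<length (eigenangles A). i \<noteq> j \<and> (eigenangles A ! i + eigenangles A ! j) / 2 \<in> I
      \<longrightarrow> \<beta> / c < \<bar>eigenangles A ! i - eigenangles A ! j\<bar>)"
proof -
  define t where "t = eigenangles A"
  define D where "D = {ereal \<bar>t ! i - t ! j\<bar> | i j. i < length t \<and> j < length t \<and> i \<noteq> j \<and> (t ! i + t ! j) / 2 \<in> I}"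
  have cs: "closest_spacing I A = Inf D" by (simp add: closest_spacing_def t_def D_def Let_def)
  have fin: "finite D"
    by (rule finite_subset[of _ "(\<lambda>(i, j). ereal \<bar>t ! i - t ! j\<bar>) ` ({..<length t} \<times> {..<length t})"]) (auto simp: D_def)
  have "ereal \<beta> < Inf D * ereal c \<longleftrightarrow> (\<forall>d\<in>D. ereal (\<beta> / c) < d)"
  proof (cases "D = {}")
    \<comment> \<open>Without any pair the infimum is \<open>top\<close>, which stays
      \<open>top\<close> after multiplication by the positive \<open>c\<close>; both sides
      hold.\<close>
    case True
    then show ?thesis using c by (simp add: top_ereal_def)
  next
    case False
    have m: "Inf D = Min D" using fin False by (rule Min_Inf[symmetric])
    then have "Inf D \<in> D" using fin False by simp
    then obtain w where w: "Inf D = ereal w" by (auto simp: D_def)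
    have "ereal \<beta> < Inf D * ereal c \<longleftrightarrow> ereal (\<beta> / c) < Inf D" using c by (simp add: w pos_divide_less_eq)
    also have "\<dots> \<longleftrightarrow> (\<forall>d\<in>D. ereal (\<beta> / c) < d)" unfolding m using fin False by simp
    finally show ?thesis .
  qed
  moreover have "(\<forall>d\<in>D. ereal (\<beta> / c) < d) \<longleftrightarrow> (\<forall>i<length t. \<forall>j<length t. i \<noteq> j \<and> (t ! i + t ! j) / 2 \<in> I \<longrightarrow> \<beta> / c < \<bar>t ! i - t ! j\<bar>)"
    unfolding D_def by (simp only: mem_Collect_eq Ball_def) (metis less_ereal.simps(1))
  ultimately show ?thesis unfolding cs t_def[symmetric] by simp
qed

text \<open>The event is invariant under permuting the angles, so it transfers to
  \<open>weyl_measure\<close>. There the coordinates are almost surely distinct, and the absence of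
  unordered close pairs becomes the absence of ordered ones.\<close>

lemma measure_closest_spacing:
  assumes n: "0 < n" and haar: "haar_prob n M" and c: "0 < c" and cp: "close_pairs n (\<beta> / c) I"
  shows "measure M {A \<in> space M. closest_spacing I A * ereal c > ereal \<beta>}
    = measure (weyl_measure n) {x \<in> space (weyl_measure n). close_pairs.pset n (\<beta> / c) I x = {}}"
proof -
  interpret haar_unitary n M by unfold_locales (rule haar)
  interpret close_pairs n "\<beta> / c" I by (rule cp)
  define P where "P y \<longleftrightarrow> (\<forall>i<n. \<forall>j<n. i \<noteq> j \<and> (y i + y j) / 2 \<in> I \<longrightarrow> \<beta> / c < \<bar>y i - y j\<bar>)" for y :: "nat \<Rightarrow> real"
  have P_cong: "P x \<longleftrightarrow> P y" if "\<And>i. i < n \<Longrightarrow> x i = y i" for x y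
    using that unfolding P_def by auto
  define E' where "E' = {y \<in> space (torus n). P y}"
  have E: "E' \<in> sets (torus n)"
  proof -
    have "Measurable.pred (torus n) (\<lambda>y. \<forall>i\<in>{..<n}. \<forall>j\<in>{..<n}. i \<noteq> j \<and> (y i + y j) / 2 \<in> I \<longrightarrow> \<beta> / c < \<bar>y i - y j\<bar>)"
    proof (intro pred_intros_finite)
      fix i j assume "i \<in> {..<n}" "j \<in> {..<n}"
      then have [measurable]: "(\<lambda>x. x i) \<in> borel_measurable (torus n)" "(\<lambda>x. x j) \<in> borel_measurable (torus n)"
        by (auto intro!: component_torus)
      show "Measurable.pred (torus n) (\<lambda>y. i \<noteq> j \<and> (y i + y j) / 2 \<in> I \<longrightarrow> \<beta> / c < \<bar>y i - y j\<bar>)" by measurable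
    qed auto
    then have "Measurable.pred (torus n) P" unfolding P_def Ball_def lessThan_iff .
    then show ?thesis unfolding E'_def by (rule predE)
  qed
  have P_perm: "P (x \<circ> \<sigma>)" if s: "\<sigma> permutes {..<n}" and "P x" for \<sigma> x
  proof -
    have "\<sigma> i < n \<longleftrightarrow> i < n" "\<sigma> i = \<sigma> j \<longleftrightarrow> i = j" for i j
      using permutes_in_image[OF s, of i] permutes_inj[OF s] by (auto simp: inj_def)
    then show ?thesis using \<open>P x\<close> unfolding P_def by simp
  qed
  have sym: "restrict (x \<circ> \<sigma>) {..<n} \<in> E' \<longleftrightarrow> restrict x {..<n} \<in> E'" if s: "\<sigma> permutes {..<n}" for \<sigma> x
  proof -
    have "x \<circ> \<sigma> \<circ> inv_into UNIV \<sigma> = x" using permutes_inv_o(1)[OF s] by (simp add: comp_assoc)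
    then have "P (x \<circ> \<sigma>) \<longleftrightarrow> P x" using P_perm[OF s, of x] P_perm[OF permutes_inv[OF s], of "x \<circ> \<sigma>"] by auto
    moreover have "P (restrict y {..<n}) \<longleftrightarrow> P y" for y by (rule P_cong) simp
    moreover have "restrict y {..<n} \<in> space (torus n)" for y :: "nat \<Rightarrow> real" by (simp add: space_PiM circ_def)
    ultimately show ?thesis unfolding E'_def by simp
  qed
  have "{A \<in> space M. closest_spacing I A * ereal c > ereal \<beta>} = {A \<in> space M. (\<lambda>i\<in>{..<n}. eigenangles A ! i) \<in> E'}"
  proof (intro Collect_cong conj_cong refl)
    fix A assume "A \<in> space M"
    then have len: "length (eigenangles A) = n" using eigenangles_unitary(1) space_haar by auto
    have "P (\<lambda>i\<in>{..<n}. eigenangles A ! i) \<longleftrightarrow> P (\<lambda>i. eigenangles A ! i)" by (rule P_cong) simp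
    moreover have "(\<lambda>i\<in>{..<n}. eigenangles A ! i) \<in> space (torus n)" by (simp add: space_PiM circ_def)
    ultimately show "ereal \<beta> < closest_spacing I A * ereal c \<longleftrightarrow> (\<lambda>i\<in>{..<n}. eigenangles A ! i) \<in> E'"
      unfolding closest_spacing_greater_iff[OF c] len E'_def P_def[symmetric] by simp
  qed
  then have 1: "measure M {A \<in> space M. closest_spacing I A * ereal c > ereal \<beta>} = measure (weyl_measure n) E'"
    using emeasure_symmetric_event(2)[OF n E sym] by (simp add: Sigma_Algebra.measure_def)
  have "measure (weyl_measure n) E' = measure (weyl_measure n) {x \<in> space (weyl_measure n). pset x = {}}"
  proof (rule measure_eq_AE)
    show "AE x in weyl_measure n. x \<in> E' \<longleftrightarrow> x \<in> {x \<in> space (weyl_measure n). pset x = {}}"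
      using AE_weyl_distinct[of n]
    proof (rule AE_mp, intro AE_I2 impI)
      fix x assume sp: "x \<in> space (weyl_measure n)" and dist: "\<forall>i<n. \<forall>j<n. i \<noteq> j \<longrightarrow> x i \<noteq> x j"
      have "P x \<longleftrightarrow> pset x = {}"
      proof
        assume "P x"
        show "pset x = {}"
        proof (rule ccontr)
          assume "pset x \<noteq> {}"
          then obtain i j where "(i, j) \<in> pset x" by auto
          then have ij: "i < n" "j < n" "x i < x j" "x j - x i \<le> \<beta> / c" "(x i + x j) / 2 \<in> I"
            by (auto simp: pset_def pr_def)
          then have "i \<noteq> j" by auto
          then have "\<beta> / c < \<bar>x i - x j\<bar>" using \<open>P x\<close> ij unfolding P_def by blast
          then show False using ij by simp
        qed
      next
        assume e: "pset x = {}"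
        show "P x" unfolding P_def
        proof (intro allI impI, rule ccontr)
          fix i j assume ij: "i < n" "j < n" "i \<noteq> j \<and> (x i + x j) / 2 \<in> I" and "\<not> \<beta> / c < \<bar>x i - x j\<bar>"
          then have le: "\<bar>x i - x j\<bar> \<le> \<beta> / c" by simp
          have ne: "x i \<noteq> x j" using dist ij by simp
          have "(x j + x i) / 2 \<in> I" using ij by (simp add: add.commute)
          then have "(i, j) \<in> pset x \<or> (j, i) \<in> pset x"
            using ij le ne by (auto simp: pset_def pr_def abs_if split: if_splits)
          then show False using e by simp
        qed
      qed
      then show "x \<in> E' \<longleftrightarrow> x \<in> {x \<in> space (weyl_measure n). pset x = {}}"
        using sp by (simp add: E'_def space_weyl_measure)
    qed
    show "E' \<in> sets (weyl_measure n)" using E by (simp add: sets_weyl_measure)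
    show "{x \<in> space (weyl_measure n). pset x = {}} \<in> sets (weyl_measure n)" by (rule pset_empty_sets)
  qed
  then show ?thesis using 1 by simp
qed

theorem mainTheorem1:
  fixes I :: "nat \<Rightarrow> real set"
    and CUE :: "nat \<Rightarrow> complex mat measure"
    and \<beta> :: real
  assumes I_interval: "\<And>n. n \<ge> 1 \<Longrightarrow> is_interval (I n)"
    and I_subset: "\<And>n. n \<ge> 1 \<Longrightarrow> I n \<subseteq> {0..<2 * pi}"
    and I_length: "filterlim (\<lambda>n. real n * measure lborel (I n)) at_top sequentially"
    and CUE_haar: "\<And>n. n \<ge> 1 \<Longrightarrow> haar_prob n (CUE n)"
    and "\<beta> > 0"
  shows "(\<lambda>n. measure (CUE n)
            {A \<in> space (CUE n).
               closest_spacing (I n) A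
                 * ereal ((real n ^ 4 * measure lborel (I n) / (144 * pi\<^sup>2)) powr (1 / 3))
               > ereal \<beta>})
         \<longlonglongrightarrow> exp (- (\<beta> ^ 3))"
proof -
  define len where "len n = measure lborel (I n)" for n
  define c where "c n = (real n ^ 4 * len n / (144 * pi\<^sup>2)) powr (1 / 3)" for n
  \<comment> \<open>The threshold for the unscaled spacing. All error terms below are controlled by
    \<open>u n\<close>, the window length in units of order the mean spacing.\<close>
  define \<delta> where "\<delta> n = \<beta> / c n" for n
  define u where "u n = real n * len n" for n
  have u: "filterlim u at_top sequentially" using I_length by (simp add: u_def[abs_def] len_def)
  have up: "\<forall>\<^sub>F n in sequentially. 0 < u n" using u by (simp add: filterlim_at_top_dense)
  have good: "close_pairs n (\<delta> n) (I n) \<and> 0 < c n \<and> 0 < n \<and> 0 < len n" if "0 < u n" for n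
  proof -
    have n: "0 < n" using that by (cases n) (auto simp: u_def)
    have L: "0 < len n" using that n by (simp add: u_def zero_less_mult_iff)
    have c: "0 < c n" using n L by (simp add: c_def)
    have "close_pairs n (\<delta> n) (I n)"
    proof
      show "0 < n" by (rule n)
      show "0 < \<delta> n" using c \<open>\<beta> > 0\<close> by (simp add: \<delta>_def)
      show "I n \<in> sets borel" using I_interval[of n] n by (intro real_interval_borel_measurable) simp
      show "I n \<subseteq> {0..<2 * pi}" using I_subset[of n] n by simp
      show "0 < measure lborel (I n)" using L by (simp add: len_def)
    qed
    then show ?thesis using n c L by simp
  qed
  have d3: "\<delta> n ^ 3 = \<beta> ^ 3 * (144 * pi\<^sup>2) / (real n ^ 4 * len n)" if "0 < u n" for n
  proof -
    have "0 < real n ^ 4 * len n / (144 * pi\<^sup>2)" using good[OF that] by simp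
    moreover have "(v powr (1 / 3)) ^ 3 = v" if "0 < v" for v :: real
    proof -
      have "(v powr (1 / 3)) ^ 3 = (v powr (1 / 3)) powr 3" using that by (subst powr_numeral) auto
      then show ?thesis using that unfolding powr_powr by simp
    qed
    ultimately have "c n ^ 3 = real n ^ 4 * len n / (144 * pi\<^sup>2)" unfolding c_def by blast
    then show ?thesis by (simp add: \<delta>_def power_divide)
  qed
  \<comment> \<open>The constant 144 enters here: the limiting mean number of close pairs,
    \<open>H / 12\<close>, becomes \<open>\<beta> ^ 3\<close>.\<close>
  have H: "close_pairs.H n (\<delta> n) (I n) = 12 * \<beta> ^ 3" if "0 < u n" for n
  proof -
    interpret close_pairs n "\<delta> n" "I n" using good[OF that] by simp
    show ?thesis using good[OF that] unfolding H_def d3[OF that] close_pairs.L_def[OF close_pairs_axioms]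
      by (simp add: len_def)
  qed
  have nd: "real n * \<delta> n = (144 * pi\<^sup>2 * \<beta> ^ 3 / u n) powr (1 / 3)" if "0 < u n" for n
  proof -
    note g = good[OF that]
    have p: "0 < real n * \<delta> n" using g \<open>\<beta> > 0\<close> by (simp add: \<delta>_def)
    have "(real n * \<delta> n) ^ 3 = 144 * pi\<^sup>2 * \<beta> ^ 3 / u n"
      unfolding power_mult_distrib d3[OF that] using g by (simp add: u_def field_simps power4_eq_xxxx power3_eq_cube)
    then have "144 * pi\<^sup>2 * \<beta> ^ 3 / u n = (real n * \<delta> n) powr 3"
      using p by (subst powr_numeral) auto
    then have "(144 * pi\<^sup>2 * \<beta> ^ 3 / u n) powr (1 / 3) = (real n * \<delta> n) powr (3 * (1 / 3))"
      by (simp only: powr_powr)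
    then show ?thesis using p by simp
  qed
  have nd0: "(\<lambda>n. real n * \<delta> n) \<longlonglongrightarrow> 0"
  proof -
    have "((\<lambda>v. (144 * pi\<^sup>2 * \<beta> ^ 3 / v) powr (1 / 3)) \<longlongrightarrow> 0) at_top"
      using \<open>\<beta> > 0\<close> by real_asymp
    from filterlim_compose[OF this u] show ?thesis
      by (rule Lim_transform_eventually) (use up in \<open>auto elim!: eventually_mono simp: nd\<close>)
  qed
  \<comment> \<open>The ratio is \<open>n * \<delta> n\<close> divided by \<open>u n\<close>, so it
    vanishes even faster than \<open>n * \<delta> n\<close>.\<close>
  have dL0: "(\<lambda>n. \<delta> n / len n) \<longlonglongrightarrow> 0"
  proof -
    have "((\<lambda>v. inverse v) \<longlongrightarrow> (0::real)) at_top" by (rule tendsto_inverse_0_at_top) (rule filterlim_ident)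
    from tendsto_mult[OF nd0 filterlim_compose[OF this u]]
    have "(\<lambda>n. real n * \<delta> n * inverse (u n)) \<longlonglongrightarrow> 0" by simp
    then show ?thesis
    proof (rule Lim_transform_eventually)
      show "\<forall>\<^sub>F n in sequentially. real n * \<delta> n * inverse (u n) = \<delta> n / len n"
        using up by eventually_elim (use good in \<open>auto simp: u_def field_simps\<close>)
    qed
  qed
  have eps0: "(\<lambda>n. (1 / 2 + pi) / sqrt (u n)) \<longlonglongrightarrow> 0"
  proof -
    have "((\<lambda>v. (1 / 2 + pi) / sqrt v) \<longlongrightarrow> 0) at_top" by real_asymp
    from filterlim_compose[OF this u] show ?thesis .
  qed
  have n0: "(\<lambda>n. 1 / (real n)\<^sup>2) \<longlonglongrightarrow> 0" by real_asymp
  define jr where "jr r n = close_pairs.pairs_real n (\<delta> n) (I n) r" for r n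
  define jr1 where "jr1 n = close_pairs.one_pair_real n (\<delta> n) (I n)" for n
  define mom where "mom r n = close_pairs.moment n (\<delta> n) (I n) r" for r n
  define k where "k n = 1 - 1 / (real n)\<^sup>2 - (real n * \<delta> n)\<^sup>2 / 2" for n
  have k1: "k \<longlonglongrightarrow> 1"
  proof -
    have "k \<longlonglongrightarrow> 1 - 0 - 0\<^sup>2 / 2" unfolding k_def by (intro tendsto_intros n0 nd0) simp
    then show ?thesis by simp
  qed
  \<comment> \<open>The expected number of close pairs, squeezed between the two bounds for the
    two-point function.\<close>
  have JR1_lim: "jr1 \<longlonglongrightarrow> \<beta> ^ 3"
  proof (rule tendsto_sandwich)
    have "(\<lambda>n. \<beta> ^ 3 * k n * (1 - \<delta> n / len n)) \<longlonglongrightarrow> \<beta> ^ 3 * 1 * (1 - 0)" by (intro tendsto_intros k1 dL0)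
    then show "(\<lambda>n. \<beta> ^ 3 * k n * (1 - \<delta> n / len n)) \<longlonglongrightarrow> \<beta> ^ 3" by simp
    show "\<forall>\<^sub>F n in sequentially. jr1 n \<le> \<beta> ^ 3"
      using up
    proof eventually_elim
      case (elim n)
      interpret close_pairs n "\<delta> n" "I n" using good[OF elim] by simp
      show ?case using one_pair_real_le unfolding jr1_def H[OF elim] by simp
    qed
    have "\<forall>\<^sub>F n in sequentially. 0 < k n" using order_tendstoD(1)[OF k1, of 0] by simp
    moreover have "\<forall>\<^sub>F n in sequentially. \<delta> n / len n < 1" using order_tendstoD(2)[OF dL0, of 1] by simp
    ultimately show "\<forall>\<^sub>F n in sequentially. \<beta> ^ 3 * k n * (1 - \<delta> n / len n) \<le> jr1 n"
      using up
    proof eventually_elim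
      case (elim n)
      note g = good[OF elim(3)]
      interpret close_pairs n "\<delta> n" "I n" using g by simp
      have Le: "close_pairs.L (I n) = len n" by (simp add: close_pairs.L_def[OF close_pairs_axioms] len_def)
      have kk: "1 - 1 / (real n)\<^sup>2 - (real n)\<^sup>2 * (\<delta> n)\<^sup>2 / 2 = k n" by (simp add: k_def power_mult_distrib)
      have "\<delta> n \<le> len n" using elim(2) g by simp
      then show ?case using one_pair_real_ge elim unfolding jr1_def H[OF elim(3)] kk Le by simp
    qed
  qed simp
  have JR_lim: "jr r \<longlonglongrightarrow> (\<beta> ^ 3) ^ r" for r
  proof (induction r)
    case 0
    have "\<forall>\<^sub>F n in sequentially. 1 = jr 0 n"
      using up
    proof eventually_elim
      case (elim n)
      interpret close_pairs n "\<delta> n" "I n" using good[OF elim] by simp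
      show ?case unfolding jr_def by (simp add: pairs_real_0)
    qed
    then have "jr 0 \<longlonglongrightarrow> 1" by (rule Lim_transform_eventually[OF tendsto_const])
    then show ?case by simp
  next
    case (Suc r)
    define B where "B n = 2 * fact (2 * Suc r) * (12 * \<beta> ^ 3) ^ r * ((12 * \<beta> ^ 3) * (4 * real r * ((1 / 2 + pi) / sqrt (u n))))" for n
    have "B \<longlonglongrightarrow> 2 * fact (2 * Suc r) * (12 * \<beta> ^ 3) ^ r * ((12 * \<beta> ^ 3) * (4 * real r * 0))"
      unfolding B_def by (intro tendsto_intros eps0)
    then have B0: "B \<longlonglongrightarrow> 0" by simp
    have "\<forall>\<^sub>F n in sequentially. norm (jr (Suc r) n - jr r n * jr1 n) \<le> B n"
      using up eventually_ge_at_top[of "2 * Suc r"]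
    proof eventually_elim
      case (elim n)
      interpret close_pairs n "\<delta> n" "I n" using good[OF elim(1)] by simp
      have Le: "close_pairs.L (I n) = len n" by (simp add: close_pairs.L_def[OF close_pairs_axioms] len_def)
      have "step_error r = B n" unfolding step_error_def eps_def H[OF elim(1)] Le B_def u_def by simp
      then show ?case using pairs_real_step[OF elim(2)] unfolding jr_def jr1_def by simp
    qed
    then have "(\<lambda>n. jr (Suc r) n - jr r n * jr1 n) \<longlonglongrightarrow> 0" by (rule Lim_null_comparison) (rule B0)
    from tendsto_add[OF this tendsto_mult[OF Suc JR1_lim]] show ?case by (simp add: mult.commute)
  qed
  have mom_lim: "mom r \<longlonglongrightarrow> (\<beta> ^ 3) ^ r / fact r" for r
  proof -
    define B where "B n = fact (2 * r) * (2 * (real r)\<^sup>2 * (4 * (\<delta> n / len n)) * (12 * \<beta> ^ 3) ^ r)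
      + 1 / (2 * pi) * fact (2 * r + 1) * (12 * \<beta> ^ 3) ^ r * (2 * real r * (2 * (real n * \<delta> n)))" for n
    have "B \<longlonglongrightarrow> fact (2 * r) * (2 * (real r)\<^sup>2 * (4 * 0) * (12 * \<beta> ^ 3) ^ r)
      + 1 / (2 * pi) * fact (2 * r + 1) * (12 * \<beta> ^ 3) ^ r * (2 * real r * (2 * 0))"
      unfolding B_def by (intro tendsto_intros dL0 nd0)
    then have B0: "B \<longlonglongrightarrow> 0" by simp
    have "\<forall>\<^sub>F n in sequentially. norm (fact r * mom r n - jr r n) \<le> B n"
      using up eventually_ge_at_top[of "2 * r + 1"]
    proof eventually_elim
      case (elim n)
      interpret close_pairs n "\<delta> n" "I n" using good[OF elim(1)] by simp
      have Le: "close_pairs.L (I n) = len n" by (simp add: close_pairs.L_def[OF close_pairs_axioms] len_def)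
      show ?case using moment_approx_pairs_real[OF elim(2)] unfolding jr_def mom_def H[OF elim(1)] Le B_def
        by (simp add: mult_ac del: fact_Suc)
    qed
    then have "(\<lambda>n. fact r * mom r n - jr r n) \<longlonglongrightarrow> 0" by (rule Lim_null_comparison) (rule B0)
    from tendsto_add[OF this JR_lim[of r]] have "(\<lambda>n. fact r * mom r n) \<longlonglongrightarrow> (\<beta> ^ 3) ^ r" by simp
    from tendsto_divide[OF this tendsto_const[of "fact r"]] show ?thesis by simp
  qed
  define p where "p n = measure (weyl_measure n) {x \<in> space (weyl_measure n). close_pairs.iso_pairs n (\<delta> n) (I n) x = {}}" for n
  define p' where "p' n = measure (weyl_measure n) {x \<in> space (weyl_measure n). close_pairs.pset n (\<delta> n) (I n) x = {}}" for n
  have "p \<longlonglongrightarrow> exp (- (\<beta> ^ 3))"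
  proof (rule bonferroni_limit[OF mom_lim])
    fix R
    show "\<forall>\<^sub>F n in sequentially. \<bar>p n - (\<Sum>i\<le>R. (- 1) ^ i * mom i n)\<bar> \<le> mom R n"
      using up
    proof eventually_elim
      case (elim n)
      interpret close_pairs n "\<delta> n" "I n" using good[OF elim] by simp
      show ?case using sieve[of R] unfolding p_def mom_def .
    qed
  qed
  \<comment> \<open>The sieve yields the probability \<open>p\<close> of no isolated pair, while the
    closest spacing concerns \<open>p'\<close>, no close pair at all; the gap is of order
    \<open>n * \<delta> n\<close>.\<close>
  moreover have "(\<lambda>n. p' n - p n) \<longlonglongrightarrow> 0"
  proof (rule Lim_null_comparison)
    define B where "B n = 1 / (2 * pi) * fact (2 * 1 + 1) * (12 * \<beta> ^ 3) ^ 1 * (2 * real 1 * (2 * (real n * \<delta> n)))" for n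
    have "B \<longlonglongrightarrow> 1 / (2 * pi) * fact (2 * 1 + 1) * (12 * \<beta> ^ 3) ^ 1 * (2 * real 1 * (2 * 0))"
      unfolding B_def by (intro tendsto_intros nd0)
    then show "B \<longlonglongrightarrow> 0" by simp
    show "\<forall>\<^sub>F n in sequentially. norm (p' n - p n) \<le> B n"
      using up eventually_ge_at_top[of 3]
    proof eventually_elim
      case (elim n)
      interpret close_pairs n "\<delta> n" "I n" using good[OF elim(1)] by simp
      have "triple_mass 1 \<le> ennreal (real n / (2 * pi) * fact (2 * 1 + 1) * (12 * \<beta> ^ 3) ^ 1 * (2 * real 1 * (2 * \<delta> n)))"
        using triple_mass_le[of 1] unfolding H[OF elim(1)] .
      also have "real n / (2 * pi) * fact (2 * 1 + 1) * (12 * \<beta> ^ 3) ^ 1 * (2 * real 1 * (2 * \<delta> n)) = B n"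
        unfolding B_def by simp
      finally have q: "triple_mass 1 \<le> ennreal (B n)" .
      have "0 \<le> B n" unfolding B_def using \<open>\<beta> > 0\<close> d by simp
      from pset_iso_gap[OF elim(2) q this] show ?case unfolding p_def p'_def by simp
    qed
  qed
  ultimately have "p' \<longlonglongrightarrow> exp (- (\<beta> ^ 3))" using tendsto_add[of "\<lambda>n. p' n - p n" 0 sequentially p] by simp
  then show ?thesis
  proof (rule Lim_transform_eventually)
    show "\<forall>\<^sub>F n in sequentially. p' n = measure (CUE n) {A \<in> space (CUE n). closest_spacing (I n) A
        * ereal ((real n ^ 4 * measure lborel (I n) / (144 * pi\<^sup>2)) powr (1 / 3)) > ereal \<beta>}"
      using up
    proof eventually_elim
      case (elim n)
      note g = good[OF elim]
      have "haar_prob n (CUE n)" using CUE_haar[of n] g by simp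
      from measure_closest_spacing[OF _ this, of "c n" \<beta> "I n"] g
      show ?case unfolding p'_def \<delta>_def c_def len_def by simp
    qed
  qed
qed

end
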